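(* Let $\Omega\subseteq\mathbb{R}^n$ be open and $\widetilde R\in\mathcal{G}^d(\Omega)$. Then $\widetilde R=0$ in $\mathcal{G}^d(\Omega)$ if and only if $\widetilde R(\widetilde X)=0$ in $\widetilde{\mathbb{C}}(\Omega)$ for all $\widetilde X\in\widetilde\Omega_c(\Omega)$.
   Context: Notation. $n\in\mathbb{N}=\{1,2,\dots\}$, $\mathbb{N}_0=\mathbb{N}\cup\{0\}$, $I:=(0,1]$, $\Omega\subseteq\mathbb{R}^n$ open. $K\subset\subset\Omega$ means $K$ is a compact subset of $\Omega$. For expressions defined for small $\varepsilon>0$, $f(\varepsilon)=O(g(\varepsilon))$ means $\exists C>0\ \exists\varepsilon_0>0\ \forall\varepsilon<\varepsilon_0$: $|f(\varepsilon)|<C|g(\varepsilon)|$. $\mathcal{D}(\Omega)$ is the space of smooth (complex-valued) functions with compact support in $\Omega$, with its usual locally convex topology. For $q\in\mathbb{N}_0$, $\mathcal{A}_q(\Omega)$ is the set of $\varphi\in\mathcal{D}(\Omega)$ with $\int\varphi=1$ and $\int x^\alpha\varphi(x)\,dx=0$ for all multi-indices $\alpha$ with $1\le|\alpha|\le q$. $(S_\varepsilon\varphi)(y):=\varepsilon^{-n}\varphi(y/\varepsilon)$, $(T_x\varphi)(y):=\varphi(y-x)$, $T(\varphi,x):=(T_x\varphi,x)$. $U(\Omega):=\{(\varphi,x)\in\mathcal{A}_0(\mathbb{R}^n)\times\Omega:\operatorname{supp}\varphi+x\subseteq\Omega\}$; $T$ restricts to a bijection $U(\Omega)\to\mathcal{A}_0(\Omega)\times\Omega$.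 Smoothness is in the sense of convenient calculus (Kriegl–Michor): a map is smooth if it maps smooth curves to smooth curves. Each $\mathcal{A}_q(\Omega)$ carries the initial smooth structure with respect to its inclusion in $\mathcal{D}(\Omega)$ (a curve into it is smooth iff it is smooth into $\mathcal{D}(\Omega)$), and $U(\Omega)$ carries the structure for which $T:U(\Omega)\to\mathcal{A}_0(\Omega)\times\Omega$ is a diffeomorphism. For $q\in\mathbb{N}_0$, $C^\infty_b(I\times\Omega,\mathcal{A}_q(\mathbb{R}^n))$ is the set of smooth maps $\phi:I\times\Omega\to\mathcal{A}_q(\mathbb{R}^n)$ such that for all $K\subset\subset\Omega$ and $\alpha\in\mathbb{N}_0^n$ the set $\{\partial_x^\alpha\phi(\varepsilon,x):\varepsilon\in I,x\in K\}$ is bounded in $\mathcal{D}(\mathbb{R}^n)$. The algebra $\mathcal{G}^d(\Omega)$. $\mathcal{E}^d(\Omega):=C^\infty(U(\Omega))$ (complex-valued). Below, $\partial^\alpha R(S_\varepsilon\phi(\varepsilon,x),x)$ denotes the $\alpha$-derivative of the composite map $x\mapsto R(S_\varepsilon\phi(\varepsilon,x),x)$. $R$ is moderate ($R\in\mathcal{E}^d_M(\Omega)$) if $\forall K\subset\subset\Omega\ \forall\alpha\in\mathbb{N}_0^n\ \exists N\in\mathbb{N}\ \forall\phi\in C^\infty_b(I\times\Omega,\mathcal{A}_0(\mathbb{R}^n))$: $\sup_{x\in K}|\partial^\alpha R(S_\varepsilon\phi(\varepsilon,x),x)|=O(\varepsilon^{-N})$. $R$ is negligible ($R\in\mathcal{N}^d(\Omega)$)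 if it is moderate and $\forall K\subset\subset\Omega\ \forall\alpha\in\mathbb{N}_0^n\ \forall m\in\mathbb{N}\ \exists q\in\mathbb{N}\ \forall\phi\in C^\infty_b(I\times\Omega,\mathcal{A}_q(\mathbb{R}^n))$: $\sup_{x\in K}|\partial^\alpha R(S_\varepsilon\phi(\varepsilon,x),x)|=O(\varepsilon^{m})$. $\mathcal{G}^d(\Omega):=\mathcal{E}^d_M(\Omega)/\mathcal{N}^d(\Omega)$. Generalized points and numbers. For $V\subseteq\mathbb{R}^p$ open (in particular $V=\Omega$, or $V=\mathbb{C}\cong\mathbb{R}^2$), $V_M(\Omega)$ is the set of $X\in C^\infty(U(\Omega),V)$ that satisfy the moderateness estimate above (with $X$ in place of $R$) and do not depend on the second variable: $X(\varphi,x)=X(\varphi,y)$ for all $(\varphi,x),(\varphi,y)\in U(\Omega)$. For $X,Y\in V_M(\Omega)$ write $X\sim Y$ if $\forall K\subset\subset\Omega\ \forall m\in\mathbb{N}\ \exists q\in\mathbb{N}\ \forall\phi\in C^\infty_b(I\times\Omega,\mathcal{A}_q(\mathbb{R}^n))$: $\sup_{x\in K}|(X-Y)(S_\varepsilon\phi(\varepsilon,x),x)|=O(\varepsilon^m)$. $\widetilde V(\Omega):=V_M(\Omega)/\sim$; for $V=\mathbb{C}$ this is the ring $\widetilde{\mathbb{C}}(\Omega)$. $\widetilde V_c(\Omega)$ is the set of $\widetilde X\in\widetilde V(\Omega)$ that have a representative $X$ for which there is $L\subset\subset V$ with $X(\varphi,x)\in L$ for all $(\varphi,x)\in U(\Omega)$;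 call such a representative good. Point values. Let $R\in\mathcal{E}^d_M(\Omega)$ and let $X\in\Omega_M(\Omega)$ be a good representative. Put $R(X)(\varphi,x):=R(\varphi,X(\varphi,x))$ whenever $(\varphi,x)$ and $(\varphi,X(\varphi,x))$ lie in $U(\Omega)$. Let $S_{R,X}\in C^\infty(U(\Omega))$ be a map, not depending on the second variable, such that for every $K\subset\subset\Omega$ and every $B\subseteq\mathcal{D}(\mathbb{R}^n)$ for which the supports of all elements of $B$ are contained in a common closed ball around $0$, there are a relatively compact open neighborhood $U$ of $K$ in $\Omega$ and $\varepsilon_0>0$ such that for all $x\in U$, $\varphi\in B\cap\mathcal{A}_0(\mathbb{R}^n)$, $\varepsilon<\varepsilon_0$ the expression $R(X)(S_\varepsilon\varphi,x)$ is defined and $S_{R,X}(S_\varepsilon\varphi,x)=R(X)(S_\varepsilon\varphi,x)$. Such a map exists, belongs to $\mathbb{C}_M(\Omega)$, and its class in $\widetilde{\mathbb{C}}(\Omega)$ depends only on the classes of $R$ and $X$. For $\widetilde R=[R]\in\mathcal{G}^d(\Omega)$ and $\widetilde X\in\widetilde\Omega_c(\Omega)$ the point value is $\widetilde R(\widetilde X):=[S_{R,X}]\in\widetilde{\mathbb{C}}(\Omega)$, with $X$ any good representative of $\widetilde X$. *)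

theory Defs
  imports "HOL-Analysis.Analysis"
begin

definition partial :: "'n \<Rightarrow> (real^'n \<Rightarrow> 'v::real_normed_vector) \<Rightarrow> real^'n \<Rightarrow> 'v" where
  "partial i f x = vector_derivative (\<lambda>h. f (x + h *\<^sub>R axis i 1)) (at 0)"

text \<open>
  Multi-indices are functions \<open>'n \<Rightarrow> nat\<close>. A partial derivative of order \<open>\<alpha>\<close> is taken by
  iterating first-order ones along some fixed list in which each coordinate \<open>i\<close> occurs \<open>\<alpha> i\<close>
  times; for smooth functions the order in the list is irrelevant.
\<close>

definition mi_list :: "('n::finite \<Rightarrow> nat) \<Rightarrow> 'n list" where
  "mi_list \<alpha> = (SOME is. \<forall>i. count_list is i = \<alpha> i)"

lemma count_list_mi_list:
  fixes \<alpha> :: "'n::finite \<Rightarrow> nat"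
  shows "count_list (mi_list \<alpha>) i = \<alpha> i"
proof -
  obtain xs where xs: "mset xs = Abs_multiset \<alpha>"
    using ex_mset by blast
  have "\<forall>i. count_list xs i = \<alpha> i"
    using xs by (metis count_mset count_Abs_multiset finite)
  then have "\<forall>i. count_list (mi_list \<alpha>) i = \<alpha> i"
    unfolding mi_list_def by (rule someI)
  then show ?thesis ..
qed

definition mi_deg :: "('n::finite \<Rightarrow> nat) \<Rightarrow> nat" where
  "mi_deg \<alpha> = (\<Sum>i\<in>UNIV. \<alpha> i)"

definition mi_power :: "real^'n \<Rightarrow> ('n::finite \<Rightarrow> nat) \<Rightarrow> real" where
  "mi_power x \<alpha> = (\<Prod>i\<in>UNIV. (x $ i) ^ \<alpha> i)"

definition mderiv ::
    "('n::finite \<Rightarrow> nat) \<Rightarrow> (real^'n \<Rightarrow> 'v::real_normed_vector) \<Rightarrow> real^'n \<Rightarrow> 'v" where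
  "mderiv \<alpha> f = foldr partial (mi_list \<alpha>) f"

text \<open>
  All iterated partial derivatives exist and are (Frechet) differentiable, hence continuous.
\<close>

definition smooth_fun :: "(real^'n \<Rightarrow> 'v::real_normed_vector) \<Rightarrow> bool" where
  "smooth_fun f \<longleftrightarrow> (\<forall>is. foldr partial is f differentiable_on UNIV)"

type_synonym 'n tfun = "real^'n \<Rightarrow> complex"

definition supp :: "'n::finite tfun \<Rightarrow> (real^'n) set" where
  "supp \<phi> = closure {x. \<phi> x \<noteq> 0}"

text \<open>Test functions on \<open>\<Omega>\<close> are represented by their extension by zero to the whole space.\<close>

definition test_funs :: "(real^'n::finite) set \<Rightarrow> 'n tfun set" where
  "test_funs \<Omega> = {\<phi>. smooth_fun \<phi> \<and> compact (supp \<phi>) \<and> supp \<phi> \<subseteq> \<Omega>}"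

definition Cm_norm :: "nat \<Rightarrow> 'n::finite tfun \<Rightarrow> real" where
  "Cm_norm m \<phi> = Sup {norm (mderiv \<alpha> \<phi> x) |\<alpha> x. mi_deg \<alpha> \<le> m}"

text \<open>
  The topology is the locally convex inductive limit of the Frechet spaces of test functions
  supported in a fixed compact \<open>K\<close>: a seminorm is continuous iff its restriction to each of
  these is. Convergence and boundedness are expressed through the continuous seminorms.
\<close>

definition cont_seminorm :: "(real^'n::finite) set \<Rightarrow> ('n tfun \<Rightarrow> real) \<Rightarrow> bool" where
  "cont_seminorm \<Omega> p \<longleftrightarrow>
     (\<forall>\<phi>\<in>test_funs \<Omega>. 0 \<le> p \<phi>) \<and>
     (\<forall>\<phi>\<in>test_funs \<Omega>. \<forall>c. p (\<lambda>x. c * \<phi> x) = norm c * p \<phi>) \<and>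
     (\<forall>\<phi>\<in>test_funs \<Omega>. \<forall>\<psi>\<in>test_funs \<Omega>. p (\<lambda>x. \<phi> x + \<psi> x) \<le> p \<phi> + p \<psi>) \<and>
     (\<forall>K. compact K \<and> K \<subseteq> \<Omega> \<longrightarrow>
        (\<exists>C m. \<forall>\<phi>\<in>test_funs \<Omega>. supp \<phi> \<subseteq> K \<longrightarrow> p \<phi> \<le> C * Cm_norm m \<phi>))"

definition tf_tendsto ::
    "(real^'n::finite) set \<Rightarrow> ('b \<Rightarrow> 'n tfun) \<Rightarrow> 'n tfun \<Rightarrow> 'b filter \<Rightarrow> bool" where
  "tf_tendsto \<Omega> f l F \<longleftrightarrow>
     (\<forall>p. cont_seminorm \<Omega> p \<longrightarrow> ((\<lambda>h. p (\<lambda>y. f h y - l y)) \<longlongrightarrow> 0) F)"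

definition tf_bounded :: "(real^'n::finite) set \<Rightarrow> 'n tfun set \<Rightarrow> bool" where
  "tf_bounded \<Omega> B \<longleftrightarrow>
     B \<subseteq> test_funs \<Omega> \<and> (\<forall>p. cont_seminorm \<Omega> p \<longrightarrow> (\<exists>M. \<forall>\<phi>\<in>B. p \<phi> \<le> M))"

definition tf_has_deriv ::
    "(real^'n::finite) set \<Rightarrow> (real \<Rightarrow> 'n tfun) \<Rightarrow> 'n tfun \<Rightarrow> real \<Rightarrow> bool" where
  "tf_has_deriv \<Omega> c c' t \<longleftrightarrow>
     tf_tendsto \<Omega> (\<lambda>h y. (c (t + h) y - c t y) /\<^sub>R h) c' (at 0)"

text \<open>
  Partial derivatives of a map from a Euclidean space into the space of test functions, as limits
  of difference quotients in that space.
\<close>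

definition tf_partial :: "'n \<Rightarrow> (real^'n::finite \<Rightarrow> 'n tfun) \<Rightarrow> real^'n \<Rightarrow> 'n tfun" where
  "tf_partial i \<Phi> x =
     (THE g. g \<in> test_funs UNIV \<and> tf_has_deriv UNIV (\<lambda>h. \<Phi> (x + h *\<^sub>R axis i 1)) g 0)"

definition tf_mderiv :: "('n::finite \<Rightarrow> nat) \<Rightarrow> (real^'n \<Rightarrow> 'n tfun) \<Rightarrow> real^'n \<Rightarrow> 'n tfun" where
  "tf_mderiv \<alpha> \<Phi> = foldr tf_partial (mi_list \<alpha>) \<Phi>"

definition smooth_curve :: "(real \<Rightarrow> 'v::real_normed_vector) \<Rightarrow> bool" where
  "smooth_curve c \<longleftrightarrow>
     (\<exists>d. d 0 = c \<and> (\<forall>k t. (d k has_vector_derivative d (Suc k) t) (at t)))"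

definition tf_smooth_curve :: "(real^'n::finite) set \<Rightarrow> (real \<Rightarrow> 'n tfun) \<Rightarrow> bool" where
  "tf_smooth_curve \<Omega> c \<longleftrightarrow>
     (\<exists>d. d 0 = c \<and> (\<forall>k t. d k t \<in> test_funs \<Omega> \<and> tf_has_deriv \<Omega> (d k) (d (Suc k) t) t))"

definition A_set :: "nat \<Rightarrow> (real^'n::finite) set \<Rightarrow> 'n tfun set" where
  "A_set q \<Omega> = {\<phi>\<in>test_funs \<Omega>. (LINT x|lborel. \<phi> x) = 1 \<and>
     (\<forall>\<alpha>. 1 \<le> mi_deg \<alpha> \<and> mi_deg \<alpha> \<le> q \<longrightarrow> (LINT x|lborel. mi_power x \<alpha> *\<^sub>R \<phi> x) = 0)}"

definition S_op :: "real \<Rightarrow> 'n::finite tfun \<Rightarrow> 'n tfun" where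
  "S_op \<epsilon> \<phi> = (\<lambda>y. \<phi> (y /\<^sub>R \<epsilon>) /\<^sub>R \<epsilon> ^ CARD('n))"

definition T_op :: "real^'n::finite \<Rightarrow> 'n tfun \<Rightarrow> 'n tfun" where
  "T_op x \<phi> = (\<lambda>y. \<phi> (y - x))"

definition U_set :: "(real^'n::finite) set \<Rightarrow> ('n tfun \<times> (real^'n)) set" where
  "U_set \<Omega> = {(\<phi>, x). \<phi> \<in> A_set 0 UNIV \<and> x \<in> \<Omega> \<and> (\<lambda>y. y + x) ` supp \<phi> \<subseteq> \<Omega>}"

text \<open>
  Curves into \<open>U_set \<Omega>\<close> are smooth iff their images under \<open>(\<phi>, x) \<mapsto> (T_op x \<phi>, x)\<close>
  are smooth into \<open>A_set 0 \<Omega> \<times> \<Omega>\<close>.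
\<close>

definition U_smooth_curve ::
    "(real^'n::finite) set \<Rightarrow> (real \<Rightarrow> 'n tfun \<times> (real^'n)) \<Rightarrow> bool" where
  "U_smooth_curve \<Omega> c \<longleftrightarrow>
     (\<forall>t. c t \<in> U_set \<Omega>) \<and>
     tf_smooth_curve \<Omega> (\<lambda>t. T_op (snd (c t)) (fst (c t))) \<and>
     smooth_curve (\<lambda>t. snd (c t))"

text \<open>
  Maps on \<open>U_set \<Omega>\<close> are total functions here; only their values on \<open>U_set \<Omega>\<close> are
  relevant in the following notions.
\<close>

definition smooth_maps ::
    "(real^'n::finite) set \<Rightarrow> 'v::euclidean_space set \<Rightarrow> ('n tfun \<times> (real^'n) \<Rightarrow> 'v) set" where
  "smooth_maps \<Omega> V = {X. (\<forall>u\<in>U_set \<Omega>. X u \<in> V) \<and>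
     (\<forall>c. U_smooth_curve \<Omega> c \<longrightarrow> smooth_curve (\<lambda>t. X (c t)))}"

definition Cb :: "(real^'n::finite) set \<Rightarrow> nat \<Rightarrow> (real \<Rightarrow> real^'n \<Rightarrow> 'n tfun) set" where
  "Cb \<Omega> q = {\<phi>.
     (\<forall>\<epsilon>\<in>{0<..1}. \<forall>x\<in>\<Omega>. \<phi> \<epsilon> x \<in> A_set q UNIV) \<and>
     (\<forall>e x. smooth_curve e \<and> smooth_curve x \<and> (\<forall>t. e t \<in> {0<..1} \<and> x t \<in> \<Omega>) \<longrightarrow>
        tf_smooth_curve UNIV (\<lambda>t. \<phi> (e t) (x t))) \<and>
     (\<forall>K \<alpha>. compact K \<and> K \<subseteq> \<Omega> \<longrightarrow>
        tf_bounded UNIV {tf_mderiv \<alpha> (\<phi> \<epsilon>) x |\<epsilon> x. \<epsilon> \<in> {0<..1} \<and> x \<in> K})}"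

text \<open>
  \<open>sup_bigO K f g\<close> says that the supremum of \<open>norm (f \<epsilon> x)\<close> over \<open>x \<in> K\<close> is
  \<open>O(g \<epsilon>)\<close> as \<open>\<epsilon>\<close> tends to 0 from above. For fixed \<open>\<phi>\<close> in \<open>Cb\<close> and compact \<open>K\<close>
  the pairs \<open>(S_op \<epsilon> (\<phi> \<epsilon> x), x)\<close>, with \<open>x\<close> in a neighbourhood of \<open>K\<close>, lie in
  \<open>U_set \<Omega>\<close> for all small \<open>\<epsilon>\<close>.
\<close>

definition sup_bigO ::
    "'a set \<Rightarrow> (real \<Rightarrow> 'a \<Rightarrow> 'v::real_normed_vector) \<Rightarrow> (real \<Rightarrow> real) \<Rightarrow> bool" where
  "sup_bigO K f g \<longleftrightarrow>
     (\<exists>C>0. \<exists>\<epsilon>0>0. \<forall>\<epsilon>. 0 < \<epsilon> \<and> \<epsilon> < \<epsilon>0 \<longrightarrow> (\<forall>x\<in>K. norm (f \<epsilon> x) \<le> C * \<bar>g \<epsilon>\<bar>))"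

definition moderate ::
    "(real^'n::finite) set \<Rightarrow> ('n tfun \<times> (real^'n) \<Rightarrow> 'v::euclidean_space) \<Rightarrow> bool" where
  "moderate \<Omega> R \<longleftrightarrow>
     (\<forall>K \<alpha>. compact K \<and> K \<subseteq> \<Omega> \<longrightarrow> (\<exists>N\<ge>1. \<forall>\<phi>\<in>Cb \<Omega> 0.
        sup_bigO K (\<lambda>\<epsilon>. mderiv \<alpha> (\<lambda>x. R (S_op \<epsilon> (\<phi> \<epsilon> x), x))) (\<lambda>\<epsilon>. inverse (\<epsilon> ^ N))))"

definition E_M :: "(real^'n::finite) set \<Rightarrow> ('n tfun \<times> (real^'n) \<Rightarrow> complex) set" where
  "E_M \<Omega> = {R\<in>smooth_maps \<Omega> UNIV. moderate \<Omega> R}"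

definition N_d :: "(real^'n::finite) set \<Rightarrow> ('n tfun \<times> (real^'n) \<Rightarrow> complex) set" where
  "N_d \<Omega> = {R\<in>E_M \<Omega>.
     (\<forall>K \<alpha>. compact K \<and> K \<subseteq> \<Omega> \<longrightarrow> (\<forall>m\<ge>1. \<exists>q\<ge>1. \<forall>\<phi>\<in>Cb \<Omega> q.
        sup_bigO K (\<lambda>\<epsilon>. mderiv \<alpha> (\<lambda>x. R (S_op \<epsilon> (\<phi> \<epsilon> x), x))) (\<lambda>\<epsilon>. \<epsilon> ^ m)))}"

definition G_rel :: "(real^'n::finite) set \<Rightarrow> ('n tfun \<times> (real^'n) \<Rightarrow> complex) rel" where
  "G_rel \<Omega> = {(R, S). R \<in> E_M \<Omega> \<and> S \<in> E_M \<Omega> \<and> (\<lambda>u. R u - S u) \<in> N_d \<Omega>}"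

definition G_d :: "(real^'n::finite) set \<Rightarrow> ('n tfun \<times> (real^'n) \<Rightarrow> complex) set set" where
  "G_d \<Omega> = E_M \<Omega> // G_rel \<Omega>"

definition G_zero :: "(real^'n::finite) set \<Rightarrow> ('n tfun \<times> (real^'n) \<Rightarrow> complex) set" where
  "G_zero \<Omega> = G_rel \<Omega> `` {\<lambda>_. 0}"

definition indep_snd ::
    "(real^'n::finite) set \<Rightarrow> ('n tfun \<times> (real^'n) \<Rightarrow> 'v) \<Rightarrow> bool" where
  "indep_snd \<Omega> X \<longleftrightarrow>
     (\<forall>\<phi> x y. (\<phi>, x) \<in> U_set \<Omega> \<and> (\<phi>, y) \<in> U_set \<Omega> \<longrightarrow> X (\<phi>, x) = X (\<phi>, y))"

definition V_M ::
    "(real^'n::finite) set \<Rightarrow> 'v::euclidean_space set \<Rightarrow> ('n tfun \<times> (real^'n) \<Rightarrow> 'v) set" where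
  "V_M \<Omega> V = {X\<in>smooth_maps \<Omega> V. moderate \<Omega> X \<and> indep_snd \<Omega> X}"

definition V_rel ::
    "(real^'n::finite) set \<Rightarrow> 'v::euclidean_space set \<Rightarrow> ('n tfun \<times> (real^'n) \<Rightarrow> 'v) rel" where
  "V_rel \<Omega> V = {(X, Y). X \<in> V_M \<Omega> V \<and> Y \<in> V_M \<Omega> V \<and>
     (\<forall>K. compact K \<and> K \<subseteq> \<Omega> \<longrightarrow> (\<forall>m\<ge>1. \<exists>q\<ge>1. \<forall>\<phi>\<in>Cb \<Omega> q.
        sup_bigO K (\<lambda>\<epsilon> x. X (S_op \<epsilon> (\<phi> \<epsilon> x), x) - Y (S_op \<epsilon> (\<phi> \<epsilon> x), x)) (\<lambda>\<epsilon>. \<epsilon> ^ m)))}"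

definition V_tilde ::
    "(real^'n::finite) set \<Rightarrow> 'v::euclidean_space set \<Rightarrow> ('n tfun \<times> (real^'n) \<Rightarrow> 'v) set set" where
  "V_tilde \<Omega> V = V_M \<Omega> V // V_rel \<Omega> V"

definition good_rep ::
    "(real^'n::finite) set \<Rightarrow> 'v::euclidean_space set \<Rightarrow> ('n tfun \<times> (real^'n) \<Rightarrow> 'v) \<Rightarrow> bool" where
  "good_rep \<Omega> V X \<longleftrightarrow> (\<exists>L. compact L \<and> L \<subseteq> V \<and> (\<forall>u\<in>U_set \<Omega>. X u \<in> L))"

definition V_tilde_c ::
    "(real^'n::finite) set \<Rightarrow> 'v::euclidean_space set \<Rightarrow> ('n tfun \<times> (real^'n) \<Rightarrow> 'v) set set" where
  "V_tilde_c \<Omega> V = {Xt\<in>V_tilde \<Omega> V. \<exists>X\<in>Xt. good_rep \<Omega> V X}"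

definition C_tilde :: "(real^'n::finite) set \<Rightarrow> ('n tfun \<times> (real^'n) \<Rightarrow> complex) set set" where
  "C_tilde \<Omega> = V_tilde \<Omega> UNIV"

definition C_zero :: "(real^'n::finite) set \<Rightarrow> ('n tfun \<times> (real^'n) \<Rightarrow> complex) set" where
  "C_zero \<Omega> = V_rel \<Omega> UNIV `` {\<lambda>_. 0}"

definition is_S_RX ::
    "(real^'n::finite) set \<Rightarrow> ('n tfun \<times> (real^'n) \<Rightarrow> complex) \<Rightarrow> ('n tfun \<times> (real^'n) \<Rightarrow> real^'n)
       \<Rightarrow> ('n tfun \<times> (real^'n) \<Rightarrow> complex) \<Rightarrow> bool" where
  "is_S_RX \<Omega> R X S \<longleftrightarrow>
     S \<in> smooth_maps \<Omega> UNIV \<and> indep_snd \<Omega> S \<and>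
     (\<forall>K B. compact K \<and> K \<subseteq> \<Omega> \<and> B \<subseteq> test_funs UNIV \<and> (\<exists>r. \<forall>\<phi>\<in>B. supp \<phi> \<subseteq> cball 0 r) \<longrightarrow>
        (\<exists>W \<epsilon>0. open W \<and> K \<subseteq> W \<and> compact (closure W) \<and> closure W \<subseteq> \<Omega> \<and> 0 < \<epsilon>0 \<and>
          (\<forall>x\<in>W. \<forall>\<phi>\<in>B \<inter> A_set 0 UNIV. \<forall>\<epsilon>. 0 < \<epsilon> \<and> \<epsilon> < \<epsilon>0 \<longrightarrow>
             (S_op \<epsilon> \<phi>, x) \<in> U_set \<Omega> \<and> (S_op \<epsilon> \<phi>, X (S_op \<epsilon> \<phi>, x)) \<in> U_set \<Omega> \<and>
             S (S_op \<epsilon> \<phi>, x) = R (S_op \<epsilon> \<phi>, X (S_op \<epsilon> \<phi>, x)))))"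

text \<open>
  The class of any map \<open>S\<close> with \<open>is_S_RX \<Omega> R X S\<close>; it depends neither on the representative
  \<open>R\<close>, nor on the good representative \<open>X\<close>, nor on the choice of \<open>S\<close>.
\<close>

definition point_value ::
    "(real^'n::finite) set \<Rightarrow> ('n tfun \<times> (real^'n) \<Rightarrow> complex) set
       \<Rightarrow> ('n tfun \<times> (real^'n) \<Rightarrow> real^'n) set \<Rightarrow> ('n tfun \<times> (real^'n) \<Rightarrow> complex) set" where
  "point_value \<Omega> Rt Xt =
     (THE Ct. Ct \<in> C_tilde \<Omega> \<and>
        (\<exists>R\<in>Rt. \<exists>X\<in>Xt. \<exists>S\<in>Ct. good_rep \<Omega> \<Omega> X \<and> is_S_RX \<Omega> R X S))"

end

theory Submission
  imports Defs
begin

text \<open>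
  By Landau's trick a moderate map is negligible as soon as the estimate without derivatives
  holds. Point values do not depend on the representatives because moderateness also bounds the
  derivative of \<open>R\<close> in the point variable. Conversely, suppose that the estimate fails for the
  exponent \<open>m\<close>. Then, near a single point \<open>a\<close> and for every order \<open>q\<close>, it fails along sequences
  of scales tending to 0 and points \<open>x\<close>. The energy, that is the squared \<open>L\<^sup>2\<close>-norm, of the
  scaled test object tends to infinity, so there is one bounded smooth path \<open>c\<close> whose value at the
  energy of each of these test objects is the corresponding \<open>x\<close>. Evaluating \<open>R\<close> at the
  generalized point \<open>c \<circ> energy\<close>, after a cut-off of the test object that makes the value defined
  everywhere, reproduces the violations. Two facts are used throughout: smoothness along curves
  is smoothness (Boman), and estimates are uniform in the test object, as test objects given at a
  sparse sequence of scales can be interpolated.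
\<close>

section \<open>Iterated directional derivatives\<close>

text \<open>A generalized point sees only the test object, not the base point, while violations of
  the estimate occur at points that move with the scale, along test objects that depend on the point
  themselves. Hence the point has to be read off from the test object. The energy suits this
  purpose: scaling divides it by \<open>ep ^ CARD('n)\<close>, and on bounded families it is bounded
  below because the integral is 1. So it separates scales, yet grows only polynomially in
  \<open>inverse ep\<close>, which keeps the constructed point moderate. The other obstacle is
  moderateness of the resulting value. Its derivatives involve those of
  \<open>R (S_op ep (\<phi> ep x), y)\<close> in \<open>x\<close> and \<open>y\<close> separately,
  whereas the hypothesis bounds derivatives along the diagonal \<open>y = x\<close> only. Replacing
  \<open>x\<close> by a smooth function of \<open>y\<close> inside the test object gives other
  curves through the same pair of points, and uniformity of the estimates makes the bounds
  independent of the function chosen. The estimates for mixed derivatives are recovered from these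
  curves.\<close>

definition dird :: "'a::real_normed_vector => ('a => 'b::real_normed_vector) => 'a => 'b" where
  "dird v f x = vector_derivative (\<lambda>h. f (x + h *\<^sub>R v)) (at 0)"

abbreviation dirds :: "'a::real_normed_vector list => ('a => 'b::real_normed_vector) => 'a => 'b"
  where "dirds \<equiv> foldr dird"

lemma partial_eq_dird: "partial i = dird (axis i 1)"
  by (intro ext) (simp add: partial_def dird_def)

lemma foldr_partial_eq_dirds: "foldr partial is f = dirds (map (\<lambda>i. axis i 1) is) f"
  by (induction "is") (simp_all add: partial_eq_dird)

lemma has_vector_derivative_line:
  assumes "(f has_derivative f') (at (x + s *\<^sub>R v))"
  shows "((\<lambda>h. f (x + h *\<^sub>R v)) has_vector_derivative f' v) (at s)"
proof -
  have "((\<lambda>h. x + h *\<^sub>R v) has_derivative (\<lambda>h. h *\<^sub>R v)) (at s)"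
    by (auto intro!: derivative_eq_intros)
  from diff_chain_at[OF this assms]
  have "((\<lambda>h. f (x + h *\<^sub>R v)) has_derivative (\<lambda>h. f' (h *\<^sub>R v))) (at s)"
    by (simp add: o_def)
  moreover have "linear f'"
    using assms by (simp add: has_derivative_linear)
  ultimately show ?thesis
    by (simp add: has_vector_derivative_def linear_scale)
qed

lemma dird_eqI:
  assumes "(f has_derivative f') (at x)"
  shows "dird v f x = f' v"
  using vector_derivative_at[OF has_vector_derivative_line[of f f' x 0 v]] assms
  by (simp add: dird_def)

lemma has_derivative_dird:
  assumes "f differentiable (at x)"
  shows "(f has_derivative (\<lambda>v. dird v f x)) (at x)"
proof -
  obtain f' where f': "(f has_derivative f') (at x)"
    using assms by (auto simp: differentiable_def)
  moreover have "f' = (\<lambda>v. dird v f x)"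
    using dird_eqI[OF f'] by auto
  ultimately show ?thesis by simp
qed

lemma dird_linear:
  assumes "f differentiable (at x)"
  shows "linear (\<lambda>v. dird v f x)"
  using has_derivative_dird[OF assms] has_derivative_linear by blast

lemma dird_cong:
  assumes "open U" "x \<in> U" "\<And>y. y \<in> U ==> f y = g y"
  shows "dird v f x = dird v g x"
proof -
  have "((\<lambda>h. x + h *\<^sub>R v) \<longlongrightarrow> x + 0 *\<^sub>R v) (nhds 0)"
    by (intro tendsto_intros filterlim_ident)
  then have "eventually (\<lambda>h. x + h *\<^sub>R v \<in> U) (nhds 0)"
    using assms(1,2) by (auto simp: tendsto_def)
  then have "eventually (\<lambda>h. h \<in> UNIV --> f (x + h *\<^sub>R v) = g (x + h *\<^sub>R v)) (nhds 0)"
    by (rule eventually_mono) (use assms(3) in auto)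
  then show ?thesis
    unfolding dird_def by (rule vector_derivative_cong_eq) auto
qed

lemma dirds_cong:
  assumes "open U" "x \<in> U" "\<And>y. y \<in> U ==> f y = g y"
  shows "dirds vs f x = dirds vs g x"
  using assms(2)
proof (induction vs arbitrary: x)
  case Nil
  then show ?case using assms by simp
next
  case (Cons v vs)
  then show ?case
    using dird_cong[OF assms(1), of x "dirds vs f" "dirds vs g"] by simp
qed

lemma dird_shift: "dird v (\<lambda>y. f (y + a)) = (\<lambda>x. dird v f (x + a))"
  by (intro ext) (simp add: dird_def algebra_simps)

lemma dirds_shift: "dirds vs (\<lambda>y. f (y + a)) = (\<lambda>x. dirds vs f (x + a))"
  by (induction vs) (simp_all add: dird_shift[of _ _ a])

lemma dird_line: "dird r (\<lambda>h. f (x + h *\<^sub>R v)) = (\<lambda>h. dird (r *\<^sub>R v) f (x + h *\<^sub>R v))"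
  by (intro ext) (simp add: dird_def algebra_simps)

lemma dirds_line:
  "dirds rs (\<lambda>h. f (x + h *\<^sub>R v)) = (\<lambda>h. dirds (map (\<lambda>r. r *\<^sub>R v) rs) f (x + h *\<^sub>R v))"
  by (induction rs) (simp_all add: dird_line)

lemma dirds_slice_snd: "dirds vs (\<lambda>y. f (a, y)) = (\<lambda>y. dirds (map (Pair 0) vs) f (a, y))"
  by (induction vs) (simp_all add: dird_def)

section \<open>Calculus of smooth maps on open sets\<close>

fun smooth_upto :: "nat => 'a::euclidean_space set => ('a => 'b::euclidean_space) => bool" where
  "smooth_upto 0 U f \<longleftrightarrow> continuous_on U f"
| "smooth_upto (Suc k) U f \<longleftrightarrow>
     (\<forall>x\<in>U. f differentiable (at x)) \<and> (\<forall>v. smooth_upto k U (dird v f))"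

definition smooth_in :: "'a::euclidean_space set => ('a => 'b::euclidean_space) => bool" where
  "smooth_in U f \<longleftrightarrow> (\<forall>k. smooth_upto k U f)"

lemma differentiable_imp_continuous_on_at:
  "(\<And>x. x \<in> U ==> f differentiable (at x)) ==> continuous_on U f"
  by (intro continuous_at_imp_continuous_on ballI differentiable_imp_continuous_within)

lemma smooth_upto_SucD: "smooth_upto (Suc k) U f ==> smooth_upto k U f"
proof (induction k arbitrary: f)
  case 0
  then show ?case
    using differentiable_imp_continuous_on_at[of U f] by simp
next
  case (Suc k)
  then show ?case by (meson smooth_upto.simps(2))
qed

lemma smooth_in_continuous: "smooth_in U f ==> continuous_on U f"
  unfolding smooth_in_def using smooth_upto.simps(1) by blast

lemma smooth_in_differentiable: "smooth_in U f ==> x \<in> U ==> f differentiable (at x)"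
  unfolding smooth_in_def using smooth_upto.simps(2) by blast

lemma smooth_in_dird: "smooth_in U f ==> smooth_in U (dird v f)"
  unfolding smooth_in_def using smooth_upto.simps(2) by blast

lemma smooth_in_dirds: "smooth_in U f ==> smooth_in U (dirds vs f)"
  by (induction vs) (auto intro: smooth_in_dird)

lemma smooth_upto_subset: "smooth_upto k U f ==> V \<subseteq> U ==> smooth_upto k V f"
  by (induction k arbitrary: f) (auto intro: continuous_on_subset)

lemma smooth_in_subset: "smooth_in U f ==> V \<subseteq> U ==> smooth_in V f"
  unfolding smooth_in_def using smooth_upto_subset by blast

lemma smooth_upto_local:
  assumes "\<And>x. x \<in> U ==> \<exists>V. open V \<and> x \<in> V \<and> smooth_upto k V f"
  shows "smooth_upto k U f"
  using assms
proof (induction k arbitrary: f)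
  case 0
  have "isCont f x" if "x \<in> U" for x
    using 0[OF that] by (auto simp: continuous_on_eq_continuous_at)
  then show ?case
    by (auto intro: continuous_at_imp_continuous_on)
next
  case (Suc k)
  then show ?case by fastforce
qed

lemma smooth_upto_cong:
  assumes "open U" "\<And>x. x \<in> U ==> f x = g x" "smooth_upto k U f"
  shows "smooth_upto k U g"
  using assms(2,3)
proof (induction k arbitrary: f g)
  case 0
  then show ?case by (metis continuous_on_cong smooth_upto.simps(1))
next
  case (Suc k)
  have "g differentiable (at x)" if x: "x \<in> U" for x
  proof -
    have "(f has_derivative (\<lambda>v. dird v f x)) (at x)"
      using Suc x by (intro has_derivative_dird) auto
    then have "(g has_derivative (\<lambda>v. dird v f x)) (at x)"
      using has_derivative_transform_within_open[OF _ assms(1) x] Suc by blast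
    then show ?thesis by (auto simp: differentiable_def)
  qed
  moreover have "smooth_upto k U (dird v g)" for v
    using Suc.IH[of "dird v f" "dird v g"] dird_cong[OF assms(1) _ Suc.prems(1)] Suc.prems by auto
  ultimately show ?case by simp
qed

lemma smooth_in_cong:
  assumes "open U" "\<And>x. x \<in> U ==> f x = g x" "smooth_in U f"
  shows "smooth_in U g"
  using smooth_upto_cong[OF assms(1,2)] assms(3) unfolding smooth_in_def by simp

lemma smooth_in_local:
  assumes "\<And>x. x \<in> U ==> \<exists>V. open V \<and> x \<in> V \<and> smooth_in V f"
  shows "smooth_in U f"
  unfolding smooth_in_def
proof
  fix k
  show "smooth_upto k U f"
    by (rule smooth_upto_local) (use assms smooth_in_def in blast)
qed

lemma smooth_in_local_eq:
  assumes "\<And>x. x \<in> U ==> \<exists>V g. open V \<and> x \<in> V \<and> smooth_in V g \<and> (\<forall>y\<in>V. f y = g y)"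
  shows "smooth_in U f"
proof (rule smooth_in_local)
  fix x assume "x \<in> U"
  then obtain V g where "open V" "x \<in> V" "smooth_in V g" "\<forall>y\<in>V. f y = g y"
    using assms by blast
  then show "\<exists>V. open V \<and> x \<in> V \<and> smooth_in V f"
    using smooth_in_cong[of V g f] by auto
qed

lemma dird_const: "dird v (\<lambda>x. c) = (\<lambda>x. 0)"
  by (intro ext) (simp add: dird_def)

lemma smooth_upto_const: "smooth_upto k U (\<lambda>x. c)"
  by (induction k arbitrary: c) (auto simp: dird_const)

lemma smooth_in_const [simp]: "smooth_in U (\<lambda>x. c)"
  by (simp add: smooth_in_def smooth_upto_const)

lemma dirds_const: "vs \<noteq> [] ==> dirds vs (\<lambda>x. c) = (\<lambda>x. 0)"
proof (induction vs)
  case (Cons v vs)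
  then show ?case by (cases "vs = []") (auto simp: dird_const)
qed simp

lemma dird_bounded_linear:
  assumes "bounded_linear L"
  shows "dird v L = (\<lambda>x. L v)"
  using dird_eqI[OF bounded_linear_imp_has_derivative[OF assms]] by auto

lemma smooth_in_bounded_linear:
  assumes "bounded_linear L"
  shows "smooth_in U L"
  unfolding smooth_in_def
proof
  fix k
  show "smooth_upto k U L"
  proof (cases k)
    case 0
    then show ?thesis
      using assms by (simp add: linear_continuous_on)
  next
    case (Suc k)
    then show ?thesis
      using assms bounded_linear_imp_differentiable
      by (auto simp: dird_bounded_linear smooth_upto_const)
  qed
qed

lemma smooth_in_id [simp]: "smooth_in U (\<lambda>x. x)"
  using smooth_in_bounded_linear[OF bounded_linear_ident] .

lemma dird_bounded_linear_comp:
  assumes "bounded_linear L" "f differentiable (at x)"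
  shows "dird v (\<lambda>x. L (f x)) x = L (dird v f x)"
proof -
  have "((\<lambda>x. L (f x)) has_derivative (\<lambda>v. L (dird v f x))) (at x)"
    using bounded_linear.has_derivative[OF assms(1) has_derivative_dird[OF assms(2)]] .
  then show ?thesis by (rule dird_eqI)
qed

lemma dird_add:
  assumes "f differentiable (at x)" "g differentiable (at x)"
  shows "dird v (\<lambda>x. f x + g x) x = dird v f x + dird v g x"
  using dird_eqI[OF has_derivative_add[OF has_derivative_dird[OF assms(1)] has_derivative_dird[OF assms(2)]]] .

lemma smooth_upto_add:
  assumes "open U" "smooth_upto k U f" "smooth_upto k U g"
  shows "smooth_upto k U (\<lambda>x. f x + g x)"
  using assms(2,3)
proof (induction k arbitrary: f g)
  case 0
  then show ?case by (simp add: continuous_on_add)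
next
  case (Suc k)
  have "smooth_upto k U (dird v (\<lambda>x. f x + g x))" for v
    by (rule smooth_upto_cong[OF assms(1), of "\<lambda>x. dird v f x + dird v g x"])
      (use Suc in \<open>auto simp: dird_add\<close>)
  with Suc show ?case by auto
qed

lemma smooth_in_add:
  "open U ==> smooth_in U f ==> smooth_in U g ==> smooth_in U (\<lambda>x. f x + g x)"
  unfolding smooth_in_def by (simp add: smooth_upto_add)

lemma smooth_upto_sum:
  assumes "open U" "\<And>i. i \<in> I ==> smooth_upto k U (f i)"
  shows "smooth_upto k U (\<lambda>x. \<Sum>i\<in>I. f i x)"
  using assms(2)
  by (induction I rule: infinite_finite_induct)
    (auto intro!: smooth_upto_add smooth_upto_const assms(1))

lemma smooth_in_sum:
  "open U ==> (\<And>i. i \<in> I ==> smooth_in U (f i)) ==> smooth_in U (\<lambda>x. \<Sum>i\<in>I. f i x)"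
  unfolding smooth_in_def by (simp add: smooth_upto_sum)

lemma dird_bilinear:
  assumes "bounded_bilinear B" "f differentiable (at x)" "g differentiable (at x)"
  shows "dird v (\<lambda>x. B (f x) (g x)) x = B (f x) (dird v g x) + B (dird v f x) (g x)"
  using dird_eqI[OF bounded_bilinear.FDERIV[OF assms(1) has_derivative_dird[OF assms(2)]
    has_derivative_dird[OF assms(3)]]] .

lemma smooth_upto_bilinear:
  assumes "open U" "bounded_bilinear B" "smooth_upto k U f" "smooth_upto k U g"
  shows "smooth_upto k U (\<lambda>x. B (f x) (g x))"
  using assms(3,4)
proof (induction k arbitrary: f g)
  case 0
  then show ?case by (simp add: bounded_bilinear.continuous_on[OF assms(2)])
next
  case (Suc k)
  have fg: "smooth_upto k U f" "smooth_upto k U g"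
    using Suc.prems smooth_upto_SucD by auto
  have "smooth_upto k U (dird v (\<lambda>x. B (f x) (g x)))" for v
    by (rule smooth_upto_cong[OF assms(1), of "\<lambda>x. B (f x) (dird v g x) + B (dird v f x) (g x)"])
      (use Suc fg in \<open>auto simp: dird_bilinear[OF assms(2)] intro!: smooth_upto_add assms(1)\<close>)
  moreover have "(\<lambda>x. B (f x) (g x)) differentiable (at x)" if "x \<in> U" for x
    using bounded_bilinear.FDERIV[OF assms(2) has_derivative_dird has_derivative_dird, of f x g]
      Suc.prems that by (auto simp: differentiable_def)
  ultimately show ?case by simp
qed

lemma smooth_in_bilinear:
  assumes "open U" "bounded_bilinear B" "smooth_in U f" "smooth_in U g"
  shows "smooth_in U (\<lambda>x. B (f x) (g x))"
  using smooth_upto_bilinear[OF assms(1,2)] assms(3,4) unfolding smooth_in_def by simp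

lemmas smooth_in_scaleR = smooth_in_bilinear[OF _ bounded_bilinear_scaleR]
lemmas smooth_in_inner = smooth_in_bilinear[OF _ bounded_bilinear_inner]

lemma smooth_in_mult:
  fixes f g :: "'a::euclidean_space => 'b::{euclidean_space, real_normed_algebra}"
  shows "open U ==> smooth_in U f ==> smooth_in U g ==> smooth_in U (\<lambda>x. f x * g x)"
  by (rule smooth_in_bilinear[OF _ bounded_bilinear_mult])

lemma smooth_in_minus: "open U ==> smooth_in U f ==> smooth_in U (\<lambda>x. - f x)"
  using smooth_in_scaleR[of U "\<lambda>x. -1" f] by simp

lemma smooth_in_diff:
  "open U ==> smooth_in U f ==> smooth_in U g ==> smooth_in U (\<lambda>x. f x - g x)"
  using smooth_in_add[of U f "\<lambda>x. - g x"] smooth_in_minus by auto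

lemma dird_comp:
  fixes f :: "'b::euclidean_space => 'c::euclidean_space"
  assumes "g differentiable (at x)" "f differentiable (at (g x))"
  shows "dird v (\<lambda>x. f (g x)) x = dird (dird v g x) f (g x)"
    and "dird v (\<lambda>x. f (g x)) x = (\<Sum>b\<in>Basis. (dird v g x \<bullet> b) *\<^sub>R dird b f (g x))"
proof -
  have "((\<lambda>x. f (g x)) has_derivative (\<lambda>v. dird (dird v g x) f (g x))) (at x)"
    using diff_chain_at[OF has_derivative_dird[OF assms(1)] has_derivative_dird[OF assms(2)]]
    by (simp add: o_def)
  then show *: "dird v (\<lambda>x. f (g x)) x = dird (dird v g x) f (g x)"
    by (rule dird_eqI)
  interpret linear "\<lambda>w. dird w f (g x)"
    using dird_linear[OF assms(2)] .
  have "dird (\<Sum>b\<in>Basis. (dird v g x \<bullet> b) *\<^sub>R b) f (g x) =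
    (\<Sum>b\<in>Basis. (dird v g x \<bullet> b) *\<^sub>R dird b f (g x))"
    by (simp add: sum scale)
  then show "dird v (\<lambda>x. f (g x)) x = (\<Sum>b\<in>Basis. (dird v g x \<bullet> b) *\<^sub>R dird b f (g x))"
    by (simp add: * euclidean_representation)
qed

text \<open>The derivative of a composition has the variable direction \<open>dird v g x\<close>.
  Expanding it in the basis leaves fixed directions \<open>dird b f\<close>, and to these the
  induction hypothesis of one order less applies.\<close>

lemma smooth_upto_comp:
  fixes f :: "'b::euclidean_space => 'c::euclidean_space"
  assumes "open U" "smooth_upto k U g" "smooth_upto k V f" "g ` U \<subseteq> V"
  shows "smooth_upto k U (\<lambda>x. f (g x))"
  using assms(2,3)
proof (induction k arbitrary: f)
  case 0
  then show ?case
    using continuous_on_compose2[OF _ _ assms(4), of f] by simp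
next
  case (Suc k)
  have g: "smooth_upto k U g"
    using Suc.prems smooth_upto_SucD by blast
  have d: "f differentiable (at (g x))" if "x \<in> U" for x
    using Suc.prems assms(4) that by auto
  have "smooth_upto k U (dird v (\<lambda>x. f (g x)))" for v
  proof (rule smooth_upto_cong[OF assms(1)])
    show "(\<Sum>b\<in>Basis. (dird v g x \<bullet> b) *\<^sub>R dird b f (g x)) = dird v (\<lambda>x. f (g x)) x" if "x \<in> U" for x
      using dird_comp(2)[of g x f v] Suc.prems d that by auto
    show "smooth_upto k U (\<lambda>x. \<Sum>b\<in>Basis. (dird v g x \<bullet> b) *\<^sub>R dird b f (g x))"
      using Suc.IH[OF g] Suc.prems g
      by (intro smooth_upto_sum assms(1) smooth_upto_bilinear[OF _ bounded_bilinear_scaleR]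
          smooth_upto_bilinear[OF _ bounded_bilinear_inner] smooth_upto_const) auto
  qed
  moreover have "(\<lambda>x. f (g x)) differentiable (at x)" if "x \<in> U" for x
    using differentiable_chain_at[of g x f] Suc.prems d that by (auto simp: o_def)
  ultimately show ?case by simp
qed

lemma smooth_in_comp:
  fixes f :: "'b::euclidean_space => 'c::euclidean_space"
  assumes "open U" "smooth_in U g" "smooth_in V f" "g ` U \<subseteq> V"
  shows "smooth_in U (\<lambda>x. f (g x))"
  using smooth_upto_comp[OF assms(1) _ _ assms(4)] assms(2,3) unfolding smooth_in_def by blast

lemma smooth_in_linear_comp:
  fixes L :: "'b::euclidean_space => 'c::euclidean_space"
  shows "open U ==> bounded_linear L ==> smooth_in U f ==> smooth_in U (\<lambda>x. L (f x))"
  using smooth_in_comp[of U f UNIV L] smooth_in_bounded_linear by auto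

lemma smooth_in_Pair:
  assumes "open U" "smooth_in U f" "smooth_in U g"
  shows "smooth_in U (\<lambda>x. (f x, g x))"
proof -
  have 1: "bounded_linear (\<lambda>a. (a, 0::'c))" "bounded_linear (\<lambda>b. (0::'b, b))"
    by (intro bounded_linear_Pair bounded_linear_ident bounded_linear_zero)+
  have "smooth_in U (\<lambda>x. (f x, 0) + (0, g x))"
    using smooth_in_linear_comp[OF assms(1) 1(1) assms(2)] smooth_in_linear_comp[OF assms(1) 1(2) assms(3)]
    by (intro smooth_in_add assms(1)) auto
  then show ?thesis by simp
qed

lemma smooth_in_fst: "open U ==> smooth_in U f ==> smooth_in U (\<lambda>x. fst (f x))"
  and smooth_in_snd: "open U ==> smooth_in U f ==> smooth_in U (\<lambda>x. snd (f x))"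
  by (auto intro: smooth_in_linear_comp bounded_linear_fst bounded_linear_snd)

lemma smooth_in_componentwise:
  fixes f :: "'a::euclidean_space => 'b::euclidean_space"
  assumes "open U" "\<And>b. b \<in> Basis ==> smooth_in U (\<lambda>x. f x \<bullet> b)"
  shows "smooth_in U f"
proof -
  have "smooth_in U (\<lambda>x. \<Sum>b\<in>Basis. (f x \<bullet> b) *\<^sub>R b)"
    using assms by (intro smooth_in_sum smooth_in_scaleR smooth_in_const) auto
  then show ?thesis by (simp add: euclidean_representation)
qed

text \<open>Derivatives of members of \<open>P\<close> need not be members again: it suffices that
  they are built from members by operations preserving smoothness of each order. The last premise
  therefore speaks of all members of \<open>P\<close> at a fixed order \<open>k\<close>.\<close>

lemma smooth_in_coinduct:
  assumes "P f"
    and "\<And>f x. P f ==> x \<in> U ==> f differentiable (at x)"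
    and "\<And>f v k. P f ==> (\<And>g. P g ==> smooth_upto k U g) ==> smooth_upto k U (dird v f)"
  shows "smooth_in U f"
  unfolding smooth_in_def
proof
  fix k
  show "smooth_upto k U f"
    using assms(1)
  proof (induction k arbitrary: f)
    case 0
    then show ?case
      using differentiable_imp_continuous_on_at[of U f] assms(2) by simp
  next
    case (Suc k)
    then show ?case
      using assms(2,3) by simp
  qed
qed

text \<open>The derivative is a polynomial in the inverse itself and \<open>dird v f\<close>, so
  order \<open>k\<close> of the inverse yields order \<open>Suc k\<close>.\<close>

lemma smooth_in_inverse:
  fixes f :: "'a::euclidean_space => real"
  assumes U: "open U" and f: "smooth_in U f" and nz: "\<And>x. x \<in> U ==> f x \<noteq> 0"
  shows "smooth_in U (\<lambda>x. inverse (f x))"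
  unfolding smooth_in_def
proof
  fix k
  show "smooth_upto k U (\<lambda>x. inverse (f x))"
  proof (induction k)
    case 0
    then show ?case
      using smooth_in_continuous[OF f] nz by (auto intro!: continuous_intros)
  next
    case (Suc k)
    have der: "((\<lambda>x. inverse (f x)) has_derivative (\<lambda>v. - (inverse (f x) * dird v f x * inverse (f x)))) (at x)"
      if "x \<in> U" for x
      using has_derivative_dird[OF smooth_in_differentiable[OF f that]] nz[OF that]
      by (auto intro!: derivative_eq_intros)
    have "smooth_upto k U (dird v (\<lambda>x. inverse (f x)))" for v
    proof (rule smooth_upto_cong[OF U, of "\<lambda>x. (-1) * (inverse (f x) * dird v f x * inverse (f x))"])
      show "(-1) * (inverse (f x) * dird v f x * inverse (f x)) = dird v (\<lambda>x. inverse (f x)) x"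
        if "x \<in> U" for x
        using dird_eqI[OF der[OF that]] by simp
      show "smooth_upto k U (\<lambda>x. (-1) * (inverse (f x) * dird v f x * inverse (f x)))"
        using Suc smooth_in_dird[OF f, of v] unfolding smooth_in_def
        by (intro smooth_upto_bilinear[OF U bounded_bilinear_mult] smooth_upto_const) auto
    qed
    then show ?case
      using der by (auto simp: differentiable_def)
  qed
qed

text \<open>Links the sequence of successive derivatives to the directional calculus: on the real
  line \<open>dird v\<close> is \<open>v\<close> times the ordinary derivative.\<close>

lemma smooth_curve_iff:
  fixes c :: "real => 'v::euclidean_space"
  shows "smooth_curve c \<longleftrightarrow> smooth_in UNIV c"
proof
  assume "smooth_curve c"
  then obtain d where d: "d 0 = c" "\<And>k t. (d k has_vector_derivative d (Suc k) t) (at t)"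
    unfolding smooth_curve_def by blast
  show "smooth_in UNIV c"
  proof (rule smooth_in_coinduct[where P="\<lambda>f. \<exists>k. f = d k"])
    show "\<exists>k. c = d k" using d by auto
  next
    fix f x assume "\<exists>k. f = d k"
    then show "f differentiable (at x)"
      using d(2) by (auto simp: differentiable_def has_vector_derivative_def)
  next
    fix f v k assume "\<exists>k. f = d k" and IH: "\<And>g. \<exists>k. g = d k ==> smooth_upto k UNIV g"
    then obtain j where j: "f = d j" by blast
    have "dird v f = (\<lambda>t. v *\<^sub>R d (Suc j) t)"
      using dird_eqI[OF d(2)[unfolded has_vector_derivative_def]] j by auto
    then show "smooth_upto k UNIV (dird v f)"
      using smooth_upto_bilinear[OF open_UNIV bounded_bilinear_scaleR smooth_upto_const IH] by auto
  qed
next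
  assume c: "smooth_in UNIV c"
  have "(f has_vector_derivative dird 1 f t) (at t)" if "smooth_in UNIV f" for f :: "real => 'v" and t
    using has_vector_derivative_line[of f "\<lambda>v. dird v f t" 0 t 1]
      has_derivative_dird[OF smooth_in_differentiable[OF that, of t]] by simp
  then have "(dirds (replicate k 1) c has_vector_derivative dirds (replicate (Suc k) 1) c t) (at t)" for k t
    using smooth_in_dirds[OF c, of "replicate k 1"] by simp
  then show "smooth_curve c"
    unfolding smooth_curve_def by (intro exI[of _ "\<lambda>k. dirds (replicate k 1) c"]) auto
qed

lemma dirds_linear_comp:
  assumes "open U" "smooth_in U f" "bounded_linear L" "x \<in> U"
  shows "dirds vs (\<lambda>x. L (f x)) x = L (dirds vs f x)"
  using assms(4)
proof (induction vs arbitrary: x)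
  case (Cons v vs)
  have "dird v (dirds vs (\<lambda>x. L (f x))) x = dird v (\<lambda>x. L (dirds vs f x)) x"
    by (rule dird_cong[OF assms(1)]) (use Cons in auto)
  also have "\<dots> = L (dird v (dirds vs f) x)"
    by (rule dird_bounded_linear_comp[OF assms(3)])
      (use Cons smooth_in_differentiable[OF smooth_in_dirds[OF assms(2)]] in auto)
  finally show ?case by simp
qed simp

lemma dirds_add:
  assumes "open U" "smooth_in U f" "smooth_in U g" "x \<in> U"
  shows "dirds vs (\<lambda>x. f x + g x) x = dirds vs f x + dirds vs g x"
  using assms(4)
proof (induction vs arbitrary: x)
  case (Cons v vs)
  have "dird v (dirds vs (\<lambda>x. f x + g x)) x = dird v (\<lambda>x. dirds vs f x + dirds vs g x) x"
    by (rule dird_cong[OF assms(1)]) (use Cons in auto)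
  also have "\<dots> = dird v (dirds vs f) x + dird v (dirds vs g) x"
    by (rule dird_add) (use Cons smooth_in_differentiable smooth_in_dirds assms in blast)+
  finally show ?case by simp
qed simp

lemma dirds_scaleR:
  assumes "open U" "smooth_in U f" "x \<in> U"
  shows "dirds vs (\<lambda>x. c *\<^sub>R f x) x = c *\<^sub>R dirds vs f x"
  using dirds_linear_comp[OF assms(1,2) bounded_linear_scaleR_right assms(3)] .

lemma dirds_diff:
  assumes "open U" "smooth_in U f" "smooth_in U g" "x \<in> U"
  shows "dirds vs (\<lambda>x. f x - g x) x = dirds vs f x - dirds vs g x"
proof -
  have "smooth_in U (\<lambda>x. (-1) *\<^sub>R g x)"
    using smooth_in_minus assms by auto
  then show ?thesis
    using dirds_add[OF assms(1,2) _ assms(4), of "\<lambda>x. (-1) *\<^sub>R g x" vs] dirds_scaleR[OF assms(1,3,4), of vs "-1"]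
    by simp
qed

lemma dirds_sum:
  assumes "open U" "\<And>i. i \<in> I ==> smooth_in U (f i)" "x \<in> U"
  shows "dirds vs (\<lambda>x. \<Sum>i\<in>I. f i x) x = (\<Sum>i\<in>I. dirds vs (f i) x)"
  using assms(2)
proof (induction I rule: infinite_finite_induct)
  case (infinite A)
  then show ?case by (cases "vs = []") (auto simp: dirds_const)
next
  case empty
  then show ?case by (cases "vs = []") (auto simp: dirds_const)
next
  case (insert i I)
  then show ?case
    using dirds_add[OF assms(1) _ smooth_in_sum[OF assms(1)] assms(3), of "f i" I f vs] by auto
qed

lemma dird_lincomb:
  assumes "f differentiable (at x)"
  shows "dird (\<Sum>s\<in>S. c s *\<^sub>R s) f x = (\<Sum>s\<in>S. c s *\<^sub>R dird s f x)"
proof -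
  interpret linear "\<lambda>v. dird v f x" using dird_linear[OF assms] .
  show ?thesis by (simp add: sum scale)
qed

lemma dirds_map_scale:
  assumes "open U" "smooth_in U f" "x \<in> U"
  shows "dirds (map (\<lambda>v. c *\<^sub>R v) vs) f x = c ^ length vs *\<^sub>R dirds vs f x"
  using assms(3)
proof (induction vs arbitrary: x)
  case (Cons v vs)
  have d: "dirds vs f differentiable (at x)"
    using smooth_in_differentiable[OF smooth_in_dirds[OF assms(2)]] Cons by auto
  have "dirds (map (\<lambda>v. c *\<^sub>R v) (v # vs)) f x = dird (c *\<^sub>R v) (\<lambda>x. c ^ length vs *\<^sub>R dirds vs f x) x"
    using dird_cong[OF assms(1), of x "dirds (map (\<lambda>v. c *\<^sub>R v) vs) f"] Cons by simp
  also have "\<dots> = c ^ length vs *\<^sub>R dird (c *\<^sub>R v) (dirds vs f) x"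
    by (rule dird_bounded_linear_comp[OF bounded_linear_scaleR_right d])
  also have "dird (c *\<^sub>R v) (dirds vs f) x = c *\<^sub>R dird v (dirds vs f) x"
    using dird_linear[OF d] by (rule linear_scale)
  finally show ?case by simp
qed simp

section \<open>Finite differences and symmetry of derivatives\<close>

definition diff :: "'a::real_normed_vector => ('a => 'b::real_normed_vector) => 'a => 'b" where
  "diff h f x = f (x + h) - f x"

abbreviation diffs :: "'a::real_normed_vector list => ('a => 'b::real_normed_vector) => 'a => 'b"
  where "diffs \<equiv> foldr diff"

lemma diff_commute: "diff h (diff k f) = diff k (diff h f)"
  by (intro ext) (simp add: diff_def algebra_simps)

lemma diff_diffs: "diff h (diffs hs f) = diffs hs (diff h f)"
  by (induction hs) (simp_all add: diff_commute[of h])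

text \<open>The mean value theorem is used once for each increment: after the induction hypothesis
  has turned the inner differences of \<open>diff h f\<close> into a derivative of it, what remains
  is an increment of \<open>dirds hs f\<close> along \<open>h\<close>. No smallness is involved,
  only room for the sum of the increments.\<close>

lemma diffs_mvt:
  fixes f :: "'a::euclidean_space => real"
  assumes "open U" "smooth_in U f" "cball x (sum_list (map norm hs)) \<subseteq> U"
  shows "\<exists>y\<in>cball x (sum_list (map norm hs)). diffs hs f x = dirds hs f y"
  using assms
proof (induction hs arbitrary: U f)
  case Nil
  then show ?case by simp
next
  case (Cons h hs)
  let ?s = "sum_list (map norm hs)"
  \<comment> \<open>\<open>diff h f\<close> is smooth only where both \<open>y\<close> and
    \<open>y + h\<close> lie in \<open>U\<close>.\<close>
  define V where "V = U \<inter> (\<lambda>y. y + h) -` U"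
  have "open V"
    unfolding V_def using Cons.prems(1) by (intro open_Int continuous_open_vimage) (auto intro!: continuous_intros)
  moreover have f1: "smooth_in V f" "smooth_in V (\<lambda>y. f (y + h))"
    using Cons.prems smooth_in_subset[of U f V] smooth_in_comp[OF \<open>open V\<close>, of "\<lambda>y. y + h" U f]
      smooth_in_add[OF \<open>open V\<close> smooth_in_id smooth_in_const, of h]
    by (auto simp: V_def)
  then have "smooth_in V (diff h f)"
    unfolding diff_def using smooth_in_diff[OF \<open>open V\<close>] by blast
  moreover have sub: "y \<in> cball x (sum_list (map norm (h # hs)))" "y + t *\<^sub>R h \<in> cball x (sum_list (map norm (h # hs)))"
    if "y \<in> cball x ?s" "0 \<le> t" "t \<le> 1" for y t
  proof -
    have "dist x (y + t *\<^sub>R h) \<le> dist x y + \<bar>t\<bar> * norm h"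
      using dist_triangle[of x "y + t *\<^sub>R h" y] by (simp add: dist_norm)
    moreover have "\<bar>t\<bar> * norm h \<le> norm h"
      using that by (simp add: mult_left_le_one_le)
    ultimately show "y + t *\<^sub>R h \<in> cball x (sum_list (map norm (h # hs)))"
      using that by simp
    show "y \<in> cball x (sum_list (map norm (h # hs)))"
      using that norm_ge_zero[of h] by (auto intro: add_increasing)
  qed
  have "cball x ?s \<subseteq> V"
    unfolding V_def using sub(1) sub(2)[of _ 1] Cons.prems(3) by fastforce
  ultimately obtain y where y: "y \<in> cball x ?s" "diffs hs (diff h f) x = dirds hs (diff h f) y"
    using Cons.IH by blast
  then have "y \<in> V" using \<open>cball x ?s \<subseteq> V\<close> by blast
  define G where "G = dirds hs f"
  have G: "smooth_in U G"
    unfolding G_def using smooth_in_dirds Cons.prems by blast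
  have yh: "dirds hs (diff h f) y = G (y + h) - G y"
    unfolding diff_def G_def
    using dirds_diff[OF \<open>open V\<close> f1(2,1) \<open>y \<in> V\<close>] by (simp add: dirds_shift)
  have "((\<lambda>t. G (y + t *\<^sub>R h)) has_real_derivative dird h G (y + t *\<^sub>R h)) (at t)" if "0 \<le> t" "t \<le> 1" for t
  proof -
    have "y + t *\<^sub>R h \<in> U" using sub(2)[OF y(1) that] Cons.prems(3) by blast
    then show ?thesis
      using has_vector_derivative_line[OF has_derivative_dird[OF smooth_in_differentiable[OF G]]]
      by (simp add: has_real_derivative_iff_has_vector_derivative)
  qed
  then obtain t where t: "0 < t" "t < 1" "G (y + 1 *\<^sub>R h) - G (y + 0 *\<^sub>R h) = (1 - 0) * dird h G (y + t *\<^sub>R h)"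
    using MVT2[of 0 1 "\<lambda>t. G (y + t *\<^sub>R h)" "\<lambda>t. dird h G (y + t *\<^sub>R h)"] by auto
  have "diffs (h # hs) f x = dirds (h # hs) f (y + t *\<^sub>R h)"
    using t y yh by (simp add: diff_diffs G_def)
  then show ?case
    using sub(2)[OF y(1), of t] t by auto
qed

text \<open>An iterated difference does not depend on the order of its increments, whereas by the
  mean value theorem it equals \<open>\<delta> ^ 2\<close> times either mixed derivative at some
  nearby point. By continuity the two mixed derivatives at \<open>x\<close> cannot differ.\<close>

lemma dird_commute_real:
  fixes f :: "'a::euclidean_space => real"
  assumes "open U" "smooth_in U f" "x \<in> U"
  shows "dird u (dird v f) x = dird v (dird u f) x"
proof (rule ccontr)
  let ?A = "dirds [u, v] f" and ?B = "dirds [v, u] f"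
  assume "\<not> ?thesis"
  then have pos: "\<bar>?A x - ?B x\<bar> / 2 > 0" by simp
  have "isCont ?A x" "isCont ?B x"
    using smooth_in_continuous[OF smooth_in_dirds[OF assms(2)]] assms(1,3)
    by (auto simp only: continuous_on_eq_continuous_at)
  then have ev: "eventually (\<lambda>y. \<bar>?A y - ?A x\<bar> < \<bar>?A x - ?B x\<bar> / 2 \<and> \<bar>?B y - ?B x\<bar> < \<bar>?A x - ?B x\<bar> / 2) (nhds x)"
    using tendstoD[OF _ pos, of ?A "?A x" "nhds x"] tendstoD[OF _ pos, of ?B "?B x" "nhds x"]
    unfolding isCont_def tendsto_at_iff_tendsto_nhds dist_real_def
    by (intro eventually_conj)
  obtain d where d: "d > 0" "\<And>y. dist y x < d ==> \<bar>?A y - ?A x\<bar> < \<bar>?A x - ?B x\<bar> / 2 \<and> \<bar>?B y - ?B x\<bar> < \<bar>?A x - ?B x\<bar> / 2"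
    using ev unfolding eventually_nhds_metric by blast
  obtain e where e: "e > 0" "ball x e \<subseteq> U"
    using assms(1,3) open_contains_ball by blast
  define r where "r = min d e / 2"
  have r: "r > 0" "r < d" "r < e" using d e by (auto simp: r_def)
  define \<delta> where "\<delta> = r / (norm u + norm v + 1)"
  have \<delta>: "\<delta> > 0" using r by (simp add: \<delta>_def add_nonneg_pos)
  have le: "\<delta> * (norm u + norm v) \<le> r"
    using r unfolding \<delta>_def by (simp add: divide_le_eq add_nonneg_pos mult_left_mono)
  have *: "\<exists>y. dist y x < d \<and> diffs [\<delta> *\<^sub>R a, \<delta> *\<^sub>R b] f x = \<delta> ^ 2 * dirds [a, b] f y"
    if "norm a + norm b = norm u + norm v" for a b
  proof -
    have s: "sum_list (map norm [\<delta> *\<^sub>R a, \<delta> *\<^sub>R b]) \<le> r"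
      using le \<delta> that by (simp add: distrib_left[symmetric])
    then have "cball x (sum_list (map norm [\<delta> *\<^sub>R a, \<delta> *\<^sub>R b])) \<subseteq> U"
      using e r by (intro order_trans[OF _ e(2)]) (auto simp del: list.map)
    from diffs_mvt[OF assms(1,2) this] obtain y where
      y: "y \<in> cball x (sum_list (map norm [\<delta> *\<^sub>R a, \<delta> *\<^sub>R b]))"
        "diffs [\<delta> *\<^sub>R a, \<delta> *\<^sub>R b] f x = dirds [\<delta> *\<^sub>R a, \<delta> *\<^sub>R b] f y" by blast
    have "dist y x \<le> r" using y s by (auto simp: dist_commute simp del: list.map)
    then have "y \<in> U" "dist y x < d" using e r by (auto simp: dist_commute intro!: subsetD[OF e(2)])
    then show ?thesis
      using y dirds_map_scale[OF assms(1,2) \<open>y \<in> U\<close>, of \<delta> "[a, b]"]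
      by (intro exI[of _ y]) (simp add: power2_eq_square)
  qed
  obtain y where y: "dist y x < d" "diffs [\<delta> *\<^sub>R u, \<delta> *\<^sub>R v] f x = \<delta> ^ 2 * ?A y"
    using *[of u v] by blast
  obtain z where z: "dist z x < d" "diffs [\<delta> *\<^sub>R v, \<delta> *\<^sub>R u] f x = \<delta> ^ 2 * ?B z"
    using *[of v u] by (auto simp: add.commute)
  have "?A y = ?B z"
    using y z \<delta> by (simp add: diff_commute[of "\<delta> *\<^sub>R u"])
  then have "\<bar>?A x - ?B x\<bar> \<le> \<bar>?A y - ?A x\<bar> + \<bar>?B z - ?B x\<bar>"
    by linarith
  also have "\<dots> < \<bar>?A x - ?B x\<bar> / 2 + \<bar>?A x - ?B x\<bar> / 2"
    using d(2)[OF y(1)] d(2)[OF z(1)] by (intro add_strict_mono) blast+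
  finally show False by simp
qed

lemma dird_commute:
  fixes f :: "'a::euclidean_space => 'b::euclidean_space"
  assumes "open U" "smooth_in U f" "x \<in> U"
  shows "dird u (dird v f) x = dird v (dird u f) x"
proof (rule euclidean_eqI)
  fix b :: 'b assume "b \<in> Basis"
  have "smooth_in U (\<lambda>x. f x \<bullet> b)"
    using smooth_in_inner[OF assms(1,2) smooth_in_const] .
  from dird_commute_real[OF assms(1) this assms(3), of u v]
  show "dird u (dird v f) x \<bullet> b = dird v (dird u f) x \<bullet> b"
    using dirds_linear_comp[OF assms(1,2) bounded_linear_inner_left assms(3), of "[u,v]" b]
      dirds_linear_comp[OF assms(1,2) bounded_linear_inner_left assms(3), of "[v,u]" b] by simp
qed

lemma dirds_move:
  assumes "open U" "smooth_in U f" "x \<in> U"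
  shows "dird v (dirds (vs @ ws) f) x = dirds (vs @ v # ws) f x"
  using assms(3)
proof (induction vs arbitrary: x)
  case (Cons a vs)
  have "dird v (dirds ((a # vs) @ ws) f) x = dird a (dird v (dirds (vs @ ws) f)) x"
    using dird_commute[OF assms(1) smooth_in_dirds[OF assms(2), of "vs @ ws"] Cons.prems, of v a] by simp
  also have "\<dots> = dird a (dirds (vs @ v # ws) f) x"
    by (rule dird_cong[OF assms(1) Cons.prems]) (use Cons.IH in simp)
  finally show ?case by simp
qed simp

lemma dirds_perm:
  assumes "open U" "smooth_in U f" "x \<in> U" "mset vs = mset ws"
  shows "dirds vs f x = dirds ws f x"
  using assms(3,4)
proof (induction vs arbitrary: x ws)
  case (Cons v vs)
  then have "v \<in> set ws" by (metis list.set_intros(1) set_mset_mset)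
  then obtain w1 w2 where ws: "ws = w1 @ v # w2" by (meson split_list)
  then have "mset vs = mset (w1 @ w2)" using Cons.prems by simp
  then have "dirds vs f y = dirds (w1 @ w2) f y" if "y \<in> U" for y
    using Cons.IH[OF that] by blast
  then have "dird v (dirds vs f) x = dird v (dirds (w1 @ w2) f) x"
    by (rule dird_cong[OF assms(1) Cons.prems(1)])
  then show ?case
    using dirds_move[OF assms(1,2) Cons.prems(1)] ws by simp
qed simp

text \<open>Multilinearity in the directions: expanding each of them in \<open>S\<close> costs the
  sum of the absolute coefficients. The induction starts at the innermost direction, since then the
  remaining list acts on \<open>dird s f\<close>, to which the hypothesis applies again.\<close>

lemma dirds_span_bound:
  assumes "finite S" "open U" "x \<in> U" "0 \<le> \<kappa>" "0 \<le> M" "smooth_in U f"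
    and "\<And>bs. set bs \<subseteq> S ==> length bs = length vs ==> norm (dirds bs f x) \<le> M"
    and "\<And>v. v \<in> set vs ==> \<exists>c. v = (\<Sum>s\<in>S. c s *\<^sub>R s) \<and> (\<Sum>s\<in>S. \<bar>c s\<bar>) \<le> \<kappa>"
  shows "norm (dirds vs f x) \<le> \<kappa> ^ length vs * M"
  using assms(6-)
proof (induction vs arbitrary: f rule: rev_induct)
  case Nil
  then show ?case by simp
next
  case (snoc v vs)
  obtain c where c: "v = (\<Sum>s\<in>S. c s *\<^sub>R s)" "(\<Sum>s\<in>S. \<bar>c s\<bar>) \<le> \<kappa>"
    using snoc.prems(3)[of v] by auto
  have IH: "norm (dirds vs (dird s f) x) \<le> \<kappa> ^ length vs * M" if "s \<in> S" for s
  proof (rule snoc.IH)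
    show "norm (dirds bs (dird s f) x) \<le> M" if "set bs \<subseteq> S" "length bs = length vs" for bs
      using snoc.prems(2)[of "bs @ [s]"] that \<open>s \<in> S\<close> by simp
  qed (use snoc.prems smooth_in_dird in auto)
  have "dirds (vs @ [v]) f x = dirds vs (\<lambda>x. \<Sum>s\<in>S. c s *\<^sub>R dird s f x) x"
    using dirds_cong[OF assms(2,3), of "dird v f" "\<lambda>x. \<Sum>s\<in>S. c s *\<^sub>R dird s f x" vs]
      dird_lincomb[OF smooth_in_differentiable[OF snoc.prems(1)]] c by simp
  also have "\<dots> = (\<Sum>s\<in>S. dirds vs (\<lambda>x. c s *\<^sub>R dird s f x) x)"
    using snoc.prems(1) smooth_in_dird
    by (intro dirds_sum[OF assms(2) _ assms(3)] smooth_in_scaleR assms(2)) auto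
  also have "\<dots> = (\<Sum>s\<in>S. c s *\<^sub>R dirds vs (dird s f) x)"
    using dirds_scaleR[OF assms(2) smooth_in_dird[OF snoc.prems(1)] assms(3)] by simp
  also have "norm \<dots> \<le> (\<Sum>s\<in>S. \<bar>c s\<bar> * (\<kappa> ^ length vs * M))"
    by (rule sum_norm_le) (use IH in \<open>auto intro!: mult_left_mono\<close>)
  also have "\<dots> = (\<Sum>s\<in>S. \<bar>c s\<bar>) * (\<kappa> ^ length vs * M)"
    by (simp add: sum_distrib_right)
  also have "\<dots> \<le> \<kappa> * (\<kappa> ^ length vs * M)"
  proof (cases "S = {}")
    case True
    then show ?thesis using assms(4,5) by simp
  next
    case False
    then obtain s where "s \<in> S" by blast
    then have "0 \<le> \<kappa> ^ length vs * M" using IH norm_ge_zero order_trans by blast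
    then show ?thesis using c by (intro mult_right_mono)
  qed
  finally show ?case by (simp add: mult.assoc)
qed

section \<open>Bounds on derivatives up to a given order\<close>

definition dbound :: "nat => 'a::euclidean_space set => ('a => 'b::euclidean_space) => real => bool" where
  "dbound k K f M \<longleftrightarrow>
     (\<forall>vs. set vs \<subseteq> Basis \<and> length vs \<le> k --> (\<forall>x\<in>K. norm (dirds vs f x) \<le> M))"

lemma dboundD: "dbound k K f M ==> set vs \<subseteq> Basis ==> length vs \<le> k ==> x \<in> K ==> norm (dirds vs f x) \<le> M"
  by (auto simp: dbound_def)

lemma dbound_mono: "dbound k K f M ==> j \<le> k ==> L \<subseteq> K ==> M \<le> N ==> dbound j L f N"
  unfolding dbound_def by (meson order_trans subsetD)

lemma dbound_dird:
  fixes f :: "'a::euclidean_space => 'b::euclidean_space"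
  assumes "dbound (Suc k) K f M" "b \<in> Basis"
  shows "dbound k K (dird b f) M"
  unfolding dbound_def
proof (intro allI impI ballI, elim conjE)
  fix vs :: "'a list" and x assume "set vs \<subseteq> Basis" "length vs \<le> k" "x \<in> K"
  then show "norm (dirds vs (dird b f) x) \<le> M"
    using dboundD[OF assms(1), of "vs @ [b]" x] assms(2) by simp
qed

lemma dbound_SucI:
  fixes f :: "'a::euclidean_space => 'b::euclidean_space"
  assumes "\<And>x. x \<in> K ==> norm (f x) \<le> M" "\<And>b. b \<in> Basis ==> dbound k K (dird b f) M"
  shows "dbound (Suc k) K f M"
  unfolding dbound_def
proof (intro allI impI ballI, elim conjE)
  fix vs :: "'a list" and x assume vs: "set vs \<subseteq> Basis" "length vs \<le> Suc k" and x: "x \<in> K"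
  show "norm (dirds vs f x) \<le> M"
  proof (cases vs rule: rev_cases)
    case Nil
    then show ?thesis using assms(1)[OF x] by simp
  next
    case (snoc us b)
    then show ?thesis using dboundD[OF assms(2)[of b], of us x] vs x by simp
  qed
qed

lemma dbound_cong:
  fixes f :: "'a::euclidean_space => 'b::euclidean_space"
  assumes "open U" "K \<subseteq> U" "\<And>x. x \<in> U ==> f x = g x" "dbound k K f M"
  shows "dbound k K g M"
  unfolding dbound_def
proof (intro allI impI ballI, elim conjE)
  fix vs :: "'a list" and x assume vs: "set vs \<subseteq> Basis" "length vs \<le> k" and x: "x \<in> K"
  have "dirds vs f x = dirds vs g x"
    by (rule dirds_cong[OF assms(1) _ assms(3)]) (use x assms(2) in auto)
  then show "norm (dirds vs g x) \<le> M"
    using dboundD[OF assms(4) vs x] by simp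
qed

lemma dbound_sum:
  fixes f :: "'i => 'a::euclidean_space => 'b::euclidean_space" and M :: real
  assumes "open U" "K \<subseteq> U" "\<And>i. i \<in> I ==> smooth_in U (f i)"
    "\<And>i. i \<in> I ==> dbound k K (f i) M"
  shows "dbound k K (\<lambda>x. \<Sum>i\<in>I. f i x) (card I * M)"
  unfolding dbound_def
proof (intro allI impI ballI, elim conjE)
  fix vs :: "'a list" and x assume vs: "set vs \<subseteq> Basis" "length vs \<le> k" and x: "x \<in> K"
  have "dirds vs (\<lambda>x. \<Sum>i\<in>I. f i x) x = (\<Sum>i\<in>I. dirds vs (f i) x)"
    using assms x by (intro dirds_sum[OF assms(1)]) auto
  also have "norm \<dots> \<le> (\<Sum>i\<in>I. M)"
    by (rule sum_norm_le) (use dboundD[OF assms(4) vs x] in auto)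
  finally show "norm (dirds vs (\<lambda>x. \<Sum>i\<in>I. f i x) x) \<le> card I * M" by simp
qed

lemma dbound_add:
  fixes f :: "'a::euclidean_space => 'b::euclidean_space"
  assumes "open U" "K \<subseteq> U" "smooth_in U f" "smooth_in U g" "dbound k K f M" "dbound k K g N"
  shows "dbound k K (\<lambda>x. f x + g x) (M + N)"
  unfolding dbound_def
proof (intro allI impI ballI, elim conjE)
  fix vs :: "'a list" and x assume vs: "set vs \<subseteq> Basis" "length vs \<le> k" and x: "x \<in> K"
  have "dirds vs (\<lambda>x. f x + g x) x = dirds vs f x + dirds vs g x"
    using assms x by (intro dirds_add[OF assms(1)]) auto
  then show "norm (dirds vs (\<lambda>x. f x + g x) x) \<le> M + N"
    using norm_triangle_mono[OF dboundD[OF assms(5) vs x] dboundD[OF assms(6) vs x]] by simp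
qed

text \<open>Each differentiation splits a product into two, hence the factor
  \<open>2 ^ k\<close>.\<close>

lemma dbound_scaleR:
  fixes u :: "'a::euclidean_space => real"
  assumes "open U" "K \<subseteq> U" "smooth_in U u" "smooth_in U h" "dbound k K u M" "dbound k K h N"
    and "0 \<le> M" "0 \<le> N"
  shows "dbound k K (\<lambda>x. u x *\<^sub>R h x) (2 ^ k * (M * N))"
  using assms(3-6)
proof (induction k arbitrary: u h)
  case 0
  have "norm (u x *\<^sub>R h x) \<le> M * N" if "x \<in> K" for x
    using dboundD[OF 0(3), of "[]" x] dboundD[OF 0(4), of "[]" x] that assms(7)
    by (auto intro!: mult_mono)
  then show ?case
    by (simp add: dbound_def)
next
  case (Suc k)
  have m: "dbound k K u M" "dbound k K h N"
    using Suc.prems dbound_mono[of "Suc k" K _ _ k K] by auto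
  show ?case
  proof (rule dbound_SucI)
    show "norm (u x *\<^sub>R h x) \<le> 2 ^ Suc k * (M * N)" if "x \<in> K" for x
    proof -
      have "norm (u x *\<^sub>R h x) \<le> M * N"
        using dboundD[OF Suc.prems(3), of "[]" x] dboundD[OF Suc.prems(4), of "[]" x] that assms(7)
        by (auto intro!: mult_mono)
      also have "\<dots> \<le> 2 ^ Suc k * (M * N)"
        using assms(7,8) mult_right_mono[OF one_le_power[of 2 "Suc k"], of "M * N"] by simp
      finally show ?thesis .
    qed
    fix b :: 'a assume b: "b \<in> Basis"
    have "dbound k K (\<lambda>x. u x *\<^sub>R dird b h x + dird b u x *\<^sub>R h x) (2 ^ k * (M * N) + 2 ^ k * (M * N))"
      using Suc.prems m b assms(1)
      by (intro dbound_add[OF assms(1,2)] smooth_in_scaleR Suc.IH dbound_dird smooth_in_dird) auto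
    then have "dbound k K (dird b (\<lambda>x. u x *\<^sub>R h x)) (2 ^ k * (M * N) + 2 ^ k * (M * N))"
      using dird_bilinear[OF bounded_bilinear_scaleR smooth_in_differentiable[OF Suc.prems(1)]
          smooth_in_differentiable[OF Suc.prems(2)]]
      by (elim dbound_cong[OF assms(1,2), rotated]) simp
    moreover have "2 ^ k * (M * N) + 2 ^ k * (M * N) = 2 ^ Suc k * (M * N)" by simp
    ultimately show "dbound k K (dird b (\<lambda>x. u x *\<^sub>R h x)) (2 ^ Suc k * (M * N))"
      by simp
  qed
qed

text \<open>Two features matter later. The inner map enters only through derivatives of order at
  least one, so it may be unbounded; and \<open>C\<close> is chosen before the maps, so that bounds
  which are powers of the scale lead to bounds of the same kind.\<close>

lemma dbound_comp:
  "\<exists>C\<ge>1. \<forall>(f::'b::euclidean_space => 'c::euclidean_space) (g::'a::euclidean_space => 'b) U V K L M.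
     open U --> smooth_in U g --> smooth_in V f --> g ` U \<subseteq> V --> K \<subseteq> U --> 1 \<le> L --> 0 \<le> M -->
     (\<forall>b\<in>Basis. dbound (k - 1) K (dird b g) L) --> dbound k (g ` K) f M -->
     dbound k K (\<lambda>x. f (g x)) (C * L ^ k * M)"
proof (induction k)
  case 0
  then show ?case by (intro exI[of _ 1]) (auto simp: dbound_def)
next
  case (Suc k)
  then obtain C where C1: "C \<ge> 1" and C: "\<And>(f::'b => 'c) (g::'a => 'b) U V K L M.
     open U ==> smooth_in U g ==> smooth_in V f ==> g ` U \<subseteq> V ==> K \<subseteq> U ==> 1 \<le> L ==> 0 \<le> M ==>
     (\<forall>b\<in>Basis. dbound (k - 1) K (dird b g) L) ==> dbound k (g ` K) f M ==>
     dbound k K (\<lambda>x. f (g x)) (C * L ^ k * M)" by blast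
  \<comment> \<open>The chain rule gives \<open>DIM('b)\<close> products, each costing
    \<open>2 ^ k\<close> by the Leibniz rule; the values of the composition itself need
    \<open>D\<close> at least 1.\<close>
  define D where "D = max 1 (real DIM('b) * (2 ^ k * C))"
  have "dbound (Suc k) K (\<lambda>x. f (g x)) (D * L ^ Suc k * M)"
    if U: "open U" and g: "smooth_in U g" and f: "smooth_in V f" and im: "g ` U \<subseteq> V" and K: "K \<subseteq> U"
      and L: "1 \<le> L" and M: "0 \<le> M"
      and bg: "\<forall>b\<in>Basis. dbound (Suc k - 1) K (dird b g) L" and bf: "dbound (Suc k) (g ` K) f M"
    for f :: "'b => 'c" and g :: "'a => 'b" and U V K L M
  proof (rule dbound_SucI)
    show "norm (f (g x)) \<le> D * L ^ Suc k * M" if "x \<in> K" for x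
    proof -
      have "norm (f (g x)) \<le> 1 * M"
        using dboundD[OF bf, of "[]" "g x"] that by simp
      also have "\<dots> \<le> D * L ^ Suc k * M"
        using M L one_le_power[OF L, of "Suc k"] mult_mono[of 1 D 1 "L ^ Suc k"]
        by (intro mult_right_mono) (auto simp: D_def)
      finally show ?thesis .
    qed
    fix v :: 'a assume v: "v \<in> Basis"
    have bg': "dbound (k - 1) K (dird b g) L" if "b \<in> Basis" for b
      by (rule dbound_mono[where k=k]) (use bg that in auto)
    have comp: "dbound k K (\<lambda>x. dird b f (g x)) (C * L ^ k * M)" if "b \<in> Basis" for b
      using that dbound_dird[OF bf] bg'
      by (intro C[OF U g smooth_in_dird[OF f] im K L M]) auto
    have inn: "dbound k K (\<lambda>x. dird v g x \<bullet> b) L" if "b \<in> Basis" for b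
      unfolding dbound_def
    proof (intro allI impI ballI, elim conjE)
      fix vs :: "'a list" and x assume vs: "set vs \<subseteq> Basis" "length vs \<le> k" and x: "x \<in> K"
      have "dirds vs (\<lambda>x. dird v g x \<bullet> b) x = dirds vs (dird v g) x \<bullet> b"
        using x K by (intro dirds_linear_comp[OF U smooth_in_dird[OF g] bounded_linear_inner_left]) auto
      moreover have "norm (dirds vs (dird v g) x \<bullet> b) \<le> norm (dirds vs (dird v g) x)"
        using Basis_le_norm[OF that] by simp
      ultimately show "norm (dirds vs (\<lambda>x. dird v g x \<bullet> b) x) \<le> L"
        using dboundD[of k K "dird v g" L vs x] bg v vs x by simp
    qed
    have sm: "smooth_in U (\<lambda>x. dird v g x \<bullet> b)" "smooth_in U (\<lambda>x. dird b f (g x))" for b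
      using smooth_in_inner[OF U smooth_in_dird[OF g] smooth_in_const]
        smooth_in_comp[OF U g smooth_in_dird[OF f] im] by auto
    have "dbound k K (\<lambda>x. \<Sum>b\<in>Basis. (dird v g x \<bullet> b) *\<^sub>R dird b f (g x))
       (real (card (Basis :: 'b set)) * (2 ^ k * (L * (C * L ^ k * M))))"
      using L M C1 by (intro dbound_sum[OF U K] smooth_in_scaleR U sm dbound_scaleR[OF U K] inn comp) auto
    moreover have "(\<Sum>b\<in>Basis. (dird v g x \<bullet> b) *\<^sub>R dird b f (g x)) = dird v (\<lambda>x. f (g x)) x" if "x \<in> U" for x
    proof -
      have "g x \<in> V" using im that by auto
      then show ?thesis
        using dird_comp(2)[OF smooth_in_differentiable[OF g that] smooth_in_differentiable[OF f]] by simp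
    qed
    ultimately have "dbound k K (dird v (\<lambda>x. f (g x))) (real DIM('b) * (2 ^ k * (L * (C * L ^ k * M))))"
      by (rule dbound_cong[OF U K, rotated])
    moreover have "real DIM('b) * (2 ^ k * (L * (C * L ^ k * M))) = (real DIM('b) * (2 ^ k * C)) * (L ^ Suc k * M)"
      by simp
    moreover have "\<dots> \<le> D * (L ^ Suc k * M)"
      unfolding D_def using L M by (intro mult_right_mono) auto
    ultimately show "dbound k K (dird v (\<lambda>x. f (g x))) (D * L ^ Suc k * M)"
      by (elim dbound_mono) (auto simp: mult_ac)
  qed
  then show ?case
    by (intro exI[of _ D] conjI allI impI) (auto simp: D_def)
qed

section \<open>Polarisation of differences and of derivatives\<close>

lemma diffs_subsets:
  "diffs hs f x = (\<Sum>S\<in>Pow {..<length hs}. (-1) ^ (length hs + card S) *\<^sub>R f (x + (\<Sum>j\<in>S. hs ! j)))"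
proof (induction hs arbitrary: f x rule: rev_induct)
  case Nil
  then show ?case by simp
next
  case (snoc h hs)
  let ?n = "length hs"
  let ?F = "\<lambda>S. (-1) ^ (Suc ?n + card S) *\<^sub>R f (x + (\<Sum>j\<in>S. (hs @ [h]) ! j))"
  have sub: "finite S" "?n \<notin> S" "(\<Sum>j\<in>S. (hs @ [h]) ! j) = (\<Sum>j\<in>S. hs ! j)" if "S \<in> Pow {..<?n}" for S
    using that by (auto simp: nth_append finite_subset intro!: sum.cong)
  have "inj_on (insert ?n) (Pow {..<?n})"
    by (rule inj_onI, subst (asm) insert_ident) auto
  moreover have "Pow {..<?n} \<inter> insert ?n ` Pow {..<?n} = {}" by auto
  ultimately have "sum ?F (Pow {..<Suc ?n}) =
      sum ?F (Pow {..<?n}) + (\<Sum>S\<in>Pow {..<?n}. ?F (insert ?n S))"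
    unfolding lessThan_Suc Pow_insert by (subst sum.union_disjoint) (auto simp: sum.reindex)
  also have "\<dots> = (\<Sum>S\<in>Pow {..<?n}. ?F S + ?F (insert ?n S))"
    by (simp only: sum.distrib)
  also have "\<dots> = (\<Sum>S\<in>Pow {..<?n}. (-1) ^ (?n + card S) *\<^sub>R diff h f (x + (\<Sum>j\<in>S. hs ! j)))"
    by (rule sum.cong) (auto simp: sub diff_def scaleR_diff_right add_ac)
  finally show ?case using snoc[of "diff h f" x] by simp
qed

lemma diff_0: "diff 0 f = (\<lambda>x. 0)"
  by (intro ext) (simp add: diff_def)

lemma diffs_zero: "0 \<in> set hs ==> diffs hs f = (\<lambda>x. 0)"
proof (induction hs)
  case (Cons h hs)
  then show ?case by (cases "h = 0") (auto simp: diff_0, auto simp: diff_def)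
qed simp

text \<open>
  Djokovic's polarisation: on the right-hand side, the \<open>k\<close>-th term of the inner differences,
  summed over \<open>S\<close>, is a mixed difference whose \<open>k\<close>-th increment vanishes, unless \<open>k = 0\<close>.
\<close>

lemma diffs_polarisation:
  fixes hs :: "'a::real_normed_vector list"
  defines "m \<equiv> length hs"
  shows "diffs hs f x = (\<Sum>S\<in>Pow {..<m}. (-1) ^ card S *\<^sub>R
    diffs (replicate m (- (\<Sum>j\<in>S. (1 / real (Suc j)) *\<^sub>R hs ! j))) f (x + (\<Sum>j\<in>S. hs ! j)))"
proof -
  let ?a = "\<lambda>S. - (\<Sum>j\<in>S. (1 / real (Suc j)) *\<^sub>R hs ! j)" and ?b = "\<lambda>S. \<Sum>j\<in>S. hs ! j"
  define H where "H k = map (\<lambda>j. (1 - real k / real (Suc j)) *\<^sub>R hs ! j) [0..<m]" for k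
  have lenH: "length (H k) = m" for k by (simp add: H_def)
  have "diffs (replicate m (?a S)) f (x + ?b S) =
    (\<Sum>T\<in>Pow {..<m}. (-1) ^ (m + card T) *\<^sub>R f (x + (\<Sum>j\<in>S. H (card T) ! j)))" if S: "S \<in> Pow {..<m}" for S
  proof -
    have "(\<Sum>j\<in>T. replicate m (?a S) ! j) = real (card T) *\<^sub>R ?a S" if "T \<in> Pow {..<m}" for T
    proof -
      have "(\<Sum>j\<in>T. replicate m (?a S) ! j) = (\<Sum>j\<in>T. ?a S)"
        using that by (intro sum.cong) auto
      then show ?thesis by (simp add: sum_constant_scaleR)
    qed
    moreover have "x + ?b S + real k *\<^sub>R ?a S = x + (\<Sum>j\<in>S. H k ! j)" for k
    proof -
      have "(\<Sum>j\<in>S. H k ! j) = (\<Sum>j\<in>S. hs ! j - real k *\<^sub>R (1 / real (Suc j)) *\<^sub>R hs ! j)"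
        using S by (intro sum.cong) (auto simp: H_def algebra_simps)
      then show ?thesis by (simp add: sum_subtractf scaleR_sum_right)
    qed
    ultimately have eq: "x + ?b S + (\<Sum>j\<in>T. replicate m (?a S) ! j) = x + (\<Sum>j\<in>S. H (card T) ! j)"
      if "T \<in> Pow {..<m}" for T
      using that by metis
    show ?thesis
      unfolding diffs_subsets[of "replicate m (?a S)"] length_replicate
      by (intro sum.cong) (simp_all only: eq)
  qed
  then have "(\<Sum>S\<in>Pow {..<m}. (-1) ^ card S *\<^sub>R diffs (replicate m (?a S)) f (x + ?b S)) =
    (\<Sum>S\<in>Pow {..<m}. \<Sum>T\<in>Pow {..<m}. (-1) ^ card T *\<^sub>R ((-1) ^ (m + card S) *\<^sub>R f (x + (\<Sum>j\<in>S. H (card T) ! j))))"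
    by (simp add: scaleR_sum_right power_add mult_ac)
  also have "\<dots> = (\<Sum>T\<in>Pow {..<m}. (-1) ^ card T *\<^sub>R diffs (H (card T)) f x)"
    by (subst sum.swap) (simp add: scaleR_sum_right diffs_subsets[of "H _"] lenH)
  also have "\<dots> = (\<Sum>T\<in>Pow {..<m}. if T = {} then diffs hs f x else 0)"
  proof (rule sum.cong)
    fix T assume T: "T \<in> Pow {..<m}"
    show "(-1) ^ card T *\<^sub>R diffs (H (card T)) f x = (if T = {} then diffs hs f x else 0)"
    proof (cases "T = {}")
      case True
      have "H 0 = hs" by (simp add: H_def m_def map_nth)
      then show ?thesis using True by simp
    next
      case False
      then have "card T > 0" "card T \<le> m"
        using T card_mono[of "{..<m}" T] by (auto simp: card_gt_0_iff finite_subset)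
      \<comment> \<open>The factor \<open>1 - real k / real (Suc j)\<close> vanishes at
        \<open>j = k - 1\<close>, list positions starting at 0.\<close>
      then have "0 \<in> set (H (card T))"
        unfolding H_def by (auto simp: image_iff intro!: bexI[of _ "card T - 1"])
      then show ?thesis using False by (simp add: diffs_zero)
    qed
  qed simp
  also have "\<dots> = diffs hs f x" by simp
  finally show ?thesis ..
qed

declare foldr_replicate [simp del]

text \<open>The polarisation identity is exact for differences. With all increments scaled by
  \<open>\<delta>\<close>, each of its terms is \<open>\<delta> ^ m\<close> times a derivative of
  order \<open>m\<close> near \<open>x\<close>. Cancelling this factor and shrinking the
  neighbourhood leaves derivatives at \<open>x\<close> itself.\<close>

lemma dirds_polarisation_bound_real:
  fixes f :: "'a::euclidean_space => real" and ws :: "'a list"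
  defines "m \<equiv> length ws"
  assumes U: "open U" and f: "smooth_in U f" and x: "x \<in> U"
  shows "\<bar>dirds ws f x\<bar> \<le>
    (\<Sum>S\<in>Pow {..<m}. \<bar>dirds (replicate m (- (\<Sum>j\<in>S. (1 / real (Suc j)) *\<^sub>R ws ! j))) f x\<bar>)"
proof -
  define a where "a S = - (\<Sum>j\<in>S. (1 / real (Suc j)) *\<^sub>R ws ! j)" for S
  define b where "b S = (\<Sum>j\<in>S. ws ! j)" for S
  define B where "B S = dirds (replicate m (a S)) f" for S
  have cont: "(dirds vs f \<longlongrightarrow> dirds vs f x) (nhds x)" for vs
    using smooth_in_continuous[OF smooth_in_dirds[OF f, of vs]] U x
    unfolding continuous_on_eq_continuous_at[OF U] isCont_def tendsto_at_iff_tendsto_nhds by blast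
  have *: "\<bar>dirds ws f x\<bar> \<le> e + (\<Sum>S\<in>Pow {..<m}. \<bar>B S x\<bar> + e)" if e: "e > 0" for e
  proof -
    have "eventually (\<lambda>y. y \<in> U \<and> dist (dirds ws f y) (dirds ws f x) < e \<and>
        (\<forall>S\<in>Pow {..<m}. dist (B S y) (B S x) < e)) (nhds x)"
      using U x tendstoD[OF cont e]
      by (intro eventually_conj eventually_ball_finite ballI) (auto simp: B_def eventually_nhds)
    then obtain d where d: "d > 0" "\<And>y. dist y x < d ==> y \<in> U" "\<And>y. dist y x < d ==> dist (dirds ws f y) (dirds ws f x) < e"
      "\<And>y S. dist y x < d ==> S \<in> Pow {..<m} ==> dist (B S y) (B S x) < e"
      unfolding eventually_nhds_metric by blast
    \<comment> \<open>\<open>c\<close> exceeds the total displacement in each of the differences, so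
      scaling by \<open>\<delta> = d / c\<close> keeps all intermediate points within distance
      \<open>d\<close> of \<open>x\<close>.\<close>
    define c where "c = (\<Sum>S\<in>Pow {..<m}. norm (b S) + m * norm (a S)) + sum_list (map norm ws) + 1"
    have sl: "0 \<le> sum_list (map norm ws)" by (rule sum_list_nonneg) auto
    have s0: "0 \<le> (\<Sum>S\<in>Pow {..<m}. norm (b S) + m * norm (a S))"
      by (intro sum_nonneg add_nonneg_nonneg mult_nonneg_nonneg) auto
    have c: "c > 0" "sum_list (map norm ws) < c"
      unfolding c_def using sl s0 by linarith+
    have cS: "norm (b S) + m * norm (a S) < c" if "S \<in> Pow {..<m}" for S
    proof -
      have "norm (b S) + m * norm (a S) \<le> (\<Sum>S\<in>Pow {..<m}. norm (b S) + m * norm (a S))"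
        using that by (intro member_le_sum) auto
      then show ?thesis unfolding c_def using sl by linarith
    qed
    define \<delta> where "\<delta> = d / c"
    have \<delta>: "\<delta> > 0" "\<delta> * c = d" using c d by (auto simp: \<delta>_def)
    have lt: "\<delta> * r < d" if "r < c" for r
      using that \<delta> mult_strict_left_mono by blast
    have mvt: "\<exists>y. dist y x < d \<and> diffs (map (\<lambda>v. \<delta> *\<^sub>R v) vs) f (x + \<delta> *\<^sub>R w) = \<delta> ^ length vs * dirds vs f y"
      if lc: "norm w + sum_list (map norm vs) < c" for vs w
    proof -
      have s: "sum_list (map norm (map (\<lambda>v. \<delta> *\<^sub>R v) vs)) = \<delta> * sum_list (map norm vs)"
        using \<delta> by (induction vs) (auto simp: distrib_left)
      have near: "dist y x < d" if "y \<in> cball (x + \<delta> *\<^sub>R w) (\<delta> * sum_list (map norm vs))" for y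
      proof -
        have "dist y x \<le> dist (x + \<delta> *\<^sub>R w) y + norm (\<delta> *\<^sub>R w)"
          using dist_triangle[of y x "x + \<delta> *\<^sub>R w"] by (simp add: dist_commute dist_norm)
        also have "\<dots> \<le> \<delta> * (norm w + sum_list (map norm vs))"
          using that \<delta> by (simp add: distrib_left)
        finally show ?thesis using lt[OF lc] by simp
      qed
      then have "cball (x + \<delta> *\<^sub>R w) (sum_list (map norm (map (\<lambda>v. \<delta> *\<^sub>R v) vs))) \<subseteq> U"
        unfolding s using d(2) by blast
      from diffs_mvt[OF U f this] obtain y where y: "y \<in> cball (x + \<delta> *\<^sub>R w) (\<delta> * sum_list (map norm vs))"
        "diffs (map (\<lambda>v. \<delta> *\<^sub>R v) vs) f (x + \<delta> *\<^sub>R w) = dirds (map (\<lambda>v. \<delta> *\<^sub>R v) vs) f y"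
        unfolding s by blast
      show ?thesis
        using near[OF y(1)] y(2) dirds_map_scale[OF U f d(2), of y \<delta> vs] by (intro exI[of _ y]) simp
    qed
    obtain y where y: "dist y x < d" "diffs (map (\<lambda>v. \<delta> *\<^sub>R v) ws) f x = \<delta> ^ m * dirds ws f y"
      using mvt[of 0 ws] c by (auto simp: m_def)
    have "\<exists>y. dist y x < d \<and> diffs (replicate m (\<delta> *\<^sub>R a S)) f (x + \<delta> *\<^sub>R b S) = \<delta> ^ m * B S y"
      if "S \<in> Pow {..<m}" for S
    proof -
      have "sum_list (map norm (replicate m (a S))) = m * norm (a S)"
        by (induction m) (auto simp: algebra_simps)
      then show ?thesis
        using mvt[of "b S" "replicate m (a S)"] cS[OF that] by (simp add: B_def map_replicate)
    qed
    then obtain z where z: "\<And>S. S \<in> Pow {..<m} ==> dist (z S) x < d"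
      "\<And>S. S \<in> Pow {..<m} ==> diffs (replicate m (\<delta> *\<^sub>R a S)) f (x + \<delta> *\<^sub>R b S) = \<delta> ^ m * B S (z S)"
      by metis
    have eqs: "- (\<Sum>j\<in>S. (1 / real (Suc j)) *\<^sub>R map (\<lambda>v. \<delta> *\<^sub>R v) ws ! j) = \<delta> *\<^sub>R a S"
      "(\<Sum>j\<in>S. map (\<lambda>v. \<delta> *\<^sub>R v) ws ! j) = \<delta> *\<^sub>R b S" if "S \<in> Pow {..<m}" for S
    proof -
      have "(\<Sum>j\<in>S. (1 / real (Suc j)) *\<^sub>R map (\<lambda>v. \<delta> *\<^sub>R v) ws ! j) = (\<Sum>j\<in>S. \<delta> *\<^sub>R ((1 / real (Suc j)) *\<^sub>R ws ! j))"
        using that by (intro sum.cong) (auto simp: m_def)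
      then show "- (\<Sum>j\<in>S. (1 / real (Suc j)) *\<^sub>R map (\<lambda>v. \<delta> *\<^sub>R v) ws ! j) = \<delta> *\<^sub>R a S"
        by (simp add: a_def scaleR_sum_right)
      have "(\<Sum>j\<in>S. map (\<lambda>v. \<delta> *\<^sub>R v) ws ! j) = (\<Sum>j\<in>S. \<delta> *\<^sub>R ws ! j)"
        using that by (intro sum.cong) (auto simp: m_def)
      then show "(\<Sum>j\<in>S. map (\<lambda>v. \<delta> *\<^sub>R v) ws ! j) = \<delta> *\<^sub>R b S"
        by (simp add: b_def scaleR_sum_right)
    qed
    have "\<delta> ^ m * dirds ws f y = (\<Sum>S\<in>Pow {..<m}. (-1) ^ card S *\<^sub>R
        diffs (replicate m (\<delta> *\<^sub>R a S)) f (x + \<delta> *\<^sub>R b S))"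
      unfolding y(2)[symmetric] diffs_polarisation[of "map (\<lambda>v. \<delta> *\<^sub>R v) ws"] length_map m_def[symmetric]
      by (intro sum.cong) (simp_all only: eqs)
    also have "\<dots> = \<delta> ^ m * (\<Sum>S\<in>Pow {..<m}. (-1) ^ card S * B S (z S))"
      using z(2) by (simp add: sum_distrib_left mult_ac)
    finally have "dirds ws f y = (\<Sum>S\<in>Pow {..<m}. (-1) ^ card S * B S (z S))"
      using \<delta> by simp
    then have "\<bar>dirds ws f y\<bar> \<le> (\<Sum>S\<in>Pow {..<m}. \<bar>(-1) ^ card S * B S (z S)\<bar>)"
      by simp
    also have "\<dots> \<le> (\<Sum>S\<in>Pow {..<m}. \<bar>B S x\<bar> + e)"
    proof (rule sum_mono)
      fix S assume "S \<in> Pow {..<m}"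
      then have "\<bar>B S (z S) - B S x\<bar> < e" using d(4)[OF z(1)] by (auto simp: dist_real_def)
      then show "\<bar>(-1) ^ card S * B S (z S)\<bar> \<le> \<bar>B S x\<bar> + e"
        by (simp add: abs_mult power_abs)
    qed
    finally show ?thesis
      using d(3)[OF y(1)] by (simp add: dist_real_def)
  qed
  have "\<bar>dirds ws f x\<bar> \<le> (\<Sum>S\<in>Pow {..<m}. \<bar>B S x\<bar>)"
  proof (rule field_le_epsilon)
    fix e :: real assume "e > 0"
    \<comment> \<open>The error occurs once by itself and once for each of the \<open>2 ^ m\<close>
      subsets.\<close>
    define e' where "e' = e / (1 + 2 ^ m)"
    have "e' > 0" using \<open>e > 0\<close> by (simp add: e'_def add_pos_nonneg)
    from *[OF this]
    have "\<bar>dirds ws f x\<bar> \<le> (\<Sum>S\<in>Pow {..<m}. \<bar>B S x\<bar>) + (1 + 2 ^ m) * e'"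
      by (simp add: sum.distrib card_Pow algebra_simps)
    moreover have "(1 + 2 ^ m) * e' = e"
      by (simp add: e'_def add_pos_nonneg less_imp_neq[symmetric])
    ultimately show "\<bar>dirds ws f x\<bar> \<le> (\<Sum>S\<in>Pow {..<m}. \<bar>B S x\<bar>) + e" by simp
  qed
  then show ?thesis by (simp add: B_def a_def)
qed

lemma dirds_polarisation_bound:
  fixes f :: "'a::euclidean_space => 'b::euclidean_space" and ws :: "'a list"
  defines "m \<equiv> length ws"
  assumes U: "open U" and f: "smooth_in U f" and x: "x \<in> U"
  shows "norm (dirds ws f x) \<le>
    (\<Sum>S\<in>Pow {..<m}. norm (dirds (replicate m (- (\<Sum>j\<in>S. (1 / real (Suc j)) *\<^sub>R ws ! j))) f x))"
proof -
  \<comment> \<open>Testing against the normalised derivative reduces the claim to real-valued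
    functions.\<close>
  define u where "u = sgn (dirds ws f x)"
  have sm: "smooth_in U (\<lambda>y. f y \<bullet> u)"
    using smooth_in_inner[OF U f smooth_in_const] .
  have inn: "dirds vs (\<lambda>y. f y \<bullet> u) x = dirds vs f x \<bullet> u" for vs
    by (rule dirds_linear_comp[OF U f bounded_linear_inner_left x])
  have "norm u \<le> 1" by (simp add: u_def norm_sgn)
  then have le: "\<bar>w \<bullet> u\<bar> \<le> norm w" for w
    using order_trans[OF Cauchy_Schwarz_ineq2[of w u] mult_left_le[of "norm u" "norm w"]] by simp
  have "norm (dirds ws f x) = \<bar>dirds ws f x \<bullet> u\<bar>"
    by (cases "dirds ws f x = 0") (auto simp: u_def sgn_div_norm dot_square_norm power2_eq_square)
  also have "\<dots> \<le> (\<Sum>S\<in>Pow {..<m}. \<bar>dirds (replicate m (- (\<Sum>j\<in>S. (1 / real (Suc j)) *\<^sub>R ws ! j))) f x \<bullet> u\<bar>)"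
    using dirds_polarisation_bound_real[OF U sm x, of ws] by (simp only: inn m_def)
  also have "\<dots> \<le> (\<Sum>S\<in>Pow {..<m}. norm (dirds (replicate m (- (\<Sum>j\<in>S. (1 / real (Suc j)) *\<^sub>R ws ! j))) f x))"
    by (intro sum_mono le)
  finally show ?thesis .
qed

section \<open>Flat functions and cut-offs\<close>

definition expinv :: "nat => real => real" where
  "expinv j x = (if x > 0 then inverse x ^ j * exp (- inverse x) else 0)"

text \<open>The family is closed under differentiation up to linear combinations, which makes
  smoothness a case of \<open>smooth_in_coinduct\<close>. Only the origin needs an argument: there
  the exponential beats every power of the inverse.\<close>

lemma expinv_deriv: "(expinv j has_real_derivative expinv (j + 2) x - real j * expinv (j + 1) x) (at x)"
proof -
  consider "x > 0" | "x < 0" | "x = 0" by linarith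
  then show ?thesis
  proof cases
    case 1
    have "((\<lambda>x. inverse x ^ j) has_real_derivative - (real j * inverse x ^ (j + 1))) (at x)"
      using DERIV_power[OF DERIV_inverse[of x], of j] 1 by (cases j) (auto simp: mult_ac)
    moreover have "((\<lambda>x. exp (- inverse x)) has_real_derivative exp (- inverse x) * inverse x ^ 2) (at x)"
      using 1 by (auto intro!: derivative_eq_intros simp: power2_eq_square)
    ultimately have "((\<lambda>x. inverse x ^ j * exp (- inverse x)) has_real_derivative
        expinv (j + 2) x - real j * expinv (j + 1) x) (at x)"
      by (rule DERIV_mult'[THEN DERIV_cong]) (use 1 in \<open>simp add: expinv_def power2_eq_square\<close>)
    then show ?thesis
      by (rule has_field_derivative_transform_within_open[of _ _ _ "{0<..}"]) (use 1 in \<open>auto simp: expinv_def\<close>)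
  next
    case 2
    have "((\<lambda>x. 0) has_real_derivative expinv (j + 2) x - real j * expinv (j + 1) x) (at x)"
      using 2 by (simp add: expinv_def)
    then show ?thesis
      by (rule has_field_derivative_transform_within_open[of _ _ _ "{..<0}"]) (use 2 in \<open>auto simp: expinv_def\<close>)
  next
    case 3
    have "((\<lambda>h. inverse h ^ Suc j / exp (inverse h)) \<longlongrightarrow> 0) (at_right (0::real))"
      using filterlim_compose[OF tendsto_power_div_exp_0 filterlim_inverse_at_top_right] .
    then have "((\<lambda>h. expinv j h / h) \<longlongrightarrow> 0) (at_right 0)"
      by (rule Lim_transform_eventually)
        (auto simp: eventually_at_filter expinv_def exp_minus divide_inverse mult_ac)
    moreover have "((\<lambda>h. expinv j h / h) \<longlongrightarrow> 0) (at_left 0)"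
      by (rule Lim_transform_eventually[of "\<lambda>h. 0"])
        (auto simp: eventually_at_filter expinv_def)
    ultimately have "((\<lambda>h. expinv j h / h) \<longlongrightarrow> 0) (at 0)"
      by (simp add: filterlim_split_at_real)
    then show ?thesis
      using 3 by (simp add: has_field_derivative_iff expinv_def)
  qed
qed

lemma smooth_expinv: "smooth_in U (expinv j)"
proof (rule smooth_in_subset[OF _ subset_UNIV], rule smooth_in_coinduct[where P="\<lambda>f. \<exists>j. f = expinv j"])
  show "\<exists>i. expinv j = expinv i" by blast
next
  fix f x assume "\<exists>j. f = expinv j"
  then show "f differentiable (at x)"
    using expinv_deriv real_differentiable_def by blast
next
  fix f v k assume "\<exists>j. f = expinv j" and IH: "\<And>g. \<exists>j. g = expinv j ==> smooth_upto k UNIV g"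
  then obtain j where j: "f = expinv j" by blast
  have "dird v f = (\<lambda>x. v * expinv (j + 2) x + (- v * real j) * expinv (j + 1) x)"
    using dird_eqI[OF expinv_deriv[unfolded has_field_derivative_def]] by (auto simp: j algebra_simps)
  moreover have "smooth_upto k UNIV (\<lambda>x. v * expinv (j + 2) x + (- v * real j) * expinv (j + 1) x)"
    by (intro smooth_upto_add smooth_upto_bilinear[OF _ bounded_bilinear_mult] smooth_upto_const IH) auto
  ultimately show "smooth_upto k UNIV (dird v f)" by simp
qed

definition step :: "real => real" where
  "step t = expinv 0 t * inverse (expinv 0 t + expinv 0 (1 - t))"

lemma step_denominator_pos: "expinv 0 t + expinv 0 (1 - t) > 0"
  by (auto simp: expinv_def add_pos_nonneg)

lemma smooth_step: "smooth_in UNIV step"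
  unfolding step_def
  using step_denominator_pos smooth_in_comp[OF open_UNIV smooth_in_diff[OF open_UNIV smooth_in_const smooth_in_id] smooth_expinv subset_UNIV]
  by (intro smooth_in_mult smooth_in_inverse smooth_in_add smooth_expinv) (auto simp: less_imp_neq[symmetric])

lemma step_0: "t \<le> 0 ==> step t = 0" and step_1: "t \<ge> 1 ==> step t = 1"
  by (auto simp: step_def expinv_def)

lemma step_bounds: "0 \<le> step t" "step t \<le> 1"
  by (auto simp: step_def expinv_def field_simps add_pos_pos less_imp_neq[symmetric])

text \<open>The squared norm is smooth at the origin, in contrast to the norm. The transition takes
  place where it lies between 1 and 2, so radius 2 is more than enough for
  \<open>bump_0\<close>.\<close>

definition bump :: "'a::euclidean_space => real" where
  "bump z = step (2 - z \<bullet> z)"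

lemma smooth_bump: "smooth_in UNIV bump"
  unfolding bump_def
  by (intro smooth_in_comp[OF open_UNIV _ smooth_step subset_UNIV] smooth_in_diff smooth_in_inner smooth_in_id smooth_in_const open_UNIV)

lemma bump_1: "norm z \<le> 1 ==> bump z = 1"
  by (simp add: bump_def step_1 dot_square_norm power_le_one)

lemma bump_0: "norm z \<ge> 2 ==> bump z = 0"
  using power_mono[of 2 "norm z" 2] by (simp add: bump_def step_0 dot_square_norm)

lemma bump_bounds: "0 \<le> bump z" "bump z \<le> 1"
  by (auto simp: bump_def step_bounds)

lemma dirds_compact_support_bounded:
  fixes f :: "'a::euclidean_space => 'b::euclidean_space"
  assumes "smooth_in UNIV f" "\<And>x. norm x > r ==> f x = 0"
  shows "\<exists>M. \<forall>x. norm (dirds vs f x) \<le> M"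
proof -
  have "compact (dirds vs f ` cball 0 r)"
    using continuous_on_subset[OF smooth_in_continuous[OF smooth_in_dirds[OF assms(1)]] subset_UNIV]
    by (rule compact_continuous_image[OF _ compact_cball])
  then obtain M where "\<forall>y\<in>dirds vs f ` cball 0 r. norm y \<le> M"
    using compact_imp_bounded bounded_iff by blast
  then have M: "norm (dirds vs f x) \<le> M" if "norm x \<le> r" for x
    using that by simp
  have "norm (dirds vs f x) \<le> max M 0" for x
  proof (cases "norm x \<le> r")
    case False
    have "open {x::'a. norm x > r}" by (intro open_Collect_less continuous_intros)
    then have "dirds vs f x = dirds vs (\<lambda>x. 0) x"
      using False assms(2) by (intro dirds_cong[of "{x. norm x > r}"]) auto
    then show ?thesis by (cases "vs = []") (auto simp: dirds_const)
  qed (use M in \<open>simp add: le_max_iff_disj\<close>)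
  then show ?thesis by blast
qed

text \<open>There are finitely many lists of basis vectors of length at most \<open>k\<close>, so
  bounds that are uniform in the index for each list combine into one.\<close>

lemma ex_dbound:
  fixes f :: "'i => 'a::euclidean_space => 'b::euclidean_space"
  assumes "\<And>vs. set vs \<subseteq> Basis ==> length vs \<le> k ==> \<exists>M. \<forall>i\<in>I. \<forall>x\<in>K i. norm (dirds vs (f i) x) \<le> M"
  shows "\<exists>M\<ge>1. \<forall>i\<in>I. dbound k (K i) (f i) M"
proof -
  let ?L = "{vs::'a list. set vs \<subseteq> Basis \<and> length vs \<le> k}"
  have fin: "finite ?L" by (rule finite_lists_length_le) simp
  have "\<forall>vs\<in>?L. \<exists>M. \<forall>i\<in>I. \<forall>x\<in>K i. norm (dirds vs (f i) x) \<le> M"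
    using assms by blast
  from bchoice[OF this] obtain M where M: "\<And>vs i x. vs \<in> ?L ==> i \<in> I ==> x \<in> K i ==> norm (dirds vs (f i) x) \<le> M vs"
    by blast
  have "M vs \<le> (\<Sum>vs\<in>?L. \<bar>M vs\<bar>)" if "vs \<in> ?L" for vs
    using member_le_sum[OF that, of "\<lambda>vs. \<bar>M vs\<bar>"] fin by force
  then have le: "M vs \<le> 1 + (\<Sum>vs\<in>?L. \<bar>M vs\<bar>)" if "vs \<in> ?L" for vs
    using that by force
  have "dbound k (K i) (f i) (1 + (\<Sum>vs\<in>?L. \<bar>M vs\<bar>))" if "i \<in> I" for i
    unfolding dbound_def using order_trans[OF M[OF _ that] le] by blast
  then show ?thesis
    by (intro exI[of _ "1 + (\<Sum>vs\<in>?L. \<bar>M vs\<bar>)"]) (auto intro: sum_nonneg)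
qed

text \<open>The Weierstrass test makes the derivatives of order \<open>j + 1\<close> converge
  uniformly, which justifies termwise differentiation at order \<open>j\<close>. Bounds are assumed
  up to \<open>Suc p\<close> because the derivative of order \<open>p\<close> is seen to be
  continuous by being differentiable.\<close>

lemma smooth_upto_suminf:
  fixes u :: "nat => real => 'b::euclidean_space"
  assumes J: "open J" "convex J" and u: "\<And>k. smooth_in J (u k)"
    and M: "\<And>j. j \<le> Suc p ==>
      \<exists>M. summable M \<and> (\<forall>k. \<forall>t\<in>J. norm (dirds (replicate j 1) (u k) t) \<le> M k)"
  shows "smooth_upto p J (\<lambda>t. \<Sum>k. u k t)"
proof -
  define D where "D j k = dirds (replicate j 1) (u k)" for j k
  define v where "v j t = (\<Sum>k. D j k t)" for j t
  have unif: "uniform_limit J (\<lambda>n t. \<Sum>k<n. D j k t) (v j) sequentially" if j: "j \<le> Suc p" for j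
  proof -
    obtain M where "summable M" "\<And>k t. t \<in> J ==> norm (D j k t) \<le> M k"
      using M[OF j] by (auto simp: D_def)
    then show ?thesis
      unfolding v_def by (intro Weierstrass_m_test)
  qed
  have sums: "(\<lambda>k. D j k t) sums v j t" if "j \<le> Suc p" "t \<in> J" for j t
    using tendsto_uniform_limitI[OF unif that(2)] that(1) by (simp add: sums_def)
  have dD: "(D j k has_derivative (\<lambda>h. h *\<^sub>R D (Suc j) k t)) (at t)" if "t \<in> J" for j k t
  proof -
    have d: "D j k differentiable (at t)"
      unfolding D_def using smooth_in_differentiable[OF smooth_in_dirds[OF u] that] .
    have 1: "dird 1 (D j k) t = D (Suc j) k t" by (simp add: D_def)
    have "dird h (D j k) t = h *\<^sub>R D (Suc j) k t" for h
      using linear_scale[OF dird_linear[OF d], of h 1]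
      by (simp only: 1 real_scaleR_def mult_1_right)
    then have "(\<lambda>h. dird h (D j k) t) = (\<lambda>h. h *\<^sub>R D (Suc j) k t)"
      by (rule ext)
    then show ?thesis
      using has_derivative_dird[OF d] by simp
  qed
  have dv: "(v j has_derivative (\<lambda>h. h *\<^sub>R v (Suc j) t)) (at t)" if t: "t \<in> J" and j: "j \<le> p" for j t
  proof -
    \<comment> \<open>The rule for series provides some limit function; it is identified with
      \<open>v j\<close> afterwards by uniqueness of sums.\<close>
    have "\<exists>g. \<forall>t\<in>J. (\<lambda>n. D j n t) sums (g t) \<and> (g has_derivative (\<lambda>h. h *\<^sub>R v (Suc j) t)) (at t within J)"
    proof (rule has_derivative_series[where f="D j" and f'="\<lambda>n x h. h *\<^sub>R D (Suc j) n x" and x=t and l="v j t"])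
      show "convex J" "t \<in> J" by fact+
      show "(\<lambda>n. D j n t) sums v j t" by (rule sums) (use t j in auto)
      show "(D j n has_derivative (\<lambda>h. h *\<^sub>R D (Suc j) n x)) (at x within J)" if "x \<in> J" for n x
        using dD[OF that] by (rule has_derivative_at_withinI)
      show "\<forall>\<^sub>F n in sequentially. \<forall>x\<in>J. \<forall>h. norm ((\<Sum>i<n. h *\<^sub>R D (Suc j) i x) - h *\<^sub>R v (Suc j) x) \<le> e * norm h"
        if "e > 0" for e :: real
      proof (rule eventually_mono[OF uniform_limitD[OF unif[of "Suc j"] that]], use j in simp, intro ballI allI)
        fix n x h assume *: "\<forall>x\<in>J. dist (\<Sum>k<n. D (Suc j) k x) (v (Suc j) x) < e" and x: "x \<in> J"
        have "norm ((\<Sum>i<n. h *\<^sub>R D (Suc j) i x) - h *\<^sub>R v (Suc j) x) = norm h * dist (\<Sum>k<n. D (Suc j) k x) (v (Suc j) x)"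
          by (simp add: scaleR_sum_right[symmetric] scaleR_diff_right[symmetric] dist_norm)
        also have "\<dots> \<le> norm h * e"
          using *[rule_format, OF x] by (intro mult_left_mono) auto
        finally show "norm ((\<Sum>i<n. h *\<^sub>R D (Suc j) i x) - h *\<^sub>R v (Suc j) x) \<le> e * norm h"
          by (simp add: mult.commute)
      qed
    qed
    then obtain g where g: "\<And>t. t \<in> J ==> (\<lambda>n. D j n t) sums (g t)"
      "(g has_derivative (\<lambda>h. h *\<^sub>R v (Suc j) t)) (at t within J)"
      using t by blast
    have "g x = v j x" if "x \<in> J" for x
      using sums_unique2[OF g(1)[OF that] sums[OF _ that]] j by simp
    moreover have "(g has_derivative (\<lambda>h. h *\<^sub>R v (Suc j) t)) (at t)"
      using g(2) at_within_open[OF t J(1)] by simp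
    ultimately show ?thesis
      using has_derivative_transform_within_open[OF _ J(1) t] by blast
  qed
  have diff: "v j differentiable (at t)" if "t \<in> J" "j \<le> p" for j t
    using dv[OF that] by (auto simp: differentiable_def)
  have "smooth_upto q J (v j)" if "j + q \<le> p" for q j
    using that
  proof (induction q arbitrary: j)
    case 0
    then show ?case
      using differentiable_imp_continuous_on_at[of J "v j"] diff by simp
  next
    case (Suc q)
    have "smooth_upto q J (dird r (v j))" for r
    proof (rule smooth_upto_cong[OF J(1)])
      show "r *\<^sub>R v (Suc j) t = dird r (v j) t" if "t \<in> J" for t
        using dird_eqI[OF dv[OF that]] Suc.prems by simp
      show "smooth_upto q J (\<lambda>t. r *\<^sub>R v (Suc j) t)"
        using Suc.prems by (intro smooth_upto_bilinear[OF J(1) bounded_bilinear_scaleR] smooth_upto_const Suc.IH) auto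
    qed
    then show ?case using diff Suc.prems by simp
  qed
  then have "smooth_upto p J (v 0)" by simp
  moreover have "v 0 = (\<lambda>t. \<Sum>k. u k t)"
    by (intro ext) (simp add: v_def D_def)
  ultimately show ?thesis by simp
qed

section \<open>Boman's theorem\<close>

lemma inverse_two_power_separated:
  fixes t :: real
  assumes "\<bar>t - (1/2)^k\<bar> < (1/2)^k / 8" "\<bar>t - (1/2)^l\<bar> < (1/2)^l / 8"
  shows "k = l"
proof -
  have "\<not> k < l" if "\<bar>t - (1/2)^k\<bar> < (1/2)^k / 8" "\<bar>t - (1/2)^l\<bar> < (1/2)^l / 8" for k l :: nat
  proof
    assume "k < l"
    then have "(1/2::real)^l \<le> (1/2)^Suc k"
      by (intro power_decreasing) auto
    moreover have "(1/2::real)^k > 0" by simp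
    ultimately show False using that unfolding abs_less_iff by simp
  qed
  then show ?thesis using assms by (metis nat_neq_iff)
qed

lemma dirds_affine_arg:
  fixes B :: "real => real" and p :: "'a::euclidean_space"
  assumes "smooth_in UNIV B"
  shows "dirds (replicate j 1) (\<lambda>t. B (m * (t - \<tau>)) *\<^sub>R p) t = (m ^ j * dirds (replicate j 1) B (m * (t - \<tau>))) *\<^sub>R p"
    and "smooth_in UNIV (\<lambda>t. B (m * (t - \<tau>)) *\<^sub>R p)"
proof -
  have eq: "(\<lambda>t. B (m * (t - \<tau>))) = (\<lambda>t. B (- m * \<tau> + t *\<^sub>R m))"
    by (simp add: algebra_simps)
  have "smooth_in UNIV (\<lambda>t. m * (t - \<tau>))"
    by (intro smooth_in_mult smooth_in_diff smooth_in_const smooth_in_id open_UNIV)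
  then have s: "smooth_in UNIV (\<lambda>t. B (m * (t - \<tau>)))"
    by (rule smooth_in_comp[OF open_UNIV _ assms]) auto
  then show "smooth_in UNIV (\<lambda>t. B (m * (t - \<tau>)) *\<^sub>R p)"
    by (intro smooth_in_scaleR smooth_in_const open_UNIV)
  have "dirds (replicate j 1) (\<lambda>t. B (m * (t - \<tau>)) *\<^sub>R p) t = dirds (replicate j 1) (\<lambda>t. B (m * (t - \<tau>))) t *\<^sub>R p"
    by (rule dirds_linear_comp[OF open_UNIV s bounded_linear_scaleR_left UNIV_I])
  also have "dirds (replicate j 1) (\<lambda>t. B (m * (t - \<tau>))) t = dirds (map (\<lambda>v. m *\<^sub>R v) (replicate j 1)) B (m * (t - \<tau>))"
    unfolding eq dirds_line by (simp add: algebra_simps)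
  also have "\<dots> = m ^ j * dirds (replicate j 1) B (m * (t - \<tau>))"
    using dirds_map_scale[OF open_UNIV assms UNIV_I, of m "replicate j 1"] by simp
  finally show "dirds (replicate j 1) (\<lambda>t. B (m * (t - \<tau>)) *\<^sub>R p) t = (m ^ j * dirds (replicate j 1) B (m * (t - \<tau>))) *\<^sub>R p" .
qed

text \<open>The special curve lemma: rapidly converging points lie on one smooth curve, which passes
  \<open>x k\<close> at time \<open>(1/2)^k\<close> along a short straight segment. Localising to a
  window of width proportional to \<open>(1/2)^k\<close> multiplies derivatives of order
  \<open>j\<close> by a constant times \<open>(2^j)^k\<close>, and the factorials dominate
  this.\<close>

lemma special_curve:
  fixes x w :: "nat => 'a::euclidean_space"
  assumes \<rho>: "\<rho> > 0" and x: "\<And>k. norm (x k - a) \<le> \<rho> / fact k" and w: "\<And>k. norm (w k) \<le> 1"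
  obtains c where "smooth_in UNIV c" "\<And>t. norm (c t - a) \<le> 2 * \<rho>"
    "\<And>k t. \<bar>t - (1/2)^k\<bar> \<le> (1/2)^k / 16 ==> c t = x k + ((t - (1/2)^k) * (\<rho> / fact k)) *\<^sub>R w k"
proof -
  \<comment> \<open>With the factor \<open>m k\<close> the bump is 1 up to distance
    \<open>(1/2)^k / 16\<close> from \<open>(1/2)^k\<close> and 0 beyond \<open>(1/2)^k / 8\<close>;
    the larger windows are still disjoint.\<close>
  define m :: "nat => real" where "m k = 16 * 2^k" for k
  define B1 :: "real => real" where "B1 s = s * bump s" for s
  define p q where "p k = x k - a" and "q k = (\<rho> / fact k / m k) *\<^sub>R w k" for k
  define u where "u k t = bump (m k * (t - (1/2)^k)) *\<^sub>R p k + B1 (m k * (t - (1/2)^k)) *\<^sub>R q k" for k t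
  have m0: "m k > 0" "m k \<ge> 1" for k
  proof -
    have "1 \<le> (2::real)^k" by (rule one_le_power) simp
    then show "m k > 0" "m k \<ge> 1" unfolding m_def by linarith+
  qed
  have mt: "m k * \<bar>t - (1/2)^k\<bar> < r \<longleftrightarrow> \<bar>t - (1/2)^k\<bar> < r * ((1/2)^k / 16)" for r k t
    by (simp add: m_def power_one_over field_simps)
  have mt_le: "m k * \<bar>t - (1/2)^k\<bar> \<le> r \<longleftrightarrow> \<bar>t - (1/2)^k\<bar> \<le> r * ((1/2)^k / 16)" for r k t
    by (simp add: m_def power_one_over field_simps)
  have u_eq: "u k t = bump (m k * (t - (1/2)^k)) *\<^sub>R (x k - a + ((t - (1/2)^k) * (\<rho> / fact k)) *\<^sub>R w k)" for k t
    using m0[of k] by (simp add: u_def B1_def p_def q_def algebra_simps)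
  have B1: "smooth_in UNIV B1"
    unfolding B1_def by (intro smooth_in_mult smooth_in_id smooth_bump open_UNIV)
  have su: "smooth_in UNIV (u k)" for k
    unfolding u_def by (intro smooth_in_add dirds_affine_arg(2) smooth_bump B1 open_UNIV)
  have nz: "\<bar>t - (1/2)^k\<bar> < (1/2)^k / 8" if "u k t \<noteq> 0" for k t
  proof -
    have "norm (m k * (t - (1/2)^k)) < 2"
    proof (rule ccontr)
      assume "\<not> ?thesis"
      then have "bump (m k * (t - (1/2)^k)) = 0" by (intro bump_0) simp
      then show False using that by (simp add: u_eq)
    qed
    then show ?thesis using mt[of k t 2] m0[of k] by (simp add: abs_mult)
  qed
  have single: "(\<Sum>k. u k t) = u l t" if "\<bar>t - (1/2)^l\<bar> < (1/2)^l / 8" for l t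
  proof -
    have "u k t = 0" if "k \<noteq> l" for k
    proof (rule ccontr)
      assume "u k t \<noteq> 0"
      from inverse_two_power_separated[OF nz[OF this] \<open>\<bar>t - (1/2)^l\<bar> < (1/2)^l / 8\<close>] that show False by simp
    qed
    then show ?thesis using suminf_finite[of "{l}" "\<lambda>k. u k t"] by simp
  qed
  have small: "norm (u k t) \<le> 2 * \<rho>" for k t
  proof (cases "u k t = 0")
    case False
    from nz[OF this] have "\<bar>t - (1/2)^k\<bar> < 1 * (1/8)"
      using power_le_one[of "1/2::real" k] by simp
    moreover have f: "\<rho> / fact k \<le> \<rho>" "0 \<le> \<rho> / fact k"
      using \<rho> fact_ge_1[of k, where 'a=real] by (auto simp: divide_le_eq mult_left_le)
    ultimately have "\<bar>t - (1/2)^k\<bar> * (\<rho> / fact k) * norm (w k) \<le> 1 * \<rho> * 1"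
      using w[of k] by (intro mult_mono mult_nonneg_nonneg) auto
    then have "norm (x k - a + ((t - (1/2)^k) * (\<rho> / fact k)) *\<^sub>R w k) \<le> \<rho> + \<rho>"
      using x[of k] f \<rho> by (intro norm_triangle_mono) (auto simp: abs_mult)
    moreover have "norm (u k t) \<le> 1 * norm (x k - a + ((t - (1/2)^k) * (\<rho> / fact k)) *\<^sub>R w k)"
      unfolding u_eq norm_scaleR using bump_bounds[of "m k * (t - (1/2)^k)"] by (intro mult_right_mono) auto
    ultimately show ?thesis by simp
  qed (use \<rho> in simp)
  have bnd: "\<exists>M. summable M \<and> (\<forall>k. \<forall>t\<in>UNIV. norm (dirds (replicate j 1) (u k) t) \<le> M k)" for j
  proof -
    obtain M0 where M0: "\<And>s. norm (dirds (replicate j 1) (bump :: real => real) s) \<le> M0"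
      using dirds_compact_support_bounded[OF smooth_bump, of 2] bump_0 by (metis less_imp_le)
    obtain M1 where M1: "\<And>s. norm (dirds (replicate j 1) B1 s) \<le> M1"
      using dirds_compact_support_bounded[OF B1, of 2] bump_0 unfolding B1_def by (metis less_imp_le mult_zero_right)
    have pos: "0 \<le> M0" "0 \<le> M1" using M0[of 0] M1[of 0] norm_ge_zero order_trans by blast+
    have "norm (dirds (replicate j 1) (u k) t) \<le> (16^j * (M0 + M1) * \<rho>) * (inverse (fact k) * (2^j)^k)" for k t
    proof -
      have q: "norm (q k) \<le> \<rho> / fact k" "norm (p k) \<le> \<rho> / fact k"
      proof -
        have "norm (q k) \<le> (\<rho> / fact k / m k) * 1"
          unfolding q_def norm_scaleR using w[of k] \<rho> m0[of k] by (intro mult_mono) auto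
        also have "\<dots> \<le> \<rho> / fact k / 1"
          using \<rho> m0[of k] by (simp only: mult_1_right) (intro divide_left_mono, auto)
        finally show "norm (q k) \<le> \<rho> / fact k" by simp
        show "norm (p k) \<le> \<rho> / fact k" using x by (simp add: p_def)
      qed
      let ?s = "m k * (t - (1/2)^k)"
      have "dirds (replicate j 1) (u k) t =
          (m k ^ j * dirds (replicate j 1) bump ?s) *\<^sub>R p k + (m k ^ j * dirds (replicate j 1) B1 ?s) *\<^sub>R q k"
        unfolding u_def
        by (subst dirds_add[OF open_UNIV dirds_affine_arg(2)[OF smooth_bump] dirds_affine_arg(2)[OF B1] UNIV_I])
          (simp only: dirds_affine_arg(1)[OF smooth_bump] dirds_affine_arg(1)[OF B1])
      moreover have "norm ((m k ^ j * dirds (replicate j 1) bump ?s) *\<^sub>R p k) \<le> (m k ^ j * M0) * (\<rho> / fact k)"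
        unfolding norm_scaleR abs_mult using M0[of ?s] q m0[of k] pos
        by (intro mult_mono mult_nonneg_nonneg) auto
      moreover have "norm ((m k ^ j * dirds (replicate j 1) B1 ?s) *\<^sub>R q k) \<le> (m k ^ j * M1) * (\<rho> / fact k)"
        unfolding norm_scaleR abs_mult using M1[of ?s] q m0[of k] pos
        by (intro mult_mono mult_nonneg_nonneg) auto
      ultimately have "norm (dirds (replicate j 1) (u k) t) \<le> (m k ^ j * M0) * (\<rho> / fact k) + (m k ^ j * M1) * (\<rho> / fact k)"
        using norm_triangle_mono by metis
      also have "\<dots> = (16^j * (M0 + M1) * \<rho>) * (inverse (fact k) * (2^j)^k)"
        by (simp add: m_def power_mult_distrib power_mult[symmetric] mult.commute[of k] divide_inverse algebra_simps)
      finally show ?thesis .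
    qed
    moreover have "summable (\<lambda>k. (16^j * (M0 + M1) * \<rho>) * (inverse (fact k) * (2^j)^k))"
      by (intro summable_mult summable_exp)
    ultimately show ?thesis by blast
  qed
  define c where "c t = a + (\<Sum>k. u k t)" for t
  show ?thesis
  proof
    have "smooth_in UNIV (\<lambda>t. \<Sum>k. u k t)"
      unfolding smooth_in_def using smooth_upto_suminf[OF open_UNIV convex_UNIV su bnd] by blast
    then show "smooth_in UNIV c"
      unfolding c_def by (intro smooth_in_add smooth_in_const open_UNIV)
    show "norm (c t - a) \<le> 2 * \<rho>" for t
    proof (cases "\<exists>l. u l t \<noteq> 0")
      case True
      then obtain l where "u l t \<noteq> 0" by blast
      then show ?thesis using single[OF nz] small by (simp add: c_def)
    qed (use \<rho> in \<open>simp add: c_def\<close>)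
    show "c t = x k + ((t - (1/2)^k) * (\<rho> / fact k)) *\<^sub>R w k" if "\<bar>t - (1/2)^k\<bar> \<le> (1/2)^k / 16" for k t
    proof -
      have "\<bar>t - (1/2)^k\<bar> < (1/2)^k / 8" using that zero_less_power[of "1/2::real" k] by linarith
      moreover have "bump (m k * (t - (1/2)^k)) = 1"
        using that m0[of k] mt_le[of k t 1] by (intro bump_1) (simp add: abs_mult)
      ultimately show ?thesis
        using single[of t k] u_eq[of k t] by (simp add: c_def del: real_scaleR_def)
    qed
  qed
qed

definition curve_smooth :: "'a::euclidean_space set => ('a => 'b::euclidean_space) => bool" where
  "curve_smooth U f \<longleftrightarrow> (\<forall>c. smooth_in (UNIV::real set) c \<and> range c \<subseteq> U --> smooth_in UNIV (\<lambda>t. f (c t)))"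

text \<open>The curve is precomposed with \<open>\<theta>\<close>, which is the identity near
  \<open>t1\<close> and maps all times into \<open>J\<close>. This gives a curve defined for all
  times, as \<open>curve_smooth\<close> demands.\<close>

lemma curve_smooth_local:
  assumes f: "curve_smooth U f" and J: "open J" and \<gamma>: "smooth_in J \<gamma>" "\<gamma> ` J \<subseteq> U"
  shows "smooth_in J (\<lambda>t::real. f (\<gamma> t))"
proof (rule smooth_in_local_eq)
  fix t1 assume "t1 \<in> J"
  then obtain r where r: "r > 0" "ball t1 r \<subseteq> J" using J open_contains_ball by blast
  define \<theta> where "\<theta> t = t1 + bump ((4 / r) * (t - t1)) * (t - t1)" for t
  have "smooth_in UNIV (\<lambda>t. bump ((4 / r) * (t - t1)) *\<^sub>R (1::real))"
    by (rule dirds_affine_arg(2)[OF smooth_bump])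
  then have s\<theta>: "smooth_in UNIV \<theta>"
    unfolding \<theta>_def by (intro smooth_in_add smooth_in_mult smooth_in_diff smooth_in_id smooth_in_const open_UNIV) simp
  have nrm: "norm ((4 / r) * (t - t1)) = (4 / r) * \<bar>t - t1\<bar>" for t
    using r by (simp only: real_norm_def abs_mult) simp
  have rg: "\<theta> t \<in> J" for t
  proof (cases "\<bar>t - t1\<bar> < r / 2")
    case True
    have "\<bar>bump ((4 / r) * (t - t1)) * (t - t1)\<bar> \<le> 1 * \<bar>t - t1\<bar>"
      unfolding abs_mult using bump_bounds[of "(4 / r) * (t - t1)"] by (intro mult_right_mono) auto
    then have "\<theta> t \<in> ball t1 r" using True r by (simp add: \<theta>_def dist_real_def)
    then show ?thesis using r by blast
  next
    case False
    then have "(4 / r) * (r / 2) \<le> (4 / r) * \<bar>t - t1\<bar>"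
      using r by (intro mult_left_mono) auto
    then have "bump ((4 / r) * (t - t1)) = 0"
      using r by (intro bump_0) (simp only: nrm, simp)
    then show ?thesis using \<open>t1 \<in> J\<close> by (simp add: \<theta>_def)
  qed
  have "smooth_in UNIV (\<lambda>t. \<gamma> (\<theta> t))"
    using smooth_in_comp[OF open_UNIV s\<theta> \<gamma>(1)] rg by blast
  then have "smooth_in UNIV (\<lambda>t. f (\<gamma> (\<theta> t)))"
    using f \<gamma>(2) rg unfolding curve_smooth_def by blast
  moreover have "f (\<gamma> t) = f (\<gamma> (\<theta> t))" if "t \<in> ball t1 (r / 4)" for t
  proof -
    have "(4 / r) * \<bar>t - t1\<bar> \<le> (4 / r) * (r / 4)"
      using that r by (intro mult_left_mono) (auto simp: dist_real_def abs_minus_commute)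
    then have "bump ((4 / r) * (t - t1)) = 1"
      using r by (intro bump_1) (simp only: nrm, simp)
    then show ?thesis by (simp add: \<theta>_def)
  qed
  ultimately show "\<exists>V g. open V \<and> t1 \<in> V \<and> smooth_in V g \<and> (\<forall>t\<in>V. f (\<gamma> t) = g t)"
    using r by (intro exI[of _ "ball t1 (r / 4)"] exI[of _ "\<lambda>t. f (\<gamma> (\<theta> t))"]) (auto intro: smooth_in_subset)
qed

lemma sum_list_replicate_real: "sum_list (replicate n (r::real)) = n * r"
  by (induction n) (auto simp: algebra_simps)

text \<open>Otherwise segments violating the bound ever more strongly could be placed on one special
  curve. Along it the differences of \<open>f\<close> are differences of a smooth function of time,
  whose derivative of order \<open>m\<close> would be unbounded on a compact interval.\<close>

lemma curve_smooth_pure_diff_bound: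
  fixes f :: "'a::euclidean_space => real"
  assumes U: "open U" and f: "curve_smooth U f" and a: "a \<in> U"
  shows "\<exists>\<delta>>0. \<exists>C. \<forall>x w. norm (x - a) < \<delta> \<and> norm w < \<delta> --> \<bar>diffs (replicate m w) f x\<bar> \<le> C * norm w ^ m"
proof (rule ccontr)
  assume neg: "\<not> ?thesis"
  obtain r where r: "r > 0" "ball a r \<subseteq> U" using U a open_contains_ball by blast
  define \<rho> where "\<rho> = r / 3"
  have \<rho>: "\<rho> > 0" using r by (simp add: \<rho>_def)
  define \<eta> where "\<eta> k = \<rho> / fact k" for k :: nat
  have \<eta>: "\<eta> k > 0" for k using \<rho> by (simp add: \<eta>_def)
  define K where "K = real m + 1"
  have K: "K > 0" by (simp add: K_def)
  \<comment> \<open>The first entry gives the rate required by \<open>special_curve\<close>; the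
    second makes all \<open>m\<close> steps fit into the straight part of the curve.\<close>
  define \<delta> where "\<delta> k = min (\<eta> k) (\<eta> k * (1/2)^k / (16 * K))" for k :: nat
  have \<delta>: "\<delta> k > 0" for k using \<eta>[of k] K by (simp add: \<delta>_def)
  \<comment> \<open>The curve has speed \<open>\<eta> k\<close> near time \<open>(1/2)^k\<close>, so
    dividing by \<open>\<eta> k ^ m\<close> turns this into a bound on differences in time.\<close>
  have "\<forall>k. \<exists>x w. norm (x - a) < \<delta> k \<and> norm w < \<delta> k \<and> \<not> \<bar>diffs (replicate m w) f x\<bar> \<le> (real k / \<eta> k ^ m) * norm w ^ m"
    using neg \<delta> by blast
  then obtain x w where xw: "\<And>k. norm (x k - a) < \<delta> k" "\<And>k. norm (w k) < \<delta> k"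
    "\<And>k. \<not> \<bar>diffs (replicate m (w k)) f (x k)\<bar> \<le> (real k / \<eta> k ^ m) * norm (w k) ^ m"
    by metis
  have x1: "norm (x k - a) \<le> \<rho> / fact k" for k
    using xw(1)[of k] unfolding \<delta>_def \<eta>_def by linarith
  have w1: "norm (sgn (w k)) \<le> 1" for k by (simp add: norm_sgn)
  obtain c where c: "smooth_in UNIV c" "\<And>t. norm (c t - a) \<le> 2 * \<rho>"
    "\<And>k t. \<bar>t - (1/2)^k\<bar> \<le> (1/2)^k / 16 ==> c t = x k + ((t - (1/2)^k) * (\<rho> / fact k)) *\<^sub>R sgn (w k)"
    using special_curve[of \<rho> x a "\<lambda>k. sgn (w k)", OF \<rho> x1 w1] by blast
  have "c t \<in> U" for t
    using c(2)[of t] r by (intro subsetD[OF r(2)]) (simp add: dist_norm norm_minus_commute \<rho>_def)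
  then have "smooth_in UNIV (\<lambda>t. f (c t))"
    using f c(1) unfolding curve_smooth_def by blast
  moreover define g where "g = (\<lambda>t. f (c t))"
  ultimately have sg: "smooth_in UNIV g" by simp
  have "compact (dirds (replicate m 1) g ` cball 0 2)"
    using continuous_on_subset[OF smooth_in_continuous[OF smooth_in_dirds[OF sg]] subset_UNIV]
    by (rule compact_continuous_image[OF _ compact_cball])
  then obtain M where "\<forall>y\<in>dirds (replicate m 1) g ` cball 0 2. norm y \<le> M"
    using compact_imp_bounded bounded_iff by blast
  then have M: "norm (dirds (replicate m 1) g y) \<le> M" if "norm y \<le> 2" for y
    using that by simp
  have lt: "real k < M" for k
  proof -
    \<comment> \<open>The time needed to travel the length of \<open>w k\<close> at speed
      \<open>\<eta> k\<close>.\<close>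
    define s where "s = norm (w k) / \<eta> k"
    have s0: "s \<ge> 0" using \<eta>[of k] by (simp add: s_def)
    have ms: "m * s \<le> (1/2)^k / 16"
    proof -
      have "norm (w k) \<le> \<eta> k * (1/2)^k / (16 * K)"
        using xw(2)[of k] unfolding \<delta>_def by linarith
      then have "s \<le> (1/2)^k / (16 * K)"
        using \<eta>[of k] K by (simp add: s_def field_simps)
      then have "m * s \<le> K * ((1/2)^k / (16 * K))"
        using s0 K by (intro mult_mono) (auto simp: K_def)
      then show ?thesis using K by simp
    qed
    have "diffs (replicate m (w k)) f (x k) = diffs (replicate m s) g ((1/2)^k)"
      unfolding diffs_subsets length_replicate
    proof (intro sum.cong refl)
      fix S assume S: "S \<in> Pow {..<m}"
      have 1: "(\<Sum>j\<in>S. replicate m (w k) ! j) = real (card S) *\<^sub>R w k"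
        "(\<Sum>j\<in>S. replicate m s ! j) = real (card S) * s"
        using S by (subst sum.cong[OF refl, of _ _ "\<lambda>_. _"]; force simp: sum_constant_scaleR)+
      have "card S \<le> m" using S card_mono[of "{..<m}" S] by auto
      then have "real (card S) * s \<le> m * s" using s0 by (intro mult_right_mono) auto
      then have "\<bar>(1/2)^k + real (card S) * s - (1/2)^k\<bar> \<le> (1/2)^k / 16"
        using ms s0 by simp
      from c(3)[OF this] have "c ((1/2)^k + real (card S) * s) = x k + (real (card S) * (s * \<eta> k)) *\<^sub>R sgn (w k)"
        by (simp add: \<eta>_def)
      also have "\<dots> = x k + real (card S) *\<^sub>R w k"
        using \<eta>[of k] by (cases "w k = 0") (auto simp: s_def sgn_div_norm)
      finally show "(-1) ^ (m + card S) *\<^sub>R f (x k + (\<Sum>j\<in>S. replicate m (w k) ! j)) =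
          (-1) ^ (m + card S) *\<^sub>R g ((1/2)^k + (\<Sum>j\<in>S. replicate m s ! j))"
        by (simp add: 1 g_def)
    qed
    moreover obtain y where y: "y \<in> cball ((1/2)^k) (m * s)" "diffs (replicate m s) g ((1/2)^k) = dirds (replicate m s) g y"
      using diffs_mvt[OF open_UNIV sg, of "(1/2)^k" "replicate m s"] s0
      by (auto simp: sum_list_replicate_real)
    moreover have "dirds (replicate m s) g y = s ^ m * dirds (replicate m 1) g y"
      using dirds_map_scale[OF open_UNIV sg UNIV_I, of s "replicate m 1" y] by (simp add: map_replicate)
    moreover have "norm y \<le> 2"
    proof -
      have "(1/2::real)^k \<le> 1" by (simp add: power_le_one)
      then show ?thesis using y(1) ms by (auto simp: dist_real_def)
    qed
    ultimately have "\<bar>diffs (replicate m (w k)) f (x k)\<bar> \<le> s ^ m * M"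
      using M[of y] s0 by (auto simp: abs_mult intro!: mult_mono)
    then have "(real k / \<eta> k ^ m) * norm (w k) ^ m < s ^ m * M"
      using xw(3)[of k] by linarith
    then have "real k * s ^ m < M * s ^ m"
      by (simp add: s_def power_divide mult.commute)
    then show ?thesis using s0 by (simp add: mult_less_cancel_right)
  qed
  show False using lt reals_Archimedean2[of M] by (meson less_asym)
qed

text \<open>Polarisation expresses mixed differences through pure ones. Their steps and the shifts
  of their base points have norm at most \<open>m * r\<close>, for which \<open>\<delta>'\<close>
  leaves room.\<close>

lemma curve_smooth_diff_bound:
  fixes f :: "'a::euclidean_space => real"
  assumes U: "open U" and f: "curve_smooth U f" and a: "a \<in> U"
  shows "\<exists>\<delta>>0. \<exists>C\<ge>0. \<forall>x hs r. norm (x - a) < \<delta> \<and> length hs = m \<and> (\<forall>h\<in>set hs. norm h \<le> r) \<and> 0 \<le> r \<and> r < \<delta> -->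
    \<bar>diffs hs f x\<bar> \<le> C * r ^ m"
proof -
  obtain \<delta> C where \<delta>: "\<delta> > 0" and C: "\<And>x w. norm (x - a) < \<delta> ==> norm w < \<delta> ==> \<bar>diffs (replicate m w) f x\<bar> \<le> C * norm w ^ m"
    using curve_smooth_pure_diff_bound[OF assms, of m] by blast
  define K where "K = real m + 1"
  have K: "K > 0" by (simp add: K_def)
  define \<delta>' where "\<delta>' = \<delta> / (2 * K)"
  have \<delta>': "\<delta>' > 0" using \<delta> K by (simp add: \<delta>'_def)
  have "\<bar>diffs hs f x\<bar> \<le> (2 ^ m * (\<bar>C\<bar> * m ^ m)) * r ^ m"
    if x: "norm (x - a) < \<delta>'" and len: "length hs = m" and hs: "\<And>h. h \<in> set hs ==> norm h \<le> r" and r: "0 \<le> r" "r < \<delta>'" for x hs r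
  proof -
    let ?a = "\<lambda>S. - (\<Sum>j\<in>S. (1 / real (Suc j)) *\<^sub>R hs ! j)"
    have mr: "m * r + \<delta>' \<le> \<delta>"
    proof -
      have "m * r + \<delta>' \<le> m * \<delta>' + \<delta>'" using r by (simp add: mult_left_mono)
      also have "\<dots> = K * \<delta>'" by (simp add: K_def algebra_simps)
      also have "\<dots> = \<delta> / 2" using K by (simp add: \<delta>'_def)
      finally show ?thesis using \<delta> by simp
    qed
    have "\<bar>diffs hs f x\<bar> \<le> (\<Sum>S\<in>Pow {..<m}. \<bar>(-1) ^ card S *\<^sub>R diffs (replicate m (?a S)) f (x + (\<Sum>j\<in>S. hs ! j))\<bar>)"
      unfolding diffs_polarisation[of hs] len by (rule sum_abs)
    also have "\<dots> \<le> (\<Sum>S\<in>Pow {..<m}. \<bar>C\<bar> * (m * r) ^ m)"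
    proof (rule sum_mono)
      fix S assume S: "S \<in> Pow {..<m}"
      have card: "card S \<le> m" using S card_mono[of "{..<m}" S] by auto
      have n: "norm (hs ! j) \<le> r" if "j \<in> S" for j
        using S that len hs by auto
      have b: "norm (\<Sum>j\<in>S. hs ! j) \<le> m * r"
      proof -
        have "norm (\<Sum>j\<in>S. hs ! j) \<le> (\<Sum>j\<in>S. r)" by (rule sum_norm_le) (rule n)
        also have "\<dots> \<le> m * r" using card r by (simp add: mult_right_mono)
        finally show ?thesis .
      qed
      have a: "norm (?a S) \<le> m * r"
      proof -
        have "norm (?a S) \<le> (\<Sum>j\<in>S. r)"
          unfolding norm_minus_cancel
        proof (rule sum_norm_le)
          fix j assume "j \<in> S"
          have "(1 / real (Suc j)) * norm (hs ! j) \<le> 1 * r"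
            using n[OF \<open>j \<in> S\<close>] r by (intro mult_mono) auto
          then show "norm ((1 / real (Suc j)) *\<^sub>R hs ! j) \<le> r" by simp
        qed
        also have "\<dots> \<le> m * r" using card r by (simp add: mult_right_mono)
        finally show ?thesis .
      qed
      have "norm (x + (\<Sum>j\<in>S. hs ! j) - a) < \<delta>"
        using norm_triangle_ineq[of "x - a" "\<Sum>j\<in>S. hs ! j"] x b mr by (simp add: algebra_simps)
      moreover have "norm (?a S) < \<delta>" using a mr \<delta>' by linarith
      ultimately have "\<bar>diffs (replicate m (?a S)) f (x + (\<Sum>j\<in>S. hs ! j))\<bar> \<le> C * norm (?a S) ^ m"
        by (rule C)
      also have "\<dots> \<le> \<bar>C\<bar> * (m * r) ^ m"
        using a by (intro mult_mono power_mono) auto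
      finally show "\<bar>(-1) ^ card S *\<^sub>R diffs (replicate m (?a S)) f (x + (\<Sum>j\<in>S. hs ! j))\<bar> \<le> \<bar>C\<bar> * (m * r) ^ m"
        by (simp add: abs_mult power_abs)
    qed
    also have "\<dots> = (2 ^ m * (\<bar>C\<bar> * m ^ m)) * r ^ m"
      by (simp add: card_Pow power_mult_distrib)
    finally show ?thesis .
  qed
  then show ?thesis
    using \<delta>' by (intro exI[of _ \<delta>'] conjI exI[of _ "2 ^ m * (\<bar>C\<bar> * m ^ m)"]) auto
qed

lemma diffs_slice_fst: "diffs rs (\<lambda>t. G (t, a)) = (\<lambda>t. diffs (map (\<lambda>r. (r, 0)) rs) G (t, a))"
  by (induction rs) (auto simp: diff_def)

lemma diff_multiple: "diff (real n *\<^sub>R h) G z = (\<Sum>i<n. diff h G (z + real i *\<^sub>R h))"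
proof -
  have "(\<Sum>i<n. diff h G (z + real i *\<^sub>R h)) = (\<Sum>i<n. G (z + real (Suc i) *\<^sub>R h) - G (z + real i *\<^sub>R h))"
    by (simp add: diff_def algebra_simps)
  also have "\<dots> = G (z + real n *\<^sub>R h) - G (z + real 0 *\<^sub>R h)"
    by (rule sum_lessThan_telescope)
  finally show ?thesis by (simp add: diff_def)
qed

lemma diff_multiple_norm_le:
  assumes "\<And>i. i < n ==> norm (diff h G (z + real i *\<^sub>R h)) \<le> B"
  shows "norm (diff (real n *\<^sub>R h) G z) \<le> n * B"
proof -
  have "norm (\<Sum>i<n. diff h G (z + real i *\<^sub>R h)) \<le> (\<Sum>i<n. B)"
    by (rule sum_norm_le) (use assms in auto)
  then show ?thesis by (simp add: diff_multiple)
qed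

lemma diff_diff_multiple_norm_le:
  assumes "\<And>i l. i < n ==> l < n ==> norm (diff h (diff h G) (z + real i *\<^sub>R h + real l *\<^sub>R h)) \<le> B"
  shows "norm (diff (real n *\<^sub>R h) (diff (real n *\<^sub>R h) G) z) \<le> n * (n * B)"
proof (rule diff_multiple_norm_le)
  fix i assume i: "i < n"
  show "norm (diff h (diff (real n *\<^sub>R h) G) (z + real i *\<^sub>R h)) \<le> n * B"
    unfolding diff_commute[of h "real n *\<^sub>R h"]
    by (rule diff_multiple_norm_le) (use assms i in \<open>simp add: diff_commute\<close>)
qed

text \<open>Only finite differences of \<open>g\<close> are controlled, not joint derivatives.
  Splitting \<open>h\<close> into \<open>n\<close> steps of length \<open>r\<close> turns the second
  difference into \<open>n * n\<close> small ones, each of which, combined with \<open>j\<close>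
  differences in time, is at most \<open>C * r ^ (j + 2)\<close>. As \<open>n * r = h\<close>, the
  total is \<open>r ^ j * (C * h ^ 2)\<close>, and dividing by \<open>r ^ j\<close> bounds the
  derivative in time.\<close>

lemma diff_dirds_bound:
  fixes g :: "real \<times> real => real"
  assumes J: "open J" and t: "t \<in> J" "\<bar>t - t0\<bar> + 2 * h < \<delta>" and h: "h > 0"
    and E: "smooth_in J (\<lambda>t. diffs [(0, h), (0, h)] g (t, 0))"
    and C: "\<And>x hs r. norm (x - (t0, 0)) < \<delta> ==> length hs = j + 2 ==> (\<forall>v\<in>set hs. norm v \<le> r) ==> 0 \<le> r ==> r < \<delta> ==>
      \<bar>diffs hs g x\<bar> \<le> C * r ^ (j + 2)"
  shows "\<bar>dirds (replicate j 1) (\<lambda>t. diffs [(0, h), (0, h)] g (t, 0)) t\<bar> \<le> C * h ^ 2"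
proof (rule ccontr)
  define A where "A = dirds (replicate j 1) (\<lambda>t. diffs [(0, h), (0, h)] g (t, 0))"
  assume "\<not> ?thesis"
  then have gt: "C * h ^ 2 < \<bar>A t\<bar>" by (simp add: A_def)
  have "isCont A t"
    using smooth_in_continuous[OF smooth_in_dirds[OF E]] t(1) continuous_on_eq_continuous_at[OF J]
    unfolding A_def by blast
  then have lim: "((\<lambda>y. \<bar>A y\<bar>) \<longlongrightarrow> \<bar>A t\<bar>) (nhds t)"
    unfolding isCont_def tendsto_at_iff_tendsto_nhds by (rule tendsto_rabs)
  have "eventually (\<lambda>y. C * h ^ 2 < \<bar>A y\<bar> \<and> y \<in> J) (nhds t)"
    by (intro eventually_conj order_tendstoD(1)[OF lim gt] eventually_nhds_in_open J t(1))
  then obtain d where d: "d > 0" "\<And>y. dist y t < d ==> C * h ^ 2 < \<bar>A y\<bar>" "\<And>y. dist y t < d ==> y \<in> J"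
    unfolding eventually_nhds_metric by blast
  \<comment> \<open>So many steps are taken that \<open>j\<close> increments in time of length
    \<open>r\<close> stay where the supposed violation persists.\<close>
  obtain n where n: "real j * h / d < real n" using reals_Archimedean2 by blast
  have "0 \<le> real j * h / d" using h d by simp
  then have n0: "real n > 0" using n by linarith
  define r where "r = h / n"
  have r: "r > 0" "r \<le> h" "n * r = h" "j * r < d"
    using n n0 h d by (auto simp: r_def field_simps)
  have "cball t (sum_list (map norm (replicate j r))) \<subseteq> J"
  proof
    fix y assume "y \<in> cball t (sum_list (map norm (replicate j r)))"
    then have "dist y t < d" using r by (simp add: sum_list_replicate_real dist_commute)
    then show "y \<in> J" by (rule d(3))
  qed
  from diffs_mvt[OF J E this] obtain y where
    y: "dist t y \<le> j * r" "diffs (replicate j r) (\<lambda>t. diffs [(0, h), (0, h)] g (t, 0)) t =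
      dirds (replicate j r) (\<lambda>t. diffs [(0, h), (0, h)] g (t, 0)) y"
    using r by (auto simp: sum_list_replicate_real)
  have yt: "dist y t < d" using y(1) r by (simp add: dist_commute)
  have 1: "dirds (replicate j r) (\<lambda>t. diffs [(0, h), (0, h)] g (t, 0)) y = r ^ j * A y"
    using dirds_map_scale[OF J E d(3)[OF yt], of r "replicate j 1"] by (simp add: A_def map_replicate)
  have 2: "diffs (replicate j r) (\<lambda>t. diffs [(0, h), (0, h)] g (t, 0)) t =
      diff (real n *\<^sub>R (0, r)) (diff (real n *\<^sub>R (0, r)) (diffs (replicate j (r, 0)) g)) (t, 0)"
    unfolding diffs_slice_fst using r by (simp add: map_replicate diff_diffs)
  have 3: "norm (diff (real n *\<^sub>R (0, r)) (diff (real n *\<^sub>R (0, r)) (diffs (replicate j (r, 0)) g)) (t, 0))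
      \<le> n * (n * (C * r ^ (j + 2)))"
  proof (rule diff_diff_multiple_norm_le)
    fix i l assume il: "i < n" "l < n"
    have "real i * r \<le> n * r" "real l * r \<le> n * r" using il r by auto
    then have "\<bar>real i * r + real l * r\<bar> \<le> 2 * h" using r by simp
    then have "norm ((t, 0) + real i *\<^sub>R (0, r) + real l *\<^sub>R (0, r) - (t0, 0)) < \<delta>"
      using norm_Pair_le[of "t - t0" "real i * r + real l * r"] t(2) by simp
    then have "\<bar>diffs ((0, r) # (0, r) # replicate j (r, 0)) g ((t, 0) + real i *\<^sub>R (0, r) + real l *\<^sub>R (0, r))\<bar> \<le> C * r ^ (j + 2)"
      by (rule C) (use r t h in \<open>auto simp: norm_Pair\<close>)
    then show "norm (diff (0, r) (diff (0, r) (diffs (replicate j (r, 0)) g)) ((t, 0) + real i *\<^sub>R (0, r) + real l *\<^sub>R (0, r))) \<le> C * r ^ (j + 2)"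
      by simp
  qed
  have "\<bar>r ^ j * A y\<bar> \<le> n * (n * (C * r ^ (j + 2)))"
    using 3 unfolding 2[symmetric] y(2) 1 real_norm_def .
  also have "\<dots> = r ^ j * (C * (n * r) ^ 2)"
    by (simp add: power_add power2_eq_square)
  finally have "r ^ j * \<bar>A y\<bar> \<le> r ^ j * (C * h ^ 2)"
    unfolding r(3) using r(1) by (simp add: abs_mult)
  then have "\<bar>A y\<bar> \<le> C * h ^ 2" using r by simp
  then show False using d(2)[OF yt] by simp
qed

text \<open>Difference quotients with steps halved each time converge to the derivative, and
  consecutive ones differ by a second difference. Thus the derivative is one quotient plus a series
  of second differences.\<close>

lemma dyadic_telescope:
  fixes F :: "real => real"
  assumes F: "(F has_real_derivative F') (at 0)" and h0: "h0 > 0"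
  defines "h \<equiv> \<lambda>k. h0 * (1/2)^k"
  shows "(\<lambda>k. - (F (2 * h (Suc k)) - 2 * F (h (Suc k)) + F 0) / h k) sums (F' - (F (h 0) - F 0) / h 0)"
proof -
  define D where "D k = (F (h k) - F 0) / h k" for k
  have h: "h k > 0" "h k = 2 * h (Suc k)" for k using h0 by (auto simp: h_def)
  have "h \<longlonglongrightarrow> h0 * 0"
    unfolding h_def by (intro tendsto_mult tendsto_const LIMSEQ_power_zero) simp
  then have "filterlim h (at 0) sequentially"
    using h(1) by (auto simp: filterlim_at less_imp_neq[symmetric])
  moreover have "((\<lambda>y. (F y - F 0) / (y - 0)) \<longlongrightarrow> F') (at 0)"
    using F by (simp add: has_field_derivative_iff)
  ultimately have "D \<longlonglongrightarrow> F'"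
    unfolding D_def using filterlim_compose by fastforce
  then have "(\<lambda>n. D n - D 0) \<longlonglongrightarrow> F' - D 0" by (intro tendsto_intros)
  then have "(\<lambda>k. D (Suc k) - D k) sums (F' - D 0)"
    unfolding sums_def sum_lessThan_telescope .
  moreover have "- (F (2 * h (Suc k)) - 2 * F (h (Suc k)) + F 0) / h k = D (Suc k) - D k" for k
    using h[of "Suc k"] h(2)[of k] by (simp add: D_def field_simps)
  ultimately show ?thesis
    by (simp only: D_def[of 0, symmetric])
qed

lemma has_real_derivative_line:
  fixes f :: "'a::euclidean_space => real"
  assumes "open U" "curve_smooth U f" "x \<in> U"
  shows "((\<lambda>s. f (x + s *\<^sub>R v)) has_real_derivative dird v f x) (at 0)"
proof -
  define S where "S = (\<lambda>s. x + s *\<^sub>R v) -` U"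
  have "open S"
    unfolding S_def by (intro continuous_open_vimage[OF assms(1)] continuous_intros)
  moreover have "0 \<in> S" using assms(3) by (simp add: S_def)
  moreover have "smooth_in S (\<lambda>s. x + s *\<^sub>R v)"
    by (intro smooth_in_add smooth_in_scaleR smooth_in_const smooth_in_id \<open>open S\<close>)
  ultimately have "smooth_in S (\<lambda>s. f (x + s *\<^sub>R v))"
    by (intro curve_smooth_local[OF assms(2)]) (auto simp: S_def)
  from has_derivative_dird[OF smooth_in_differentiable[OF this \<open>0 \<in> S\<close>]]
  have "((\<lambda>s. f (x + s *\<^sub>R v)) has_vector_derivative dird 1 (\<lambda>s. f (x + s *\<^sub>R v)) 0) (at 0)"
    using has_vector_derivative_line[of "\<lambda>s. f (x + s *\<^sub>R v)" _ 0 0 1] by simp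
  then show ?thesis
    by (simp add: has_real_derivative_iff_has_vector_derivative dird_line)
qed

text \<open>Along a curve the derivative is one difference quotient plus the dyadic series of second
  differences. Its terms are smooth in time because \<open>f\<close> is smooth along curves. Second
  differences and their time derivatives are of the size of the squared step; divided by the step
  they are dominated by a geometric series, so the sum is smooth to every order.\<close>

lemma curve_smooth_dird:
  fixes f :: "'a::euclidean_space => real"
  assumes U: "open U" and f: "curve_smooth U f"
  shows "curve_smooth U (dird v f)"
  unfolding curve_smooth_def smooth_in_def
proof (intro allI impI)
  fix c :: "real => 'a" and p assume "(\<forall>k. smooth_upto k UNIV c) \<and> range c \<subseteq> U"
  then have c: "smooth_in UNIV c" "\<And>t. c t \<in> U" by (auto simp: smooth_in_def)
  \<comment> \<open>Time and displacement along \<open>v\<close> become two variables;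
    \<open>g\<close> is again smooth along curves, on the open set \<open>V\<close> of the
    plane.\<close>
  define g where "g z = f (c (fst z) + snd z *\<^sub>R v)" for z
  define V where "V = {z. c (fst z) + snd z *\<^sub>R v \<in> U}"
  have sc: "smooth_in S (\<lambda>s. c (fst (z s)) + snd (z s) *\<^sub>R v)" if "open S" "smooth_in S z"
    for z :: "'b::euclidean_space => real \<times> real" and S
    using that by (intro smooth_in_add smooth_in_scaleR smooth_in_fst smooth_in_snd smooth_in_const
        smooth_in_comp[OF _ _ c(1)]) auto
  have V: "open V"
    using open_vimage[OF U smooth_in_continuous[OF sc[OF open_UNIV smooth_in_id]]]
    by (simp add: V_def vimage_def)
  have g: "curve_smooth V g"
    unfolding curve_smooth_def
  proof (intro allI impI, elim conjE)
    fix z :: "real => real \<times> real" assume z: "smooth_in UNIV z" "range z \<subseteq> V"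
    have "smooth_in UNIV (\<lambda>s. f (c (fst (z s)) + snd (z s) *\<^sub>R v))"
      using f sc[OF open_UNIV z(1)] z(2) unfolding curve_smooth_def V_def by blast
    then show "smooth_in UNIV (\<lambda>s. g (z s))" by (simp add: g_def)
  qed
  show "smooth_upto p UNIV (\<lambda>t. dird v f (c t))"
  proof (rule smooth_upto_local)
    fix t0 :: real
    have t0V: "(t0, 0) \<in> V" using c(2) by (simp add: V_def)
    obtain \<delta>0 where \<delta>0: "\<delta>0 > 0" "ball (t0, 0) \<delta>0 \<subseteq> V" using V t0V open_contains_ball by blast
    have "\<forall>j. \<exists>\<delta> C. \<delta> > 0 \<and> C \<ge> 0 \<and> (\<forall>x hs r. norm (x - (t0, 0)) < \<delta> \<and> length hs = j + 2 \<and> (\<forall>v\<in>set hs. norm v \<le> r) \<and> 0 \<le> r \<and> r < \<delta> -->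
      \<bar>diffs hs g x\<bar> \<le> C * r ^ (j + 2))"
      using curve_smooth_diff_bound[OF V g t0V] by blast
    then obtain d C where dC: "\<And>j. d j > 0" "\<And>j. C j \<ge> 0"
      "\<And>j x hs r. norm (x - (t0, 0)) < d j ==> length hs = j + 2 ==> (\<forall>v\<in>set hs. norm v \<le> r) ==> 0 \<le> r ==> r < d j ==>
      \<bar>diffs hs g x\<bar> \<le> C j * r ^ (j + 2)"
      by metis
    \<comment> \<open>A common radius exists because for a fixed order \<open>p\<close> only
      differences in time up to order \<open>Suc p\<close> are needed.\<close>
    define \<delta> where "\<delta> = Min (insert \<delta>0 (d ` {..Suc p}))"
    have \<delta>: "\<delta> > 0" "\<delta> \<le> \<delta>0" "\<And>j. j \<le> Suc p ==> \<delta> \<le> d j"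
    proof -
      show "\<delta> > 0" unfolding \<delta>_def using \<delta>0 dC(1) by (subst Min_gr_iff) auto
      show "\<delta> \<le> \<delta>0" unfolding \<delta>_def by (rule Min_le) auto
      show "\<delta> \<le> d j" if "j \<le> Suc p" for j unfolding \<delta>_def by (rule Min_le) (use that in auto)
    qed
    \<comment> \<open>A fifth leaves room for times within \<open>h0\<close> of \<open>t0\<close>
      together with displacements up to \<open>2 * h0\<close>.\<close>
    define h0 where "h0 = \<delta> / 5"
    define h where "h k = h0 * (1/2)^k" for k
    have h0: "h0 > 0" using \<delta> by (simp add: h0_def)
    have h: "h k > 0" "h k \<le> h0" "h k = 2 * h (Suc k)" for k
      using h0 power_le_one[of "1/2::real" k] by (auto simp: h_def mult_left_le)
    define J where "J = ball t0 h0"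
    have J: "open J" "convex J" "t0 \<in> J" using h0 by (auto simp: J_def)
    have inV: "(t, s) \<in> V" if "t \<in> J" "\<bar>s\<bar> \<le> 2 * h0" for t s
    proof -
      have "norm ((t, s) - (t0, 0)) \<le> norm (t - t0) + norm s"
        using norm_Pair_le[of "t - t0" s] by simp
      also have "\<dots> < \<delta>"
      proof -
        have "norm (t - t0) < \<delta> / 5" unfolding dist_norm[symmetric] using that(1) by (simp add: J_def h0_def dist_commute)
        moreover have "norm s \<le> 2 * (\<delta> / 5)" using that(2) by (simp add: h0_def)
        ultimately show ?thesis using \<delta>(1) by linarith
      qed
      finally have "dist (t, s) (t0, 0) < \<delta>" by (simp only: dist_norm)
      then show ?thesis using \<delta>(2) by (intro subsetD[OF \<delta>0(2)]) (simp add: dist_commute)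
    qed
    have gs: "smooth_in J (\<lambda>t. g (t, s))" if "\<bar>s\<bar> \<le> 2 * h0" for s
      using inV that by (intro curve_smooth_local[OF g J(1)] smooth_in_Pair smooth_in_id smooth_in_const J(1)) auto
    define e where "e k t = diffs [(0, h k), (0, h k)] g (t, 0)" for k t
    have e_eq: "e k t = g (t, 2 * h k) - 2 * g (t, h k) + g (t, 0)" for k t
      by (simp add: e_def diff_def)
    have e: "smooth_in J (e k)" for k
    proof -
      have "smooth_in J (\<lambda>t. g (t, 2 * h k) - 2 * g (t, h k) + g (t, 0))"
        using h[of k] h0 by (intro smooth_in_add smooth_in_diff smooth_in_mult smooth_in_const gs J) auto
      then show ?thesis by (simp add: e_eq[abs_def])
    qed
    define u where "u k t = (- 1 / h k) *\<^sub>R e (Suc k) t" for k t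
    have u: "smooth_in J (u k)" for k
      unfolding u_def by (intro smooth_in_scaleR smooth_in_const J e)
    have M: "\<exists>M. summable M \<and> (\<forall>k. \<forall>t\<in>J. norm (dirds (replicate j 1) (u k) t) \<le> M k)" if j: "j \<le> Suc p" for j
    proof -
      have "norm (dirds (replicate j 1) (u k) t) \<le> (C j * h0) * (1/2)^k" if t: "t \<in> J" for k t
      proof -
        have "\<bar>dirds (replicate j 1) (e (Suc k)) t\<bar> \<le> C j * h (Suc k) ^ 2"
          unfolding e_def
        proof (rule diff_dirds_bound[OF J(1) t _ h(1)])
          show "smooth_in J (\<lambda>t. diffs [(0, h (Suc k)), (0, h (Suc k))] g (t, 0))"
            using e[of "Suc k"] unfolding e_def .
          show "\<bar>t - t0\<bar> + 2 * h (Suc k) < \<delta>"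
          proof -
            have "norm (t - t0) < \<delta> / 5" unfolding dist_norm[symmetric] using t by (simp add: J_def h0_def dist_commute)
            then show ?thesis using h(2)[of "Suc k"] \<delta>(1) unfolding h0_def real_norm_def by linarith
          qed
          show "\<bar>diffs hs g x\<bar> \<le> C j * r ^ (j + 2)"
            if "norm (x - (t0, 0)) < \<delta>" "length hs = j + 2" "\<forall>v\<in>set hs. norm v \<le> r" "0 \<le> r" "r < \<delta>" for x hs r
            by (rule dC(3)) (use that \<delta>(3)[OF j] in auto)
        qed
        then have "(1 / h k) * \<bar>dirds (replicate j 1) (e (Suc k)) t\<bar> \<le> (1 / h k) * (C j * h (Suc k) ^ 2)"
          using h(1)[of k] by (intro mult_left_mono) auto
        also have "\<dots> = C j * h k / 4"
          using h(1)[of "Suc k"] h(3)[of k] by (simp add: power2_eq_square field_simps)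
        also have "\<dots> \<le> C j * h k" using dC(2)[of j] h(1)[of k] by simp
        finally show ?thesis
          unfolding u_def dirds_scaleR[OF J(1) e t] using h(1)[of k] by (simp add: h_def)
      qed
      moreover have "summable (\<lambda>k. (C j * h0) * (1/2)^k)"
        by (intro summable_mult summable_geometric) simp
      ultimately show ?thesis by blast
    qed
    define D0 where "D0 t = (1 / h 0) *\<^sub>R (g (t, h 0) - g (t, 0))" for t
    have D0: "smooth_in J D0"
      unfolding D0_def using h[of 0] h0 by (intro smooth_in_scaleR smooth_in_diff smooth_in_const gs J) auto
    have "smooth_upto p J (\<lambda>t. D0 t + (\<Sum>k. u k t))"
      using D0 smooth_upto_suminf[OF J(1,2) u M] unfolding smooth_in_def
      by (intro smooth_upto_add J) auto
    then have "smooth_upto p J (\<lambda>t. dird v f (c t))"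
    proof (rule smooth_upto_cong[OF J(1), rotated])
      fix t assume t: "t \<in> J"
      have "((\<lambda>s. g (t, s)) has_real_derivative dird v f (c t)) (at 0)"
        using has_real_derivative_line[OF U f c(2), of t v] by (simp add: g_def)
      from dyadic_telescope[OF this h0]
      have "(\<lambda>k. u k t) sums (dird v f (c t) - D0 t)"
        unfolding u_def e_eq D0_def h_def real_scaleR_def times_divide_eq_left mult_minus1 mult_1_left .
      from sums_unique[OF this] show "D0 t + (\<Sum>k. u k t) = dird v f (c t)"
        by linarith
    qed
    then show "\<exists>V. open V \<and> t0 \<in> V \<and> smooth_upto p V (\<lambda>t. dird v f (c t))"
      using J by blast
  qed
qed

text \<open>Second differences are quadratically small. For mixed ones this forces the directional
  derivative to be additive in the direction; for pure ones, summed over the dyadic series, it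
  bounds the remainder of the linear approximation uniformly in the direction.\<close>

lemma curve_smooth_differentiable:
  fixes f :: "'a::euclidean_space => real"
  assumes U: "open U" and f: "curve_smooth U f" and x: "x \<in> U"
  shows "f differentiable (at x)"
proof -
  let ?L = "\<lambda>v. dird v f x"
  note der = has_real_derivative_line[OF U f x]
  obtain \<delta> C where \<delta>: "\<delta> > 0" and C0: "C \<ge> 0" and C: "\<And>y hs r. norm (y - x) < \<delta> ==> length hs = 2 ==> (\<forall>h\<in>set hs. norm h \<le> r) ==> 0 \<le> r ==> r < \<delta> ==>
    \<bar>diffs hs f y\<bar> \<le> C * r ^ 2"
    using curve_smooth_diff_bound[OF U f x, of 2] by blast
  have scale: "?L (a *\<^sub>R v) = a * ?L v" for a v
  proof -
    have "((\<lambda>s. f (x + (a * s) *\<^sub>R v)) has_real_derivative (?L v * a)) (at 0)"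
      using DERIV_chain'[of "\<lambda>s. a * s" a 0 UNIV "\<lambda>s. f (x + s *\<^sub>R v)" "?L v"] der[of v]
      by (auto intro!: derivative_eq_intros)
    then have "((\<lambda>s. f (x + s *\<^sub>R (a *\<^sub>R v))) has_real_derivative (?L v * a)) (at 0)"
      by (simp add: mult.commute)
    from DERIV_unique[OF der this] show ?thesis by simp
  qed
  have add: "?L (v + w) = ?L v + ?L w" for v w
  proof (rule ccontr)
    define r where "r = norm v + norm w + 1"
    have r: "r > 0" "norm v \<le> r" "norm w \<le> r" by (auto simp: r_def add_nonneg_pos)
    let ?F = "\<lambda>s. f (x + s *\<^sub>R (v + w)) - f (x + s *\<^sub>R v) - f (x + s *\<^sub>R w) + f x"
    assume "?L (v + w) \<noteq> ?L v + ?L w"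
    moreover have "(?F has_real_derivative (?L (v + w) - ?L v - ?L w + 0)) (at 0)"
      by (intro DERIV_add DERIV_diff der DERIV_const)
    then have "((\<lambda>h. ?F h / h) \<longlongrightarrow> ?L (v + w) - ?L v - ?L w) (at 0)"
      by (simp add: has_field_derivative_iff)
    moreover have "((\<lambda>h. ?F h / h) \<longlongrightarrow> 0) (at 0)"
    proof (rule Lim_null_comparison)
      have "((\<lambda>h. C * r ^ 2 * \<bar>h\<bar>) \<longlongrightarrow> C * r ^ 2 * \<bar>0\<bar>) (at 0)" by (intro tendsto_intros)
      then show "((\<lambda>h. C * r ^ 2 * \<bar>h\<bar>) \<longlongrightarrow> 0) (at 0)" by simp
      have "norm (?F h / h) \<le> C * r ^ 2 * \<bar>h\<bar>" if "h \<noteq> 0" "\<bar>h\<bar> < \<delta> / r" for h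
      proof -
        have "\<bar>diffs [h *\<^sub>R v, h *\<^sub>R w] f x\<bar> \<le> C * (\<bar>h\<bar> * r) ^ 2"
          by (rule C) (use \<delta> r that in \<open>auto simp: field_simps intro!: mult_left_mono\<close>)
        moreover have "diffs [h *\<^sub>R v, h *\<^sub>R w] f x = ?F h"
          by (simp add: diff_def algebra_simps)
        ultimately have "\<bar>?F h\<bar> \<le> C * r ^ 2 * \<bar>h\<bar> * \<bar>h\<bar>"
          by (simp add: power2_eq_square mult_ac)
        then show ?thesis using that(1) by (simp add: divide_le_eq)
      qed
      moreover have "eventually (\<lambda>h. h \<noteq> 0 \<and> \<bar>h\<bar> < \<delta> / r) (at (0::real))"
        unfolding eventually_at using \<delta> r by (intro exI[of _ "\<delta> / r"]) auto
      ultimately show "\<forall>\<^sub>F h in at 0. norm (?F h / h) \<le> C * r ^ 2 * \<bar>h\<bar>"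
        by (auto elim: eventually_mono)
    qed
    ultimately show False using tendsto_unique[OF at_neq_bot] by fastforce
  qed
  have lin: "linear ?L" by (rule linearI) (auto simp: add scale)
  have rem: "\<bar>f (x + v) - f x - ?L v\<bar> \<le> C * norm v ^ 2" if v: "norm v < \<delta> / 2" for v
  proof -
    \<comment> \<open>The dyadic series with initial step 1, so that the first quotient is the
      increment along \<open>v\<close> itself.\<close>
    have s: "(\<lambda>k. - (f (x + (2 * (1/2)^Suc k) *\<^sub>R v) - 2 * f (x + ((1/2)^Suc k) *\<^sub>R v) + f x) / (1/2)^k) sums (?L v - (f (x + v) - f x))"
      using dyadic_telescope[OF der[of v], of 1] by simp
    have g: "(\<lambda>k. (C * norm v ^ 2) * ((1/2) ^ Suc k)) sums ((C * norm v ^ 2) * 1)"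
      by (intro sums_mult power_half_series)
    have b: "norm (- (f (x + (2 * (1/2)^Suc k) *\<^sub>R v) - 2 * f (x + ((1/2)^Suc k) *\<^sub>R v) + f x) / (1/2)^k) \<le> (C * norm v ^ 2) * ((1/2) ^ Suc k)" for k
    proof -
      define h :: real where "h = (1/2)^Suc k"
      have h: "h > 0" "h \<le> 1" "(1/2)^k = 2 * h"
        using power_le_one[of "1/2::real" "Suc k"] unfolding h_def by auto
      have "h * norm v \<le> norm v" using h by (simp add: mult_left_le_one_le)
      then have "\<bar>diffs [h *\<^sub>R v, h *\<^sub>R v] f x\<bar> \<le> C * (h * norm v) ^ 2"
        by (intro C) (use \<delta> v h in \<open>auto simp: field_simps\<close>)
      moreover have "diffs [h *\<^sub>R v, h *\<^sub>R v] f x = f (x + (2 * h) *\<^sub>R v) - 2 * f (x + h *\<^sub>R v) + f x"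
        by (simp add: diff_def algebra_simps flip: scaleR_left.add)
      ultimately have "\<bar>f (x + (2 * h) *\<^sub>R v) - 2 * f (x + h *\<^sub>R v) + f x\<bar> / (2 * h) \<le> C * (h * norm v) ^ 2 / (2 * h)"
        using h by (intro divide_right_mono) auto
      also have "\<dots> = (C * norm v ^ 2) * h / 2"
        using h by (simp add: power2_eq_square)
      also have "\<dots> \<le> (C * norm v ^ 2) * h" using C0 h by simp
      finally show ?thesis
        unfolding h_def[symmetric] h(3) real_norm_def abs_divide abs_minus_cancel using h by simp
    qed
    have "norm (?L v - (f (x + v) - f x)) \<le> C * norm v ^ 2"
      using norm_suminf_le[OF b sums_summable[OF g]] sums_unique[OF s] sums_unique[OF g] by simp
    then show ?thesis by (simp add: abs_minus_commute)
  qed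
  have "(f has_derivative ?L) (at x)"
    unfolding has_derivative_at
  proof (intro conjI)
    show "bounded_linear ?L" using lin linear_conv_bounded_linear by blast
    show "((\<lambda>h. norm (f (x + h) - f x - ?L h) / norm h) \<longlongrightarrow> 0) (at 0)"
    proof (rule Lim_null_comparison)
      have "((\<lambda>h::'a. C * norm h) \<longlongrightarrow> C * norm (0::'a)) (at 0)" by (intro tendsto_intros)
      then show "((\<lambda>h::'a. C * norm h) \<longlongrightarrow> 0) (at 0)" by simp
      have "norm (norm (f (x + h) - f x - ?L h) / norm h) \<le> C * norm h" if "h \<noteq> 0" "norm h < \<delta> / 2" for h
        using rem[OF that(2)] that(1) by (simp add: divide_le_eq power2_eq_square mult.assoc)
      moreover have "eventually (\<lambda>h::'a. h \<noteq> 0 \<and> norm h < \<delta> / 2) (at 0)"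
        unfolding eventually_at using \<delta> by (intro exI[of _ "\<delta> / 2"]) auto
      ultimately show "\<forall>\<^sub>F h in at 0. norm (norm (f (x + h) - f x - ?L h) / norm h) \<le> C * norm h"
        by (auto elim: eventually_mono)
    qed
  qed
  then show ?thesis by (auto simp: differentiable_def)
qed

text \<open>Smoothness along curves implies differentiability and is inherited by directional
  derivatives, so \<open>smooth_in_coinduct\<close> applies to the class of real functions with this
  property.\<close>

lemma curve_smooth_imp_smooth_in:
  fixes f :: "'a::euclidean_space => 'b::euclidean_space"
  assumes U: "open U" and f: "curve_smooth U f"
  shows "smooth_in U f"
proof (rule smooth_in_componentwise[OF U])
  fix b :: 'b assume "b \<in> Basis"
  have "curve_smooth U (\<lambda>x. f x \<bullet> b)"
    unfolding curve_smooth_def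
  proof (intro allI impI)
    fix c :: "real => 'a" assume "smooth_in UNIV c \<and> range c \<subseteq> U"
    then have "smooth_in UNIV (\<lambda>t. f (c t))"
      using f unfolding curve_smooth_def by blast
    then show "smooth_in UNIV (\<lambda>t. f (c t) \<bullet> b)"
      by (rule smooth_in_inner[OF open_UNIV _ smooth_in_const])
  qed
  then show "smooth_in U (\<lambda>x. f x \<bullet> b)"
  proof (rule smooth_in_coinduct[where P="curve_smooth U"])
    show "h differentiable (at x)" if "curve_smooth U h" "x \<in> U" for h :: "'a => real" and x
      using curve_smooth_differentiable[OF U that] .
    show "smooth_upto k U (dird v h)" if "curve_smooth U h" "\<And>g :: 'a => real. curve_smooth U g ==> smooth_upto k U g" for h :: "'a => real" and v k
      using that(2)[OF curve_smooth_dird[OF U that(1)]] .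
  qed
qed

section \<open>Test functions\<close>

abbreviation axes :: "'n::finite list => (real^'n) list" where
  "axes is \<equiv> map (\<lambda>i. axis i 1) is"

lemma Basis_eq_axis: "(Basis :: (real^'n) set) = range (\<lambda>i. axis i 1)"
  by (auto simp: Basis_vec_def)

lemma axes_Basis: "set (axes is) \<subseteq> Basis"
  by (auto simp: Basis_eq_axis)

lemma Basis_list_axes:
  assumes "set bs \<subseteq> (Basis :: (real^'n) set)"
  obtains "is" where "bs = axes is"
  using assms unfolding Basis_eq_axis by (metis (no_types, lifting) ex_map_conv image_iff subsetD)

lemma smooth_upto_partials:
  fixes f :: "real^'n::finite => 'b::euclidean_space"
  assumes "\<And>is. foldr partial is f differentiable_on UNIV"
  shows "smooth_upto k UNIV f"
  using assms
proof (induction k arbitrary: f)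
  case 0
  from 0[of "[]"] show ?case by (simp add: differentiable_imp_continuous_on)
next
  case (Suc k)
  have d: "f differentiable (at x)" for x
    using Suc.prems[of "[]"] by (simp add: differentiable_on_def)
  have "smooth_upto k UNIV (dird b f)" if b: "b \<in> Basis" for b
  proof -
    obtain i where i: "b = axis i 1" using b by (auto simp: Basis_eq_axis)
    show ?thesis
    proof (rule Suc.IH)
      show "foldr partial is (dird b f) differentiable_on UNIV" for "is"
        using Suc.prems[of "is @ [i]"] by (simp add: i flip: partial_eq_dird)
    qed
  qed
  then have "smooth_upto k UNIV (\<lambda>x. \<Sum>b\<in>Basis. (v \<bullet> b) *\<^sub>R dird b f x)" for v
    by (intro smooth_upto_sum smooth_upto_bilinear[OF _ bounded_bilinear_scaleR] smooth_upto_const open_UNIV)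
  moreover have "(\<lambda>x. \<Sum>b\<in>Basis. (v \<bullet> b) *\<^sub>R dird b f x) = dird v f" for v
    using dird_lincomb[OF d, of "\<lambda>b. v \<bullet> b" Basis] by (auto simp: euclidean_representation)
  ultimately show ?case using d by simp
qed

lemma smooth_fun_iff:
  fixes f :: "real^'n::finite => 'b::euclidean_space"
  shows "smooth_fun f \<longleftrightarrow> smooth_in UNIV f"
proof
  assume "smooth_fun f"
  then show "smooth_in UNIV f"
    unfolding smooth_in_def smooth_fun_def using smooth_upto_partials by blast
next
  assume "smooth_in UNIV f"
  then show "smooth_fun f"
    unfolding smooth_fun_def foldr_partial_eq_dirds differentiable_on_def
    using smooth_in_differentiable[OF smooth_in_dirds] by blast
qed

lemma mderiv_eq_dirds: "mderiv \<alpha> f = dirds (axes (mi_list \<alpha>)) f"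
  by (simp add: mderiv_def foldr_partial_eq_dirds)

lemma length_mi_list: "length (mi_list \<alpha>) = mi_deg \<alpha>"
  using sum_count_set[of "mi_list \<alpha>" UNIV] by (simp add: mi_deg_def count_list_mi_list)

lemma mi_deg_count_list: "mi_deg (count_list is) = length is"
  using sum_count_set[of "is" UNIV] by (simp add: mi_deg_def)

lemma mset_mi_list_count_list: "mset (mi_list (count_list is)) = mset is"
  by (rule multiset_eqI) (simp add: count_mset count_list_mi_list)

text \<open>\<open>mi_list\<close> fixes the order of the derivatives by choice only; symmetry makes
  every list with the same multiplicities equivalent.\<close>

lemma mderiv_count_list:
  assumes "open U" "smooth_in U f" "x \<in> U"
  shows "mderiv (count_list is) f x = dirds (axes is) f x"
  unfolding mderiv_eq_dirds by (rule dirds_perm[OF assms]) (simp add: mset_mi_list_count_list mset_map)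

lemma mi_list_zero: "mi_list (\<lambda>_. 0) = []"
  using length_mi_list[of "\<lambda>_. 0"] by (simp add: mi_deg_def)

lemma mderiv_zero: "mderiv (\<lambda>_. 0) f = f"
  by (simp add: mderiv_eq_dirds mi_list_zero)

lemma supp_outside: "x \<notin> supp \<phi> ==> \<phi> x = 0"
  using closure_subset[of "{x. \<phi> x \<noteq> 0}"] by (auto simp: supp_def)

lemma supp_subsetI: "closed K ==> (\<And>x. x \<notin> K ==> \<phi> x = 0) ==> supp \<phi> \<subseteq> K"
  unfolding supp_def by (rule closure_minimal) auto

lemma supp_cball_iff: "supp \<phi> \<subseteq> cball 0 r \<longleftrightarrow> (\<forall>x. norm x > r --> \<phi> x = 0)"
proof
  show "supp \<phi> \<subseteq> cball 0 r ==> \<forall>x. r < norm x --> \<phi> x = 0"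
    using supp_outside by fastforce
  show "\<forall>x. r < norm x --> \<phi> x = 0 ==> supp \<phi> \<subseteq> cball 0 r"
    by (rule supp_subsetI) auto
qed

lemma test_funsI:
  assumes "smooth_in UNIV \<phi>" "compact K" "K \<subseteq> \<Omega>" "\<And>x. x \<notin> K ==> \<phi> x = 0"
  shows "\<phi> \<in> test_funs \<Omega>" "supp \<phi> \<subseteq> K"
proof -
  show s: "supp \<phi> \<subseteq> K" using assms by (intro supp_subsetI compact_imp_closed) auto
  have "compact (supp \<phi>)"
    using compact_Int_closed[OF assms(2), of "supp \<phi>"] s by (simp add: supp_def Int_absorb1)
  then show "\<phi> \<in> test_funs \<Omega>" using s assms by (auto simp: test_funs_def smooth_fun_iff)
qed

lemma test_funsD:
  assumes "\<phi> \<in> test_funs \<Omega>"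
  shows "smooth_in UNIV \<phi>" "compact (supp \<phi>)" "supp \<phi> \<subseteq> \<Omega>"
  using assms by (auto simp: test_funs_def smooth_fun_iff)

lemma test_funs_bounded:
  assumes "\<phi> \<in> test_funs \<Omega>"
  obtains r where "\<And>x. norm x > r ==> \<phi> x = 0"
proof -
  obtain r where "\<forall>x\<in>supp \<phi>. norm x \<le> r"
    using compact_imp_bounded[OF test_funsD(2)[OF assms]] unfolding bounded_iff by blast
  then have "supp \<phi> \<subseteq> cball 0 r" by auto
  then have "\<forall>x. norm x > r --> \<phi> x = 0" by (simp only: supp_cball_iff)
  then show ?thesis using that by blast
qed

lemma test_funs_UNIV: "\<phi> \<in> test_funs \<Omega> ==> \<phi> \<in> test_funs UNIV"
  by (simp add: test_funs_def)

lemma test_funs_lincomb: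
  fixes \<phi> \<psi> :: "'n::finite tfun"
  assumes "\<phi> \<in> test_funs \<Omega>" "\<psi> \<in> test_funs \<Omega>"
  shows "(\<lambda>x. c * \<phi> x + d * \<psi> x) \<in> test_funs \<Omega>"
proof (rule test_funsI(1))
  show "smooth_in UNIV (\<lambda>x. c * \<phi> x + d * \<psi> x)"
    by (intro smooth_in_add smooth_in_mult smooth_in_const test_funsD(1)[OF assms(1)] test_funsD(1)[OF assms(2)] open_UNIV)
  show "compact (supp \<phi> \<union> supp \<psi>)" "supp \<phi> \<union> supp \<psi> \<subseteq> \<Omega>"
    using test_funsD[OF assms(1)] test_funsD[OF assms(2)] by (auto intro: compact_Un)
  show "c * \<phi> x + d * \<psi> x = 0" if "x \<notin> supp \<phi> \<union> supp \<psi>" for x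
    using that supp_outside[of x \<phi>] supp_outside[of x \<psi>] by simp
qed

lemma test_funs_scale: "\<phi> \<in> test_funs \<Omega> ==> (\<lambda>x. c * \<phi> x) \<in> test_funs \<Omega>"
  using test_funs_lincomb[of \<phi> \<Omega> \<phi> c 0] by simp

lemma test_funs_add: "\<phi> \<in> test_funs \<Omega> ==> \<psi> \<in> test_funs \<Omega> ==> (\<lambda>x. \<phi> x + \<psi> x) \<in> test_funs \<Omega>"
  using test_funs_lincomb[of \<phi> \<Omega> \<psi> 1 1] by simp

lemma test_funs_diff: "\<phi> \<in> test_funs \<Omega> ==> \<psi> \<in> test_funs \<Omega> ==> (\<lambda>x. \<phi> x - \<psi> x) \<in> test_funs \<Omega>"
  using test_funs_lincomb[of \<phi> \<Omega> \<psi> 1 "-1"] by simp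

lemma Cm_norm_le:
  assumes "\<And>is x. length is \<le> m ==> norm (dirds (axes is) \<phi> x) \<le> M"
  shows "Cm_norm m \<phi> \<le> M"
  unfolding Cm_norm_def
proof (rule cSup_least)
  have "mi_deg (\<lambda>_::'a. 0) \<le> m" by (simp add: mi_deg_def)
  then show "{norm (mderiv \<alpha> \<phi> x) |\<alpha> x. mi_deg \<alpha> \<le> m} \<noteq> {}" by blast
  show "z \<le> M" if "z \<in> {norm (mderiv \<alpha> \<phi> x) |\<alpha> x. mi_deg \<alpha> \<le> m}" for z
    using that assms by (auto simp: mderiv_eq_dirds length_mi_list[symmetric])
qed

text \<open>A supremum bounds its members only if these are bounded above, which compact support
  guarantees.\<close>

lemma Cm_norm_ge:
  assumes \<phi>: "\<phi> \<in> test_funs \<Omega>" and l: "length is \<le> m"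
  shows "norm (dirds (axes is) \<phi> x) \<le> Cm_norm m \<phi>"
proof -
  obtain r where r: "\<And>x. norm x > r ==> \<phi> x = 0" using test_funs_bounded[OF \<phi>] by blast
  have "\<exists>M. \<forall>i\<in>{()}. \<forall>x\<in>UNIV. norm (dirds vs \<phi> x) \<le> M" for vs
    using dirds_compact_support_bounded[OF test_funsD(1)[OF \<phi>] r] by blast
  from ex_dbound[of m "{()}" "\<lambda>_. UNIV" "\<lambda>_. \<phi>", OF this]
  obtain M where M: "dbound m UNIV \<phi> M" by blast
  have "norm (dirds (axes is) \<phi> x) = norm (mderiv (count_list is) \<phi> x)"
    using mderiv_count_list[OF open_UNIV test_funsD(1)[OF \<phi>]] by simp
  also have "\<dots> \<le> Cm_norm m \<phi>"
    unfolding Cm_norm_def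
  proof (rule cSup_upper)
    show "norm (mderiv (count_list is) \<phi> x) \<in> {norm (mderiv \<alpha> \<phi> x) |\<alpha> x. mi_deg \<alpha> \<le> m}"
      using l mi_deg_count_list[of "is"] by auto
    show "bdd_above {norm (mderiv \<alpha> \<phi> x) |\<alpha> x. mi_deg \<alpha> \<le> m}"
    proof (rule bdd_aboveI)
      fix z assume "z \<in> {norm (mderiv \<alpha> \<phi> x) |\<alpha> x. mi_deg \<alpha> \<le> m}"
      then obtain \<alpha> x where "z = norm (dirds (axes (mi_list \<alpha>)) \<phi> x)" "length (mi_list \<alpha>) \<le> m"
        by (auto simp: mderiv_eq_dirds length_mi_list)
      then show "z \<le> M" using dboundD[OF M axes_Basis, of "mi_list \<alpha>" x] by simp
    qed
  qed
  finally show ?thesis .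
qed

lemma Cm_norm_ge_Basis:
  assumes "\<phi> \<in> test_funs \<Omega>" "set bs \<subseteq> Basis" "length bs \<le> m"
  shows "norm (dirds bs \<phi> x) \<le> Cm_norm m \<phi>"
proof -
  obtain "is" where "bs = axes is" using Basis_list_axes[OF assms(2)] by blast
  then show ?thesis using Cm_norm_ge[OF assms(1), of "is" m x] assms(3) by simp
qed

lemma Cm_norm_ge_0: "\<phi> \<in> test_funs \<Omega> ==> norm (\<phi> x) \<le> Cm_norm m \<phi>"
  using Cm_norm_ge[of \<phi> \<Omega> "[]" m x] by simp

lemma Cm_norm_nonneg: "\<phi> \<in> test_funs \<Omega> ==> 0 \<le> Cm_norm m \<phi>"
  using Cm_norm_ge_0 norm_ge_zero order_trans by blast

lemma Cm_norm_scale_le: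
  assumes "\<phi> \<in> test_funs \<Omega>"
  shows "Cm_norm m (\<lambda>x. c * \<phi> x) \<le> norm c * Cm_norm m \<phi>"
proof (rule Cm_norm_le)
  fix "is" :: "'a list" and x assume "length is \<le> m"
  then show "norm (dirds (axes is) (\<lambda>x. c * \<phi> x) x) \<le> norm c * Cm_norm m \<phi>"
    using Cm_norm_ge[OF assms, of "is" m x]
    by (simp add: dirds_linear_comp[OF open_UNIV test_funsD(1)[OF assms] bounded_linear_mult_right UNIV_I]
        norm_mult mult_left_mono)
qed

lemma cont_seminorm_Cm_norm: "cont_seminorm \<Omega> (Cm_norm m)"
  unfolding cont_seminorm_def
proof (intro conjI ballI allI impI)
  show "0 \<le> Cm_norm m \<phi>" if "\<phi> \<in> test_funs \<Omega>" for \<phi> using Cm_norm_nonneg[OF that] .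
  show "Cm_norm m (\<lambda>x. c * \<phi> x) = norm c * Cm_norm m \<phi>" if \<phi>: "\<phi> \<in> test_funs \<Omega>" for \<phi> c
  proof (cases "c = 0")
    case True
    then show ?thesis
      using Cm_norm_scale_le[OF \<phi>, of m c] Cm_norm_nonneg[OF test_funs_scale[OF \<phi>, of c], of m] by simp
  next
    case False
    \<comment> \<open>The reverse inequality is the scaling bound for the factor
      \<open>inverse c\<close>.\<close>
    have "Cm_norm m (\<lambda>x. inverse c * (c * \<phi> x)) \<le> norm (inverse c) * Cm_norm m (\<lambda>x. c * \<phi> x)"
      by (rule Cm_norm_scale_le[OF test_funs_scale[OF \<phi>]])
    moreover have "(\<lambda>x. inverse c * (c * \<phi> x)) = \<phi>" using False by (auto simp: mult.assoc[symmetric])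
    ultimately have "Cm_norm m \<phi> \<le> norm (inverse c) * Cm_norm m (\<lambda>x. c * \<phi> x)"
      by (simp only:)
    then have "norm c * Cm_norm m \<phi> \<le> norm c * (norm (inverse c) * Cm_norm m (\<lambda>x. c * \<phi> x))"
      by (rule mult_left_mono) simp
    then have "norm c * Cm_norm m \<phi> \<le> Cm_norm m (\<lambda>x. c * \<phi> x)"
      using False by (simp add: mult.assoc[symmetric] norm_mult[symmetric])
    then show ?thesis using Cm_norm_scale_le[OF \<phi>, of m c] by simp
  qed
  show "Cm_norm m (\<lambda>x. \<phi> x + \<psi> x) \<le> Cm_norm m \<phi> + Cm_norm m \<psi>"
    if \<phi>: "\<phi> \<in> test_funs \<Omega>" and \<psi>: "\<psi> \<in> test_funs \<Omega>" for \<phi> \<psi>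
  proof (rule Cm_norm_le)
    fix "is" :: "'a list" and x assume l: "length is \<le> m"
    show "norm (dirds (axes is) (\<lambda>x. \<phi> x + \<psi> x) x) \<le> Cm_norm m \<phi> + Cm_norm m \<psi>"
      unfolding dirds_add[OF open_UNIV test_funsD(1)[OF \<phi>] test_funsD(1)[OF \<psi>] UNIV_I]
      by (rule norm_triangle_mono[OF Cm_norm_ge[OF \<phi> l] Cm_norm_ge[OF \<psi> l]])
  qed
  show "\<exists>C l. \<forall>\<phi>\<in>test_funs \<Omega>. supp \<phi> \<subseteq> K --> Cm_norm m \<phi> \<le> C * Cm_norm l \<phi>" for K
    by (intro exI[of _ 1] exI[of _ m]) simp
qed

lemma cont_seminormD:
  assumes "cont_seminorm \<Omega> p" "compact K" "K \<subseteq> \<Omega>"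
  shows "\<exists>C m. \<forall>\<phi>\<in>test_funs \<Omega>. supp \<phi> \<subseteq> K --> p \<phi> \<le> C * Cm_norm m \<phi>"
  using assms by (simp add: cont_seminorm_def)

lemma cont_seminorm_nonneg: "cont_seminorm \<Omega> p ==> \<phi> \<in> test_funs \<Omega> ==> 0 \<le> p \<phi>"
  by (simp add: cont_seminorm_def)

lemma tf_boundedD: "tf_bounded \<Omega> B ==> cont_seminorm \<Omega> p ==> \<exists>M. \<forall>\<phi>\<in>B. p \<phi> \<le> M"
  by (simp add: tf_bounded_def)

lemma tf_tendstoD:
  "tf_tendsto \<Omega> f l F ==> cont_seminorm \<Omega> p ==> ((\<lambda>h. p (\<lambda>y. f h y - l y)) \<longlongrightarrow> 0) F"
  by (simp add: tf_tendsto_def)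

section \<open>Supports of bounded sets and of differentiable curves\<close>

definition point_seminorm :: "(nat => real) => (nat => real^'n::finite) => 'n tfun => real" where
  "point_seminorm a y \<phi> = (\<Sum>k. a k * norm (\<phi> (y k)))"

lemma point_seminorm_finite:
  assumes y: "\<And>k. norm (y k) \<ge> real k" and \<phi>: "\<phi> \<in> test_funs \<Omega>"
  shows "finite {k. \<phi> (y k) \<noteq> 0}" "summable (\<lambda>k. a k * norm (\<phi> (y k)))"
proof -
  obtain r where r: "\<And>x. norm x > r ==> \<phi> x = 0" using test_funs_bounded[OF \<phi>] by blast
  have "{k. \<phi> (y k) \<noteq> 0} \<subseteq> {k. real k \<le> r}"
    using r y by (metis (mono_tags, lifting) Collect_mono not_le order_trans)
  moreover have "finite {k. real k \<le> r}"
    by (rule finite_subset[of _ "{..nat \<lfloor>r\<rfloor>}"]) (auto simp: le_nat_iff le_floor_iff intro: order_trans)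
  ultimately show f: "finite {k. \<phi> (y k) \<noteq> 0}" by (rule finite_subset)
  show "summable (\<lambda>k. a k * norm (\<phi> (y k)))" by (rule summable_finite[OF f]) auto
qed

lemma point_seminorm_ge:
  assumes "\<And>k. norm (y k) \<ge> real k" "\<And>k. a k \<ge> 0" "\<phi> \<in> test_funs \<Omega>"
  shows "a k * norm (\<phi> (y k)) \<le> point_seminorm a y \<phi>"
  using sum_le_suminf[OF point_seminorm_finite(2)[OF assms(1,3)], of "{k}" a] assms(2)
  unfolding point_seminorm_def by simp

text \<open>The points escape to infinity, so on functions supported in a given compact set the
  series is a finite sum, whatever the weights. Arbitrarily large weights are therefore allowed in a
  continuous seminorm.\<close>

lemma cont_seminorm_point_seminorm:
  assumes y: "\<And>k. norm (y k) \<ge> real k" and a: "\<And>k. a k \<ge> 0"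
  shows "cont_seminorm \<Omega> (point_seminorm a y)"
  unfolding cont_seminorm_def
proof (intro conjI ballI allI impI)
  note s = point_seminorm_finite(2)[OF y]
  show "0 \<le> point_seminorm a y \<phi>" if "\<phi> \<in> test_funs \<Omega>" for \<phi>
    unfolding point_seminorm_def using s[OF that] a by (intro suminf_nonneg) auto
  show "point_seminorm a y (\<lambda>x. c * \<phi> x) = norm c * point_seminorm a y \<phi>" if "\<phi> \<in> test_funs \<Omega>" for \<phi> c
    unfolding point_seminorm_def using suminf_mult[OF s[OF that, of a], of "norm c"]
    by (simp add: norm_mult mult_ac)
  show "point_seminorm a y (\<lambda>x. \<phi> x + \<psi> x) \<le> point_seminorm a y \<phi> + point_seminorm a y \<psi>"
    if \<phi>: "\<phi> \<in> test_funs \<Omega>" and \<psi>: "\<psi> \<in> test_funs \<Omega>" for \<phi> \<psi>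
    unfolding point_seminorm_def suminf_add[OF s[OF \<phi>, of a] s[OF \<psi>, of a]]
  proof (rule suminf_le)
    show "a k * norm (\<phi> (y k) + \<psi> (y k)) \<le> a k * norm (\<phi> (y k)) + a k * norm (\<psi> (y k))" for k
      using mult_left_mono[OF norm_triangle_ineq a] by (simp add: distrib_left)
  qed (use s[OF test_funs_add[OF \<phi> \<psi>], of a] summable_add[OF s[OF \<phi>, of a] s[OF \<psi>, of a]] in auto)
  fix K :: "(real^'a) set" assume "compact K \<and> K \<subseteq> \<Omega>"
  then obtain r where "\<forall>x\<in>K. norm x \<le> r"
    using compact_imp_bounded[of K] unfolding bounded_iff by blast
  then have r: "K \<subseteq> cball 0 r" by auto
  have "point_seminorm a y \<phi> \<le> (\<Sum>k\<le>nat \<lfloor>r\<rfloor>. a k) * Cm_norm 0 \<phi>" if \<phi>: "\<phi> \<in> test_funs \<Omega>" "supp \<phi> \<subseteq> K" for \<phi>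
  proof -
    have "\<phi> (y k) = 0" if "k \<notin> {..nat \<lfloor>r\<rfloor>}" for k
    proof -
      have "real k > r" using that by (auto simp: not_le) linarith
      then have "norm (y k) > r" using y[of k] by linarith
      then show ?thesis using \<phi>(2) r supp_cball_iff by blast
    qed
    then have "point_seminorm a y \<phi> = (\<Sum>k\<le>nat \<lfloor>r\<rfloor>. a k * norm (\<phi> (y k)))"
      unfolding point_seminorm_def by (intro suminf_finite) auto
    also have "\<dots> \<le> (\<Sum>k\<le>nat \<lfloor>r\<rfloor>. a k * Cm_norm 0 \<phi>)"
      by (intro sum_mono mult_left_mono a Cm_norm_ge_0[OF \<phi>(1)])
    finally show ?thesis by (simp add: sum_distrib_right)
  qed
  then show "\<exists>C m. \<forall>\<phi>\<in>test_funs \<Omega>. supp \<phi> \<subseteq> K --> point_seminorm a y \<phi> \<le> C * Cm_norm m \<phi>" by blast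
qed

text \<open>If supports were not contained in a common ball, values at points escaping to infinity
  could be weighted so heavily that the seminorm is unbounded on \<open>B\<close>.\<close>

lemma tf_bounded_supp:
  assumes "tf_bounded UNIV B"
  obtains r where "\<And>\<phi> x. \<phi> \<in> B ==> norm x > r ==> \<phi> x = 0"
proof -
  have "\<exists>r::nat. \<forall>\<phi>\<in>B. \<forall>x. norm x > real r --> \<phi> x = 0"
  proof (rule ccontr)
    assume "\<not> ?thesis"
    then have "\<forall>k::nat. \<exists>\<phi> x. \<phi> \<in> B \<and> norm x > real k \<and> \<phi> x \<noteq> 0" by blast
    then obtain \<phi> x where \<phi>: "\<And>k. \<phi> k \<in> B" "\<And>k::nat. norm (x k) > real k" "\<And>k. \<phi> k (x k) \<noteq> 0" by metis
    \<comment> \<open>With this weight the \<open>k\<close>-th summand alone has the value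
      \<open>k\<close> on \<open>\<phi> k\<close>.\<close>
    define a where "a k = real k / norm (\<phi> k (x k))" for k
    have x: "norm (x k) \<ge> real k" and a: "a k \<ge> 0" for k using \<phi>(2)[of k] by (auto simp: a_def)
    obtain M where M: "\<And>\<phi>. \<phi> \<in> B ==> point_seminorm a x \<phi> \<le> M"
      using tf_boundedD[OF assms cont_seminorm_point_seminorm[of x a, OF x a]] by blast
    have "real k \<le> M" for k
    proof -
      have "\<phi> k \<in> test_funs UNIV" using assms \<phi>(1) by (auto simp: tf_bounded_def)
      from point_seminorm_ge[where y=x and a=a and k=k, OF x a this] M[OF \<phi>(1)[of k]] \<phi>(3)[of k] show ?thesis
        by (simp add: a_def)
    qed
    then show False using reals_Archimedean2[of M] not_le by blast
  qed
  then show ?thesis using that by blast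
qed

lemma tf_bounded_Cm_norm:
  assumes "tf_bounded UNIV B"
  shows "\<exists>M. \<forall>\<phi>\<in>B. Cm_norm m \<phi> \<le> M"
  by (rule tf_boundedD[OF assms cont_seminorm_Cm_norm])

lemma tf_boundedI:
  assumes B: "B \<subseteq> test_funs UNIV" and r: "\<And>\<phi> x. \<phi> \<in> B ==> norm x > r ==> \<phi> x = 0"
    and M: "\<And>bs. set bs \<subseteq> Basis ==> \<exists>M. \<forall>\<phi>\<in>B. \<forall>x. norm (dirds bs \<phi> x) \<le> M"
  shows "tf_bounded UNIV B"
  unfolding tf_bounded_def
proof (intro conjI allI impI B)
  fix p :: "'a tfun => real" assume p: "cont_seminorm UNIV p"
  then obtain C m where C: "\<And>\<phi>. \<phi> \<in> test_funs UNIV ==> supp \<phi> \<subseteq> cball 0 r ==> p \<phi> \<le> C * Cm_norm m \<phi>"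
    using cont_seminormD[OF p compact_cball subset_UNIV] by blast
  obtain M where M: "\<And>\<phi>. \<phi> \<in> B ==> dbound m UNIV \<phi> M"
    using ex_dbound[of m B "\<lambda>_. UNIV" "\<lambda>\<phi>. \<phi>"] M by blast
  have "p \<phi> \<le> \<bar>C\<bar> * M" if "\<phi> \<in> B" for \<phi>
  proof -
    have \<phi>: "\<phi> \<in> test_funs UNIV" using that B by blast
    have "supp \<phi> \<subseteq> cball 0 r" using r[OF that] by (simp add: supp_cball_iff)
    then have "p \<phi> \<le> C * Cm_norm m \<phi>" using C \<phi> by blast
    also have "\<dots> \<le> \<bar>C\<bar> * Cm_norm m \<phi>" using Cm_norm_nonneg[OF \<phi>] by (intro mult_right_mono) auto
    also have "Cm_norm m \<phi> \<le> M"
      by (rule Cm_norm_le) (use dboundD[OF M[OF that] axes_Basis] in simp)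
    finally show ?thesis by (simp add: mult_left_mono)
  qed
  then show "\<exists>M. \<forall>\<phi>\<in>B. p \<phi> \<le> M" by blast
qed

lemma tf_tendsto_unique:
  assumes "tf_tendsto UNIV f g F" "tf_tendsto UNIV f g' F" "F \<noteq> bot"
    "g \<in> test_funs UNIV" "g' \<in> test_funs UNIV" "eventually (\<lambda>h. f h \<in> test_funs UNIV) F"
  shows "g = g'"
proof (rule ext)
  fix y
  have lim: "((\<lambda>h. f h y) \<longlongrightarrow> l y) F" if "tf_tendsto UNIV f l F" "l \<in> test_funs UNIV" for l
  proof -
    have "((\<lambda>h. Cm_norm 0 (\<lambda>y. f h y - l y)) \<longlongrightarrow> 0) F"
      by (rule tf_tendstoD[OF that(1) cont_seminorm_Cm_norm])
    then have "((\<lambda>h. f h y - l y) \<longlongrightarrow> 0) F"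
      by (rule Lim_null_comparison[OF eventually_mono[OF assms(6)], rotated])
        (rule Cm_norm_ge_0[OF test_funs_diff[OF _ that(2)]])
    then show ?thesis by (rule LIM_zero_cancel)
  qed
  show "g y = g' y"
    using tendsto_unique[OF assms(3) lim[OF assms(1,4)] lim[OF assms(2,5)]] .
qed

text \<open>Supports that spread out arbitrarily close to time \<open>t\<close> would give non-zero
  values at points escaping to infinity. Weights that normalise these values to 1 make the seminorm
  of the difference quotient at least the inverse of the step, which contradicts
  convergence.\<close>

lemma tf_has_deriv_local_supp:
  assumes d: "tf_has_deriv UNIV c c' t" and c: "\<And>s. c s \<in> test_funs UNIV" and c': "c' \<in> test_funs UNIV"
  obtains \<delta> r where "\<delta> > 0" "\<And>s x. \<bar>s - t\<bar> < \<delta> ==> norm x > r ==> c s x = 0"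
proof -
  have "\<exists>k::nat. \<forall>h x. \<bar>h\<bar> < 1 / Suc k --> norm x > real k --> c (t + h) x = 0"
  proof (rule ccontr)
    assume "\<not> ?thesis"
    then have "\<forall>k::nat. \<exists>h x. \<bar>h\<bar> < 1 / Suc k \<and> norm x > real k \<and> c (t + h) x \<noteq> 0" by blast
    then obtain h x where hx: "\<And>k::nat. \<bar>h k\<bar> < 1 / Suc k" "\<And>k::nat. norm (x k) > real k" "\<And>k. c (t + h k) (x k) \<noteq> 0"
      by metis
    define a where "a k = 1 / norm (c (t + h k) (x k))" for k
    have x: "norm (x k) \<ge> real k" and a: "a k \<ge> 0" for k using hx(2)[of k] by (auto simp: a_def)
    have "((\<lambda>h. point_seminorm a x (\<lambda>y. (c (t + h) y - c t y) /\<^sub>R h - c' y)) \<longlongrightarrow> 0) (at 0)"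
      using d cont_seminorm_point_seminorm[of x a, OF x a] unfolding tf_has_deriv_def tf_tendsto_def by simp
    then have "eventually (\<lambda>h. norm (point_seminorm a x (\<lambda>y. (c (t + h) y - c t y) /\<^sub>R h - c' y)) < 1) (at 0)"
      by (auto simp: tendsto_iff dest!: spec[of _ 1])
    then obtain e where e: "e > 0" "\<And>h. h \<noteq> 0 ==> \<bar>h\<bar> < e ==> norm (point_seminorm a x (\<lambda>y. (c (t + h) y - c t y) /\<^sub>R h - c' y)) < 1"
      unfolding eventually_at by (auto simp: dist_real_def)
    obtain r where r: "\<And>x. norm x > r ==> c t x = 0" using test_funs_bounded[OF c] by blast
    obtain r' where r': "\<And>x. norm x > r' ==> c' x = 0" using test_funs_bounded[OF c'] by blast
    \<comment> \<open>At the chosen point both \<open>c t\<close> and \<open>c'\<close> vanish, so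
      only the value of \<open>c (t + h k)\<close> is left in the difference quotient.\<close>
    obtain k :: nat where k: "real k > max r (max r' (1 / e))" using reals_Archimedean2 by blast
    have k1: "c t (x k) = 0" "c' (x k) = 0" using r r' k hx(2)[of k] by auto
    have "h k \<noteq> 0" using hx(3)[of k] k1 by auto
    have "1 / real (Suc k) < e" using k e(1) by (auto simp: field_simps)
    then have "\<bar>h k\<bar> < e" using hx(1)[of k] by linarith
    have tf: "(\<lambda>y. (c (t + h k) y - c t y) /\<^sub>R h k - c' y) \<in> test_funs UNIV"
      using test_funs_diff[OF test_funs_scale[OF test_funs_diff[OF c c], of "of_real (inverse (h k))"] c']
      by (simp add: scaleR_conv_of_real)
    have "a k * norm ((c (t + h k) (x k) - c t (x k)) /\<^sub>R h k - c' (x k)) < 1"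
      using point_seminorm_ge[where y=x and a=a and k=k, OF x a tf] e(2)[OF \<open>h k \<noteq> 0\<close> \<open>\<bar>h k\<bar> < e\<close>] by simp
    then have "1 / \<bar>h k\<bar> < 1" using hx(3)[of k] \<open>h k \<noteq> 0\<close> by (simp add: a_def k1 field_simps)
    moreover have "1 / real (Suc k) \<le> 1" by simp
    then have "\<bar>h k\<bar> < 1" using hx(1)[of k] by linarith
    ultimately show False using \<open>h k \<noteq> 0\<close> by (simp add: divide_less_eq)
  qed
  then obtain k :: nat where k: "\<And>h x. \<bar>h\<bar> < 1 / Suc k ==> norm x > real k ==> c (t + h) x = 0" by blast
  show ?thesis
    by (rule that[of "1 / Suc k" "real k"]) (use k[of "_ - t"] in auto)
qed

section \<open>Curves of test functions as functions of two variables\<close>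

lemma compact_uniform_bound:
  fixes P :: "real => 'a::metric_space => bool"
  assumes "compact K" and loc: "\<And>x. x \<in> K ==> \<exists>\<delta>>0. \<exists>r. \<forall>y. dist y x < \<delta> --> P r y"
    and mono: "\<And>r s y. P r y ==> r \<le> s ==> P s y"
  shows "\<exists>r. \<forall>y\<in>K. P r y"
proof -
  obtain \<delta> r where dr: "\<And>x. x \<in> K ==> \<delta> x > 0" "\<And>x y. x \<in> K ==> dist y x < \<delta> x ==> P (r x) y"
    using loc by metis
  have "K \<subseteq> (\<Union>x\<in>K. ball x (\<delta> x))" using dr(1) by force
  then obtain F where F: "F \<subseteq> K" "finite F" "K \<subseteq> (\<Union>x\<in>F. ball x (\<delta> x))"
    using compactE_image[OF assms(1), of K "\<lambda>x. ball x (\<delta> x)"] by auto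
  have "P (\<Sum>x\<in>F. \<bar>r x\<bar>) y" if y: "y \<in> K" for y
  proof -
    obtain x where x: "x \<in> F" "dist x y < \<delta> x" using F(3) y by auto
    then have "P (r x) y" using dr(2)[of x y] F(1) by (auto simp: dist_commute)
    moreover have "r x \<le> (\<Sum>x\<in>F. \<bar>r x\<bar>)"
      using member_le_sum[OF x(1), of "\<lambda>x. \<bar>r x\<bar>"] F(2) by force
    ultimately show ?thesis by (rule mono)
  qed
  then show ?thesis by blast
qed

text \<open>Convergence in the \<open>Cm_norm\<close> norms allows differentiating in time below any
  space derivative. Hence the functions \<open>G k bs\<close>, with \<open>k\<close> derivatives in
  time and those along \<open>bs\<close> in space, are closed under differentiation up to linear
  combinations. Supports are bounded locally in time, hence on compact intervals.\<close>

lemma tf_smooth_curve_joint: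
  assumes "tf_smooth_curve UNIV c"
  shows "smooth_in UNIV (\<lambda>z. c (fst z) (snd z))"
    and "\<exists>r. \<forall>t x. \<bar>t\<bar> \<le> T --> norm x > r --> c t x = 0"
proof -
  obtain d where d0: "d 0 = c" and d: "\<And>k t. d k t \<in> test_funs UNIV"
    "\<And>k t. tf_has_deriv UNIV (d k) (d (Suc k) t) t"
    using assms unfolding tf_smooth_curve_def by blast
  define G where "G k bs z = dirds bs (d k (fst z)) (snd z)" for k bs z
  have sm: "smooth_in UNIV (dirds bs (d k t))" for bs k t
    by (rule smooth_in_dirds[OF test_funsD(1)[OF d(1)]])
  have der: "(G k bs has_derivative (\<lambda>w. dird (snd w) (dirds bs (d k t)) y + fst w *\<^sub>R dirds bs (d (Suc k) t) y)) (at (t, y))"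
    if bs: "set bs \<subseteq> Basis" for k bs t y
  proof -
    define F where "F = dirds bs (d k t)"
    define H where "H = dirds bs (d (Suc k) t)"
    \<comment> \<open>The error of the expansion in time alone. The norm bounds it uniformly in the
      space variable, so as a function of both variables its derivative at \<open>(t, y)\<close> is
      0.\<close>
    define \<rho> where "\<rho> z = G k bs z - F (snd z) - (fst z - t) *\<^sub>R H (snd z)" for z
    define \<omega> where "\<omega> h = Cm_norm (length bs) (\<lambda>y. (d k (t + h) y - d k t y) /\<^sub>R h - d (Suc k) t y)" for h
    have \<omega>: "(\<omega> \<longlongrightarrow> 0) (at 0)"
      using tf_tendstoD[OF d(2)[of k t, unfolded tf_has_deriv_def] cont_seminorm_Cm_norm]
      unfolding \<omega>_def .
    have \<rho>_le: "norm (\<rho> (t + h, z)) \<le> \<bar>h\<bar> * \<omega> h" if "h \<noteq> 0" for h z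
    proof -
      let ?\<psi> = "\<lambda>y. (d k (t + h) y - d k t y) /\<^sub>R h - d (Suc k) t y"
      have tf: "?\<psi> \<in> test_funs UNIV"
        using test_funs_diff[OF test_funs_scale[OF test_funs_diff[OF d(1) d(1)], of "of_real (inverse h)"] d(1)]
        by (simp add: scaleR_conv_of_real)
      have s1: "smooth_in UNIV (\<lambda>y. d k (t + h) y - d k t y)"
        by (intro smooth_in_diff open_UNIV test_funsD(1)[OF d(1)])
      then have s2: "smooth_in UNIV (\<lambda>y. (d k (t + h) y - d k t y) /\<^sub>R h)"
        by (intro smooth_in_scaleR smooth_in_const open_UNIV)
      have "dirds bs ?\<psi> z = (dirds bs (d k (t + h)) z - dirds bs (d k t) z) /\<^sub>R h - dirds bs (d (Suc k) t) z"
        by (simp only: dirds_diff[OF open_UNIV s2 test_funsD(1)[OF d(1)] UNIV_I] dirds_scaleR[OF open_UNIV s1 UNIV_I]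
            dirds_diff[OF open_UNIV test_funsD(1)[OF d(1)] test_funsD(1)[OF d(1)] UNIV_I])
      then have "\<rho> (t + h, z) = h *\<^sub>R dirds bs ?\<psi> z"
        using that by (simp add: \<rho>_def G_def F_def H_def scaleR_diff_right)
      moreover have "norm (dirds bs ?\<psi> z) \<le> \<omega> h"
        unfolding \<omega>_def by (rule Cm_norm_ge_Basis[OF tf bs]) simp
      ultimately show ?thesis by (simp add: mult_left_mono)
    qed
    have \<rho>0: "\<rho> (t, z) = 0" for z by (simp add: \<rho>_def G_def F_def)
    have "(\<rho> has_derivative (\<lambda>w. 0)) (at (t, y))"
      unfolding has_derivative_at_alt
    proof (intro conjI allI impI bounded_linear_zero)
      fix e :: real assume "e > 0"
      then have "eventually (\<lambda>h. norm (\<omega> h) < e) (at 0)"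
        using \<omega> by (auto simp: tendsto_iff)
      then obtain \<delta> where \<delta>: "\<delta> > 0" "\<And>h. h \<noteq> 0 ==> \<bar>h\<bar> < \<delta> ==> \<bar>\<omega> h\<bar> < e"
        unfolding eventually_at by (auto simp: dist_real_def)
      have "norm (\<rho> z - \<rho> (t, y) - 0) \<le> e * norm (z - (t, y))" if "norm (z - (t, y)) < \<delta>" for z
      proof (cases "fst z = t")
        case True
        then have "z = (t, snd z)" by (simp add: prod_eq_iff)
        then have "\<rho> z = 0" using \<rho>0 by metis
        then show ?thesis using \<rho>0 \<open>e > 0\<close> by simp
      next
        case False
        define h where "h = fst z - t"
        have h: "h \<noteq> 0" "z = (t + h, snd z)" using False by (auto simp: h_def prod_eq_iff)
        have hle: "\<bar>h\<bar> \<le> norm (z - (t, y))"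
          using norm_fst_le[of "fst z - t" "snd z - y"] by (simp add: h_def minus_prod_def)
        then have "\<bar>\<omega> h\<bar> < e" using \<delta>(2) h(1) that by simp
        have "norm (\<rho> z) \<le> \<bar>h\<bar> * \<omega> h" using \<rho>_le[OF h(1)] h(2) by metis
        also have "\<dots> \<le> \<bar>h\<bar> * e" using \<open>\<bar>\<omega> h\<bar> < e\<close> by (intro mult_left_mono) auto
        also have "\<dots> \<le> norm (z - (t, y)) * e" using hle \<open>e > 0\<close> by (intro mult_right_mono) auto
        finally show ?thesis by (simp add: \<rho>0 mult.commute)
      qed
      then show "\<exists>\<delta>>0. \<forall>z. norm (z - (t, y)) < \<delta> --> norm (\<rho> z - \<rho> (t, y) - 0) \<le> e * norm (z - (t, y))"
        using \<delta>(1) by blast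
    qed
    moreover have "((\<lambda>z. F (snd z)) has_derivative (\<lambda>w. dird (snd w) F y)) (at (t, y))"
    proof -
      have "(F has_derivative (\<lambda>v. dird v F y)) (at (snd (t, y)))"
        using has_derivative_dird[OF smooth_in_differentiable[OF sm]] by (simp add: F_def)
      from diff_chain_at[OF has_derivative_snd[OF has_derivative_ident] this] show ?thesis by (simp add: o_def)
    qed
    moreover have "((\<lambda>z. (fst z - t) *\<^sub>R H (snd z)) has_derivative (\<lambda>w. fst w *\<^sub>R H y)) (at (t, y))"
    proof -
      have "(H has_derivative (\<lambda>v. dird v H y)) (at (snd (t, y)))"
        using has_derivative_dird[OF smooth_in_differentiable[OF sm]] by (simp add: H_def)
      from diff_chain_at[OF has_derivative_snd[OF has_derivative_ident] this]
      have "((\<lambda>z. H (snd z)) has_derivative (\<lambda>w. dird (snd w) H y)) (at (t, y))" by (simp add: o_def)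
      moreover have "((\<lambda>z::real \<times> (real^'a). fst z - t) has_derivative (\<lambda>w. fst w)) (at (t, y))"
        by (auto intro!: derivative_eq_intros)
      ultimately show ?thesis
        using has_derivative_scaleR[of "\<lambda>z. fst z - t" "\<lambda>w. fst w" "(t, y)" UNIV "\<lambda>z. H (snd z)"] by fastforce
    qed
    ultimately have "((\<lambda>z. \<rho> z + F (snd z) + (fst z - t) *\<^sub>R H (snd z)) has_derivative
        (\<lambda>w. 0 + dird (snd w) F y + fst w *\<^sub>R H y)) (at (t, y))"
      by (intro has_derivative_add)
    moreover have "(\<lambda>z. \<rho> z + F (snd z) + (fst z - t) *\<^sub>R H (snd z)) = G k bs"
      by (auto simp: \<rho>_def)
    ultimately show ?thesis by (simp add: F_def H_def)
  qed
  have "smooth_in UNIV (G 0 [])"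
  proof (rule smooth_in_coinduct[where P="\<lambda>f. \<exists>k bs. f = G k bs \<and> set bs \<subseteq> Basis"])
    show "\<exists>k bs. G 0 [] = G k bs \<and> set bs \<subseteq> Basis" by (intro exI[of _ 0] exI[of _ "[]"]) auto
  next
    fix f and z :: "real \<times> (real^'a)" assume "\<exists>k bs. f = G k bs \<and> set bs \<subseteq> Basis"
    then show "f differentiable (at z)"
      using der[of _ _ "fst z" "snd z"] by (auto simp: differentiable_def)
  next
    fix f and w :: "real \<times> (real^'a)" and j
    assume "\<exists>k bs. f = G k bs \<and> set bs \<subseteq> Basis"
      and IH: "\<And>g. \<exists>k bs. g = G k bs \<and> set bs \<subseteq> Basis ==> smooth_upto j UNIV g"
    then obtain k bs where f: "f = G k bs" and bs: "set bs \<subseteq> Basis" by blast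
    have "dird w f z = (\<Sum>b\<in>Basis. (snd w \<bullet> b) *\<^sub>R G k (b # bs) z) + fst w *\<^sub>R G (Suc k) bs z" for z
    proof -
      have "dird w f z = dird (snd w) (dirds bs (d k (fst z))) (snd z) + fst w *\<^sub>R G (Suc k) bs z"
        using dird_eqI[OF der[OF bs, of k "fst z" "snd z"]] by (simp add: f G_def)
      also have "dird (snd w) (dirds bs (d k (fst z))) (snd z) = (\<Sum>b\<in>Basis. (snd w \<bullet> b) *\<^sub>R G k (b # bs) z)"
        using dird_lincomb[OF smooth_in_differentiable[OF sm[of bs k "fst z"] UNIV_I], of "\<lambda>b. snd w \<bullet> b" Basis "snd z"]
        by (simp add: euclidean_representation G_def)
      finally show ?thesis .
    qed
    then have "dird w f = (\<lambda>z. (\<Sum>b\<in>Basis. (snd w \<bullet> b) *\<^sub>R G k (b # bs) z) + fst w *\<^sub>R G (Suc k) bs z)"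
      by (rule ext)
    moreover have "smooth_upto j UNIV (\<lambda>z. (\<Sum>b\<in>Basis. (snd w \<bullet> b) *\<^sub>R G k (b # bs) z) + fst w *\<^sub>R G (Suc k) bs z)"
      using bs by (intro smooth_upto_add smooth_upto_sum smooth_upto_bilinear[OF _ bounded_bilinear_scaleR]
          smooth_upto_const IH open_UNIV) (auto intro!: exI)
    ultimately show "smooth_upto j UNIV (dird w f)" by (simp only:)
  qed
  then show "smooth_in UNIV (\<lambda>z. c (fst z) (snd z))"
    by (simp add: G_def[abs_def] d0)
  have "\<exists>r. \<forall>t\<in>{-T..T}. \<forall>x. norm x > r --> c t x = 0"
  proof (rule compact_uniform_bound[OF compact_Icc])
    fix t
    obtain \<delta> r where "\<delta> > 0" "\<And>s x. \<bar>s - t\<bar> < \<delta> ==> norm x > r ==> d 0 s x = 0"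
      using tf_has_deriv_local_supp[OF d(2)[of 0 t] d(1) d(1)] by blast
    then show "\<exists>\<delta>>0. \<exists>r. \<forall>y. dist y t < \<delta> --> (\<forall>x. norm x > r --> c y x = 0)"
      unfolding dist_real_def d0 by blast
  qed auto
  then obtain r where r: "\<forall>t\<in>{-T..T}. \<forall>x. norm x > r --> c t x = 0" ..
  show "\<exists>r. \<forall>t x. \<bar>t\<bar> \<le> T --> norm x > r --> c t x = 0"
    by (intro exI[of _ r] allI impI r[rule_format]) auto
qed

text \<open>The mean value inequality is applied first to the derivative and then to the function
  minus its linear part; hence \<open>M\<close> instead of \<open>M / 2\<close>.\<close>

lemma second_order_remainder:
  fixes g :: "real => 'b::euclidean_space"
  assumes g: "smooth_in J g" and J: "\<And>s. \<bar>s\<bar> \<le> \<bar>h\<bar> ==> s \<in> J"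
    and M: "\<And>s. \<bar>s\<bar> \<le> \<bar>h\<bar> ==> norm (dirds [1, 1] g s) \<le> M"
  shows "norm (g h - g 0 - h *\<^sub>R dird 1 g 0) \<le> M * h\<^sup>2"
proof -
  let ?S = "{-\<bar>h\<bar>..\<bar>h\<bar>}"
  have M0: "0 \<le> M" using M[of 0] norm_ge_zero order_trans by (metis abs_ge_zero abs_zero)
  have der: "(f has_derivative (\<lambda>r. r *\<^sub>R dird 1 f s)) (at s within ?S)" if "smooth_in J f" "s \<in> ?S" for f :: "real => 'b" and s
  proof -
    have "f differentiable (at s)" using smooth_in_differentiable[OF that(1)] J that(2) by auto
    note d = this
    have "dird r f s = r *\<^sub>R dird 1 f s" for r
      using linear_scale[OF dird_linear[OF d], of r 1] by (simp only: real_scaleR_def mult_1_right)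
    then have "(\<lambda>r. dird r f s) = (\<lambda>r. r *\<^sub>R dird 1 f s)" by (rule ext)
    then have "(f has_derivative (\<lambda>r. r *\<^sub>R dird 1 f s)) (at s)"
      using has_derivative_dird[OF d] by metis
    then show ?thesis by (rule has_derivative_at_withinI)
  qed
  have on: "onorm (\<lambda>r::real. r *\<^sub>R v) \<le> B" if "norm v \<le> B" for v :: 'b and B
    by (rule onorm_le) (use that in \<open>simp add: mult.commute[of B] mult_left_mono\<close>)
  have 1: "norm (dird 1 g s - dird 1 g 0) \<le> M * \<bar>h\<bar>" if s: "s \<in> ?S" for s
  proof -
    have "norm (dird 1 g s - dird 1 g 0) \<le> M * norm (s - 0)"
    proof (rule differentiable_bound[of ?S])
      show "(dird 1 g has_derivative (\<lambda>r. r *\<^sub>R dird 1 (dird 1 g) x)) (at x within ?S)" if "x \<in> ?S" for x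
        using der[OF smooth_in_dird[OF g] that] .
      show "onorm (\<lambda>r::real. r *\<^sub>R dird 1 (dird 1 g) x) \<le> M" if "x \<in> ?S" for x
        using M[of x] that by (intro on) auto
    qed (use s in auto)
    also have "\<dots> \<le> M * \<bar>h\<bar>" using s M0 by (intro mult_left_mono) auto
    finally show ?thesis .
  qed
  have "norm ((g h - h *\<^sub>R dird 1 g 0) - (g 0 - 0 *\<^sub>R dird 1 g 0)) \<le> M * \<bar>h\<bar> * norm (h - 0)"
  proof (rule differentiable_bound[of ?S])
    show "((\<lambda>s. g s - s *\<^sub>R dird 1 g 0) has_derivative (\<lambda>r. r *\<^sub>R (dird 1 g x - dird 1 g 0))) (at x within ?S)"
      if "x \<in> ?S" for x
      using has_derivative_diff[OF der[OF g that] has_derivative_scaleR_left[OF has_derivative_ident]]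
      by (simp add: scaleR_diff_right)
    show "onorm (\<lambda>r::real. r *\<^sub>R (dird 1 g x - dird 1 g 0)) \<le> M * \<bar>h\<bar>" if "x \<in> ?S" for x
      by (rule on[OF 1[OF that]])
  qed auto
  then show ?thesis by (simp add: power2_eq_square algebra_simps)
qed

lemma compact_dbound:
  fixes f :: "'a::euclidean_space => 'b::euclidean_space"
  assumes "smooth_in U f" "compact K" "K \<subseteq> U"
  shows "\<exists>M\<ge>1. dbound m K f M"
proof -
  have "\<exists>M. \<forall>i\<in>{()}. \<forall>x\<in>K. norm (dirds vs f x) \<le> M" for vs
  proof -
    have "compact (dirds vs f ` K)"
      by (rule compact_continuous_image[OF continuous_on_subset[OF smooth_in_continuous[OF smooth_in_dirds[OF assms(1)]] assms(3)] assms(2)])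
    then have "bounded (dirds vs f ` K)" by (rule compact_imp_bounded)
    then show ?thesis unfolding bounded_iff by auto
  qed
  from ex_dbound[of m "{()}" "\<lambda>_. K" "\<lambda>_. f", OF this] show ?thesis by blast
qed

text \<open>On functions supported in the fixed compact \<open>K\<close> every continuous seminorm
  is dominated by some \<open>Cm_norm m\<close>. For these norms the second-order remainder in time,
  taken for each space derivative, shows that the quotients converge at a rate linear in the
  step.\<close>

lemma tf_has_deriv_joint:
  fixes G :: "real \<times> (real^'n::finite) => complex"
  assumes J: "open J" "t \<in> J" and G: "smooth_in (J \<times> UNIV) G" and K: "compact K" "K \<subseteq> \<Omega>"
    and z: "\<And>s y. s \<in> J ==> y \<notin> K ==> G (s, y) = 0"
    and c: "\<And>s y. s \<in> J ==> c s y = G (s, y)"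
  shows "tf_has_deriv \<Omega> c (\<lambda>y. dird (1, 0) G (t, y)) t"
  unfolding tf_has_deriv_def tf_tendsto_def
proof (intro allI impI)
  fix p :: "'n tfun => real" assume p: "cont_seminorm \<Omega> p"
  obtain C m where C: "\<And>\<phi>. \<phi> \<in> test_funs \<Omega> ==> supp \<phi> \<subseteq> K ==> p \<phi> \<le> C * Cm_norm m \<phi>"
    using cont_seminormD[OF p K] by blast
  obtain \<delta> where \<delta>: "\<delta> > 0" "cball t \<delta> \<subseteq> J" using J open_contains_cball by blast
  have oJ: "open (J \<times> (UNIV :: (real^'n) set))" using J by (intro open_Times open_UNIV)
  \<comment> \<open>Two orders on top of \<open>m\<close>, for the second derivative in time of a
    space derivative.\<close>
  obtain M where M1: "M \<ge> 1" and M: "dbound (m + 2) (cball t \<delta> \<times> K) G M"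
    using compact_dbound[OF G compact_Times[OF compact_cball K(1)], of t \<delta> "m + 2"] \<delta>(2) by auto
  have sl: "smooth_in UNIV (\<lambda>y. H (s, y))" if "s \<in> J" "smooth_in (J \<times> UNIV) H" for s and H :: "real \<times> (real^'n) => complex"
    by (rule smooth_in_comp[OF open_UNIV _ that(2)])
      (use that(1) in \<open>auto intro!: smooth_in_Pair smooth_in_const smooth_in_id\<close>)
  have dz: "dird (1, 0) G (t, y) = 0" if "y \<notin> K" for y
  proof -
    have "dird (1, 0) G (t, y) = dird (1, 0) (\<lambda>_. 0) (t, y)"
      by (rule dird_cong[of "J \<times> (- K)"])
        (use J that z compact_imp_closed[OF K(1)] in \<open>auto intro!: open_Times simp: open_Compl\<close>)
    then show ?thesis by (simp add: dird_const)
  qed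
  have bound: "0 \<le> p (\<lambda>y. (c (t + h) y - c t y) /\<^sub>R h - dird (1, 0) G (t, y)) \<and>
      p (\<lambda>y. (c (t + h) y - c t y) /\<^sub>R h - dird (1, 0) G (t, y)) \<le> \<bar>C\<bar> * (M * \<bar>h\<bar>)"
    if h: "h \<noteq> 0" "\<bar>h\<bar> < \<delta>" for h
  proof -
    have th: "t + s \<in> cball t \<delta>" if "\<bar>s\<bar> \<le> \<bar>h\<bar>" for s
      using that h by (simp add: dist_real_def)
    then have thJ: "t + h \<in> J" using \<delta>(2) by blast
    let ?\<psi> = "\<lambda>y. (G (t + h, y) - G (t, y)) /\<^sub>R h - dird (1, 0) G (t, y)"
    have s: "smooth_in UNIV (\<lambda>y. G (t + h, y))" "smooth_in UNIV (\<lambda>y. G (t, y))" "smooth_in UNIV (\<lambda>y. dird (1, 0) G (t, y))"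
      using sl[OF thJ G] sl[OF J(2) G] sl[OF J(2) smooth_in_dird[OF G]] by auto
    have s': "smooth_in UNIV (\<lambda>y. G (t + h, y) - G (t, y))" by (intro smooth_in_diff s open_UNIV)
    have s'': "smooth_in UNIV (\<lambda>y. (G (t + h, y) - G (t, y)) /\<^sub>R h)" by (intro smooth_in_scaleR smooth_in_const s' open_UNIV)
    have tf: "?\<psi> \<in> test_funs \<Omega>" "supp ?\<psi> \<subseteq> K"
      using test_funsI[OF smooth_in_diff[OF open_UNIV s'' s(3)] K] z[OF thJ] z[OF J(2)] dz by auto
    have "Cm_norm m ?\<psi> \<le> M * \<bar>h\<bar>"
    proof (rule Cm_norm_le)
      fix "is" :: "'n list" and y assume l: "length is \<le> m"
      show "norm (dirds (axes is) ?\<psi> y) \<le> M * \<bar>h\<bar>"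
      proof (cases "y \<in> K")
        case False
        have "dirds (axes is) ?\<psi> y = dirds (axes is) (\<lambda>_. 0) y"
          by (rule dirds_cong[of "- K"])
            (use False z[OF thJ] z[OF J(2)] dz compact_imp_closed[OF K(1)] in \<open>auto simp: open_Compl\<close>)
        then show ?thesis using M1 by (cases "axes is = []") (auto simp: dirds_const)
      next
        case True
        define bs where "bs = map (Pair (0::real)) (axes is)"
        define G' where "G' = dirds bs G"
        have G': "smooth_in (J \<times> UNIV) G'" unfolding G'_def by (rule smooth_in_dirds[OF G])
        have bs: "set bs \<subseteq> Basis" using axes_Basis by (auto simp: bs_def Basis_prod_def Basis_eq_axis)
        have sl': "dirds (axes is) (\<lambda>y. H (s, y)) y = dirds bs H (s, y)" for H s
          by (simp only: dirds_slice_snd bs_def)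
        have "dirds (axes is) ?\<psi> y = (G' (t + h, y) - G' (t, y)) /\<^sub>R h - dirds bs (dird (1, 0) G) (t, y)"
          by (simp only: dirds_diff[OF open_UNIV s'' s(3) UNIV_I] dirds_scaleR[OF open_UNIV s' UNIV_I]
              dirds_diff[OF open_UNIV s(1,2) UNIV_I] sl' G'_def)
        moreover have "dirds bs (dird (1, 0) G) (t, y) = dird (1, 0) G' (t, y)"
          using dirds_move[OF oJ G, of "(t, y)" "(1, 0)" bs "[]"] J(2) by (simp add: G'_def)
        moreover define g where "g s = G' ((t, y) + s *\<^sub>R (1, 0))" for s
        have g: "smooth_in ((\<lambda>s. t + s) -` J) g"
          unfolding g_def
        proof (rule smooth_in_comp[OF _ _ G'])
          show oS: "open ((\<lambda>s. t + s) -` J)" by (intro open_vimage J continuous_intros)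
          show "smooth_in ((\<lambda>s. t + s) -` J) (\<lambda>s. (t, y) + s *\<^sub>R (1, 0))"
            by (intro smooth_in_add smooth_in_scaleR smooth_in_const smooth_in_id oS)
        qed auto
        have "norm (g h - g 0 - h *\<^sub>R dird 1 g 0) \<le> M * h\<^sup>2"
        proof (rule second_order_remainder[OF g])
          show "s \<in> (\<lambda>s. t + s) -` J" if "\<bar>s\<bar> \<le> \<bar>h\<bar>" for s using th[OF that] \<delta>(2) by auto
          show "norm (dirds [1, 1] g s) \<le> M" if "\<bar>s\<bar> \<le> \<bar>h\<bar>" for s
          proof -
            have "dirds [1, 1] g s = dirds ((1, 0) # (1, 0) # bs) G (t + s, y)"
              unfolding g_def dirds_line by (simp add: G'_def)
            moreover have "norm (dirds ((1, 0) # (1, 0) # bs) G (t + s, y)) \<le> M"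
              by (rule dboundD[OF M]) (use bs l th[OF that] True in \<open>auto simp: Basis_prod_def bs_def\<close>)
            ultimately show ?thesis by simp
          qed
        qed
        moreover have "dird 1 g 0 = dird (1, 0) G' (t, y)"
          unfolding g_def dird_line by simp
        ultimately have "norm (h *\<^sub>R dirds (axes is) ?\<psi> y) \<le> M * h\<^sup>2"
          using h(1) by (simp add: g_def scaleR_diff_right)
        then have "\<bar>h\<bar> * norm (dirds (axes is) ?\<psi> y) \<le> \<bar>h\<bar> * (M * \<bar>h\<bar>)"
          by (simp add: power2_eq_square mult_ac)
        then show ?thesis using h(1) by simp
      qed
    qed
    then have "\<bar>C\<bar> * Cm_norm m ?\<psi> \<le> \<bar>C\<bar> * (M * \<bar>h\<bar>)" by (intro mult_left_mono) auto
    moreover have "p ?\<psi> \<le> C * Cm_norm m ?\<psi>" by (rule C[OF tf])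
    moreover have "C * Cm_norm m ?\<psi> \<le> \<bar>C\<bar> * Cm_norm m ?\<psi>"
      using Cm_norm_nonneg[OF tf(1)] by (intro mult_right_mono) auto
    ultimately have le: "p ?\<psi> \<le> \<bar>C\<bar> * (M * \<bar>h\<bar>)" by linarith
    have eq: "(\<lambda>y. (c (t + h) y - c t y) /\<^sub>R h - dird (1, 0) G (t, y)) = ?\<psi>"
      using c[OF thJ] c[OF J(2)] by simp
    show ?thesis unfolding eq using le cont_seminorm_nonneg[OF p tf(1)] by blast
  qed
  show "((\<lambda>h. p (\<lambda>y. (c (t + h) y - c t y) /\<^sub>R h - dird (1, 0) G (t, y))) \<longlongrightarrow> 0) (at 0)"
  proof (rule Lim_null_comparison)
    have "((\<lambda>h. \<bar>C\<bar> * (M * \<bar>h\<bar>)) \<longlongrightarrow> \<bar>C\<bar> * (M * \<bar>0\<bar>)) (at (0::real))" by (intro tendsto_intros)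
    then show "((\<lambda>h. \<bar>C\<bar> * (M * \<bar>h\<bar>)) \<longlongrightarrow> 0) (at (0::real))" by simp
    show "\<forall>\<^sub>F h in at 0. norm (p (\<lambda>y. (c (t + h) y - c t y) /\<^sub>R h - dird (1, 0) G (t, y))) \<le> \<bar>C\<bar> * (M * \<bar>h\<bar>)"
      unfolding eventually_at using \<delta>(1) bound by (intro exI[of _ \<delta>]) auto
  qed
qed

lemma dirds_outside:
  assumes "open V" "z \<in> V" "\<And>w. w \<in> V ==> f w = 0"
  shows "dirds vs f z = 0"
proof -
  have "dirds vs f z = dirds vs (\<lambda>_. 0) z" by (rule dirds_cong[OF assms(1,2)]) (use assms(3) in simp)
  then show ?thesis by (cases "vs = []") (auto simp: dirds_const)
qed

text \<open>Converse of \<open>tf_smooth_curve_joint\<close>. The successive derivatives are the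
  partial derivatives in time, which inherit joint smoothness and the compact sets.\<close>

lemma tf_smooth_curveI:
  fixes c :: "real => 'n::finite tfun"
  assumes c: "smooth_in UNIV (\<lambda>z. c (fst z) (snd z))"
    and K: "\<And>T :: real. T > 0 ==> \<exists>K. compact K \<and> K \<subseteq> \<Omega> \<and> (\<forall>t y. \<bar>t\<bar> < T --> y \<notin> K --> c t y = 0)"
  shows "tf_smooth_curve \<Omega> c"
  unfolding tf_smooth_curve_def
proof (intro exI conjI allI)
  let ?c = "\<lambda>z. c (fst z) (snd z)"
  let ?d = "\<lambda>k t y. dirds (replicate k (1, 0)) ?c (t, y)"
  show "?d 0 = c" by simp
  fix k and t :: real
  define T where "T = \<bar>t\<bar> + 1"
  obtain K where K: "compact K" "K \<subseteq> \<Omega>" "\<And>t y. \<bar>t\<bar> < T ==> y \<notin> K ==> c t y = 0"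
    using K[of T] abs_ge_zero[of t] unfolding T_def by (metis add_nonneg_pos zero_less_one)
  define J where "J = {s. \<bar>s\<bar> < T}"
  have J: "open J" "t \<in> J" unfolding J_def by (auto simp: T_def intro!: open_Collect_less continuous_intros)
  have z: "?d k s y = 0" if "s \<in> J" "y \<notin> K" for s y
    by (rule dirds_outside[of "J \<times> (- K)"])
      (use J that K compact_imp_closed[OF K(1)] in \<open>auto intro!: open_Times simp: open_Compl J_def\<close>)
  have sm: "smooth_in UNIV (dirds (replicate k (1, 0)) ?c)" by (rule smooth_in_dirds[OF c])
  have "smooth_in UNIV (\<lambda>y. dirds (replicate k (1, 0)) ?c (t, y))"
    by (rule smooth_in_comp[OF open_UNIV _ sm]) (auto intro!: smooth_in_Pair smooth_in_const smooth_in_id)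
  then show "?d k t \<in> test_funs \<Omega>"
    using test_funsI(1)[OF _ K(1,2)] z J(2) by blast
  have "tf_has_deriv \<Omega> (?d k) (\<lambda>y. dird (1, 0) (dirds (replicate k (1, 0)) ?c) (t, y)) t"
    by (rule tf_has_deriv_joint[OF J smooth_in_subset[OF sm subset_UNIV] K(1,2)]) (use z in auto)
  then show "tf_has_deriv \<Omega> (?d k) (?d (Suc k) t) t" by simp
qed

section \<open>Bounded families of test objects\<close>

text \<open>Over an open parameter set one common support cannot be expected. Supports bounded
  locally uniformly suffice for integration, pass to derivatives, and become uniform on compact sets
  of parameters.\<close>

definition local_supp :: "'p::euclidean_space set => ('p \<times> (real^'n::finite) => 'c::euclidean_space) => bool" where
  "local_supp W G \<longleftrightarrow>
     (\<forall>x\<in>W. \<exists>\<delta>>0. \<exists>r. \<forall>x'\<in>W. dist x' x < \<delta> --> (\<forall>y. norm y > r --> G (x', y) = 0))"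

lemma local_supp_dird:
  assumes "open W" "local_supp W G"
  shows "local_supp W (dird v G)"
  unfolding local_supp_def
proof
  fix x assume "x \<in> W"
  then obtain \<delta> r where dr: "\<delta> > 0" "\<And>x' y. x' \<in> W ==> dist x' x < \<delta> ==> norm y > r ==> G (x', y) = 0"
    using assms(2) unfolding local_supp_def by meson
  have "dird v G (x', y) = 0" if "x' \<in> W" "dist x' x < \<delta>" "norm y > r" for x' y
  proof -
    have "open ((W \<inter> ball x \<delta>) \<times> {y. norm y > r})"
      by (intro open_Times open_Int assms(1) open_ball open_Collect_less continuous_intros)
    then show ?thesis
      using dirds_outside[of "(W \<inter> ball x \<delta>) \<times> {y. norm y > r}" "(x', y)" G "[v]"] that dr(2)
      by (auto simp: dist_commute)
  qed
  then show "\<exists>\<delta>>0. \<exists>r. \<forall>x'\<in>W. dist x' x < \<delta> --> (\<forall>y. norm y > r --> dird v G (x', y) = 0)"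
    using dr(1) by blast
qed

lemma local_supp_dirds: "open W ==> local_supp W G ==> local_supp W (dirds vs G)"
  by (induction vs) (auto intro: local_supp_dird)

lemma local_supp_compact:
  assumes "local_supp W G" "compact K" "K \<subseteq> W"
  shows "\<exists>r. \<forall>x\<in>K. \<forall>y. norm y > r --> G (x, y) = 0"
proof -
  have "\<exists>r. \<forall>x\<in>K. x \<in> W --> (\<forall>y. norm y > r --> G (x, y) = 0)"
  proof (rule compact_uniform_bound[OF assms(2)])
    fix x assume "x \<in> K"
    then obtain \<delta> r where "\<delta> > 0" "\<forall>x'\<in>W. dist x' x < \<delta> --> (\<forall>y. norm y > r --> G (x', y) = 0)"
      using assms(1,3) unfolding local_supp_def by blast
    then show "\<exists>\<delta>>0. \<exists>r. \<forall>x'. dist x' x < \<delta> --> x' \<in> W --> (\<forall>y. norm y > r --> G (x', y) = 0)"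
      by blast
  qed auto
  then show ?thesis using assms(3) by blast
qed

lemma local_suppI:
  assumes "open W" "\<And>K. compact K ==> K \<subseteq> W ==> \<exists>r. \<forall>x\<in>K. \<forall>y. norm y > r --> G (x, y) = 0"
  shows "local_supp W G"
  unfolding local_supp_def
proof
  fix x assume "x \<in> W"
  then obtain e where e: "e > 0" "cball x e \<subseteq> W" using assms(1) open_contains_cball by blast
  obtain r where "\<forall>x\<in>cball x e. \<forall>y. norm y > r --> G (x, y) = 0" using assms(2)[OF compact_cball e(2)] by blast
  then show "\<exists>\<delta>>0. \<exists>r. \<forall>x'\<in>W. dist x' x < \<delta> --> (\<forall>y. norm y > r --> G (x', y) = 0)"
    using e(1) by (intro exI[of _ e] conjI exI[of _ r]) (auto simp: dist_commute)
qed

lemma smooth_in_slice: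
  assumes "smooth_in (W \<times> UNIV) G" "x \<in> W"
  shows "smooth_in UNIV (\<lambda>y. G (x, y))"
  by (rule smooth_in_comp[OF open_UNIV _ assms(1)])
    (use assms(2) in \<open>auto intro!: smooth_in_Pair smooth_in_const smooth_in_id\<close>)

lemma slice_test_fun:
  assumes "smooth_in (W \<times> UNIV) G" "local_supp W G" "x \<in> W"
  shows "(\<lambda>y. G (x, y)) \<in> test_funs UNIV"
proof -
  obtain r where "\<forall>x\<in>{x}. \<forall>y. norm y > r --> G (x, y) = 0"
    using local_supp_compact[OF assms(2), of "{x}"] assms(3) by auto
  then show ?thesis
    by (intro test_funsI(1)[OF smooth_in_slice[OF assms(1,3)] compact_cball[of 0 r] subset_UNIV]) auto
qed

text \<open>\<open>tf_partial\<close> is a definite description. Existence of the limit comes from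
  joint smoothness along a line through \<open>x\<close>, uniqueness from
  \<open>tf_tendsto_unique\<close>, for which the quotients have to be test functions at small
  steps.\<close>

lemma tf_partial_joint:
  assumes W: "open W" "x \<in> W" and G: "smooth_in (W \<times> UNIV) G" and s: "local_supp W G"
    and \<Phi>: "\<And>x. x \<in> W ==> \<Phi> x = (\<lambda>y. G (x, y))"
  shows "tf_partial i \<Phi> x = (\<lambda>y. dird (axis i 1, 0) G (x, y))"
proof -
  define v :: "real^'a" where "v = axis i 1"
  obtain e where e: "e > 0" "cball x e \<subseteq> W" using W open_contains_cball by blast
  obtain r where r: "\<And>x' y. x' \<in> cball x e ==> norm y > r ==> G (x', y) = 0"
    using local_supp_compact[OF s compact_cball e(2)] by blast
  define J where "J = ball (0::real) e"
  have J: "open J" "0 \<in> J" using e by (auto simp: J_def)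
  have xs: "x + s *\<^sub>R v \<in> cball x e" if "s \<in> J" for s
    using that by (simp add: J_def v_def dist_norm)
  define G' where "G' = (\<lambda>z. G (x + fst z *\<^sub>R v, snd z))"
  have oJ: "open (J \<times> (UNIV :: (real^'a) set))" using J by (intro open_Times open_UNIV)
  have "smooth_in (J \<times> UNIV) G'"
    unfolding G'_def
  proof (rule smooth_in_comp[OF oJ _ G])
    show "smooth_in (J \<times> UNIV) (\<lambda>z::real \<times> (real^'a). (x + fst z *\<^sub>R v, snd z))"
      by (intro smooth_in_Pair smooth_in_add smooth_in_scaleR smooth_in_fst smooth_in_snd smooth_in_const smooth_in_id oJ)
  qed (use xs e(2) in auto)
  then have "tf_has_deriv UNIV (\<lambda>h. \<Phi> (x + h *\<^sub>R v)) (\<lambda>y. dird (1, 0) G' (0, y)) 0"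
  proof (rule tf_has_deriv_joint[OF J _ compact_cball[of 0 r] subset_UNIV])
    show "G' (s, y) = 0" if "s \<in> J" "y \<notin> cball 0 r" for s y
      using r[OF xs[OF that(1)]] that(2) by (simp add: G'_def)
    show "\<Phi> (x + s *\<^sub>R v) y = G' (s, y)" if "s \<in> J" for s y
      using \<Phi>[of "x + s *\<^sub>R v"] xs[OF that] e(2) by (auto simp: G'_def)
  qed
  moreover have "dird (1, 0) G' (0, y) = dird (v, 0) G (x, y)" for y
    by (simp add: dird_def G'_def)
  ultimately have d: "tf_has_deriv UNIV (\<lambda>h. \<Phi> (x + h *\<^sub>R v)) (\<lambda>y. dird (v, 0) G (x, y)) 0"
    by simp
  have t: "(\<lambda>y. dird (v, 0) G (x, y)) \<in> test_funs UNIV"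
    by (rule slice_test_fun[OF smooth_in_dird[OF G] local_supp_dird[OF W(1) s] W(2)])
  show ?thesis
    unfolding tf_partial_def v_def[symmetric]
  proof (rule the_equality)
    show "(\<lambda>y. dird (v, 0) G (x, y)) \<in> test_funs UNIV \<and>
      tf_has_deriv UNIV (\<lambda>h. \<Phi> (x + h *\<^sub>R v)) (\<lambda>y. dird (v, 0) G (x, y)) 0" using d t by simp
    fix g assume g: "g \<in> test_funs UNIV \<and> tf_has_deriv UNIV (\<lambda>h. \<Phi> (x + h *\<^sub>R v)) g 0"
    have "eventually (\<lambda>h. h \<in> J) (at 0)" using eventually_nhds_in_open[OF J] eventually_nhds_conv_at by blast
    then have "eventually (\<lambda>h. (\<lambda>y. (\<Phi> (x + (0 + h) *\<^sub>R v) y - \<Phi> (x + 0 *\<^sub>R v) y) /\<^sub>R h) \<in> test_funs UNIV) (at 0)"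
    proof (rule eventually_mono)
      fix h assume "h \<in> J"
      then have "x + h *\<^sub>R v \<in> W" using xs e(2) by blast
      then have "\<Phi> (x + h *\<^sub>R v) \<in> test_funs UNIV" "\<Phi> x \<in> test_funs UNIV"
        using slice_test_fun[OF G s] \<Phi> W(2) by auto
      then show "(\<lambda>y. (\<Phi> (x + (0 + h) *\<^sub>R v) y - \<Phi> (x + 0 *\<^sub>R v) y) /\<^sub>R h) \<in> test_funs UNIV"
        using test_funs_scale[OF test_funs_diff, of "\<Phi> (x + h *\<^sub>R v)" UNIV "\<Phi> x" "of_real (inverse h)"]
        by (simp add: scaleR_conv_of_real)
    qed
    from tf_tendsto_unique[OF conjunct2[OF g, unfolded tf_has_deriv_def] d[unfolded tf_has_deriv_def]
        at_neq_bot conjunct1[OF g] t this]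
    show "g = (\<lambda>y. dird (v, 0) G (x, y))" .
  qed
qed

abbreviation xaxes :: "'n::finite list => ((real^'n) \<times> (real^'n)) list" where
  "xaxes is \<equiv> map (\<lambda>i. (axis i 1, 0)) is"

lemma foldr_tf_partial_joint:
  assumes W: "open W" and G: "smooth_in (W \<times> UNIV) G" and s: "local_supp W G"
    and \<Phi>: "\<And>x. x \<in> W ==> \<Phi> x = (\<lambda>y. G (x, y))" and x: "x \<in> W"
  shows "foldr tf_partial is \<Phi> x = (\<lambda>y. dirds (xaxes is) G (x, y))"
  using x
proof (induction "is" arbitrary: x)
  case Nil
  then show ?case using \<Phi> by simp
next
  case (Cons i "is")
  have "tf_partial i (foldr tf_partial is \<Phi>) x = (\<lambda>y. dird (axis i 1, 0) (dirds (xaxes is) G) (x, y))"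
    by (rule tf_partial_joint[OF W Cons.prems smooth_in_dirds[OF G] local_supp_dirds[OF W s]]) (rule Cons.IH)
  then show ?case by simp
qed

lemma CbD:
  assumes "\<phi> \<in> Cb \<Omega> q"
  shows "\<And>ep x. 0 < ep ==> ep \<le> 1 ==> x \<in> \<Omega> ==> \<phi> ep x \<in> A_set q UNIV"
    "\<And>e x. smooth_curve e ==> smooth_curve x ==> (\<And>t. e t \<in> {0<..1} \<and> x t \<in> \<Omega>) ==> tf_smooth_curve UNIV (\<lambda>t. \<phi> (e t) (x t))"
    "\<And>K \<alpha>. compact K ==> K \<subseteq> \<Omega> ==> tf_bounded UNIV {tf_mderiv \<alpha> (\<phi> ep) x |ep x. ep \<in> {0<..1} \<and> x \<in> K}"
  using assms unfolding Cb_def by auto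

text \<open>Members of \<open>Cb\<close> are by definition smooth along curves only. With
  \<open>ep\<close> frozen, a curve of points gives a curve of test functions, which is jointly
  smooth in time and space; evaluating it along the space component of the curve yields the premise
  of Boman's theorem.\<close>

lemma Cb_joint:
  assumes "open \<Omega>" "\<phi> \<in> Cb \<Omega> q" "0 < ep" "ep \<le> 1"
  shows "smooth_in (\<Omega> \<times> UNIV) (\<lambda>z. \<phi> ep (fst z) (snd z))"
proof (rule curve_smooth_imp_smooth_in)
  show "open (\<Omega> \<times> (UNIV :: (real^'a) set))" using assms(1) by (intro open_Times open_UNIV)
  show "curve_smooth (\<Omega> \<times> UNIV) (\<lambda>z. \<phi> ep (fst z) (snd z))"
    unfolding curve_smooth_def
  proof (intro allI impI, elim conjE)
    fix z :: "real => (real^'a) \<times> (real^'a)" assume z: "smooth_in UNIV z" "range z \<subseteq> \<Omega> \<times> UNIV"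
    have r: "fst (z t) \<in> \<Omega>" for t using z(2) by (metis mem_Times_iff range_subsetD)
    have "tf_smooth_curve UNIV (\<lambda>t. \<phi> ((\<lambda>_. ep) t) (fst (z t)))"
      by (rule CbD(2)[OF assms(2)])
        (use z assms r in \<open>auto simp: smooth_curve_iff intro!: smooth_in_fst smooth_in_const\<close>)
    from tf_smooth_curve_joint(1)[OF this]
    have "smooth_in UNIV (\<lambda>w. \<phi> ep (fst (z (fst w))) (snd w))" by simp
    from smooth_in_comp[OF open_UNIV smooth_in_Pair[OF open_UNIV smooth_in_id smooth_in_snd[OF open_UNIV z(1)]] this]
    show "smooth_in UNIV (\<lambda>t. \<phi> ep (fst (z t)) (snd (z t)))" by simp
  qed
qed

lemma Cb_supp:
  assumes "\<phi> \<in> Cb \<Omega> q" "compact K" "K \<subseteq> \<Omega>"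
  obtains r where "\<And>ep x y. 0 < ep ==> ep \<le> 1 ==> x \<in> K ==> norm y > r ==> \<phi> ep x y = 0"
proof -
  have eq: "tf_mderiv (\<lambda>_. 0) (\<phi> ep) x = \<phi> ep x" for ep x
    by (simp add: tf_mderiv_def mi_list_zero)
  have b: "tf_bounded UNIV {\<phi> ep x |ep x. ep \<in> {0<..1} \<and> x \<in> K}"
    using CbD(3)[OF assms, of "\<lambda>_. 0"] by (simp only: eq)
  obtain r where r: "\<And>\<psi> y. \<psi> \<in> {\<phi> ep x |ep x. ep \<in> {0<..1} \<and> x \<in> K} ==> norm y > r ==> \<psi> y = 0"
    by (rule tf_bounded_supp[OF b], rule that) blast
  show ?thesis by (rule that[of r], rule r) auto
qed

lemma Cb_local_supp:
  assumes "open \<Omega>" "\<phi> \<in> Cb \<Omega> q" "0 < ep" "ep \<le> 1"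
  shows "local_supp \<Omega> (\<lambda>z. \<phi> ep (fst z) (snd z))"
proof (rule local_suppI[OF assms(1)])
  fix K assume K: "compact K" "K \<subseteq> \<Omega>"
  obtain r where "\<And>ep x y. 0 < ep ==> ep \<le> 1 ==> x \<in> K ==> norm y > r ==> \<phi> ep x y = 0"
    by (rule Cb_supp[OF assms(2) K], rule that) blast
  then show "\<exists>r. \<forall>x\<in>K. \<forall>y. norm y > r --> \<phi> ep (fst (x, y)) (snd (x, y)) = 0"
    using assms(3,4) by auto
qed

lemma Basis_list_split:
  fixes bs :: "((real^'n::finite) \<times> (real^'n)) list"
  assumes "set bs \<subseteq> Basis"
  obtains js "is" where "mset bs = mset (map (Pair 0) (axes js) @ xaxes is)"
  using assms
proof (induction bs arbitrary: thesis)
  case Nil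
  from Nil(1)[of "[]" "[]"] show ?case by simp
next
  case (Cons b bs)
  obtain js "is" where IH: "mset bs = mset (map (Pair 0) (axes js) @ xaxes is)" using Cons.IH Cons.prems(2) by auto
  have "b \<in> Basis" using Cons.prems(2) by simp
  then consider i where "b = (axis i 1, 0)" | j where "b = (0, axis j 1)"
    by (auto simp: Basis_prod_def Basis_eq_axis)
  then show ?case
  proof cases
    case 1
    then show ?thesis using Cons.prems(1)[of js "i # is"] IH by simp
  next
    case 2
    then show ?thesis using Cons.prems(1)[of "j # js" "is"] IH by simp
  qed
qed

text \<open>Boundedness in the space of test functions covers derivatives in \<open>x\<close>, taken
  there, followed by derivatives in \<open>y\<close>, seen by the norms. Symmetry sorts any mixed
  list into this form.\<close>

lemma Cb_bounds:
  assumes \<Omega>: "open \<Omega>" and \<phi>: "\<phi> \<in> Cb \<Omega> q" and K: "compact K" "K \<subseteq> \<Omega>" and bs: "set bs \<subseteq> Basis"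
  shows "\<exists>M. \<forall>ep\<in>{0<..1}. \<forall>z\<in>K \<times> UNIV. norm (dirds bs (\<lambda>z. \<phi> ep (fst z) (snd z)) z) \<le> M"
proof -
  obtain js "is" where m: "mset bs = mset (map (Pair 0) (axes js) @ xaxes is)"
    using Basis_list_split[OF bs] by blast
  let ?B = "{tf_mderiv (count_list is) (\<phi> ep) x |ep x. ep \<in> {0<..1} \<and> x \<in> K}"
  have b: "tf_bounded UNIV ?B" by (rule CbD(3)[OF \<phi> K])
  obtain M where M: "\<And>\<psi>. \<psi> \<in> ?B ==> Cm_norm (length js) \<psi> \<le> M" using tf_bounded_Cm_norm[OF b] by blast
  have "norm (dirds bs (\<lambda>z. \<phi> ep (fst z) (snd z)) (x, y)) \<le> M" if ep: "0 < ep" "ep \<le> 1" and x: "x \<in> K" for ep x y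
  proof -
    let ?G = "\<lambda>z. \<phi> ep (fst z) (snd z)"
    have G: "smooth_in (\<Omega> \<times> UNIV) ?G" "local_supp \<Omega> ?G" and o: "open (\<Omega> \<times> (UNIV :: (real^'a) set))"
      using Cb_joint[OF \<Omega> \<phi> ep] Cb_local_supp[OF \<Omega> \<phi> ep] \<Omega> by (auto intro: open_Times)
    have x\<Omega>: "x \<in> \<Omega>" using x K by blast
    define \<psi> where "\<psi> = tf_mderiv (count_list is) (\<phi> ep) x"
    have "\<psi> = (\<lambda>y. dirds (xaxes (mi_list (count_list is))) ?G (x, y))"
      unfolding \<psi>_def tf_mderiv_def by (rule foldr_tf_partial_joint[OF \<Omega> G _ x\<Omega>]) simp
    then have "dirds (axes js) \<psi> y = dirds (map (Pair 0) (axes js) @ xaxes (mi_list (count_list is))) ?G (x, y)"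
      by (simp add: dirds_slice_snd)
    also have "\<dots> = dirds bs ?G (x, y)"
      by (rule dirds_perm[OF o G(1)]) (use x\<Omega> m mset_mi_list_count_list[of "is"] in \<open>simp_all add: mset_map\<close>)
    finally have eq: "dirds bs ?G (x, y) = dirds (axes js) \<psi> y" ..
    have "\<psi> \<in> ?B" using ep x by (auto simp: \<psi>_def)
    moreover from this have "\<psi> \<in> test_funs UNIV" using b by (auto simp: tf_bounded_def)
    ultimately show ?thesis
      unfolding eq using Cm_norm_ge[of \<psi> UNIV js "length js" y] M[of \<psi>] by simp
  qed
  then show ?thesis by (intro exI[of _ M]) auto
qed

text \<open>Criterion for constructing members of \<open>Cb\<close>: the conditions in the topology
  of test functions become common supports and uniform bounds on ordinary partial
  derivatives.\<close>

lemma CbI: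
  assumes \<Omega>: "open \<Omega>"
    and A: "\<And>ep x. 0 < ep ==> ep \<le> 1 ==> x \<in> \<Omega> ==> \<psi> ep x \<in> A_set q UNIV"
    and sm: "\<And>ep. 0 < ep ==> ep \<le> 1 ==> smooth_in (\<Omega> \<times> UNIV) (\<lambda>z. \<psi> ep (fst z) (snd z))"
    and curves: "\<And>e x. smooth_in UNIV e ==> smooth_in UNIV x ==> (\<And>t::real. 0 < e t \<and> e t \<le> 1 \<and> x t \<in> \<Omega>) ==>
      smooth_in UNIV (\<lambda>z. \<psi> (e (fst z)) (x (fst z)) (snd z))"
    and supp: "\<And>K. compact K ==> K \<subseteq> \<Omega> ==> \<exists>r. \<forall>ep\<in>{0<..1}. \<forall>x\<in>K. \<forall>y. norm y > r --> \<psi> ep x y = 0"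
    and bounds: "\<And>K bs. compact K ==> K \<subseteq> \<Omega> ==> set bs \<subseteq> Basis ==>
      \<exists>M. \<forall>ep\<in>{0<..1}. \<forall>z\<in>K \<times> UNIV. norm (dirds bs (\<lambda>z. \<psi> ep (fst z) (snd z)) z) \<le> M"
  shows "\<psi> \<in> Cb \<Omega> q"
  unfolding Cb_def mem_Collect_eq
proof (intro conjI ballI allI impI)
  show "\<psi> ep x \<in> A_set q UNIV" if "ep \<in> {0<..1}" "x \<in> \<Omega>" for ep x
    using A that by auto
next
  fix e :: "real => real" and x :: "real => real^'a"
  assume *: "smooth_curve e \<and> smooth_curve x \<and> (\<forall>t. e t \<in> {0<..1} \<and> x t \<in> \<Omega>)"
  then have ex: "smooth_in UNIV e" "smooth_in UNIV x" "\<And>t. 0 < e t \<and> e t \<le> 1 \<and> x t \<in> \<Omega>"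
    by (auto simp: smooth_curve_iff)
  show "tf_smooth_curve UNIV (\<lambda>t. \<psi> (e t) (x t))"
  proof (rule tf_smooth_curveI[OF curves[OF ex]])
    fix T :: real
    have "compact (x ` {-T..T})"
      by (rule compact_continuous_image[OF continuous_on_subset[OF smooth_in_continuous[OF ex(2)] subset_UNIV] compact_Icc])
    then obtain r where r: "\<forall>ep\<in>{0<..1}. \<forall>x\<in>x ` {-T..T}. \<forall>y. norm y > r --> \<psi> ep x y = 0"
      using supp[of "x ` {-T..T}"] ex(3) by blast
    have "\<psi> (e t) (x t) y = 0" if "\<bar>t\<bar> < T" "y \<notin> cball 0 r" for t y
    proof -
      have "x t \<in> x ` {-T..T}" using that(1) by (intro imageI) auto
      then show ?thesis using r ex(3)[of t] that(2) by auto
    qed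
    then show "\<exists>K. compact K \<and> K \<subseteq> UNIV \<and> (\<forall>t y. \<bar>t\<bar> < T --> y \<notin> K --> \<psi> (e t) (x t) y = 0)"
      using compact_cball by blast
  qed
next
  fix K :: "(real^'a) set" and \<alpha> assume "compact K \<and> K \<subseteq> \<Omega>"
  then have K: "compact K" "K \<subseteq> \<Omega>" by auto
  have ls: "local_supp \<Omega> (\<lambda>z. \<psi> ep (fst z) (snd z))" if "0 < ep" "ep \<le> 1" for ep
  proof (rule local_suppI[OF \<Omega>])
    show "\<exists>r. \<forall>x\<in>K. \<forall>y. norm y > r --> \<psi> ep (fst (x, y)) (snd (x, y)) = 0" if "compact K" "K \<subseteq> \<Omega>" for K
      using supp[OF that] \<open>0 < ep\<close> \<open>ep \<le> 1\<close> by force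
  qed
  have eq: "tf_mderiv \<alpha> (\<psi> ep) x = (\<lambda>y. dirds (xaxes (mi_list \<alpha>)) (\<lambda>z. \<psi> ep (fst z) (snd z)) (x, y))"
    if "0 < ep" "ep \<le> 1" "x \<in> \<Omega>" for ep x
    unfolding tf_mderiv_def by (rule foldr_tf_partial_joint[OF \<Omega> sm[OF that(1,2)] ls[OF that(1,2)] _ that(3)]) simp
  define D where "D ep = dirds (xaxes (mi_list \<alpha>)) (\<lambda>z. \<psi> ep (fst z) (snd z))" for ep
  obtain e where e: "e > 0" "(\<Union>x\<in>K. cball x e) \<subseteq> \<Omega>"
    using compact_subset_open_imp_cball_epsilon_subset[OF K(1) \<Omega> K(2)] by blast
  \<comment> \<open>Derivatives at points of \<open>K\<close> see a neighbourhood of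
    \<open>K\<close>, so the support bound is taken on a compact neighbourhood.\<close>
  define K' where "K' = {x + y |x y. x \<in> K \<and> y \<in> cball 0 e}"
  have K': "compact K'" unfolding K'_def by (rule compact_sums[OF K(1) compact_cball])
  have "K' \<subseteq> \<Omega>"
  proof
    fix z assume "z \<in> K'"
    then obtain x y where "z = x + y" "x \<in> K" "norm y \<le> e" by (auto simp: K'_def)
    then have "z \<in> (\<Union>x\<in>K. cball x e)" by (auto simp: dist_norm intro!: bexI[of _ x])
    then show "z \<in> \<Omega>" using e(2) by blast
  qed
  from supp[OF K' this] obtain r where
    r0: "\<forall>ep\<in>{0<..1}. \<forall>x\<in>K'. \<forall>y. norm y > r --> \<psi> ep x y = 0" ..
  have r: "\<psi> ep x y = 0" if "0 < ep" "ep \<le> 1" "x \<in> K'" "norm y > r" for ep x y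
    using r0 that by simp
  have Dr: "D ep (x, y) = 0" if "0 < ep" "ep \<le> 1" "x \<in> K" "norm y > r" for ep x y
    unfolding D_def
  proof (rule dirds_outside[of "ball x e \<times> {y. norm y > r}"])
    show "open (ball x e \<times> {y::real^'a. norm y > r})"
      by (intro open_Times open_ball open_Collect_less continuous_intros)
    show "\<psi> ep (fst w) (snd w) = 0" if "w \<in> ball x e \<times> {y. norm y > r}" for w
    proof (rule r)
      have "fst w = x + (fst w - x)" "fst w - x \<in> cball 0 e"
        using that by (auto simp: dist_norm norm_minus_commute)
      then show "fst w \<in> K'" unfolding K'_def using \<open>x \<in> K\<close> by blast
    qed (use that \<open>0 < ep\<close> \<open>ep \<le> 1\<close> in auto)
  qed (use that e in auto)
  let ?B = "{tf_mderiv \<alpha> (\<psi> ep) x |ep x. ep \<in> {0<..1} \<and> x \<in> K}"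
  have B: "\<exists>ep x. 0 < ep \<and> ep \<le> 1 \<and> x \<in> K \<and> x \<in> \<Omega> \<and> \<phi> = (\<lambda>y. D ep (x, y))" if "\<phi> \<in> ?B" for \<phi>
    using that eq K(2) unfolding D_def by fastforce
  show "tf_bounded UNIV ?B"
  proof (rule tf_boundedI)
    show "?B \<subseteq> test_funs UNIV"
    proof
      fix \<phi> assume "\<phi> \<in> ?B"
      then obtain ep x where *: "0 < ep" "ep \<le> 1" "x \<in> \<Omega>" "\<phi> = (\<lambda>y. D ep (x, y))" using B by blast
      show "\<phi> \<in> test_funs UNIV"
        unfolding *(4) D_def
        by (rule slice_test_fun[OF smooth_in_dirds[OF sm[OF *(1,2)]] local_supp_dirds[OF \<Omega> ls[OF *(1,2)]] *(3)])
    qed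
    show "\<phi> y = 0" if "\<phi> \<in> ?B" "norm y > r" for \<phi> y
      using B[OF that(1)] Dr that(2) by auto
    fix bs :: "(real^'a) list" assume bs: "set bs \<subseteq> Basis"
    have "set (map (Pair 0) bs @ xaxes (mi_list \<alpha>)) \<subseteq> Basis"
      using bs by (auto simp: Basis_prod_def Basis_eq_axis)
    from bounds[OF K this] obtain M where
      M0: "\<forall>ep\<in>{0<..1}. \<forall>z\<in>K \<times> UNIV. norm (dirds (map (Pair 0) bs @ xaxes (mi_list \<alpha>)) (\<lambda>z. \<psi> ep (fst z) (snd z)) z) \<le> M" ..
    have M: "norm (dirds (map (Pair 0) bs @ xaxes (mi_list \<alpha>)) (\<lambda>z. \<psi> ep (fst z) (snd z)) (x, y)) \<le> M"
      if "0 < ep" "ep \<le> 1" "x \<in> K" for ep x y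
      using that by (intro M0[rule_format]) auto
    have "norm (dirds bs \<phi> y) \<le> M" if \<phi>: "\<phi> \<in> ?B" for \<phi> y
    proof -
      obtain ep x where *: "0 < ep" "ep \<le> 1" "x \<in> K" "\<phi> = (\<lambda>y. D ep (x, y))" using B[OF \<phi>] by blast
      show ?thesis using M[OF *(1,2,3)] by (simp add: *(4) D_def dirds_slice_snd)
    qed
    then show "\<exists>M. \<forall>\<phi>\<in>?B. \<forall>x. norm (dirds bs \<phi> x) \<le> M" by blast
  qed
qed

section \<open>Integrals and the affine space of test objects\<close>

lemma integrable_compact_supp:
  fixes f :: "'a::euclidean_space => 'b::euclidean_space"
  assumes "continuous_on UNIV f" "\<And>x. norm x > r ==> f x = 0"
  shows "integrable lborel f"
proof -
  have "integrable lborel (\<lambda>x. indicator (cball 0 r) x *\<^sub>R f x)"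
    by (rule borel_integrable_compact[OF compact_cball continuous_on_subset[OF assms(1) subset_UNIV]])
  moreover have "(\<lambda>x. indicator (cball 0 r) x *\<^sub>R f x) = f"
    using assms(2) by (auto simp: indicator_def fun_eq_iff)
  ultimately show ?thesis by simp
qed

lemma A_setD:
  assumes "\<phi> \<in> A_set q \<Omega>"
  shows "\<phi> \<in> test_funs \<Omega>" "(LINT x|lborel. \<phi> x) = 1"
    "\<And>\<alpha>. 1 \<le> mi_deg \<alpha> ==> mi_deg \<alpha> \<le> q ==> (LINT x|lborel. mi_power x \<alpha> *\<^sub>R \<phi> x) = 0"
  using assms by (auto simp: A_set_def)

lemma continuous_mi_power: "continuous_on UNIV (\<lambda>x. mi_power x \<alpha>)"
  unfolding mi_power_def by (intro continuous_intros)

lemma integrable_moment: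
  assumes "\<phi> \<in> test_funs \<Omega>"
  shows "integrable lborel (\<lambda>x. mi_power x \<alpha> *\<^sub>R \<phi> x)" "integrable lborel \<phi>"
proof -
  obtain r where r: "\<And>x. norm x > r ==> \<phi> x = 0" using test_funs_bounded[OF assms] by blast
  note c = smooth_in_continuous[OF test_funsD(1)[OF assms]]
  show "integrable lborel (\<lambda>x. mi_power x \<alpha> *\<^sub>R \<phi> x)"
    by (rule integrable_compact_supp[OF continuous_on_scaleR[OF continuous_mi_power c]]) (use r in auto)
  show "integrable lborel \<phi>" by (rule integrable_compact_supp[OF c r])
qed

text \<open>Unit integral and vanishing moments are affine conditions, so interpolation between test
  objects keeps the order \<open>q\<close>.\<close>

lemma A_set_affine:
  assumes "\<phi> \<in> A_set q UNIV" "\<psi> \<in> A_set q UNIV"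
  shows "(\<lambda>y. \<phi> y + of_real b * (\<psi> y - \<phi> y)) \<in> A_set q UNIV"
proof -
  note t = A_setD(1)[OF assms(1)] A_setD(1)[OF assms(2)]
  have eq: "\<phi> y + of_real b * (\<psi> y - \<phi> y) = of_real (1 - b) * \<phi> y + of_real b * \<psi> y" for y
    by (simp add: algebra_simps)
  have i: "integrable lborel (\<lambda>y. of_real (1 - b) * \<phi> y)" "integrable lborel (\<lambda>y. of_real b * \<psi> y)"
    using integrable_moment(2)[OF t(1)] integrable_moment(2)[OF t(2)] by auto
  have 1: "(LINT y|lborel. of_real (1 - b) * \<phi> y + of_real b * \<psi> y) = 1"
    using A_setD(2)[OF assms(1)] A_setD(2)[OF assms(2)] i by simp
  have 2: "(LINT y|lborel. mi_power y \<alpha> *\<^sub>R (of_real (1 - b) * \<phi> y + of_real b * \<psi> y)) = 0"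
    if "1 \<le> mi_deg \<alpha>" "mi_deg \<alpha> \<le> q" for \<alpha>
  proof -
    have "(LINT y|lborel. mi_power y \<alpha> *\<^sub>R (of_real (1 - b) * \<phi> y + of_real b * \<psi> y)) =
        (LINT y|lborel. of_real (1 - b) * (mi_power y \<alpha> *\<^sub>R \<phi> y) + of_real b * (mi_power y \<alpha> *\<^sub>R \<psi> y))"
      by (simp add: scaleR_add_right)
    also have "\<dots> = (LINT y|lborel. of_real (1 - b) * (mi_power y \<alpha> *\<^sub>R \<phi> y)) + (LINT y|lborel. of_real b * (mi_power y \<alpha> *\<^sub>R \<psi> y))"
      by (intro Bochner_Integration.integral_add integrable_mult_right integrable_moment(1)[OF t(1)]
          integrable_moment(1)[OF t(2)])
    also have "\<dots> = of_real (1 - b) * (LINT y|lborel. mi_power y \<alpha> *\<^sub>R \<phi> y) + of_real b * (LINT y|lborel. mi_power y \<alpha> *\<^sub>R \<psi> y)"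
      by (simp only: integral_mult_right_zero)
    finally show ?thesis using A_setD(3)[OF assms(1) that] A_setD(3)[OF assms(2) that] by simp
  qed
  show ?thesis
    unfolding A_set_def mem_Collect_eq eq using test_funs_lincomb[OF t] 1 2 by blast
qed

lemma A_set_antimono: "p \<le> q ==> A_set q \<Omega> \<subseteq> A_set p \<Omega>"
  by (auto simp: A_set_def)

lemma Cb_antimono: "p \<le> q ==> Cb \<Omega> q \<subseteq> Cb \<Omega> p"
  using A_set_antimono[of p q UNIV] by (fastforce simp: Cb_def)

lemma lborel_integral_scale:
  fixes g :: "'a::euclidean_space => 'b::euclidean_space"
  assumes "ep > 0" "g \<in> borel_measurable borel"
  shows "(LINT y|lborel. g (y /\<^sub>R ep)) = ep ^ DIM('a) *\<^sub>R (LINT y|lborel. g y)"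
proof -
  have [measurable]: "g \<in> borel_measurable borel" by fact
  have "(LINT y|lborel. g (y /\<^sub>R ep)) =
      (LINT y|density (distr lborel borel (\<lambda>x. 0 + ep *\<^sub>R x)) (\<lambda>_. ennreal (\<bar>ep\<bar> ^ DIM('a))). g (y /\<^sub>R ep))"
    using lborel_affine[of ep "0::'a"] assms(1) by (simp only: less_imp_neq[symmetric] not_False_eq_True)
  also have "\<dots> = (LINT y|distr lborel borel (\<lambda>x. 0 + ep *\<^sub>R x). \<bar>ep\<bar> ^ DIM('a) *\<^sub>R g (y /\<^sub>R ep))"
    by (rule integral_density) auto
  also have "\<dots> = (LINT x|lborel. \<bar>ep\<bar> ^ DIM('a) *\<^sub>R g ((0 + ep *\<^sub>R x) /\<^sub>R ep))"
    by (rule integral_distr) auto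
  finally show ?thesis using assms(1) by simp
qed

lemma sparse_sequence_le:
  fixes s :: "nat => real"
  assumes "\<And>k. 0 < s k" "\<And>k. s (Suc k) \<le> s k / 10" "k < l"
  shows "s l \<le> s k / 10"
proof -
  have "s (Suc n) \<le> s n" for n using assms(1)[of n] assms(2)[of n] by linarith
  then have "s l \<le> s (Suc k)" using assms(3) lift_Suc_antimono_le[of s "Suc k" l] by simp
  then show ?thesis using assms(2)[of k] by linarith
qed

text \<open>Windows of relative radius 1/4 around terms that decrease by a factor 10 are far apart.
  If some \<open>s k\<close> is within a factor 2 of \<open>ep0\<close>, only its window can be met
  nearby; otherwise none is met and the index 0 is arbitrary.\<close>

lemma sparse_sequence_isolated:
  fixes s :: "nat => real"
  assumes s: "\<And>k. 0 < s k" "\<And>k. s (Suc k) \<le> s k / 10" and ep0: "ep0 > 0"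
  shows "\<exists>k a b. a < ep0 \<and> ep0 < b \<and> (\<forall>ep j. a < ep \<and> ep < b \<and> j \<noteq> k --> \<not> \<bar>ep - s j\<bar> < s j / 4)"
proof (cases "\<exists>k. s k / 2 < ep0 \<and> ep0 < 2 * s k")
  case True
  then obtain k where k: "s k / 2 < ep0" "ep0 < 2 * s k" by blast
  have "\<not> \<bar>ep - s j\<bar> < s j / 4" if "s k / 2 < ep" "ep < 2 * s k" "j \<noteq> k" for ep j
  proof (cases "j < k")
    case True
    from sparse_sequence_le[of s, OF s True] show ?thesis using that s(1)[of k] s(1)[of j] unfolding abs_less_iff by linarith
  next
    case False
    then have "k < j" using that by simp
    from sparse_sequence_le[of s, OF s this] show ?thesis using that s(1)[of k] s(1)[of j] unfolding abs_less_iff by linarith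
  qed
  then show ?thesis using k by (intro exI[of _ k] exI[of _ "s k / 2"] exI[of _ "2 * s k"]) auto
next
  case False
  have "\<not> \<bar>ep - s j\<bar> < s j / 4" if "ep0 * 4 / 5 < ep" "ep < ep0 * 5 / 4" for ep j
  proof
    assume "\<bar>ep - s j\<bar> < s j / 4"
    then have "s j / 2 < ep0 \<and> ep0 < 2 * s j" using that s(1)[of j] unfolding abs_less_iff by linarith
    then show False using False by blast
  qed
  then show ?thesis using ep0 by (intro exI[of _ 0] exI[of _ "ep0 * 4 / 5"] exI[of _ "ep0 * 5 / 4"]) auto
qed

section \<open>Interpolation of test objects and uniformity of estimates\<close>

lemma dirds_fst_arg: "dirds vs (\<lambda>z. f (fst z)) = (\<lambda>z. dirds (map fst vs) f (fst z))"
  by (induction vs) (simp_all add: dird_def)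

lemma dirds_snd_arg: "dirds vs (\<lambda>z. f (snd z)) = (\<lambda>z. dirds (map snd vs) f (snd z))"
  by (induction vs) (simp_all add: dird_def)

lemma dirds_Pair:
  assumes "open U" "smooth_in U f" "smooth_in U g" "x \<in> U"
  shows "dirds vs (\<lambda>x. (f x, g x)) x = (dirds vs f x, dirds vs g x)"
  using dirds_linear_comp[OF assms(1) smooth_in_Pair[OF assms(1-3)] bounded_linear_fst assms(4), of vs]
    dirds_linear_comp[OF assms(1) smooth_in_Pair[OF assms(1-3)] bounded_linear_snd assms(4), of vs]
  by (simp add: prod_eq_iff)

lemma dirds_id_bound:
  assumes "ws \<noteq> []"
  shows "\<exists>M. \<forall>y. norm (dirds ws (\<lambda>y. y) y) \<le> M"
proof -
  obtain us w where ws: "ws = us @ [w]" using assms by (metis rev_exhaust)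
  have "dird w (\<lambda>y. y) = (\<lambda>_. w)" using dird_bounded_linear[OF bounded_linear_ident] .
  then show ?thesis
    using ws by (intro exI[of _ "norm w"]) (cases "us = []"; simp add: dirds_const)
qed

text \<open>All members of the family share the bounds. The inner maps only have to send
  \<open>K\<close> into \<open>L\<close>, so no bound of order zero is asked of them.\<close>

lemma dbound_comp_family:
  fixes f :: "'i => 'b::euclidean_space => 'c::euclidean_space" and g :: "'i => 'a::euclidean_space => 'b"
  assumes U: "open U" and g: "\<And>i. i \<in> I ==> smooth_in U (g i)" and f: "\<And>i. i \<in> I ==> smooth_in V (f i)"
    and im: "\<And>i. i \<in> I ==> g i ` U \<subseteq> V" and K: "K \<subseteq> U" and L: "\<And>i. i \<in> I ==> g i ` K \<subseteq> L"
    and bg: "\<And>vs. vs \<noteq> [] ==> set vs \<subseteq> Basis ==> \<exists>M. \<forall>i\<in>I. \<forall>x\<in>K. norm (dirds vs (g i) x) \<le> M"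
    and bf: "\<And>vs. set vs \<subseteq> Basis ==> \<exists>M. \<forall>i\<in>I. \<forall>x\<in>L. norm (dirds vs (f i) x) \<le> M"
  shows "\<exists>M. \<forall>i\<in>I. dbound k K (\<lambda>x. f i (g i x)) M"
proof -
  obtain C where C: "\<And>(f::'b => 'c) (g::'a => 'b) U V K L M.
     open U ==> smooth_in U g ==> smooth_in V f ==> g ` U \<subseteq> V ==> K \<subseteq> U ==> 1 \<le> L ==> 0 \<le> M ==>
     (\<forall>b\<in>Basis. dbound (k - 1) K (dird b g) L) ==> dbound k (g ` K) f M ==>
     dbound k K (\<lambda>x. f (g x)) (C * L ^ k * M)"
    using dbound_comp[where 'b='b and 'c='c and 'a='a, of k] by blast
  obtain Mf where Mf: "Mf \<ge> 1" "\<forall>i\<in>I. dbound k L (f i) Mf"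
    using ex_dbound[of k I "\<lambda>_. L" f] bf by blast
  have "\<exists>M\<ge>1. \<forall>i\<in>I. dbound (k - 1) K (dird b (g i)) M" if "b \<in> Basis" for b
  proof (rule ex_dbound)
    show "\<exists>M. \<forall>i\<in>I. \<forall>x\<in>K. norm (dirds vs (dird b (g i)) x) \<le> M" if "set vs \<subseteq> Basis" for vs
      using bg[of "vs @ [b]"] that \<open>b \<in> Basis\<close> by simp
  qed
  then have "\<forall>b\<in>Basis. \<exists>M. M \<ge> 1 \<and> (\<forall>i\<in>I. dbound (k - 1) K (dird b (g i)) M)" by blast
  from bchoice[OF this] obtain Mg where Mg: "\<And>b. b \<in> Basis ==> Mg b \<ge> 1"
    "\<And>b i. b \<in> Basis ==> i \<in> I ==> dbound (k - 1) K (dird b (g i)) (Mg b)" by blast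
  define N where "N = 1 + (\<Sum>b\<in>Basis. Mg b)"
  have N: "N \<ge> 1" unfolding N_def using sum_nonneg[of Basis Mg] Mg(1) by force
  have Nb: "Mg b \<le> N" if "b \<in> Basis" for b
    using member_le_sum[OF that, of Mg] Mg(1) unfolding N_def by force
  have "dbound k K (\<lambda>x. f i (g i x)) (C * N ^ k * Mf)" if i: "i \<in> I" for i
  proof (rule C[OF U g[OF i] f[OF i] im[OF i] K N])
    show "\<forall>b\<in>Basis. dbound (k - 1) K (dird b (g i)) N"
      using dbound_mono[OF Mg(2)[OF _ i] order_refl subset_refl Nb] by blast
    show "dbound k (g i ` K) (f i) Mf"
      using dbound_mono[OF Mf(2)[rule_format, OF i] order_refl L[OF i] order_refl] .
  qed (use Mf in auto)
  then show ?thesis by blast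
qed

text \<open>
  Prescribed values at a sparse sequence of parameters are interpolated by convex combinations
  with a fixed element.
\<close>

lemma Cb_interpolate:
  fixes \<Omega> :: "(real^'n::finite) set"
  assumes \<Omega>: "open \<Omega>" and \<phi>: "\<phi> \<in> Cb \<Omega> q" and K': "compact K'" "K' \<subseteq> \<Omega>"
    and s: "\<And>k. 0 < s k" "\<And>k. s k \<le> 1" "\<And>k. s (Suc k) \<le> s k / 10"
    and \<xi>: "\<And>k. smooth_in UNIV (\<xi> k)" "\<And>k x. \<xi> k x \<in> K'"
    and b\<xi>: "\<And>vs. vs \<noteq> [] ==> \<exists>M. \<forall>k x. norm (dirds vs (\<xi> k) x) \<le> M"
  shows "\<exists>\<psi>\<in>Cb \<Omega> q. \<forall>k. \<psi> (s k) = (\<lambda>x. \<phi> (s k) (\<xi> k x))"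
proof -
  define near where "near k ep \<longleftrightarrow> \<bar>ep - s k\<bar> < s k / 4" for k and ep :: real
  \<comment> \<open>\<open>\<beta> k\<close> is 1 within \<open>s k / 8\<close> of
    \<open>s k\<close> and vanishes where \<open>near k\<close> fails.\<close>
  define \<beta> where "\<beta> k ep = bump ((8 / s k) * (ep - s k))" for k and ep :: real
  \<comment> \<open>Outside all windows \<open>N ep\<close> is an arbitrary index; its weight is
    then 0 and \<open>\<psi>\<close> is the constant family \<open>\<phi>0\<close>.\<close>
  define N where "N ep = (SOME k. near k ep)" for ep
  define \<phi>0 where "\<phi>0 = \<phi> (s 0) (\<xi> 0 0)"
  define P where "P k b x y = \<phi>0 y + of_real b * (\<phi> (s k) (\<xi> k x) y - \<phi>0 y)" for k b x y
  define \<psi> where "\<psi> ep x = P (N ep) (\<beta> (N ep) ep) x" for ep x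
  have \<beta>_near: "\<beta> k ep = 0" if "\<not> near k ep" for k ep
  proof -
    have "norm ((8 / s k) * (ep - s k)) = (8 / s k) * \<bar>ep - s k\<bar>" using s(1)[of k] by (simp only: real_norm_def abs_mult) simp
    moreover have "(8 / s k) * (s k / 4) \<le> (8 / s k) * \<bar>ep - s k\<bar>"
      using that s(1)[of k] unfolding near_def by (intro mult_left_mono) auto
    ultimately have "2 \<le> norm ((8 / s k) * (ep - s k))" using s(1)[of k] by simp
    then show ?thesis unfolding \<beta>_def by (rule bump_0)
  qed
  have near_unique: "k = l" if "near k ep" "near l ep" for k l ep
  proof -
    have "\<not> i < j" if "near i ep" "near j ep" for i j
    proof
      assume "i < j"
      from sparse_sequence_le[of s, OF s(1,3) this] that show False
        using s(1)[of i] s(1)[of j] unfolding near_def abs_less_iff by linarith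
    qed
    then show ?thesis using that by (metis nat_neq_iff)
  qed
  have \<psi>_local: "\<psi> ep x = P k (\<beta> k ep) x" if "\<And>j. j \<noteq> k ==> \<not> near j ep" for ep x k
  proof (cases "near k ep")
    case True
    then have "N ep = k" unfolding N_def using near_unique by (intro some_equality) auto
    then show ?thesis by (simp add: \<psi>_def)
  next
    case False
    then have "\<not> near j ep" for j using that by metis
    then show ?thesis by (simp add: \<psi>_def P_def \<beta>_near fun_eq_iff)
  qed
  have \<beta>_bounds: "0 \<le> \<beta> k ep" "\<beta> k ep \<le> 1" for k ep unfolding \<beta>_def by (rule bump_bounds)+
  have s\<beta>: "smooth_in UNIV (\<beta> k)" for k
    using dirds_affine_arg(2)[OF smooth_bump, of "8 / s k" "s k" "1::real"] by (simp add: \<beta>_def[abs_def])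
  have val: "\<psi> (s k) = (\<lambda>x. \<phi> (s k) (\<xi> k x))" for k
  proof (intro ext)
    fix x y
    have nk: "near k (s k)" using s(1)[of k] by (simp add: near_def)
    then have "\<psi> (s k) x = P k (\<beta> k (s k)) x" by (intro \<psi>_local) (use near_unique in blast)
    moreover have "\<beta> k (s k) = 1" unfolding \<beta>_def by (rule bump_1) simp
    ultimately show "\<psi> (s k) x y = \<phi> (s k) (\<xi> k x) y" by (simp add: P_def)
  qed
  have \<Phi>: "smooth_in (\<Omega> \<times> UNIV) (\<lambda>z. \<phi> (s k) (fst z) (snd z))" for k
    by (rule Cb_joint[OF \<Omega> \<phi> s(1,2)])
  have A: "\<phi> (s k) (\<xi> k x) \<in> A_set q UNIV" for k x
    by (rule CbD(1)[OF \<phi> s(1,2)]) (use \<xi>(2) K'(2) in blast)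
  have A0: "\<phi>0 \<in> A_set q UNIV" unfolding \<phi>0_def by (rule A)
  define g where "g k z = (\<xi> k (fst z), snd z)" for k and z :: "(real^'n) \<times> (real^'n)"
  have s\<xi>: "smooth_in UNIV (\<lambda>z::(real^'n) \<times> (real^'n). \<xi> k (fst z))" for k
    by (rule smooth_in_comp[OF open_UNIV _ \<xi>(1)]) (auto intro: smooth_in_fst)
  have sg: "smooth_in UNIV (g k)" for k
    unfolding g_def by (intro smooth_in_Pair s\<xi> smooth_in_snd smooth_in_id open_UNIV)
  have img: "range (g k) \<subseteq> K' \<times> UNIV" for k using \<xi>(2) by (auto simp: g_def)
  have img\<Omega>: "range (g k) \<subseteq> \<Omega> \<times> UNIV" for k using \<xi>(2)[of k] K'(2) by (auto simp: g_def)
  have s\<Phi>g: "smooth_in UNIV (\<lambda>z. \<phi> (s k) (fst (g k z)) (snd (g k z)))" for k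
    by (rule smooth_in_comp[OF open_UNIV sg \<Phi> img\<Omega>])
  have s\<phi>0: "smooth_in UNIV (\<lambda>z::'w::euclidean_space \<times> (real^'n). \<phi>0 (snd z))"
    by (rule smooth_in_comp[OF open_UNIV _ test_funsD(1)[OF A_setD(1)[OF A0]]])
      (auto intro: smooth_in_snd)
  have joint: "smooth_in UNIV (\<lambda>z. P k b (fst z) (snd z))" for k b
  proof -
    have "smooth_in UNIV (\<lambda>z. \<phi>0 (snd z) + of_real b * (\<phi> (s k) (fst (g k z)) (snd (g k z)) - \<phi>0 (snd z)))"
      by (intro smooth_in_add smooth_in_mult smooth_in_diff smooth_in_const s\<Phi>g s\<phi>0 open_UNIV)
    then show ?thesis by (simp add: P_def g_def)
  qed
  obtain r where r: "\<And>ep x y. 0 < ep ==> ep \<le> 1 ==> x \<in> K' ==> norm y > r ==> \<phi> ep x y = 0"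
    by (rule Cb_supp[OF \<phi> K'], rule that) blast
  have r0: "\<phi>0 y = 0" if "norm y > r" for y
    unfolding \<phi>0_def by (rule r[OF s(1,2) \<xi>(2) that])
  have "\<psi> \<in> Cb \<Omega> q"
  proof (rule CbI[OF \<Omega>])
    show "\<psi> ep x \<in> A_set q UNIV" for ep x
      unfolding \<psi>_def P_def by (rule A_set_affine[OF A0 A])
    show "smooth_in (\<Omega> \<times> UNIV) (\<lambda>z. \<psi> ep (fst z) (snd z))" for ep
      unfolding \<psi>_def using smooth_in_subset[OF joint subset_UNIV] .
    show "\<exists>r. \<forall>ep\<in>{0<..1}. \<forall>x\<in>K. \<forall>y. norm y > r --> \<psi> ep x y = 0" for K
      using r[OF s(1,2) \<xi>(2)] r0 by (intro exI[of _ r]) (simp add: \<psi>_def P_def)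
  next
    fix e :: "real => real" and x :: "real => real^'n"
    assume e: "smooth_in UNIV e" and x: "smooth_in UNIV x" and ex: "\<And>t. 0 < e t \<and> e t \<le> 1 \<and> x t \<in> \<Omega>"
    show "smooth_in UNIV (\<lambda>z. \<psi> (e (fst z)) (x (fst z)) (snd z))"
    proof (rule smooth_in_local_eq)
      fix z0 :: "real \<times> (real^'n)"
      \<comment> \<open>Near each time the curve of scales meets at most one window, so
        \<open>\<psi>\<close> is locally given by a single index.\<close>
      obtain k a b where k: "a < e (fst z0)" "e (fst z0) < b"
        "\<And>ep j. a < ep ==> ep < b ==> j \<noteq> k ==> \<not> near j ep"
        using sparse_sequence_isolated[of s "e (fst z0)", OF s(1,3)] ex unfolding near_def by blast
      define V where "V = (\<lambda>z::real \<times> (real^'n). e (fst z)) -` {a<..<b}"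
      have se: "smooth_in UNIV (\<lambda>z::real \<times> (real^'n). e (fst z))"
        by (rule smooth_in_comp[OF open_UNIV _ e]) (auto intro: smooth_in_fst)
      have sx: "smooth_in UNIV (\<lambda>z::real \<times> (real^'n). (x (fst z), snd z))"
        by (intro smooth_in_Pair smooth_in_snd smooth_in_id open_UNIV smooth_in_comp[OF open_UNIV _ x] smooth_in_fst) auto
      have "smooth_in UNIV (\<lambda>z. (\<phi>0 (snd z)) + of_real (\<beta> k (e (fst z))) *
          (\<phi> (s k) (fst (g k (x (fst z), snd z))) (snd (g k (x (fst z), snd z))) - \<phi>0 (snd z)))"
        by (intro smooth_in_add smooth_in_mult smooth_in_diff s\<phi>0 open_UNIV
            smooth_in_linear_comp[OF open_UNIV bounded_linear_of_real] smooth_in_comp[OF open_UNIV se s\<beta>]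
            smooth_in_comp[OF open_UNIV sx s\<Phi>g]) auto
      moreover have "open V" unfolding V_def by (intro open_vimage smooth_in_continuous[OF se] open_greaterThanLessThan)
      moreover have "\<psi> (e (fst z)) (x (fst z)) (snd z) = (\<phi>0 (snd z)) + of_real (\<beta> k (e (fst z))) *
          (\<phi> (s k) (fst (g k (x (fst z), snd z))) (snd (g k (x (fst z), snd z))) - \<phi>0 (snd z))" if "z \<in> V" for z
        using \<psi>_local[of k "e (fst z)"] k(3)[of "e (fst z)"] that by (simp add: V_def P_def g_def)
      ultimately show "\<exists>V g. open V \<and> z0 \<in> V \<and> smooth_in V g \<and> (\<forall>z\<in>V. \<psi> (e (fst z)) (x (fst z)) (snd z) = g z)"
        using k(1,2) smooth_in_subset[OF _ subset_UNIV] unfolding V_def by (intro exI[of _ V]) (auto simp: V_def intro!: exI)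
    qed
  next
    fix K :: "(real^'n) set" and bs :: "((real^'n) \<times> (real^'n)) list" assume "set bs \<subseteq> Basis"
    have "\<exists>M. \<forall>i\<in>UNIV. dbound (length bs) UNIV (\<lambda>z. (\<lambda>z. \<phi> (s i) (fst z) (snd z)) (g i z)) M"
    proof (rule dbound_comp_family[OF open_UNIV sg \<Phi>, where L = "K' \<times> UNIV"])
      show "range (g i) \<subseteq> \<Omega> \<times> UNIV" "range (g i) \<subseteq> K' \<times> UNIV" for i by (rule img\<Omega>, rule img)
      fix vs :: "((real^'n) \<times> (real^'n)) list"
      show "\<exists>M. \<forall>i\<in>UNIV. \<forall>x\<in>K' \<times> UNIV. norm (dirds vs (\<lambda>z. \<phi> (s i) (fst z) (snd z)) x) \<le> M" if "set vs \<subseteq> Basis"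
        using Cb_bounds[OF \<Omega> \<phi> K' that] s(1,2) by fastforce
      assume "vs \<noteq> []"
      then have ne: "map fst vs \<noteq> []" "map snd vs \<noteq> []" by auto
      obtain M1 where M1: "\<forall>k x. norm (dirds (map fst vs) (\<xi> k) x) \<le> M1" using b\<xi>[OF ne(1)] ..
      obtain M2 where M2: "\<forall>y. norm (dirds (map snd vs) (\<lambda>y. y) y) \<le> M2" using dirds_id_bound[OF ne(2)] ..
      have "norm (dirds vs (g i) z) \<le> M1 + M2" for i z
      proof -
        have "dirds vs (g i) z = (dirds (map fst vs) (\<xi> i) (fst z), dirds (map snd vs) (\<lambda>y. y) (snd z))"
          unfolding g_def using dirds_Pair[OF open_UNIV s\<xi> smooth_in_snd[OF open_UNIV smooth_in_id] UNIV_I]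
          by (simp add: dirds_fst_arg[of vs "\<xi> i"] dirds_snd_arg[of vs "\<lambda>y. y"])
        then show ?thesis
          using order_trans[OF norm_Pair_le add_mono[OF M1[rule_format] M2[rule_format]]] by simp
      qed
      then show "\<exists>M. \<forall>i\<in>UNIV. \<forall>x\<in>UNIV. norm (dirds vs (g i) x) \<le> M" by blast
    qed auto
    then obtain M where M: "\<And>i. dbound (length bs) UNIV (\<lambda>z. \<phi> (s i) (fst (g i z)) (snd (g i z))) M" by auto
    obtain r0 where "\<And>y. norm y > r0 ==> \<phi>0 y = 0" using test_funs_bounded[OF A_setD(1)[OF A0]] by blast
    from dirds_compact_support_bounded[OF test_funsD(1)[OF A_setD(1)[OF A0]] this]
    obtain M0 where M0: "\<And>y. norm (dirds (map snd bs) \<phi>0 y) \<le> M0" by blast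
    have "norm (dirds bs (\<lambda>z. \<psi> ep (fst z) (snd z)) z) \<le> M0 + (M + M0)" for ep z
    proof -
      let ?k = "N ep" and ?b = "\<beta> (N ep) ep"
      let ?F = "\<lambda>z. \<phi> (s ?k) (fst (g ?k z)) (snd (g ?k z))" and ?H = "\<lambda>z::(real^'n) \<times> (real^'n). \<phi>0 (snd z)"
      have eq: "(\<lambda>z. \<psi> ep (fst z) (snd z)) = (\<lambda>z. ?H z + ?b *\<^sub>R (?F z - ?H z))"
        by (simp only: \<psi>_def P_def g_def scaleR_conv_of_real fst_conv snd_conv)
      have eqd: "dirds bs (\<lambda>z. \<psi> ep (fst z) (snd z)) z = dirds bs ?H z + ?b *\<^sub>R (dirds bs ?F z - dirds bs ?H z)"
        unfolding eq
        by (subst dirds_add[OF open_UNIV s\<phi>0 smooth_in_scaleR[OF open_UNIV smooth_in_const smooth_in_diff[OF open_UNIV s\<Phi>g s\<phi>0]] UNIV_I])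
          (simp only: dirds_scaleR[OF open_UNIV smooth_in_diff[OF open_UNIV s\<Phi>g s\<phi>0] UNIV_I] dirds_diff[OF open_UNIV s\<Phi>g s\<phi>0 UNIV_I])
      have n0: "norm (dirds bs ?H z) \<le> M0" unfolding dirds_snd_arg by (rule M0)
      have "norm (dirds bs ?F z) \<le> M" by (rule dboundD[OF M \<open>set bs \<subseteq> Basis\<close>]) auto
      then have d: "norm (dirds bs ?F z - dirds bs ?H z) \<le> M + M0"
        using n0 norm_triangle_ineq4[of "dirds bs ?F z" "dirds bs ?H z"] by linarith
      have "norm (?b *\<^sub>R (dirds bs ?F z - dirds bs ?H z)) \<le> 1 * (M + M0)"
        unfolding norm_scaleR using d \<beta>_bounds[of ?k ep] by (intro mult_mono) auto
      from norm_triangle_mono[OF n0 this] show ?thesis unfolding eqd by simp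
    qed
    then show "\<exists>M. \<forall>ep\<in>{0<..1}. \<forall>z\<in>K \<times> UNIV. norm (dirds bs (\<lambda>z. \<psi> ep (fst z) (snd z)) z) \<le> M" by blast
  qed
  then show ?thesis using val by blast
qed

text \<open>
  An estimate that holds for every test object separately is uniform over reparametrised test
  objects, as a sequence of violations would be attained along a single test object.
\<close>

lemma Cb_uniform:
  fixes \<Omega> :: "(real^'n::finite) set" and H :: "real => (real^'n => 'n tfun) => 'y => 'v::real_normed_vector"
  assumes \<Omega>: "open \<Omega>" and \<phi>: "\<phi> \<in> Cb \<Omega> q" and K': "compact K'" "K' \<subseteq> \<Omega>"
    and \<Xi>: "\<And>\<xi>. \<xi> \<in> \<Xi> ==> smooth_in UNIV \<xi>" "\<And>\<xi> x. \<xi> \<in> \<Xi> ==> \<xi> x \<in> K'"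
    and b\<Xi>: "\<And>vs. vs \<noteq> [] ==> \<exists>M. \<forall>\<xi>\<in>\<Xi>. \<forall>x. norm (dirds vs \<xi> x) \<le> M"
    and H: "\<And>\<psi>. \<psi> \<in> Cb \<Omega> q ==> sup_bigO L (\<lambda>ep. H ep (\<psi> ep)) g"
  shows "\<exists>C>0. \<exists>ep0>0. \<forall>ep. 0 < ep \<and> ep < ep0 -->
    (\<forall>\<xi>\<in>\<Xi>. \<forall>y\<in>L. norm (H ep (\<lambda>x. \<phi> ep (\<xi> x)) y) \<le> C * \<bar>g ep\<bar>)"
proof (rule ccontr)
  assume neg: "\<not> ?thesis"
  have ex: "\<exists>ep \<xi> y. 0 < ep \<and> ep < e \<and> \<xi> \<in> \<Xi> \<and> y \<in> L \<and> norm (H ep (\<lambda>x. \<phi> ep (\<xi> x)) y) > C * \<bar>g ep\<bar>"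
    if "C > 0" "e > 0" for C e
    using neg that by (meson not_le)
  define P where "P = (\<lambda>k (ep, \<xi>, y). 0 < ep \<and> ep < 1 / real (Suc k) \<and> \<xi> \<in> \<Xi> \<and> y \<in> L \<and>
    norm (H ep (\<lambda>x. \<phi> ep (\<xi> x)) y) > real (Suc k) * \<bar>g ep\<bar>)"
  \<comment> \<open>The factor 1/10 provides the sparseness needed for interpolation; constants
    \<open>Suc k\<close> at scales below \<open>1 / real (Suc k)\<close> contradict any single
    estimate.\<close>
  have "\<exists>f. \<forall>k. P k (f k) \<and> fst (f (Suc k)) \<le> fst (f k) / 10"
  proof (rule dependent_nat_choice)
    show "\<exists>x. P 0 x" using ex[of 1 1] by (auto simp: P_def)
    fix x k assume "P k x"
    then have "0 < min (fst x / 10) (1 / real (Suc (Suc k)))" by (auto simp: P_def)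
    from ex[OF _ this, of "real (Suc (Suc k))"] obtain ep \<xi> y where
      "0 < ep" "ep < min (fst x / 10) (1 / real (Suc (Suc k)))" "\<xi> \<in> \<Xi>" "y \<in> L"
      "norm (H ep (\<lambda>x. \<phi> ep (\<xi> x)) y) > real (Suc (Suc k)) * \<bar>g ep\<bar>" by auto
    then show "\<exists>z. P (Suc k) z \<and> fst z \<le> fst x / 10"
      by (intro exI[of _ "(ep, \<xi>, y)"]) (auto simp: P_def)
  qed
  then obtain f where f: "\<And>k. P k (f k)" "\<And>k. fst (f (Suc k)) \<le> fst (f k) / 10" by blast
  define s \<xi> y where "s k = fst (f k)" and "\<xi> k = fst (snd (f k))" and "y k = snd (snd (f k))" for k
  have sxy: "0 < s k" "s k < 1 / real (Suc k)" "\<xi> k \<in> \<Xi>" "y k \<in> L"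
    "norm (H (s k) (\<lambda>x. \<phi> (s k) (\<xi> k x)) (y k)) > real (Suc k) * \<bar>g (s k)\<bar>" for k
    using f(1)[of k] by (auto simp: P_def s_def \<xi>_def y_def split: prod.splits)
  have s1: "s k \<le> 1" for k
  proof -
    have "1 / real (Suc k) \<le> 1" by simp
    then show ?thesis using sxy(2)[of k] by linarith
  qed
  have s10: "s (Suc k) \<le> s k / 10" for k using f(2)[of k] by (simp add: s_def)
  have bM: "\<exists>M. \<forall>k x. norm (dirds vs (\<xi> k) x) \<le> M" if "vs \<noteq> []" for vs
    using b\<Xi>[OF that] sxy(3) by meson
  have "\<exists>\<psi>\<in>Cb \<Omega> q. \<forall>k. \<psi> (s k) = (\<lambda>x. \<phi> (s k) (\<xi> k x))"
    by (rule Cb_interpolate[where s=s and \<xi>=\<xi>, OF \<Omega> \<phi> K' sxy(1) s1 s10 \<Xi>(1)[OF sxy(3)] \<Xi>(2)[OF sxy(3)] bM])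
  then obtain \<psi> where \<psi>: "\<psi> \<in> Cb \<Omega> q" "\<And>k. \<psi> (s k) = (\<lambda>x. \<phi> (s k) (\<xi> k x))" by auto
  obtain C e where C: "C > 0" "e > 0" "\<And>ep y. 0 < ep ==> ep < e ==> y \<in> L ==> norm (H ep (\<psi> ep) y) \<le> C * \<bar>g ep\<bar>"
    using H[OF \<psi>(1)] unfolding sup_bigO_def by blast
  obtain k :: nat where k: "real k > max C (1 / e)" using reals_Archimedean2 by blast
  have "1 / real (Suc k) < e" using k C(2) by (auto simp: field_simps)
  then have "norm (H (s k) (\<psi> (s k)) (y k)) \<le> C * \<bar>g (s k)\<bar>"
    using sxy(1,2)[of k] by (intro C(3) sxy(4)) auto
  also have "\<dots> \<le> real (Suc k) * \<bar>g (s k)\<bar>" using k by (intro mult_right_mono) auto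
  finally show False using sxy(5)[of k] unfolding \<psi>(2) by simp
qed

section \<open>Differentiation under the integral sign\<close>

lemma integral_eq_integral_cbox:
  fixes f :: "'a::euclidean_space => 'b::euclidean_space"
  assumes "continuous_on UNIV f" "\<And>x. norm x > r ==> f x = 0" "cball 0 r \<subseteq> cbox a b"
  shows "(LINT x|lborel. f x) = integral (cbox a b) f"
proof -
  have z: "f x = 0" if "x \<notin> cbox a b" for x
    using that assms(2,3) by (metis mem_cball_0 not_le subsetD)
  have feq: "f = (\<lambda>x. if x \<in> cbox a b then f x else 0)" using z by auto
  have "(LINT x|lborel. f x) = integral UNIV f"
    using integral_lborel[OF integrable_compact_supp[OF assms(1,2)]] by simp
  also have "\<dots> = integral UNIV (\<lambda>x. if x \<in> cbox a b then f x else 0)" by (rule arg_cong[OF feq])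
  also have "\<dots> = integral (cbox a b) f" by (rule Henstock_Kurzweil_Integration.integral_restrict_UNIV)
  finally show ?thesis .
qed

lemma has_vector_derivative_integral:
  fixes G :: "real \<times> 'a::euclidean_space => 'b::euclidean_space"
  assumes J: "open J" "t \<in> J" and G: "smooth_in (J \<times> UNIV) G"
    and z: "\<And>s y. s \<in> J ==> norm y > r ==> G (s, y) = 0"
  shows "((\<lambda>s. LINT y|lborel. G (s, y)) has_vector_derivative (LINT y|lborel. dird (1, 0) G (t, y))) (at t)"
proof -
  obtain e where e: "e > 0" "cball t e \<subseteq> J" using J open_contains_cball by blast
  obtain a where a: "cball (0::'a) r \<subseteq> cbox (- a) a"
    using bounded_subset_cbox_symmetric[OF bounded_cball] by blast
  have sl: "smooth_in UNIV (\<lambda>y. H (s, y))" if "smooth_in (J \<times> UNIV) H" "s \<in> J" for H :: "real \<times> 'a => 'b" and s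
    by (rule smooth_in_comp[OF open_UNIV _ that(1)])
      (use that(2) in \<open>auto intro!: smooth_in_Pair smooth_in_const smooth_in_id\<close>)
  note G' = smooth_in_dird[OF G, of "(1, 0)"]
  have z': "dird (1, 0) G (s, y) = 0" if "s \<in> J" "norm y > r" for s y
  proof -
    have "open (J \<times> {y::'a. norm y > r})" by (intro open_Times J open_Collect_less continuous_intros)
    then show ?thesis
      using dirds_outside[of "J \<times> {y. norm y > r}" "(s, y)" G "[(1, 0)]"] that z by auto
  qed
  have eq: "(LINT y|lborel. G (s, y)) = integral (cbox (- a) a) (\<lambda>y. G (s, y))"
    "(LINT y|lborel. dird (1, 0) G (s, y)) = integral (cbox (- a) a) (\<lambda>y. dird (1, 0) G (s, y))" if "s \<in> J" for s
    using integral_eq_integral_cbox[OF smooth_in_continuous[OF sl[OF G that]] z[OF that] a]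
      integral_eq_integral_cbox[OF smooth_in_continuous[OF sl[OF G' that]] z'[OF that] a] by auto
  have "((\<lambda>s. integral (cbox (- a) a) (\<lambda>y. G (s, y))) has_vector_derivative
      integral (cbox (- a) a) (\<lambda>y. dird (1, 0) G (t, y))) (at t within cball t e)"
  proof (rule leibniz_rule_vector_derivative)
    fix s y assume s: "s \<in> cball t e"
    have "((\<lambda>h. G ((0, y) + h *\<^sub>R (1, 0))) has_vector_derivative dird (1, 0) G (s, y)) (at s)"
      using has_vector_derivative_line[of G "\<lambda>v. dird v G (s, y)" "(0, y)" s "(1, 0)"]
        has_derivative_dird[OF smooth_in_differentiable[OF G, of "(s, y)"]] s e(2) by auto
    then show "((\<lambda>s. G (s, y)) has_vector_derivative dird (1, 0) G (s, y)) (at s within cball t e)"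
      by (simp add: has_vector_derivative_at_within)
  next
    show "(\<lambda>y. G (s, y)) integrable_on cbox (- a) a" if "s \<in> cball t e" for s
      using sl[OF G, of s] that e(2)
      by (intro integrable_continuous continuous_on_subset[OF smooth_in_continuous subset_UNIV]) auto
    have "(\<lambda>(x, t). dird (1, 0) G (x, t)) = dird (1, 0) G" by auto
    then show "continuous_on (cball t e \<times> cbox (- a) a) (\<lambda>(x, t). dird (1, 0) G (x, t))"
      using continuous_on_subset[OF smooth_in_continuous[OF G']] e(2) by (metis Sigma_mono top_greatest)
  qed (use e in auto)
  then have "((\<lambda>s. integral (cbox (- a) a) (\<lambda>y. G (s, y))) has_vector_derivative
      integral (cbox (- a) a) (\<lambda>y. dird (1, 0) G (t, y))) (at t)"
    using at_within_interior[of t "cball t e"] e(1) by (simp add: interior_cball)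
  then show ?thesis
    unfolding eq(2)[OF J(2)]
    by (rule has_vector_derivative_transform_within_open[OF _ J]) (simp add: eq(1))
qed

lemma local_supp_comp:
  assumes "open W" "local_supp V G" "smooth_in W c" "c ` W \<subseteq> V"
  shows "local_supp W (\<lambda>z. G (c (fst z), snd z))"
proof (rule local_suppI[OF assms(1)])
  fix K assume K: "compact K" "K \<subseteq> W"
  have "compact (c ` K)"
    by (rule compact_continuous_image[OF continuous_on_subset[OF smooth_in_continuous[OF assms(3)] K(2)] K(1)])
  moreover have "c ` K \<subseteq> V" using K(2) assms(4) by blast
  ultimately obtain r where "\<forall>x\<in>c ` K. \<forall>y. norm y > r --> G (x, y) = 0"
    using local_supp_compact[OF assms(2)] by blast
  then show "\<exists>r. \<forall>x\<in>K. \<forall>y. norm y > r --> G (c (fst (x, y)), snd (x, y)) = 0" by auto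
qed

lemma smooth_in_comp_fst:
  fixes G :: "'b::euclidean_space \<times> 'c::euclidean_space => 'e::euclidean_space" and c :: "'a::euclidean_space => 'b"
  assumes "open W" "smooth_in (V \<times> UNIV) G" "smooth_in W c" "c ` W \<subseteq> V"
  shows "smooth_in (W \<times> UNIV) (\<lambda>z. G (c (fst z), snd z))"
proof (rule smooth_in_comp[OF _ _ assms(2)])
  show o: "open (W \<times> (UNIV :: 'c set))" using assms(1) by (intro open_Times open_UNIV)
  show "smooth_in (W \<times> UNIV) (\<lambda>z::'a \<times> 'c. (c (fst z), snd z))"
    by (intro smooth_in_Pair smooth_in_snd smooth_in_id o smooth_in_comp[OF o _ assms(3)] smooth_in_fst) auto
qed (use assms(4) in auto)

text \<open>By Boman's theorem only curves of parameters matter, and for one real parameter the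
  derivative passes under the integral because supports are bounded for all nearby
  parameters.\<close>

lemma smooth_in_integral:
  fixes h :: "'p::euclidean_space \<times> (real^'n::finite) => 'b::euclidean_space"
  assumes W: "open W" and h: "smooth_in (W \<times> UNIV) h" "local_supp W h"
  shows "smooth_in W (\<lambda>w. LINT y|lborel. h (w, y))"
proof (rule curve_smooth_imp_smooth_in[OF W], unfold curve_smooth_def, intro allI impI, elim conjE)
  fix c :: "real => 'p" assume c: "smooth_in UNIV c" "range c \<subseteq> W"
  define H where "H = (\<lambda>z. h (c (fst z), snd z))"
  have H: "smooth_in (UNIV \<times> UNIV) H" "local_supp UNIV H"
    unfolding H_def using smooth_in_comp_fst[OF open_UNIV h(1) c] local_supp_comp[OF open_UNIV h(2) c] by auto
  define d where "d k t = (LINT y|lborel. dirds (replicate k (1, 0)) H (t, y))" for k t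
  have "(d k has_vector_derivative d (Suc k) t) (at t)" for k t
  proof -
    obtain r where r: "\<forall>s\<in>cball t 1. \<forall>y. norm y > r --> dirds (replicate k (1, 0)) H (s, y) = 0"
      using local_supp_compact[OF local_supp_dirds[OF open_UNIV H(2)] compact_cball subset_UNIV] by blast
    have s: "smooth_in (ball t 1 \<times> UNIV) (dirds (replicate k (1, 0)) H)"
      by (rule smooth_in_subset[OF smooth_in_dirds[OF H(1)]]) auto
    have "((\<lambda>s. LINT y|lborel. dirds (replicate k (1, 0)) H (s, y)) has_vector_derivative
        (LINT y|lborel. dird (1, 0) (dirds (replicate k (1, 0)) H) (t, y))) (at t)"
      by (rule has_vector_derivative_integral[OF open_ball _ s, of _ r]) (use r in auto)
    then show ?thesis by (simp add: d_def[abs_def])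
  qed
  then have "smooth_curve (d 0)" unfolding smooth_curve_def by blast
  then show "smooth_in UNIV (\<lambda>t. LINT y|lborel. h (c t, y))"
    by (simp add: smooth_curve_iff d_def[abs_def] H_def)
qed

lemma dird_integral:
  fixes h :: "'p::euclidean_space \<times> (real^'n::finite) => 'b::euclidean_space"
  assumes W: "open W" "w \<in> W" and h: "smooth_in (W \<times> UNIV) h" "local_supp W h"
  shows "dird v (\<lambda>w. LINT y|lborel. h (w, y)) w = (LINT y|lborel. dird (v, 0) h (w, y))"
proof -
  define J where "J = (\<lambda>s::real. w + s *\<^sub>R v) -` W"
  have J: "open J" "0 \<in> J"
    unfolding J_def using W by (auto intro!: open_vimage continuous_intros)
  have sc: "smooth_in J (\<lambda>s. w + s *\<^sub>R v)"
    by (intro smooth_in_add smooth_in_scaleR smooth_in_const smooth_in_id J)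
  have im: "(\<lambda>s. w + s *\<^sub>R v) ` J \<subseteq> W" by (auto simp: J_def)
  define G where "G = (\<lambda>z. h (w + fst z *\<^sub>R v, snd z))"
  have G: "smooth_in (J \<times> UNIV) G" "local_supp J G"
    unfolding G_def using smooth_in_comp_fst[OF J(1) h(1) sc im] local_supp_comp[OF J(1) h(2) sc im] by auto
  obtain e where e: "e > 0" "cball 0 e \<subseteq> J" using J open_contains_cball by blast
  obtain r where r: "\<forall>s\<in>cball 0 e. \<forall>y. norm y > r --> G (s, y) = 0"
    using local_supp_compact[OF G(2) compact_cball e(2)] by blast
  have s: "smooth_in (ball 0 e \<times> UNIV) G"
    by (rule smooth_in_subset[OF G(1)]) (use e(2) in auto)
  have "((\<lambda>s. LINT y|lborel. G (s, y)) has_vector_derivative (LINT y|lborel. dird (1, 0) G (0, y))) (at 0)"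
    by (rule has_vector_derivative_integral[OF open_ball _ s, of _ r]) (use r e(1) in auto)
  moreover have "dird (1, 0) G (0, y) = dird (v, 0) h (w, y)" for y
    by (simp add: dird_def G_def)
  ultimately show ?thesis
    unfolding dird_def[of v] by (intro vector_derivative_at) (simp add: G_def)
qed

lemma dirds_integral:
  fixes h :: "'p::euclidean_space \<times> (real^'n::finite) => 'b::euclidean_space"
  assumes W: "open W" "w \<in> W" and h: "smooth_in (W \<times> UNIV) h" "local_supp W h"
  shows "dirds vs (\<lambda>w. LINT y|lborel. h (w, y)) w = (LINT y|lborel. dirds (map (\<lambda>v. (v, 0)) vs) h (w, y))"
  using W(2)
proof (induction vs arbitrary: w)
  case (Cons v vs)
  have "dird v (dirds vs (\<lambda>w. LINT y|lborel. h (w, y))) w =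
      dird v (\<lambda>w. LINT y|lborel. dirds (map (\<lambda>v. (v, 0)) vs) h (w, y)) w"
    by (rule dird_cong[OF W(1) Cons.prems Cons.IH])
  also have "\<dots> = (LINT y|lborel. dird (v, 0) (dirds (map (\<lambda>v. (v, 0)) vs) h) (w, y))"
    by (rule dird_integral[OF W(1) Cons.prems smooth_in_dirds[OF h(1)] local_supp_dirds[OF W(1) h(2)]])
  finally show ?case by simp
qed simp

section \<open>Scaled test objects as arguments of smooth maps\<close>

lemma S_op_outside:
  assumes "\<And>y. norm y > r ==> \<phi> y = 0" "ep > 0" "norm y > ep * r"
  shows "S_op ep \<phi> y = 0"
proof -
  have "norm (y /\<^sub>R ep) > r" using assms(2,3) by (simp add: field_simps)
  then show ?thesis using assms(1) by (simp add: S_op_def)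
qed

lemma S_op_A_set:
  assumes \<phi>: "\<phi> \<in> A_set 0 UNIV" and ep: "ep > 0"
  shows "S_op ep \<phi> \<in> A_set 0 (UNIV :: (real^'n::finite) set)"
proof -
  note t = A_setD(1)[OF \<phi>]
  obtain r where r: "\<And>y. norm y > r ==> \<phi> y = 0" using test_funs_bounded[OF t] by blast
  have sm: "smooth_in UNIV (S_op ep \<phi>)"
    unfolding S_op_def
    by (intro smooth_in_scaleR smooth_in_const open_UNIV smooth_in_comp[OF open_UNIV _ test_funsD(1)[OF t]] smooth_in_id) auto
  have out: "S_op ep \<phi> y = 0" if "norm y > ep * r" for y
    by (rule S_op_outside[where r=r, OF r ep that])
  have 1: "S_op ep \<phi> \<in> test_funs UNIV"
    by (rule test_funsI(1)[OF sm compact_cball[of 0 "ep * r"] subset_UNIV]) (use out in auto)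
  have "(LINT y|lborel. S_op ep \<phi> y) = (LINT y|lborel. \<phi> (y /\<^sub>R ep)) /\<^sub>R ep ^ CARD('n)"
    unfolding S_op_def by (rule integral_scaleR_right)
  also have "(LINT y|lborel. \<phi> (y /\<^sub>R ep)) = ep ^ CARD('n) *\<^sub>R (LINT y|lborel. \<phi> y)"
    using lborel_integral_scale[OF ep, of \<phi>] borel_measurable_continuous_onI[OF smooth_in_continuous[OF test_funsD(1)[OF t]]]
    by simp
  finally have "(LINT y|lborel. S_op ep \<phi> y) = 1"
    using A_setD(2)[OF \<phi>] ep by simp
  then show ?thesis using 1 by (auto simp: A_set_def)
qed

lemma U_setI:
  assumes "\<phi> \<in> A_set 0 UNIV" "\<And>y. norm y > r ==> \<phi> y = 0" "cball x r \<subseteq> \<Omega>" "x \<in> \<Omega>"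
  shows "(\<phi>, x) \<in> U_set \<Omega>"
proof -
  have "supp \<phi> \<subseteq> cball 0 r" using assms(2) by (simp add: supp_cball_iff)
  then have "(\<lambda>y. y + x) ` supp \<phi> \<subseteq> cball x r" by (auto simp: dist_norm)
  then show ?thesis using assms by (auto simp: U_set_def)
qed

text \<open>Turns smoothness along curves in \<open>U_set\<close> into ordinary smoothness in
  finitely many parameters. Along a curve of parameters the translated test objects are jointly
  smooth with supports in \<open>K\<close>, hence form a smooth curve; Boman's theorem then
  applies.\<close>

lemma smooth_maps_comp:
  fixes \<psi> :: "'p::euclidean_space => 'n::finite tfun" and R :: "'n tfun \<times> (real^'n) => 'v::euclidean_space"
  assumes R: "R \<in> smooth_maps \<Omega> V" and P: "open P"
    and \<psi>: "smooth_in (P \<times> UNIV) (\<lambda>z. \<psi> (fst z) (snd z))" "\<And>p. p \<in> P ==> \<psi> p \<in> A_set 0 UNIV"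
    and x: "smooth_in P x" and s: "\<And>p y. p \<in> P ==> norm y > \<rho> ==> \<psi> p y = 0"
    and K: "compact K" "K \<subseteq> \<Omega>" "\<And>p. p \<in> P ==> x p \<in> K \<and> cball (x p) \<rho> \<subseteq> K"
  shows "smooth_in P (\<lambda>p. R (\<psi> p, x p))" "\<And>p. p \<in> P ==> (\<psi> p, x p) \<in> U_set \<Omega>"
proof -
  show U: "(\<psi> p, x p) \<in> U_set \<Omega>" if "p \<in> P" for p
    by (rule U_setI[OF \<psi>(2)[OF that] s[OF that]]) (use K(2,3) that in blast)+
  show "smooth_in P (\<lambda>p. R (\<psi> p, x p))"
  proof (rule curve_smooth_imp_smooth_in[OF P], unfold curve_smooth_def, intro allI impI, elim conjE)
    fix c :: "real => 'p" assume c: "smooth_in UNIV c" "range c \<subseteq> P"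
    then have cP: "c t \<in> P" for t by blast
    have sx: "smooth_in UNIV (\<lambda>t. x (c t))" by (rule smooth_in_comp[OF open_UNIV c(1) x c(2)])
    have sc: "smooth_in UNIV (\<lambda>z::real \<times> (real^'n). f (fst z))" if "smooth_in UNIV f" for f :: "real => 'q::euclidean_space"
      by (rule smooth_in_comp[OF open_UNIV _ that]) (auto intro: smooth_in_fst)
    have "smooth_in UNIV (\<lambda>z::real \<times> (real^'n). (c (fst z), snd z - x (c (fst z))))"
      by (intro smooth_in_Pair smooth_in_diff smooth_in_snd smooth_in_id open_UNIV sc c(1) sc[OF sx])
    then have "smooth_in UNIV (\<lambda>z::real \<times> (real^'n). (\<lambda>z. \<psi> (fst z) (snd z)) (c (fst z), snd z - x (c (fst z))))"
      by (rule smooth_in_comp[OF open_UNIV _ \<psi>(1)]) (use cP in auto)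
    then have j: "smooth_in UNIV (\<lambda>z. T_op (x (c (fst z))) (\<psi> (c (fst z))) (snd z))"
      by (simp add: T_op_def)
    have "tf_smooth_curve \<Omega> (\<lambda>t. T_op (x (c t)) (\<psi> (c t)))"
    proof (rule tf_smooth_curveI[OF j])
      have "T_op (x (c t)) (\<psi> (c t)) y = 0" if "y \<notin> K" for t y
      proof -
        have "y \<notin> cball (x (c t)) \<rho>" using K(3)[OF cP] that by blast
        then show ?thesis unfolding T_op_def by (intro s cP) (simp add: dist_norm norm_minus_commute)
      qed
      then show "\<exists>K. compact K \<and> K \<subseteq> \<Omega> \<and> (\<forall>t y. \<bar>t\<bar> < T --> y \<notin> K --> T_op (x (c t)) (\<psi> (c t)) y = 0)" for T :: real
        using K(1,2) by blast
    qed
    then have "U_smooth_curve \<Omega> (\<lambda>t. (\<psi> (c t), x (c t)))"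
      unfolding U_smooth_curve_def using U cP sx by (simp add: smooth_curve_iff)
    then show "smooth_in UNIV (\<lambda>t. R (\<psi> (c t), x (c t)))"
      using R unfolding smooth_maps_def smooth_curve_iff by blast
  qed
qed

text \<open>Estimates are taken on the closed neighbourhood, which is compact with \<open>K\<close>;
  smoothness is used on its open counterpart \<open>nbo\<close>.\<close>

definition nb :: "'a::metric_space set => real => 'a set" where
  "nb K \<delta> = (\<Union>k\<in>K. cball k \<delta>)"

definition nbo :: "'a::metric_space set => real => 'a set" where
  "nbo K \<delta> = (\<Union>k\<in>K. ball k \<delta>)"

lemma open_nbo: "open (nbo K \<delta>)" by (auto simp: nbo_def)

lemma nbo_subset_nb: "nbo K \<delta> \<subseteq> nb K \<delta>" by (force simp: nbo_def nb_def)

lemma subset_nbo: "\<delta> > 0 ==> K \<subseteq> nbo K \<delta>" by (force simp: nbo_def)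

lemma subset_nb: "\<delta> \<ge> 0 ==> K \<subseteq> nb K \<delta>" by (force simp: nb_def)

lemma nb_mono: "\<delta> \<le> \<delta>' ==> nb K \<delta> \<subseteq> nb K \<delta>'" by (force simp: nb_def)

lemma cball_subset_nb: "x \<in> nb K \<delta> ==> cball x \<eta> \<subseteq> nb K (\<delta> + \<eta>)"
proof
  fix y assume "x \<in> nb K \<delta>" "y \<in> cball x \<eta>"
  then obtain k where "k \<in> K" "dist k x \<le> \<delta>" "dist x y \<le> \<eta>" by (auto simp: nb_def)
  then have "dist k y \<le> \<delta> + \<eta>" using dist_triangle[of k y x] by linarith
  then show "y \<in> nb K (\<delta> + \<eta>)" using \<open>k \<in> K\<close> by (auto simp: nb_def)
qed

lemma compact_nb:
  fixes K :: "'a::euclidean_space set"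
  assumes "compact K"
  shows "compact (nb K \<delta>)"
proof -
  have eq: "nb K \<delta> = {x + y |x y. x \<in> K \<and> y \<in> cball 0 \<delta>}"
  proof
    show "nb K \<delta> \<subseteq> {x + y |x y. x \<in> K \<and> y \<in> cball 0 \<delta>}"
    proof
      fix z assume "z \<in> nb K \<delta>"
      then obtain k where "k \<in> K" "dist k z \<le> \<delta>" by (auto simp: nb_def)
      then have "z = k + (z - k)" "z - k \<in> cball 0 \<delta>" by (auto simp: dist_norm norm_minus_commute)
      then show "z \<in> {x + y |x y. x \<in> K \<and> y \<in> cball 0 \<delta>}" using \<open>k \<in> K\<close> by blast
    qed
    show "{x + y |x y. x \<in> K \<and> y \<in> cball 0 \<delta>} \<subseteq> nb K \<delta>"
      by (auto simp: nb_def dist_norm intro!: bexI)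
  qed
  show ?thesis unfolding eq by (rule compact_sums[OF assms compact_cball])
qed

lemma nb_exists:
  fixes K :: "'a::euclidean_space set"
  assumes "compact K" "open \<Omega>" "K \<subseteq> \<Omega>"
  obtains \<delta> where "\<delta> > 0" "nb K (2 * \<delta>) \<subseteq> \<Omega>"
proof -
  obtain e where "e > 0" "(\<Union>x\<in>K. cball x e) \<subseteq> \<Omega>"
    using compact_subset_open_imp_cball_epsilon_subset[OF assms] by blast
  then show ?thesis using that[of "e / 2"] by (simp add: nb_def)
qed

text \<open>The supports of \<open>\<phi> ep x\<close> for \<open>x\<close> near \<open>K\<close>
  lie in one ball, so at small scales they have radius at most \<open>\<delta>\<close> and can be
  translated to any point near \<open>L\<close>. The point inside the test object and the second
  variable are kept apart, as point values and mixed derivatives need them to be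
  independent.\<close>

lemma smooth_maps_Cb:
  fixes R :: "'n::finite tfun \<times> (real^'n) => 'v::euclidean_space"
  assumes \<Omega>: "open \<Omega>" and \<phi>: "\<phi> \<in> Cb \<Omega> q" and R: "R \<in> smooth_maps \<Omega> V" and \<delta>: "\<delta> > 0"
    and K: "compact K" "nb K (2 * \<delta>) \<subseteq> \<Omega>" and L: "compact L" "nb L (2 * \<delta>) \<subseteq> \<Omega>"
  obtains e where "e > 0" "e \<le> 1"
    "\<And>ep. 0 < ep ==> ep < e ==> smooth_in (nbo K \<delta> \<times> nbo L \<delta>) (\<lambda>z. R (S_op ep (\<phi> ep (fst z)), snd z))"
    "\<And>ep x y. 0 < ep ==> ep < e ==> x \<in> nbo K \<delta> ==> y \<in> nbo L \<delta> ==> (S_op ep (\<phi> ep x), y) \<in> U_set \<Omega>"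
    "\<And>ep x y. 0 < ep ==> ep < e ==> x \<in> nbo K \<delta> ==> norm y > \<delta> ==> S_op ep (\<phi> ep x) y = 0"
proof -
  have K\<Omega>: "nbo K \<delta> \<subseteq> nb K \<delta>" "nb K \<delta> \<subseteq> \<Omega>" and L2: "nbo L \<delta> \<subseteq> nb L \<delta>" "nb L \<delta> \<subseteq> nb L (2 * \<delta>)"
    using nbo_subset_nb nb_mono[of \<delta> "2 * \<delta>"] \<delta> K(2) by fastforce+
  obtain r where r: "\<And>ep x y. 0 < ep ==> ep \<le> 1 ==> x \<in> nb K \<delta> ==> norm y > r ==> \<phi> ep x y = 0"
    by (rule Cb_supp[OF \<phi> compact_nb[OF K(1)] K\<Omega>(2)], rule that) blast
  define e where "e = min 1 (\<delta> / (\<bar>r\<bar> + 1))"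
  have e: "e > 0" "e \<le> 1" using \<delta> by (auto simp: e_def)
  have A: "S_op ep (\<phi> ep x) \<in> A_set 0 UNIV" if "0 < ep" "ep < e" "x \<in> nbo K \<delta>" for ep x
    using CbD(1)[OF \<phi>, of ep x] A_set_antimono[of 0 q UNIV] that e K\<Omega> by (intro S_op_A_set) auto
  have s: "S_op ep (\<phi> ep x) y = 0" if "0 < ep" "ep < e" "x \<in> nbo K \<delta>" "norm y > \<delta>" for ep x y
  proof (rule S_op_outside)
    show "\<phi> ep x y = 0" if "norm y > r" for y
      using r[of ep x y] that \<open>0 < ep\<close> \<open>ep < e\<close> e K\<Omega> \<open>x \<in> nbo K \<delta>\<close> by auto
    have "ep * r \<le> ep * (\<bar>r\<bar> + 1)" using that(1) by (intro mult_left_mono) auto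
    also have "\<dots> \<le> \<delta> / (\<bar>r\<bar> + 1) * (\<bar>r\<bar> + 1)" using that(2) by (intro mult_right_mono) (auto simp: e_def)
    also have "\<dots> = \<delta>" by simp
    finally show "norm y > ep * r" using that(4) by simp
  qed (rule that(1))
  have o: "open (nbo K \<delta> \<times> nbo L \<delta>)" by (intro open_Times open_nbo)
  have main: "smooth_in (nbo K \<delta> \<times> nbo L \<delta>) (\<lambda>z. R (S_op ep (\<phi> ep (fst z)), snd z))"
    "\<And>z. z \<in> nbo K \<delta> \<times> nbo L \<delta> ==> (S_op ep (\<phi> ep (fst z)), snd z) \<in> U_set \<Omega>"
    if ep: "0 < ep" "ep < e" for ep
  proof -
    have \<Phi>: "smooth_in (\<Omega> \<times> UNIV) (\<lambda>z. \<phi> ep (fst z) (snd z))" using Cb_joint[OF \<Omega> \<phi>] ep e by auto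
    have o': "open ((nbo K \<delta> \<times> nbo L \<delta>) \<times> (UNIV :: (real^'n) set))" by (intro open_Times open_nbo open_UNIV)
    have "smooth_in ((nbo K \<delta> \<times> nbo L \<delta>) \<times> UNIV) (\<lambda>z. (\<lambda>z. \<phi> ep (fst z) (snd z)) (fst (fst z), snd z /\<^sub>R ep))"
      by (rule smooth_in_comp[OF o' _ \<Phi>])
        (use K\<Omega> in \<open>auto intro!: smooth_in_Pair smooth_in_scaleR smooth_in_fst smooth_in_snd smooth_in_const smooth_in_id o'\<close>)
    then have "smooth_in ((nbo K \<delta> \<times> nbo L \<delta>) \<times> UNIV) (\<lambda>z. (\<lambda>z. \<phi> ep (fst z) (snd z)) (fst (fst z), snd z /\<^sub>R ep) /\<^sub>R ep ^ CARD('n))"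
      by (intro smooth_in_scaleR smooth_in_const o')
    then have 1: "smooth_in ((nbo K \<delta> \<times> nbo L \<delta>) \<times> UNIV) (\<lambda>z. S_op ep (\<phi> ep (fst (fst z))) (snd z))"
      by (simp add: S_op_def)
    have 2: "S_op ep (\<phi> ep (fst p)) \<in> A_set 0 UNIV" if "p \<in> nbo K \<delta> \<times> nbo L \<delta>" for p
      by (rule A[OF ep]) (use that in auto)
    have 3: "smooth_in (nbo K \<delta> \<times> nbo L \<delta>) snd" by (intro smooth_in_bounded_linear bounded_linear_snd)
    have 4: "S_op ep (\<phi> ep (fst p)) y = 0" if "p \<in> nbo K \<delta> \<times> nbo L \<delta>" "norm y > \<delta>" for p y
      by (rule s[OF ep _ that(2)]) (use that(1) in auto)
    have 5: "snd p \<in> nb L (2 * \<delta>) \<and> cball (snd p) \<delta> \<subseteq> nb L (2 * \<delta>)" if "p \<in> nbo K \<delta> \<times> nbo L \<delta>" for p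
    proof -
      have "snd p \<in> nbo L \<delta>" using that by (simp add: mem_Times_iff)
      then have sp: "snd p \<in> nb L \<delta>" by (rule subsetD[OF L2(1)])
      show ?thesis
        using subsetD[OF L2(2) sp] cball_subset_nb[OF sp, of \<delta>] by (simp only: mult_2)
    qed
    note * = smooth_maps_comp[where \<psi>="\<lambda>p. S_op ep (\<phi> ep (fst p))" and x=snd, OF R o 1 2 3 4 compact_nb[OF L(1)] L(2) 5]
    show "smooth_in (nbo K \<delta> \<times> nbo L \<delta>) (\<lambda>z. R (S_op ep (\<phi> ep (fst z)), snd z))" by (rule *(1))
    show "\<And>z. z \<in> nbo K \<delta> \<times> nbo L \<delta> ==> (S_op ep (\<phi> ep (fst z)), snd z) \<in> U_set \<Omega>" by (rule *(2))
  qed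
  show ?thesis
  proof (rule that[OF e])
    show "smooth_in (nbo K \<delta> \<times> nbo L \<delta>) (\<lambda>z. R (S_op ep (\<phi> ep (fst z)), snd z))" if "0 < ep" "ep < e" for ep
      by (rule main(1)[OF that])
    show "(S_op ep (\<phi> ep x), y) \<in> U_set \<Omega>" if "0 < ep" "ep < e" "x \<in> nbo K \<delta>" "y \<in> nbo L \<delta>" for ep x y
      using main(2)[OF that(1,2), of "(x, y)"] that(3,4) by simp
    show "S_op ep (\<phi> ep x) y = 0" if "0 < ep" "ep < e" "x \<in> nbo K \<delta>" "norm y > \<delta>" for ep x y
      by (rule s[OF that])
  qed
qed

section \<open>Negligibility and point values\<close>

lemma sup_bigOI:
  assumes "C > 0" "e > 0" "\<And>ep x. 0 < ep ==> ep < e ==> x \<in> K ==> norm (f ep x) \<le> C * \<bar>g ep\<bar>"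
  shows "sup_bigO K f g"
  using assms unfolding sup_bigO_def by blast

lemma sup_bigOE:
  fixes f :: "real => 'a => 'v::real_normed_vector"
  assumes "sup_bigO K f g"
  obtains C e where "C > 0" "e > 0" "\<And>ep x. 0 < ep ==> ep < e ==> x \<in> K ==> norm (f ep x) \<le> C * \<bar>g ep\<bar>"
proof -
  from assms[unfolded sup_bigO_def] obtain C where C: "C > 0 \<and> (\<exists>e>0. \<forall>ep. 0 < ep \<and> ep < e --> (\<forall>x\<in>K. norm (f ep x) \<le> C * \<bar>g ep\<bar>))"
    by (rule exE)
  from conjunct2[OF C] obtain e where e: "0 < e \<and> (\<forall>ep. 0 < ep \<and> ep < e --> (\<forall>x\<in>K. norm (f ep x) \<le> C * \<bar>g ep\<bar>))"
    by (rule exE)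
  show ?thesis
    by (rule that[OF conjunct1[OF C] conjunct1[OF e]], rule conjunct2[OF e, rule_format]) simp_all
qed

lemma sup_bigO_cong:
  assumes "sup_bigO K f g" "e > 0" "\<And>ep x. 0 < ep ==> ep < e ==> x \<in> K ==> f ep x = f' ep x"
  shows "sup_bigO K f' g"
proof -
  obtain C ep0 where C: "C > 0" "ep0 > 0" "\<And>ep x. 0 < ep ==> ep < ep0 ==> x \<in> K ==> norm (f ep x) \<le> C * \<bar>g ep\<bar>"
    by (rule sup_bigOE[OF assms(1)], rule that)
  show ?thesis
  proof (rule sup_bigOI[OF C(1), of "min ep0 e"])
    show "norm (f' ep x) \<le> C * \<bar>g ep\<bar>" if "0 < ep" "ep < min ep0 e" "x \<in> K" for ep x
      using C(3)[of ep x] assms(3)[of ep x] that by simp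
  qed (use C(2) assms(2) in simp)
qed

lemma sup_bigO_add:
  assumes "sup_bigO K f g" "sup_bigO K f' g"
  shows "sup_bigO K (\<lambda>ep x. f ep x + f' ep x) g"
proof -
  obtain C ep0 where C: "C > 0" "ep0 > 0" "\<And>ep x. 0 < ep ==> ep < ep0 ==> x \<in> K ==> norm (f ep x) \<le> C * \<bar>g ep\<bar>"
    by (rule sup_bigOE[OF assms(1)], rule that)
  obtain C' ep1 where C': "C' > 0" "ep1 > 0" "\<And>ep x. 0 < ep ==> ep < ep1 ==> x \<in> K ==> norm (f' ep x) \<le> C' * \<bar>g ep\<bar>"
    by (rule sup_bigOE[OF assms(2)], rule that)
  show ?thesis
  proof (rule sup_bigOI[of "C + C'" "min ep0 ep1"])
    show "norm (f ep x + f' ep x) \<le> (C + C') * \<bar>g ep\<bar>" if "0 < ep" "ep < min ep0 ep1" "x \<in> K" for ep x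
      using norm_triangle_mono[OF C(3)[of ep x] C'(3)[of ep x]] that by (simp add: distrib_right)
  qed (use C(1,2) C'(1,2) in auto)
qed

lemma sup_bigO_norm_eq: "sup_bigO K f g ==> (\<And>ep x. norm (f' ep x) = norm (f ep x)) ==> sup_bigO K f' g"
  unfolding sup_bigO_def by simp

lemma sup_bigO_subset: "sup_bigO K f g ==> K' \<subseteq> K ==> sup_bigO K' f g"
  unfolding sup_bigO_def by (meson subsetD)

lemma sup_bigO_weaken:
  assumes "sup_bigO K f g" "\<And>ep. 0 < ep ==> ep < 1 ==> \<bar>g ep\<bar> \<le> \<bar>h ep\<bar>"
  shows "sup_bigO K f h"
proof -
  obtain C ep0 where C: "C > 0" "ep0 > 0" "\<And>ep x. 0 < ep ==> ep < ep0 ==> x \<in> K ==> norm (f ep x) \<le> C * \<bar>g ep\<bar>"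
    by (rule sup_bigOE[OF assms(1)], rule that)
  show ?thesis
  proof (rule sup_bigOI[OF C(1), of "min ep0 1"])
    fix ep x assume ep: "0 < ep" "ep < min ep0 1" "x \<in> K"
    have "norm (f ep x) \<le> C * \<bar>g ep\<bar>" using C(3)[of ep x] ep by simp
    also have "\<dots> \<le> C * \<bar>h ep\<bar>" using assms(2)[of ep] ep C(1) by (intro mult_left_mono) auto
    finally show "norm (f ep x) \<le> C * \<bar>h ep\<bar>" .
  qed (use C(2) in simp)
qed

lemma sup_bigO_inverse_power_mono:
  assumes "sup_bigO K f (\<lambda>ep. inverse (ep ^ N))" "N \<le> N'"
  shows "sup_bigO K f (\<lambda>ep. inverse (ep ^ N'))"
proof (rule sup_bigO_weaken[OF assms(1)])
  fix ep :: real assume "0 < ep" "ep < 1"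
  then have "ep ^ N' \<le> ep ^ N" using assms(2) by (intro power_decreasing) auto
  then show "\<bar>inverse (ep ^ N)\<bar> \<le> \<bar>inverse (ep ^ N')\<bar>"
    using \<open>0 < ep\<close> by (simp add: le_imp_inverse_le)
qed

text \<open>The part of negligibility without derivatives. Values in any normed space are allowed,
  so that the equivalence of generalized points and of generalized numbers is the same
  notion.\<close>

definition vanishing :: "(real^'n::finite) set => ('n tfun \<times> (real^'n) => 'v::real_normed_vector) => bool" where
  "vanishing \<Omega> D \<longleftrightarrow> (\<forall>K. compact K \<and> K \<subseteq> \<Omega> --> (\<forall>m\<ge>1. \<exists>q\<ge>1. \<forall>\<phi>\<in>Cb \<Omega> q.
     sup_bigO K (\<lambda>ep x. D (S_op ep (\<phi> ep x), x)) (\<lambda>ep. ep ^ m)))"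

lemma vanishingE:
  assumes "vanishing \<Omega> D" "compact K" "K \<subseteq> \<Omega>" "m \<ge> 1"
  obtains q where "q \<ge> 1" "\<And>\<phi>. \<phi> \<in> Cb \<Omega> q ==> sup_bigO K (\<lambda>ep x. D (S_op ep (\<phi> ep x), x)) (\<lambda>ep. ep ^ m)"
proof -
  have "\<exists>q\<ge>1. \<forall>\<phi>\<in>Cb \<Omega> q. sup_bigO K (\<lambda>ep x. D (S_op ep (\<phi> ep x), x)) (\<lambda>ep. ep ^ m)"
    by (rule assms(1)[unfolded vanishing_def, rule_format]) (use assms in simp_all)
  then obtain q where q: "1 \<le> q \<and> (\<forall>\<phi>\<in>Cb \<Omega> q. sup_bigO K (\<lambda>ep x. D (S_op ep (\<phi> ep x), x)) (\<lambda>ep. ep ^ m))"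
    by (rule exE)
  show ?thesis by (rule that[OF conjunct1[OF q] bspec[OF conjunct2[OF q]]])
qed

lemma vanishing_add:
  assumes "vanishing \<Omega> D" "vanishing \<Omega> D'"
  shows "vanishing \<Omega> (\<lambda>u. D u + D' u)"
  unfolding vanishing_def
proof (intro allI impI, elim conjE)
  fix K and m :: nat assume K: "compact K" "K \<subseteq> \<Omega>" and m: "1 \<le> m"
  obtain q where q: "q \<ge> 1" "\<And>\<phi>. \<phi> \<in> Cb \<Omega> q ==> sup_bigO K (\<lambda>ep x. D (S_op ep (\<phi> ep x), x)) (\<lambda>ep. ep ^ m)"
    by (rule vanishingE[OF assms(1) K m], rule that)
  obtain q' where q': "q' \<ge> 1" "\<And>\<phi>. \<phi> \<in> Cb \<Omega> q' ==> sup_bigO K (\<lambda>ep x. D' (S_op ep (\<phi> ep x), x)) (\<lambda>ep. ep ^ m)"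
    by (rule vanishingE[OF assms(2) K m], rule that)
  have "sup_bigO K (\<lambda>ep x. D (S_op ep (\<phi> ep x), x) + D' (S_op ep (\<phi> ep x), x)) (\<lambda>ep. ep ^ m)"
    if "\<phi> \<in> Cb \<Omega> (max q q')" for \<phi>
    using Cb_antimono[of q "max q q'" \<Omega>] Cb_antimono[of q' "max q q'" \<Omega>] that
    by (intro sup_bigO_add q(2) q'(2)) auto
  then show "\<exists>q\<ge>1. \<forall>\<phi>\<in>Cb \<Omega> q. sup_bigO K (\<lambda>ep x. D (S_op ep (\<phi> ep x), x) + D' (S_op ep (\<phi> ep x), x)) (\<lambda>ep. ep ^ m)"
    using q(1) by (intro exI[of _ "max q q'"]) auto
qed

lemma vanishing_minus:
  assumes "vanishing \<Omega> D"
  shows "vanishing \<Omega> (\<lambda>u. - D u)"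
  using assms unfolding vanishing_def sup_bigO_def by simp

lemma vanishing_0: "vanishing \<Omega> (\<lambda>u. 0)"
  unfolding vanishing_def sup_bigO_def by (auto intro!: exI[of _ 1])

lemma vanishing_diff_commute: "vanishing \<Omega> (\<lambda>u. D u - E u) ==> vanishing \<Omega> (\<lambda>u. E u - D u)"
  using vanishing_minus[of \<Omega> "\<lambda>u. D u - E u"] by simp

lemma vanishing_diff_trans:
  "vanishing \<Omega> (\<lambda>u. D u - E u) ==> vanishing \<Omega> (\<lambda>u. E u - F u) ==> vanishing \<Omega> (\<lambda>u. D u - F u)"
  using vanishing_add[of \<Omega> "\<lambda>u. D u - E u" "\<lambda>u. E u - F u"] by simp

lemma along_smooth:
  fixes R :: "'n::finite tfun \<times> (real^'n) => 'v::euclidean_space"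
  assumes "open \<Omega>" "\<phi> \<in> Cb \<Omega> q" "R \<in> smooth_maps \<Omega> V" "\<delta> > 0" "compact K" "nb K (2 * \<delta>) \<subseteq> \<Omega>"
  obtains e where "e > 0" "\<And>ep. 0 < ep ==> ep < e ==> smooth_in (nbo K \<delta>) (\<lambda>x. R (S_op ep (\<phi> ep x), x))"
proof -
  obtain e where e: "e > 0" "\<And>ep. 0 < ep ==> ep < e ==> smooth_in (nbo K \<delta> \<times> nbo K \<delta>) (\<lambda>z. R (S_op ep (\<phi> ep (fst z)), snd z))"
    by (rule smooth_maps_Cb[OF assms(1-6) assms(5,6)], rule that)
  have "smooth_in (nbo K \<delta>) (\<lambda>x. R (S_op ep (\<phi> ep x), x))" if ep: "0 < ep" "ep < e" for ep
    using smooth_in_comp[OF open_nbo smooth_in_Pair[OF open_nbo smooth_in_id smooth_in_id] e(2)[OF ep]] by fastforce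
  then show ?thesis by (rule that[OF e(1)])
qed

text \<open>At small scales the composite is smooth near \<open>K\<close>, so the estimates for
  multi-indices hold for every order of the derivatives.\<close>

lemma moderate_dirds:
  fixes R :: "'n::finite tfun \<times> (real^'n) => 'v::euclidean_space"
  assumes \<Omega>: "open \<Omega>" and R: "R \<in> smooth_maps \<Omega> V" "moderate \<Omega> R" and K: "compact K" "K \<subseteq> \<Omega>"
  obtains N where "N \<ge> 1" "\<And>\<phi>. \<phi> \<in> Cb \<Omega> 0 ==>
    sup_bigO K (\<lambda>ep. dirds (axes is) (\<lambda>x. R (S_op ep (\<phi> ep x), x))) (\<lambda>ep. inverse (ep ^ N))"
proof -
  obtain \<delta> where \<delta>: "\<delta> > 0" "nb K (2 * \<delta>) \<subseteq> \<Omega>" by (rule nb_exists[OF K(1) \<Omega> K(2)])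
  obtain N where N: "N \<ge> 1 \<and> (\<forall>\<phi>\<in>Cb \<Omega> 0.
      sup_bigO K (\<lambda>ep. mderiv (count_list is) (\<lambda>x. R (S_op ep (\<phi> ep x), x))) (\<lambda>ep. inverse (ep ^ N)))"
    using exE[OF R(2)[unfolded moderate_def, rule_format, OF conjI[OF K]]] .
  have "sup_bigO K (\<lambda>ep. dirds (axes is) (\<lambda>x. R (S_op ep (\<phi> ep x), x))) (\<lambda>ep. inverse (ep ^ N))" if \<phi>: "\<phi> \<in> Cb \<Omega> 0" for \<phi>
  proof -
    obtain e where e: "e > 0" "\<And>ep. 0 < ep ==> ep < e ==> smooth_in (nbo K \<delta>) (\<lambda>x. R (S_op ep (\<phi> ep x), x))"
      by (rule along_smooth[OF \<Omega> \<phi> R(1) \<delta>(1) K(1) \<delta>(2)], rule that)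
    show ?thesis
      by (rule sup_bigO_cong[OF bspec[OF conjunct2[OF N] \<phi>] e(1)], rule mderiv_count_list[OF open_nbo e(2)])
        (use subset_nbo[OF \<delta>(1)] in auto)
  qed
  then show ?thesis by (rule that[OF conjunct1[OF N]])
qed

text \<open>
  Landau's trick: a small function with moderate second derivative has a small first derivative.
\<close>

lemma vanishing_dirds:
  fixes R :: "'n::finite tfun \<times> (real^'n) => 'v::euclidean_space"
  assumes \<Omega>: "open \<Omega>" and R: "R \<in> smooth_maps \<Omega> V" "moderate \<Omega> R" and v: "vanishing \<Omega> R"
    and K: "compact K" "K \<subseteq> \<Omega>" and m: "m \<ge> 1"
  shows "\<exists>q\<ge>1. \<forall>\<phi>\<in>Cb \<Omega> q. sup_bigO K (\<lambda>ep. dirds (axes is) (\<lambda>x. R (S_op ep (\<phi> ep x), x))) (\<lambda>ep. ep ^ m)"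
  using K m
proof (induction "is" arbitrary: K m)
  case Nil
  then show ?case using v unfolding vanishing_def by auto
next
  case (Cons i "is")
  note K = Cons.prems(1,2)
  obtain \<delta> where \<delta>: "\<delta> > 0" "nb K (2 * \<delta>) \<subseteq> \<Omega>" by (rule nb_exists[OF K(1) \<Omega> K(2)])
  have K1: "compact (nb K \<delta>)" "nb K \<delta> \<subseteq> \<Omega>"
    using compact_nb[OF K(1)] nb_mono[of \<delta> "2 * \<delta>" K] \<delta> by auto
  obtain N where N: "N \<ge> 1" "\<And>\<phi>. \<phi> \<in> Cb \<Omega> 0 ==>
      sup_bigO (nb K \<delta>) (\<lambda>ep. dirds (axes (i # i # is)) (\<lambda>x. R (S_op ep (\<phi> ep x), x))) (\<lambda>ep. inverse (ep ^ N))"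
    by (rule moderate_dirds[OF \<Omega> R K1, of "i # i # is"], rule that)
  obtain q where q: "q \<ge> 1" "\<And>\<phi>. \<phi> \<in> Cb \<Omega> q ==>
      sup_bigO (nb K \<delta>) (\<lambda>ep. dirds (axes is) (\<lambda>x. R (S_op ep (\<phi> ep x), x))) (\<lambda>ep. ep ^ (2 * m + N))"
    using Cons.IH[OF K1, of "2 * m + N"] Cons.prems(3) by auto
  have "sup_bigO K (\<lambda>ep. dirds (axes (i # is)) (\<lambda>x. R (S_op ep (\<phi> ep x), x))) (\<lambda>ep. ep ^ m)" if \<phi>: "\<phi> \<in> Cb \<Omega> q" for \<phi>
  proof -
    define g where "g ep = dirds (axes is) (\<lambda>x. R (S_op ep (\<phi> ep x), x))" for ep
    define b :: "real^'n" where "b = axis i 1"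
    have \<phi>0: "\<phi> \<in> Cb \<Omega> 0" using \<phi> Cb_antimono[of 0 q \<Omega>] by auto
    obtain e where e: "e > 0" "\<And>ep. 0 < ep ==> ep < e ==> smooth_in (nbo K \<delta>) (\<lambda>x. R (S_op ep (\<phi> ep x), x))"
      by (rule along_smooth[OF \<Omega> \<phi> R(1) \<delta>(1) K(1) \<delta>(2)], rule that)
    have sb: "sup_bigO (nb K \<delta>) g (\<lambda>ep. ep ^ (2 * m + N))" unfolding g_def[abs_def] by (rule q(2)[OF \<phi>])
    obtain C1 e1 where C1: "C1 > 0" "e1 > 0" "\<And>ep x. 0 < ep ==> ep < e1 ==> x \<in> nb K \<delta> ==> norm (g ep x) \<le> C1 * \<bar>ep ^ (2 * m + N)\<bar>"
      by (rule sup_bigOE[OF sb], rule that)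
    obtain C2 e2 where C2: "C2 > 0" "e2 > 0" "\<And>ep x. 0 < ep ==> ep < e2 ==> x \<in> nb K \<delta> ==>
        norm (dirds (axes (i # i # is)) (\<lambda>x. R (S_op ep (\<phi> ep x), x)) x) \<le> C2 * \<bar>inverse (ep ^ N)\<bar>"
      by (rule sup_bigOE[OF N(2)[OF \<phi>0]], rule that)
    define e0 where "e0 = min (min e 1) (min \<delta> (min e1 e2))"
    have e0: "e0 > 0" using e C1 C2 \<delta> by (simp add: e0_def)
    have "norm (dirds (axes (i # is)) (\<lambda>x. R (S_op ep (\<phi> ep x), x)) x) \<le> (2 * C1 + C2) * \<bar>ep ^ m\<bar>"
      if ep: "0 < ep" "ep < e0" and x: "x \<in> K" for ep x
    proof -
      have ep': "ep < e" "ep < 1" "ep < \<delta>" "ep < e1" "ep < e2" using ep(2) by (auto simp: e0_def)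
      have sg: "smooth_in (nbo K \<delta>) (g ep)" unfolding g_def by (rule smooth_in_dirds[OF e(2)[OF ep(1) ep'(1)]])
      \<comment> \<open>The step balances two errors: values of size \<open>ep ^ (2 * m + N)\<close>
        divided by \<open>h\<close>, and a second derivative of size \<open>inverse (ep ^ N)\<close>
        times \<open>h\<close>, are both of size \<open>ep ^ m\<close>.\<close>
      define h where "h = ep ^ (m + N)"
      have h: "h > 0" "h < \<delta>"
      proof -
        have "h \<le> ep ^ 1" unfolding h_def using ep ep' N(1) by (intro power_decreasing) auto
        then show "h > 0" "h < \<delta>" using ep ep' by (auto simp: h_def)
      qed
      have near: "x + s *\<^sub>R b \<in> nbo K \<delta>" "x + s *\<^sub>R b \<in> nb K \<delta>" if "\<bar>s\<bar> \<le> \<bar>h\<bar>" for s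
      proof -
        have "dist x (x + s *\<^sub>R b) < \<delta>" using that h by (simp add: dist_norm b_def)
        then show "x + s *\<^sub>R b \<in> nbo K \<delta>" using x by (auto simp: nbo_def)
        then show "x + s *\<^sub>R b \<in> nb K \<delta>" using nbo_subset_nb by blast
      qed
      define J where "J = (\<lambda>s::real. x + s *\<^sub>R b) -` nbo K \<delta>"
      have J: "open J" unfolding J_def by (intro open_vimage open_nbo continuous_intros)
      define G where "G s = g ep (x + s *\<^sub>R b)" for s
      have "smooth_in J G"
        unfolding G_def
      proof (rule smooth_in_comp[OF J _ sg])
        show "smooth_in J (\<lambda>s. x + s *\<^sub>R b)" by (intro smooth_in_add smooth_in_scaleR smooth_in_const smooth_in_id J)
      qed (auto simp: J_def)
      moreover have "norm (dirds [1, 1] G s) \<le> C2 * inverse (ep ^ N)" if "\<bar>s\<bar> \<le> \<bar>h\<bar>" for s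
      proof -
        have "dirds [1, 1] G s = dirds (axes (i # i # is)) (\<lambda>x. R (S_op ep (\<phi> ep x), x)) (x + s *\<^sub>R b)"
          unfolding G_def dirds_line by (simp add: g_def b_def)
        then show ?thesis using C2(3)[OF ep(1) ep'(5) near(2)[OF that]] ep(1) by simp
      qed
      ultimately have "norm (G h - G 0 - h *\<^sub>R dird 1 G 0) \<le> C2 * inverse (ep ^ N) * h\<^sup>2"
        by (intro second_order_remainder[of J]) (auto simp: J_def near(1))
      moreover have "norm (G h) \<le> C1 * ep ^ (2 * m + N)" "norm (G 0) \<le> C1 * ep ^ (2 * m + N)"
        using C1(3)[OF ep(1) ep'(4) near(2)[of h]] C1(3)[OF ep(1) ep'(4) near(2)[of 0]] ep(1) by (auto simp: G_def)
      moreover have "norm (h *\<^sub>R dird 1 G 0) \<le> norm (G h) + norm (G 0) + norm (G h - G 0 - h *\<^sub>R dird 1 G 0)"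
        using norm_triangle_ineq4[of "G h - G 0" "G h - G 0 - h *\<^sub>R dird 1 G 0"] norm_triangle_ineq4[of "G h" "G 0"] by simp
      ultimately have "h * norm (dird 1 G 0) \<le> 2 * (C1 * ep ^ (2 * m + N)) + C2 * inverse (ep ^ N) * h\<^sup>2"
        using h(1) by simp
      also have "ep ^ (2 * m + N) = h * ep ^ m" by (simp add: h_def power_add mult_2)
      also have "C2 * inverse (ep ^ N) * h\<^sup>2 = h * (C2 * ep ^ m)"
        using ep(1) by (simp add: h_def power_add power2_eq_square)
      also have "2 * (C1 * (h * ep ^ m)) + h * (C2 * ep ^ m) = h * ((2 * C1 + C2) * ep ^ m)" by (simp add: algebra_simps)
      finally have "norm (dird 1 G 0) \<le> (2 * C1 + C2) * ep ^ m" using h(1) by simp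
      moreover have "dird 1 G 0 = dirds (axes (i # is)) (\<lambda>x. R (S_op ep (\<phi> ep x), x)) x"
        unfolding G_def dird_line by (simp add: g_def b_def)
      ultimately show ?thesis using ep(1) by simp
    qed
    then show ?thesis using C1(1) C2(1) by (intro sup_bigOI[of "2 * C1 + C2" e0] e0) auto
  qed
  then show ?case using q(1) by blast
qed

lemma N_d_iff_vanishing:
  assumes \<Omega>: "open \<Omega>" and R: "R \<in> E_M \<Omega>"
  shows "R \<in> N_d \<Omega> \<longleftrightarrow> vanishing \<Omega> R"
proof
  assume N: "R \<in> N_d \<Omega>"
  show "vanishing \<Omega> R"
    unfolding vanishing_def
  proof (intro allI impI)
    fix K and m :: nat assume "compact K \<and> K \<subseteq> \<Omega>" "1 \<le> m"
    then have "\<exists>q\<ge>1. \<forall>\<phi>\<in>Cb \<Omega> q. sup_bigO K (\<lambda>ep. mderiv (\<lambda>_. 0) (\<lambda>x. R (S_op ep (\<phi> ep x), x))) (\<lambda>ep. ep ^ m)"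
      using N unfolding N_d_def by blast
    then show "\<exists>q\<ge>1. \<forall>\<phi>\<in>Cb \<Omega> q. sup_bigO K (\<lambda>ep x. R (S_op ep (\<phi> ep x), x)) (\<lambda>ep. ep ^ m)"
      by (simp only: mderiv_zero)
  qed
next
  assume v: "vanishing \<Omega> R"
  have R': "R \<in> smooth_maps \<Omega> UNIV" "moderate \<Omega> R" using R by (auto simp: E_M_def)
  show "R \<in> N_d \<Omega>"
    unfolding N_d_def mem_Collect_eq
  proof (intro conjI R allI impI, elim conjE)
    fix K :: "(real^'a) set" and \<alpha> :: "'a => nat" and m :: nat assume "compact K" "K \<subseteq> \<Omega>" "1 \<le> m"
    from vanishing_dirds[OF \<Omega> R' v this, of "mi_list \<alpha>"]
    show "\<exists>q\<ge>1. \<forall>\<phi>\<in>Cb \<Omega> q. sup_bigO K (\<lambda>ep. mderiv \<alpha> (\<lambda>x. R (S_op ep (\<phi> ep x), x))) (\<lambda>ep. ep ^ m)"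
      by (simp only: mderiv_eq_dirds)
  qed
qed

lemma smooth_maps_diff:
  assumes "R \<in> smooth_maps \<Omega> UNIV" "S \<in> smooth_maps \<Omega> UNIV"
  shows "(\<lambda>u. R u - S u) \<in> smooth_maps \<Omega> UNIV"
  using assms unfolding smooth_maps_def smooth_curve_iff by (auto intro!: smooth_in_diff)

lemma E_M_diff:
  assumes \<Omega>: "open \<Omega>" and R: "R \<in> E_M \<Omega>" and S: "S \<in> E_M \<Omega>"
  shows "(\<lambda>u. R u - S u) \<in> E_M \<Omega>"
proof -
  have R': "R \<in> smooth_maps \<Omega> UNIV" "moderate \<Omega> R" and S': "S \<in> smooth_maps \<Omega> UNIV" "moderate \<Omega> S"
    using R S by (auto simp: E_M_def)
  have "moderate \<Omega> (\<lambda>u. R u - S u)"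
    unfolding moderate_def
  proof (intro allI impI, elim conjE)
    fix K :: "(real^'a) set" and \<alpha> :: "'a => nat" assume K: "compact K" "K \<subseteq> \<Omega>"
    let ?is = "axes (mi_list \<alpha>)"
    obtain N1 where N1: "N1 \<ge> 1" "\<And>\<phi>. \<phi> \<in> Cb \<Omega> 0 ==>
      sup_bigO K (\<lambda>ep. dirds ?is (\<lambda>x. R (S_op ep (\<phi> ep x), x))) (\<lambda>ep. inverse (ep ^ N1))"
      by (rule moderate_dirds[OF \<Omega> R' K, of "mi_list \<alpha>"], rule that)
    obtain N2 where N2: "N2 \<ge> 1" "\<And>\<phi>. \<phi> \<in> Cb \<Omega> 0 ==>
      sup_bigO K (\<lambda>ep. dirds ?is (\<lambda>x. S (S_op ep (\<phi> ep x), x))) (\<lambda>ep. inverse (ep ^ N2))"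
      by (rule moderate_dirds[OF \<Omega> S' K, of "mi_list \<alpha>"], rule that)
    obtain \<delta> where \<delta>: "\<delta> > 0" "nb K (2 * \<delta>) \<subseteq> \<Omega>" by (rule nb_exists[OF K(1) \<Omega> K(2)])
    have "sup_bigO K (\<lambda>ep. mderiv \<alpha> (\<lambda>x. R (S_op ep (\<phi> ep x), x) - S (S_op ep (\<phi> ep x), x))) (\<lambda>ep. inverse (ep ^ (max N1 N2)))"
      if \<phi>: "\<phi> \<in> Cb \<Omega> 0" for \<phi>
    proof -
      obtain e1 where e1: "e1 > 0" "\<And>ep. 0 < ep ==> ep < e1 ==> smooth_in (nbo K \<delta>) (\<lambda>x. R (S_op ep (\<phi> ep x), x))"
        by (rule along_smooth[OF \<Omega> \<phi> R'(1) \<delta>(1) K(1) \<delta>(2)], rule that)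
      obtain e2 where e2: "e2 > 0" "\<And>ep. 0 < ep ==> ep < e2 ==> smooth_in (nbo K \<delta>) (\<lambda>x. S (S_op ep (\<phi> ep x), x))"
        by (rule along_smooth[OF \<Omega> \<phi> S'(1) \<delta>(1) K(1) \<delta>(2)], rule that)
      have 1: "sup_bigO K (\<lambda>ep. dirds ?is (\<lambda>x. R (S_op ep (\<phi> ep x), x))) (\<lambda>ep. inverse (ep ^ (max N1 N2)))"
        by (rule sup_bigO_inverse_power_mono[OF N1(2)[OF \<phi>]]) simp
      have "sup_bigO K (\<lambda>ep. dirds ?is (\<lambda>x. S (S_op ep (\<phi> ep x), x))) (\<lambda>ep. inverse (ep ^ (max N1 N2)))"
        by (rule sup_bigO_inverse_power_mono[OF N2(2)[OF \<phi>]]) simp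
      then have 2: "sup_bigO K (\<lambda>ep x. - dirds ?is (\<lambda>x. S (S_op ep (\<phi> ep x), x)) x) (\<lambda>ep. inverse (ep ^ (max N1 N2)))"
        by (rule sup_bigO_norm_eq) simp
      show ?thesis
      proof (rule sup_bigO_cong[OF sup_bigO_add[OF 1 2], of "min e1 e2"])
        fix ep x assume "0 < ep" "ep < min e1 e2" "x \<in> K"
        then show "dirds ?is (\<lambda>x. R (S_op ep (\<phi> ep x), x)) x + - dirds ?is (\<lambda>x. S (S_op ep (\<phi> ep x), x)) x =
            mderiv \<alpha> (\<lambda>x. R (S_op ep (\<phi> ep x), x) - S (S_op ep (\<phi> ep x), x)) x"
          using dirds_diff[OF open_nbo e1(2)[of ep] e2(2)[of ep], of x ?is] subset_nbo[OF \<delta>(1), of K]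
          by (auto simp: mderiv_eq_dirds)
      qed (use e1(1) e2(1) in simp)
    qed
    then show "\<exists>N\<ge>1. \<forall>\<phi>\<in>Cb \<Omega> 0. sup_bigO K (\<lambda>ep. mderiv \<alpha> (\<lambda>x. R (S_op ep (\<phi> ep x), x) - S (S_op ep (\<phi> ep x), x))) (\<lambda>ep. inverse (ep ^ N))"
      using N1(1) by (intro exI[of _ "max N1 N2"]) auto
  qed
  then show ?thesis using smooth_maps_diff[OF R'(1) S'(1)] by (auto simp: E_M_def)
qed

text \<open>Constant reparametrisations freeze the test object at \<open>x\<close> while the second
  variable moves. This frees the estimates from the coupling of test object and point.\<close>

lemma Cb_uniform_const:
  fixes \<Omega> :: "(real^'n::finite) set" and H :: "real => (real^'n => 'n tfun) => 'y => 'v::real_normed_vector"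
  assumes \<Omega>: "open \<Omega>" and \<phi>: "\<phi> \<in> Cb \<Omega> q" and K: "compact K" "K \<subseteq> \<Omega>"
    and H: "\<And>\<psi>. \<psi> \<in> Cb \<Omega> q ==> sup_bigO L (\<lambda>ep. H ep (\<psi> ep)) g"
  obtains C e where "C > 0" "e > 0"
    "\<And>ep x y. 0 < ep ==> ep < e ==> x \<in> K ==> y \<in> L ==> norm (H ep (\<lambda>_. \<phi> ep x) y) \<le> C * \<bar>g ep\<bar>"
proof -
  have "\<exists>M. \<forall>\<xi>\<in>{\<lambda>_. x |x. x \<in> K}. \<forall>y. norm (dirds vs \<xi> y) \<le> M" if "vs \<noteq> []" for vs :: "(real^'n) list"
  proof (rule exI[of _ 0], intro ballI allI)
    fix \<xi> :: "real^'n => real^'n" and y assume "\<xi> \<in> {\<lambda>_. x |x. x \<in> K}"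
    then show "norm (dirds vs \<xi> y) \<le> 0" by (auto simp: dirds_const[OF that])
  qed
  then have "\<exists>C>0. \<exists>e>0. \<forall>ep. 0 < ep \<and> ep < e -->
    (\<forall>\<xi>\<in>{\<lambda>_. x |x. x \<in> K}. \<forall>y\<in>L. norm (H ep (\<lambda>x. \<phi> ep (\<xi> x)) y) \<le> C * \<bar>g ep\<bar>)"
    by (intro Cb_uniform[OF \<Omega> \<phi> K, where H=H and L=L and g=g, OF _ _ _ H]) auto
  then obtain C where C: "0 < C \<and> (\<exists>e>0. \<forall>ep. 0 < ep \<and> ep < e -->
    (\<forall>\<xi>\<in>{\<lambda>_. x |x. x \<in> K}. \<forall>y\<in>L. norm (H ep (\<lambda>x. \<phi> ep (\<xi> x)) y) \<le> C * \<bar>g ep\<bar>))" by (rule exE)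
  from conjunct2[OF C] obtain e where e: "0 < e \<and> (\<forall>ep. 0 < ep \<and> ep < e -->
    (\<forall>\<xi>\<in>{\<lambda>_. x |x. x \<in> K}. \<forall>y\<in>L. norm (H ep (\<lambda>x. \<phi> ep (\<xi> x)) y) \<le> C * \<bar>g ep\<bar>))" by (rule exE)
  show ?thesis
  proof (rule that[OF conjunct1[OF C] conjunct1[OF e]])
    fix ep x y assume *: "0 < ep" "ep < e" "x \<in> K" "y \<in> L"
    show "norm (H ep (\<lambda>_. \<phi> ep x) y) \<le> C * \<bar>g ep\<bar>"
      by (rule conjunct2[OF e, rule_format, of ep "\<lambda>_. x" y]) (use * in auto)
  qed
qed

lemma norm_dird_le_axes:
  fixes f :: "real^'n::finite => 'b::euclidean_space"
  assumes "f differentiable (at x)" "\<And>i. norm (dird (axis i 1) f x) \<le> B"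
  shows "norm (dird v f x) \<le> real CARD('n) * B * norm v"
proof -
  have "dird v f x = (\<Sum>b\<in>Basis. (v \<bullet> b) *\<^sub>R dird b f x)"
    using dird_lincomb[OF assms(1), of "\<lambda>b. v \<bullet> b" Basis] by (simp add: euclidean_representation)
  also have "norm \<dots> \<le> (\<Sum>b\<in>(Basis :: (real^'n) set). norm v * B)"
  proof (rule sum_norm_le)
    fix b :: "real^'n" assume "b \<in> Basis"
    then show "norm ((v \<bullet> b) *\<^sub>R dird b f x) \<le> norm v * B"
      unfolding norm_scaleR using assms(2) Basis_le_norm[of b v] by (intro mult_mono) (auto simp: Basis_eq_axis)
  qed
  finally show ?thesis by (simp add: mult_ac)
qed

lemma sup_bigO_Times_finite:
  assumes "finite I" "\<And>i. i \<in> I ==> sup_bigO K (\<lambda>ep. f ep i) g"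
  shows "sup_bigO (I \<times> K) (\<lambda>ep p. f ep (fst p) (snd p)) g"
  using assms
proof (induction I rule: finite_induct)
  case empty
  show ?case by (rule sup_bigOI[of 1 1]) auto
next
  case (insert i I)
  have 1: "sup_bigO (I \<times> K) (\<lambda>ep p. f ep (fst p) (snd p)) g"
    by (rule insert.IH) (rule insert.prems, simp)
  have 2: "sup_bigO K (\<lambda>ep. f ep i) g" by (rule insert.prems) simp
  obtain C e where C: "C > 0" "e > 0"
    "\<And>ep p. 0 < ep ==> ep < e ==> p \<in> I \<times> K ==> norm (f ep (fst p) (snd p)) \<le> C * \<bar>g ep\<bar>"
    by (rule sup_bigOE[OF 1], rule that)
  obtain C' e' where C': "C' > 0" "e' > 0"
    "\<And>ep x. 0 < ep ==> ep < e' ==> x \<in> K ==> norm (f ep i x) \<le> C' * \<bar>g ep\<bar>"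
    by (rule sup_bigOE[OF 2], rule that)
  show ?case
  proof (rule sup_bigOI[of "C + C'" "min e e'"])
    fix ep p assume ep: "0 < ep" "ep < min e e'" and p: "p \<in> insert i I \<times> K"
    have m: "C * \<bar>g ep\<bar> \<le> (C + C') * \<bar>g ep\<bar>" "C' * \<bar>g ep\<bar> \<le> (C + C') * \<bar>g ep\<bar>"
      using C(1) C'(1) by (intro mult_right_mono; simp)+
    show "norm (f ep (fst p) (snd p)) \<le> (C + C') * \<bar>g ep\<bar>"
    proof (cases "fst p = i")
      case True
      have "norm (f ep i (snd p)) \<le> C' * \<bar>g ep\<bar>" by (rule C'(3)) (use ep p in auto)
      then show ?thesis using m(2) True by simp
    next
      case False
      have "norm (f ep (fst p) (snd p)) \<le> C * \<bar>g ep\<bar>" by (rule C(3)) (use ep p False in auto)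
      then show ?thesis using m(1) by simp
    qed
  qed (use C C' in auto)
qed

section \<open>Independence of the choice of representatives\<close>

lemma smooth_in_ball_lipschitz:
  fixes f :: "real^'n::finite => 'b::euclidean_space"
  assumes f: "smooth_in (ball y \<delta>) f" and B: "\<And>z i. z \<in> ball y \<delta> ==> norm (dird (axis i 1) f z) \<le> B"
    and y': "y' \<in> ball y \<delta>"
  shows "norm (f y' - f y) \<le> real CARD('n) * B * norm (y' - y)"
proof (rule differentiable_bound[OF convex_ball])
  fix z assume z: "z \<in> ball y \<delta>"
  note d = smooth_in_differentiable[OF f z]
  show "(f has_derivative (\<lambda>v. dird v f z)) (at z within ball y \<delta>)"
    by (rule has_derivative_at_withinI[OF has_derivative_dird[OF d]])
  show "onorm (\<lambda>v. dird v f z) \<le> real CARD('n) * B"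
    by (rule onorm_le, rule norm_dird_le_axes[OF d B[OF z]])
qed (use y' in \<open>auto simp: dist_norm intro: le_less_trans[OF norm_ge_zero]\<close>)

text \<open>The test objects of \<open>\<phi>\<close> over \<open>K\<close> have supports in a
  common ball, so they form an admissible set \<open>B\<close> in \<open>is_S_RX\<close>.\<close>

lemma is_S_RX_Cb:
  assumes S: "is_S_RX \<Omega> R X S" and \<phi>: "\<phi> \<in> Cb \<Omega> q" and K: "compact K" "K \<subseteq> \<Omega>"
  obtains e where "e > 0" "\<And>ep x. 0 < ep ==> ep < e ==> x \<in> K ==> (S_op ep (\<phi> ep x), x) \<in> U_set \<Omega>"
    "\<And>ep x. 0 < ep ==> ep < e ==> x \<in> K ==> S (S_op ep (\<phi> ep x), x) = R (S_op ep (\<phi> ep x), X (S_op ep (\<phi> ep x), x))"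
proof -
  define B where "B = {\<phi> ep x |ep x. 0 < ep \<and> ep \<le> 1 \<and> x \<in> K}"
  have BA: "B \<subseteq> A_set 0 UNIV"
    unfolding B_def using CbD(1)[OF \<phi>] A_set_antimono[of 0 q UNIV] K(2) by fast
  obtain r where r: "\<And>ep x y. 0 < ep ==> ep \<le> 1 ==> x \<in> K ==> norm y > r ==> \<phi> ep x y = 0"
    by (rule Cb_supp[OF \<phi> K], rule that)
  have "\<exists>r. \<forall>\<psi>\<in>B. supp \<psi> \<subseteq> cball 0 r"
    unfolding supp_cball_iff by (intro exI[of _ r]) (auto simp: B_def r)
  moreover have "B \<subseteq> test_funs UNIV" using BA A_setD(1) by blast
  ultimately have *: "compact K \<and> K \<subseteq> \<Omega> \<and> B \<subseteq> test_funs UNIV \<and> (\<exists>r. \<forall>\<phi>\<in>B. supp \<phi> \<subseteq> cball 0 r)"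
    using K by simp
  obtain W e where W: "K \<subseteq> W" "0 < e" "\<forall>x\<in>W. \<forall>\<psi>\<in>B \<inter> A_set 0 UNIV. \<forall>ep. 0 < ep \<and> ep < e -->
             (S_op ep \<psi>, x) \<in> U_set \<Omega> \<and> (S_op ep \<psi>, X (S_op ep \<psi>, x)) \<in> U_set \<Omega> \<and>
             S (S_op ep \<psi>, x) = R (S_op ep \<psi>, X (S_op ep \<psi>, x))"
    using S[unfolded is_S_RX_def, THEN conjunct2, THEN conjunct2, rule_format, OF *] by (elim exE conjE) metis
  have main: "(S_op ep (\<phi> ep x), x) \<in> U_set \<Omega> \<and> (S_op ep (\<phi> ep x), X (S_op ep (\<phi> ep x), x)) \<in> U_set \<Omega> \<and>
      S (S_op ep (\<phi> ep x), x) = R (S_op ep (\<phi> ep x), X (S_op ep (\<phi> ep x), x))"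
    if ep: "0 < ep" "ep < min e 1" "x \<in> K" for ep x
  proof (rule W(3)[rule_format])
    show "x \<in> W" using ep W(1) by blast
    have "\<phi> ep x \<in> B" unfolding B_def using ep by (intro CollectI exI[of _ ep] exI[of _ x]) auto
    then show "\<phi> ep x \<in> B \<inter> A_set 0 UNIV" using BA by blast
  qed (use ep in auto)
  show ?thesis
    by (rule that[of "min e 1"]) (use W(2) main in auto)
qed

text \<open>The difference is split at the value of \<open>R\<close> in the point \<open>X'\<close>.
  Moving from \<open>X'\<close> to \<open>X\<close> costs a moderate derivative times a negligible
  distance; replacing \<open>R\<close> by \<open>R'\<close> at a point of the compact
  \<open>L\<close> is covered by the vanishing of their difference. Both estimates need test objects
  frozen at \<open>x\<close> while the point varies, which \<open>Cb_uniform_const\<close>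
  supplies.\<close>

lemma point_value_rep_unique:
  fixes \<Omega> :: "(real^'n::finite) set"
  assumes \<Omega>: "open \<Omega>" and R: "R \<in> E_M \<Omega>" and vR: "vanishing \<Omega> (\<lambda>u. R u - R' u)"
    and g: "good_rep \<Omega> \<Omega> X" "good_rep \<Omega> \<Omega> X'" and vX: "vanishing \<Omega> (\<lambda>u. X u - X' u)"
    and S: "is_S_RX \<Omega> R X S" "is_S_RX \<Omega> R' X' S'"
  shows "vanishing \<Omega> (\<lambda>u. S u - S' u)"
  unfolding vanishing_def
proof (intro allI impI, elim conjE)
  fix K and m :: nat assume K: "compact K" "K \<subseteq> \<Omega>" and m: "1 \<le> m"
  have R': "R \<in> smooth_maps \<Omega> UNIV" "moderate \<Omega> R" using R by (auto simp: E_M_def)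
  from g(1)[unfolded good_rep_def] obtain L1 where L1: "compact L1 \<and> L1 \<subseteq> \<Omega> \<and> (\<forall>u\<in>U_set \<Omega>. X u \<in> L1)" by (rule exE)
  from g(2)[unfolded good_rep_def] obtain L2 where L2: "compact L2 \<and> L2 \<subseteq> \<Omega> \<and> (\<forall>u\<in>U_set \<Omega>. X' u \<in> L2)" by (rule exE)
  define L where "L = L1 \<union> L2"
  have L: "compact L" "L \<subseteq> \<Omega>" "\<And>u. u \<in> U_set \<Omega> ==> X u \<in> L" "\<And>u. u \<in> U_set \<Omega> ==> X' u \<in> L"
    using L1 L2 by (auto simp: L_def)
  have KL: "compact (K \<union> L)" "K \<union> L \<subseteq> \<Omega>" using K L by auto
  obtain \<delta> where \<delta>: "\<delta> > 0" "nb (K \<union> L) (2 * \<delta>) \<subseteq> \<Omega>" by (rule nb_exists[OF KL(1) \<Omega> KL(2)])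
  have \<delta>': "nb K (2 * \<delta>) \<subseteq> \<Omega>" "nb L (2 * \<delta>) \<subseteq> \<Omega>" using \<delta>(2) by (auto simp: nb_def)
  have L': "compact (nb L \<delta>)" "nb L \<delta> \<subseteq> \<Omega>"
    using compact_nb[OF L(1)] nb_mono[of \<delta> "2 * \<delta>" L] \<delta> \<delta>' by auto
  have "\<forall>i. \<exists>N. \<forall>\<phi>\<in>Cb \<Omega> 0. sup_bigO (nb L \<delta>) (\<lambda>ep. dirds (axes [i]) (\<lambda>x. R (S_op ep (\<phi> ep x), x))) (\<lambda>ep. inverse (ep ^ N))"
    by (rule allI, rule moderate_dirds[OF \<Omega> R' L'], rule exI, rule ballI)
  from choice[OF this] obtain N where N': "\<forall>i. \<forall>\<phi>\<in>Cb \<Omega> 0.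
      sup_bigO (nb L \<delta>) (\<lambda>ep. dirds (axes [i]) (\<lambda>x. R (S_op ep (\<phi> ep x), x))) (\<lambda>ep. inverse (ep ^ N i))"
    by (rule exE)
  note N = bspec[OF spec[OF N']]
  define N0 where "N0 = (\<Sum>i\<in>UNIV. N i)"
  have NN: "N i \<le> N0" for i unfolding N0_def by (rule member_le_sum) auto
  \<comment> \<open>The additional exponent \<open>N0\<close> pays for the growth of the derivative
    of \<open>R\<close>.\<close>
  obtain q1 where q1: "q1 \<ge> 1" "\<And>\<phi>. \<phi> \<in> Cb \<Omega> q1 ==>
      sup_bigO K (\<lambda>ep x. X (S_op ep (\<phi> ep x), x) - X' (S_op ep (\<phi> ep x), x)) (\<lambda>ep. ep ^ (m + N0))"
    by (rule vanishingE[OF vX K trans_le_add1[OF m]], rule that)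
  obtain q2 where q2: "q2 \<ge> 1" "\<And>\<phi>. \<phi> \<in> Cb \<Omega> q2 ==>
      sup_bigO L (\<lambda>ep x. R (S_op ep (\<phi> ep x), x) - R' (S_op ep (\<phi> ep x), x)) (\<lambda>ep. ep ^ m)"
    by (rule vanishingE[OF vR L(1,2) m], rule that)
  have "sup_bigO K (\<lambda>ep x. S (S_op ep (\<phi> ep x), x) - S' (S_op ep (\<phi> ep x), x)) (\<lambda>ep. ep ^ m)"
    if \<phi>: "\<phi> \<in> Cb \<Omega> (max q1 q2)" for \<phi>
  proof -
    have \<phi>': "\<phi> \<in> Cb \<Omega> q1" "\<phi> \<in> Cb \<Omega> q2" "\<phi> \<in> Cb \<Omega> 0"
      using subsetD[OF Cb_antimono \<phi>, of q1] subsetD[OF Cb_antimono \<phi>, of q2] subsetD[OF Cb_antimono \<phi>, of 0] by auto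
    obtain C1 e1 where C1: "C1 > 0" "e1 > 0" "\<And>ep x. 0 < ep ==> ep < e1 ==> x \<in> K ==>
        norm (X (S_op ep (\<phi> ep x), x) - X' (S_op ep (\<phi> ep x), x)) \<le> C1 * \<bar>ep ^ (m + N0)\<bar>"
      by (rule sup_bigOE[OF q1(2)[OF \<phi>'(1)]], rule that)
    obtain C2 e2 where C2: "C2 > 0" "e2 > 0" "\<And>ep x y. 0 < ep ==> ep < e2 ==> x \<in> K ==> y \<in> L ==>
        norm (R (S_op ep (\<phi> ep x), y) - R' (S_op ep (\<phi> ep x), y)) \<le> C2 * \<bar>ep ^ m\<bar>"
      by (rule Cb_uniform_const[OF \<Omega> \<phi>'(2) K,
            where H="\<lambda>ep \<psi> y. R (S_op ep (\<psi> y), y) - R' (S_op ep (\<psi> y), y)", OF q2(2)], assumption, rule that)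
    have "sup_bigO (UNIV \<times> nb L \<delta>) (\<lambda>ep p. dirds (axes [fst p]) (\<lambda>x. R (S_op ep (\<psi> ep x), x)) (snd p)) (\<lambda>ep. inverse (ep ^ N0))"
      if "\<psi> \<in> Cb \<Omega> 0" for \<psi>
      by (rule sup_bigO_Times_finite[OF finite_class.finite_UNIV, where f="\<lambda>ep i. dirds (axes [i]) (\<lambda>x. R (S_op ep (\<psi> ep x), x))"],
          rule sup_bigO_inverse_power_mono[OF N[OF that] NN])
    note mod = this
    obtain C3 e3 where C3: "C3 > 0" "e3 > 0" "\<And>ep x p. 0 < ep ==> ep < e3 ==> x \<in> K ==> p \<in> UNIV \<times> nb L \<delta> ==>
        norm (dirds (axes [fst p]) (\<lambda>y. R (S_op ep (\<phi> ep x), y)) (snd p)) \<le> C3 * \<bar>inverse (ep ^ N0)\<bar>"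
      by (rule Cb_uniform_const[OF \<Omega> \<phi>'(3) K,
            where H="\<lambda>ep \<psi> p. dirds (axes [fst p]) (\<lambda>y. R (S_op ep (\<psi> y), y)) (snd p)", OF mod], assumption, rule that)
    obtain e4 where e4: "e4 > 0" "e4 \<le> 1"
      "\<And>ep. 0 < ep ==> ep < e4 ==> smooth_in (nbo K \<delta> \<times> nbo L \<delta>) (\<lambda>z. R (S_op ep (\<phi> ep (fst z)), snd z))"
      by (rule smooth_maps_Cb[OF \<Omega> \<phi> R'(1) \<delta>(1) K(1) \<delta>'(1) L(1) \<delta>'(2)], rule that)
    obtain e5 where e5: "e5 > 0"
      "\<And>ep x. 0 < ep ==> ep < e5 ==> x \<in> K ==> (S_op ep (\<phi> ep x), x) \<in> U_set \<Omega>"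
      "\<And>ep x. 0 < ep ==> ep < e5 ==> x \<in> K ==> S (S_op ep (\<phi> ep x), x) = R (S_op ep (\<phi> ep x), X (S_op ep (\<phi> ep x), x))"
      by (rule is_S_RX_Cb[OF S(1) \<phi> K], rule that)
    obtain e6 where e6: "e6 > 0"
      "\<And>ep x. 0 < ep ==> ep < e6 ==> x \<in> K ==> (S_op ep (\<phi> ep x), x) \<in> U_set \<Omega>"
      "\<And>ep x. 0 < ep ==> ep < e6 ==> x \<in> K ==> S' (S_op ep (\<phi> ep x), x) = R' (S_op ep (\<phi> ep x), X' (S_op ep (\<phi> ep x), x))"
      by (rule is_S_RX_Cb[OF S(2) \<phi> K], rule that)
    \<comment> \<open>Below \<open>\<delta> / C1\<close> the two points are less than
      \<open>\<delta>\<close> apart, so the segment between them stays where the derivative of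
      \<open>R\<close> is controlled.\<close>
    define e where "e = min (min (min e1 e2) (min e3 e4)) (min (min e5 e6) (\<delta> / C1))"
    have e: "e > 0" using C1(1,2) C2(2) C3(2) e4(1) e5(1) e6(1) \<delta>(1) by (simp add: e_def)
    define C where "C = real CARD('n) * C3 * C1 + C2"
    show ?thesis
    proof (rule sup_bigOI[of C e])
      show "C > 0" unfolding C_def using C1(1) C2(1) C3(1) by (simp add: add_nonneg_pos)
      fix ep x assume ep: "0 < ep" "ep < e" and x: "x \<in> K"
      have es: "ep < e1" "ep < e2" "ep < e3" "ep < e4" "ep < e5" "ep < e6" "ep < \<delta> / C1"
        using ep(2) by (auto simp: e_def)
      define \<psi> where "\<psi> = S_op ep (\<phi> ep x)"
      have U: "(\<psi>, x) \<in> U_set \<Omega>" unfolding \<psi>_def by (rule e5(2)[OF ep(1) es(5) x])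
      define y y' where "y = X (\<psi>, x)" and "y' = X' (\<psi>, x)"
      have y: "y \<in> L" "y' \<in> L" unfolding y_def y'_def using L(3,4) U by auto
      have d: "norm (y - y') \<le> C1 * ep ^ (m + N0)"
        using C1(3)[OF ep(1) es(1) x] ep(1) by (simp add: y_def y'_def \<psi>_def)
      have "ep ^ (m + N0) \<le> ep ^ 1" using ep(1) es(4) e4(2) m by (intro power_decreasing) auto
      then have "C1 * ep ^ (m + N0) \<le> C1 * ep" using C1(1) by simp
      also have "\<dots> < \<delta>" using es(7) C1(1) by (simp add: field_simps)
      finally have yb: "y \<in> ball y' \<delta>" using d by (simp add: dist_norm norm_minus_commute)
      have bL: "ball y' \<delta> \<subseteq> nbo L \<delta>" using y(2) by (auto simp: nbo_def)
      have sm: "smooth_in (ball y' \<delta>) (\<lambda>z. R (\<psi>, z))"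
      proof -
        have "smooth_in (ball y' \<delta>) (\<lambda>z. (\<lambda>z. R (S_op ep (\<phi> ep (fst z)), snd z)) (x, z))"
          by (rule smooth_in_comp[OF open_ball _ e4(3)[OF ep(1) es(4)]])
            (use bL x subset_nbo[OF \<delta>(1), of K] in \<open>auto intro!: smooth_in_Pair smooth_in_const smooth_in_id\<close>)
        then show ?thesis by (simp add: \<psi>_def)
      qed
      have "norm (R (\<psi>, y) - R (\<psi>, y')) \<le> real CARD('n) * (C3 * inverse (ep ^ N0)) * norm (y - y')"
      proof (rule smooth_in_ball_lipschitz[OF sm _ yb])
        fix z i assume "z \<in> ball y' \<delta>"
        then have "z \<in> nb L \<delta>" using bL nbo_subset_nb[of L \<delta>] by blast
        then show "norm (dird (axis i 1) (\<lambda>z. R (\<psi>, z)) z) \<le> C3 * inverse (ep ^ N0)"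
          using C3(3)[OF ep(1) es(3) x, of "(i, z)"] ep(1) by (simp add: \<psi>_def)
      qed
      also have "\<dots> \<le> real CARD('n) * (C3 * inverse (ep ^ N0)) * (C1 * ep ^ (m + N0))"
        using d C3(1) ep(1) by (intro mult_left_mono) auto
      also have "\<dots> = real CARD('n) * C3 * C1 * ep ^ m"
        using ep(1) by (simp add: power_add field_simps)
      finally have 1: "norm (R (\<psi>, y) - R (\<psi>, y')) \<le> real CARD('n) * C3 * C1 * ep ^ m" .
      have 2: "norm (R (\<psi>, y') - R' (\<psi>, y')) \<le> C2 * ep ^ m"
        using C2(3)[OF ep(1) es(2) x y(2)] ep(1) by (simp add: \<psi>_def)
      have "S (\<psi>, x) - S' (\<psi>, x) = (R (\<psi>, y) - R (\<psi>, y')) + (R (\<psi>, y') - R' (\<psi>, y'))"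
        using e5(3)[OF ep(1) es(5) x] e6(3)[OF ep(1) es(6) x] by (simp add: \<psi>_def y_def y'_def)
      then have "norm (S (\<psi>, x) - S' (\<psi>, x)) \<le> real CARD('n) * C3 * C1 * ep ^ m + C2 * ep ^ m"
        using norm_triangle_mono[OF 1 2] by simp
      then show "norm (S (S_op ep (\<phi> ep x), x) - S' (S_op ep (\<phi> ep x), x)) \<le> C * \<bar>ep ^ m\<bar>"
        using ep(1) by (simp add: C_def \<psi>_def distrib_right)
    qed (rule e)
  qed
  then show "\<exists>q\<ge>1. \<forall>\<phi>\<in>Cb \<Omega> q. sup_bigO K (\<lambda>ep x. S (S_op ep (\<phi> ep x), x) - S' (S_op ep (\<phi> ep x), x)) (\<lambda>ep. ep ^ m)"
    using q1(1) by (intro exI[of _ "max q1 q2"]) auto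
qed

text \<open>A common choice of neighbourhood and scale for the conditions in \<open>is_S_RX\<close>:
  translation to points of \<open>W\<close> and to the possible values in \<open>L\<close> is
  admissible at once.\<close>

lemma small_scales:
  fixes \<Omega> :: "(real^'n::finite) set"
  assumes \<Omega>: "open \<Omega>" and K: "compact K" "K \<subseteq> \<Omega>" and L: "compact L" "L \<subseteq> \<Omega>" and \<delta>0: "\<delta>0 > 0"
  obtains W e where "open W" "K \<subseteq> W" "compact (closure W)" "closure W \<subseteq> \<Omega>" "e > 0"
    "\<And>x \<psi> ep. x \<in> W \<union> L ==> \<psi> \<in> A_set 0 UNIV ==> supp \<psi> \<subseteq> cball 0 r ==> 0 < ep ==> ep < e ==>
      (S_op ep \<psi>, x) \<in> U_set \<Omega>"
    "\<And>(\<psi> :: 'n tfun) ep y. supp \<psi> \<subseteq> cball 0 r ==> 0 < ep ==> ep < e ==> norm y > \<delta>0 ==> S_op ep \<psi> y = 0"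
proof -
  have KL: "compact (K \<union> L)" "K \<union> L \<subseteq> \<Omega>" using K L by auto
  obtain \<delta>1 where \<delta>1: "\<delta>1 > 0" "nb (K \<union> L) (2 * \<delta>1) \<subseteq> \<Omega>" by (rule nb_exists[OF KL(1) \<Omega> KL(2)])
  define \<delta> where "\<delta> = min \<delta>0 \<delta>1"
  have \<delta>: "\<delta> > 0" "\<delta> \<le> \<delta>0" "nb (K \<union> L) (2 * \<delta>) \<subseteq> \<Omega>"
    using \<delta>0 \<delta>1 nb_mono[of "2 * \<delta>" "2 * \<delta>1" "K \<union> L"] by (auto simp: \<delta>_def)
  have W: "closure (nbo K \<delta>) \<subseteq> nb K \<delta>" "nb K \<delta> \<subseteq> nb (K \<union> L) \<delta>" "nb (K \<union> L) \<delta> \<subseteq> nb (K \<union> L) (2 * \<delta>)"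
    using closure_minimal[OF nbo_subset_nb compact_imp_closed[OF compact_nb[OF K(1)]]] nb_mono[of \<delta> "2 * \<delta>"] \<delta>(1)
    by (auto simp: nb_def)
  define e where "e = \<delta> / (\<bar>r\<bar> + 1)"
  have out: "S_op ep \<psi> y = 0" if s: "supp \<psi> \<subseteq> cball 0 r" "0 < ep" "ep < e" "norm y > \<delta>" for \<psi> :: "'n tfun" and ep y
  proof (rule S_op_outside)
    show "\<psi> z = 0" if "norm z > r" for z using s(1) that by (auto simp: supp_cball_iff)
    have "ep * r \<le> ep * (\<bar>r\<bar> + 1)" using s(2) by (intro mult_left_mono) auto
    also have "\<dots> \<le> \<delta> / (\<bar>r\<bar> + 1) * (\<bar>r\<bar> + 1)" using s(3) by (intro mult_right_mono) (auto simp: e_def)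
    also have "\<dots> = \<delta>" by simp
    finally show "norm y > ep * r" using s(4) by simp
  qed (rule s(2))
  show ?thesis
  proof (rule that[OF open_nbo subset_nbo[OF \<delta>(1)]])
    show "compact (closure (nbo K \<delta>))"
      unfolding compact_closure by (rule bounded_subset[OF compact_imp_bounded[OF compact_nb[OF K(1)]] nbo_subset_nb])
    show "closure (nbo K \<delta>) \<subseteq> \<Omega>" by (rule order_trans[OF W(1) order_trans[OF W(2) order_trans[OF W(3) \<delta>(3)]]])
    show "e > 0" unfolding e_def using \<delta>(1) by (intro divide_pos_pos) auto
    show "S_op ep \<psi> y = 0" if "supp \<psi> \<subseteq> cball 0 r" "0 < ep" "ep < e" "norm y > \<delta>0" for \<psi> :: "'n tfun" and ep y
      using out[OF that(1-3)] that(4) \<delta>(2) by simp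
    fix x and \<psi> :: "'n tfun" and ep assume a: "x \<in> nbo K \<delta> \<union> L" "\<psi> \<in> A_set 0 UNIV" "supp \<psi> \<subseteq> cball 0 r" "0 < ep" "ep < e"
    have "nbo K \<delta> \<subseteq> nb (K \<union> L) \<delta>" by (rule order_trans[OF nbo_subset_nb W(2)])
    moreover have "L \<subseteq> nb (K \<union> L) \<delta>" by (rule order_trans[OF Un_upper2 subset_nb]) (use \<delta>(1) in simp)
    ultimately have "nbo K \<delta> \<union> L \<subseteq> nb (K \<union> L) \<delta>" by (rule Un_least)
    then have x: "x \<in> nb (K \<union> L) \<delta>" using a(1) by (rule subsetD)
    have c: "cball x \<delta> \<subseteq> \<Omega>" by (rule order_trans[OF cball_subset_nb[OF x] \<delta>(3)[unfolded mult_2]])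
    have "x \<in> \<Omega>" by (rule subsetD[OF c]) (use \<delta>(1) in simp)
    from U_setI[OF S_op_A_set[OF a(2,4)] out[OF a(3-5)] c this] show "(S_op ep \<psi>, x) \<in> U_set \<Omega>" .
  qed
qed

section \<open>Equivalence classes and the description of the point value\<close>

lemma V_rel_iff:
  "(X, Y) \<in> V_rel \<Omega> V \<longleftrightarrow> X \<in> V_M \<Omega> V \<and> Y \<in> V_M \<Omega> V \<and> vanishing \<Omega> (\<lambda>u. X u - Y u)"
  by (simp add: V_rel_def vanishing_def)

lemma equiv_V_rel: "equiv (V_M \<Omega> V) (V_rel \<Omega> V)"
proof (rule equivI)
  show "V_rel \<Omega> V \<subseteq> V_M \<Omega> V \<times> V_M \<Omega> V" by (auto simp: V_rel_iff)
  show "refl_on (V_M \<Omega> V) (V_rel \<Omega> V)"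
    by (rule refl_onI) (auto simp: V_rel_iff vanishing_0)
  show "sym (V_rel \<Omega> V)" by (rule symI) (auto simp: V_rel_iff intro: vanishing_diff_commute)
  show "trans (V_rel \<Omega> V)" by (rule transI) (auto simp: V_rel_iff intro: vanishing_diff_trans)
qed

lemma G_rel_iff:
  assumes "open \<Omega>"
  shows "(R, S) \<in> G_rel \<Omega> \<longleftrightarrow> R \<in> E_M \<Omega> \<and> S \<in> E_M \<Omega> \<and> vanishing \<Omega> (\<lambda>u. R u - S u)"
  using N_d_iff_vanishing[OF assms E_M_diff[OF assms]] by (auto simp: G_rel_def)

lemma equiv_G_rel:
  assumes "open \<Omega>"
  shows "equiv (E_M \<Omega>) (G_rel \<Omega>)"
proof (rule equivI)
  note * = G_rel_iff[OF assms]
  show "G_rel \<Omega> \<subseteq> E_M \<Omega> \<times> E_M \<Omega>" by (auto simp: *)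
  show "refl_on (E_M \<Omega>) (G_rel \<Omega>)"
    by (rule refl_onI) (auto simp: * vanishing_0)
  show "sym (G_rel \<Omega>)" by (rule symI) (auto simp: * intro: vanishing_diff_commute)
  show "trans (G_rel \<Omega>)" by (rule transI) (auto simp: * intro: vanishing_diff_trans)
qed

lemma zero_E_M: "(\<lambda>_. 0) \<in> E_M (\<Omega> :: (real^'n::finite) set)"
proof -
  have d: "dirds vs (\<lambda>x::real^'n. 0 :: complex) = (\<lambda>x. 0)" for vs :: "(real^'n) list"
    by (cases "vs = []") (auto simp: dirds_const)
  have "moderate \<Omega> (\<lambda>_ :: 'n tfun \<times> (real^'n). 0 :: complex)"
    unfolding moderate_def mderiv_eq_dirds d by (auto intro!: exI[of _ 1] sup_bigOI[of 1 1])
  then show ?thesis by (simp add: E_M_def smooth_maps_def smooth_curve_iff)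
qed

lemma zero_V_M: "(\<lambda>_. 0) \<in> V_M \<Omega> (UNIV :: complex set)"
  using zero_E_M[of \<Omega>] by (simp add: E_M_def V_M_def indep_snd_def)

lemma is_S_RX_zero:
  assumes \<Omega>: "open \<Omega>" and X: "good_rep \<Omega> \<Omega> X"
  shows "is_S_RX \<Omega> (\<lambda>_. 0) X (\<lambda>_. 0)"
proof -
  from X[unfolded good_rep_def] obtain L where "compact L \<and> L \<subseteq> \<Omega> \<and> (\<forall>u\<in>U_set \<Omega>. X u \<in> L)" by (rule exE)
  then have L: "compact L" "L \<subseteq> \<Omega>" "\<forall>u\<in>U_set \<Omega>. X u \<in> L" by simp_all
  have "\<exists>W e. open W \<and> K \<subseteq> W \<and> compact (closure W) \<and> closure W \<subseteq> \<Omega> \<and> 0 < e \<and>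
          (\<forall>x\<in>W. \<forall>\<phi>\<in>B \<inter> A_set 0 UNIV. \<forall>ep. 0 < ep \<and> ep < e -->
             (S_op ep \<phi>, x) \<in> U_set \<Omega> \<and> (S_op ep \<phi>, X (S_op ep \<phi>, x)) \<in> U_set \<Omega> \<and> (0 :: complex) = 0)"
    if K: "compact K" "K \<subseteq> \<Omega>" and r: "\<forall>\<phi>\<in>B. supp \<phi> \<subseteq> cball 0 r" for K B r
  proof -
    obtain W e where W: "open W" "K \<subseteq> W" "compact (closure W)" "closure W \<subseteq> \<Omega>" "e > 0"
      "\<And>x \<psi> ep. x \<in> W \<union> L ==> \<psi> \<in> A_set 0 UNIV ==> supp \<psi> \<subseteq> cball 0 r ==> 0 < ep ==> ep < e ==>
        (S_op ep \<psi>, x) \<in> U_set \<Omega>"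
      by (rule small_scales[OF \<Omega> K L(1,2) zero_less_one, of r], rule that)
    have "(S_op ep \<phi>, x) \<in> U_set \<Omega> \<and> (S_op ep \<phi>, X (S_op ep \<phi>, x)) \<in> U_set \<Omega>"
      if a: "x \<in> W" "\<phi> \<in> B \<inter> A_set 0 UNIV" "0 < ep" "ep < e" for x \<phi> ep
    proof
      show *: "(S_op ep \<phi>, x) \<in> U_set \<Omega>" by (rule W(6)) (use a r in auto)
      show "(S_op ep \<phi>, X (S_op ep \<phi>, x)) \<in> U_set \<Omega>" by (rule W(6)) (use a r L(3) * in auto)
    qed
    then show ?thesis using W(1-5) by (intro exI[of _ W] exI[of _ e]) simp
  qed
  then show ?thesis
    unfolding is_S_RX_def using zero_V_M[of \<Omega>] by (auto simp: V_M_def)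
qed

text \<open>By \<open>point_value_rep_unique\<close> any two admissible choices of \<open>R\<close>,
  \<open>X\<close> and \<open>S\<close> give equivalent maps, so the definite description has one
  solution and any convenient choice computes it.\<close>

lemma point_value_eq:
  assumes \<Omega>: "open \<Omega>" and Rt: "Rt \<in> G_d \<Omega>" "R \<in> Rt" and Xt: "Xt \<in> V_tilde \<Omega> \<Omega>" "X \<in> Xt" "good_rep \<Omega> \<Omega> X"
    and S: "S \<in> V_M \<Omega> UNIV" "is_S_RX \<Omega> R X S"
  shows "point_value \<Omega> Rt Xt = V_rel \<Omega> UNIV `` {S}"
  unfolding point_value_def
proof (rule the_equality)
  have "V_rel \<Omega> UNIV `` {S} \<in> C_tilde \<Omega>" unfolding C_tilde_def V_tilde_def by (rule quotientI[OF S(1)])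
  moreover have "S \<in> V_rel \<Omega> UNIV `` {S}" by (rule equiv_class_self[OF equiv_V_rel S(1)])
  ultimately show "V_rel \<Omega> UNIV `` {S} \<in> C_tilde \<Omega> \<and>
      (\<exists>R\<in>Rt. \<exists>X\<in>Xt. \<exists>S\<in>V_rel \<Omega> UNIV `` {S}. good_rep \<Omega> \<Omega> X \<and> is_S_RX \<Omega> R X S)"
    using Rt(2) Xt(2,3) S(2) by blast
  fix Ct assume "Ct \<in> C_tilde \<Omega> \<and> (\<exists>R\<in>Rt. \<exists>X\<in>Xt. \<exists>S\<in>Ct. good_rep \<Omega> \<Omega> X \<and> is_S_RX \<Omega> R X S)"
  then obtain R' X' S' where Ct: "Ct \<in> C_tilde \<Omega>" and R': "R' \<in> Rt" and X': "X' \<in> Xt" "good_rep \<Omega> \<Omega> X'"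
    and S': "S' \<in> Ct" "is_S_RX \<Omega> R' X' S'" by blast
  have RR: "(R, R') \<in> G_rel \<Omega>"
    by (rule quotient_eq_iff[OF equiv_G_rel[OF \<Omega>] Rt(1)[unfolded G_d_def] Rt(1)[unfolded G_d_def] Rt(2) R', THEN iffD1, OF refl])
  have XX: "(X, X') \<in> V_rel \<Omega> \<Omega>"
    by (rule quotient_eq_iff[OF equiv_V_rel Xt(1)[unfolded V_tilde_def] Xt(1)[unfolded V_tilde_def] Xt(2) X'(1), THEN iffD1, OF refl])
  note Ct' = Ct[unfolded C_tilde_def V_tilde_def]
  have S'M: "S' \<in> V_M \<Omega> UNIV" using in_quotient_imp_subset[OF equiv_V_rel Ct'] S'(1) by blast
  have "vanishing \<Omega> (\<lambda>u. S u - S' u)"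
    by (rule point_value_rep_unique[OF \<Omega> _ _ Xt(3) X'(2) _ S(2) S'(2)])
      (use RR XX in \<open>auto simp: G_rel_iff[OF \<Omega>] V_rel_iff\<close>)
  then have "(S', S) \<in> V_rel \<Omega> UNIV" using S(1) S'M by (auto simp: V_rel_iff intro: vanishing_diff_commute)
  then show "Ct = V_rel \<Omega> UNIV `` {S}"
    using quotient_eq_iff[OF equiv_V_rel Ct' quotientI[OF S(1)] S'(1) equiv_class_self[OF equiv_V_rel S(1)]] by simp
qed

section \<open>A detecting point\<close>

text \<open>The inclusion of \<open>test_funs \<Omega>\<close> into all test functions is
  continuous, compact subsets of \<open>\<Omega>\<close> being compact in the whole space.\<close>

lemma cont_seminorm_UNIV:
  assumes p: "cont_seminorm UNIV p"
  shows "cont_seminorm \<Omega> p"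
proof -
  have t: "\<phi> \<in> test_funs UNIV" if "\<phi> \<in> test_funs \<Omega>" for \<phi> by (rule test_funs_UNIV[OF that])
  have 1: "\<forall>\<phi>\<in>test_funs UNIV. 0 \<le> p \<phi>" using p unfolding cont_seminorm_def by (elim conjE)
  have 2: "\<forall>\<phi>\<in>test_funs UNIV. \<forall>c. p (\<lambda>x. c * \<phi> x) = norm c * p \<phi>" using p unfolding cont_seminorm_def by (elim conjE)
  have 3: "\<forall>\<phi>\<in>test_funs UNIV. \<forall>\<psi>\<in>test_funs UNIV. p (\<lambda>x. \<phi> x + \<psi> x) \<le> p \<phi> + p \<psi>"
    using p unfolding cont_seminorm_def by (elim conjE)
  have 4: "\<exists>C m. \<forall>\<phi>\<in>test_funs \<Omega>. supp \<phi> \<subseteq> K --> p \<phi> \<le> C * Cm_norm m \<phi>" if K: "compact K" for K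
  proof -
    from cont_seminormD[OF p K subset_UNIV] obtain C where
      C: "\<exists>m. \<forall>\<phi>\<in>test_funs UNIV. supp \<phi> \<subseteq> K --> p \<phi> \<le> C * Cm_norm m \<phi>" by (rule exE)
    from C obtain m where m: "\<forall>\<phi>\<in>test_funs UNIV. supp \<phi> \<subseteq> K --> p \<phi> \<le> C * Cm_norm m \<phi>" by (rule exE)
    show ?thesis
      by (intro exI[of _ C] exI[of _ m] ballI impI) (rule m[rule_format, OF t])
  qed
  show ?thesis
    unfolding cont_seminorm_def
  proof (intro conjI)
    show "\<forall>\<phi>\<in>test_funs \<Omega>. 0 \<le> p \<phi>" by (rule ballI, rule bspec[OF 1 t])
    show "\<forall>\<phi>\<in>test_funs \<Omega>. \<forall>c. p (\<lambda>x. c * \<phi> x) = norm c * p \<phi>" by (rule ballI, rule bspec[OF 2 t])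
    show "\<forall>\<phi>\<in>test_funs \<Omega>. \<forall>\<psi>\<in>test_funs \<Omega>. p (\<lambda>x. \<phi> x + \<psi> x) \<le> p \<phi> + p \<psi>"
      by (rule ballI, rule ballI, rule bspec[OF bspec[OF 3 t] t])
    show "\<forall>K. compact K \<and> K \<subseteq> \<Omega> --> (\<exists>C m. \<forall>\<phi>\<in>test_funs \<Omega>. supp \<phi> \<subseteq> K --> p \<phi> \<le> C * Cm_norm m \<phi>)"
      by (rule allI, rule impI, rule 4[OF conjunct1])
  qed
qed

lemma tf_smooth_curve_UNIV:
  assumes "tf_smooth_curve \<Omega> c"
  shows "tf_smooth_curve UNIV c"
proof -
  from assms[unfolded tf_smooth_curve_def] obtain d where
    d: "d 0 = c \<and> (\<forall>k t. d k t \<in> test_funs \<Omega> \<and> tf_has_deriv \<Omega> (d k) (d (Suc k) t) t)" by (rule exE)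
  have t: "tf_has_deriv UNIV f g t" if "tf_has_deriv \<Omega> f g t" for f g t
    unfolding tf_has_deriv_def tf_tendsto_def
    by (intro allI impI, rule tf_tendstoD[OF that[unfolded tf_has_deriv_def] cont_seminorm_UNIV])
  show ?thesis
    unfolding tf_smooth_curve_def
  proof (intro exI[of _ d] conjI allI)
    show "d 0 = c" using d by (rule conjunct1)
    show "d k t \<in> test_funs UNIV" for k t by (rule test_funs_UNIV[OF conjunct1[OF spec[OF spec[OF conjunct2[OF d]]]]])
    show "tf_has_deriv UNIV (d k) (d (Suc k) t) t" for k t
      by (rule t[OF conjunct2[OF spec[OF spec[OF conjunct2[OF d]]]]])
  qed
qed

text \<open>Smoothness in \<open>U_set\<close> is defined through translated test objects.
  Translating back along the smooth curve of points keeps joint smoothness and shifts supports by a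
  bounded amount over compact times.\<close>

lemma U_smooth_curve_joint:
  fixes c :: "real => 'n::finite tfun \<times> (real^'n)"
  assumes c: "U_smooth_curve \<Omega> c"
  shows "smooth_in UNIV (\<lambda>z. fst (c (fst z)) (snd z))"
    and "local_supp UNIV (\<lambda>z. fst (c (fst z)) (snd z))"
proof -
  define T where "T t = T_op (snd (c t)) (fst (c t))" for t
  have "tf_smooth_curve \<Omega> T" using c unfolding U_smooth_curve_def T_def[abs_def] by (elim conjE)
  then have T: "tf_smooth_curve UNIV T" by (rule tf_smooth_curve_UNIV)
  have sx: "smooth_in UNIV (\<lambda>t. snd (c t))" using c by (simp add: U_smooth_curve_def smooth_curve_iff)
  have eq: "fst (c t) y = T t (y + snd (c t))" for t y by (simp add: T_def T_op_def)
  have sx': "smooth_in UNIV (\<lambda>z::real \<times> (real^'n). snd (c (fst z)))"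
    by (rule smooth_in_comp[OF open_UNIV _ sx]) (auto intro: smooth_in_fst)
  have "smooth_in UNIV (\<lambda>z::real \<times> (real^'n). (fst z, snd z + snd (c (fst z))))"
    by (intro smooth_in_Pair smooth_in_add sx' smooth_in_fst smooth_in_snd smooth_in_id open_UNIV)
  from smooth_in_comp[OF open_UNIV this tf_smooth_curve_joint(1)[OF T]]
  show "smooth_in UNIV (\<lambda>z. fst (c (fst z)) (snd z))" by (simp add: eq)
  show "local_supp UNIV (\<lambda>z. fst (c (fst z)) (snd z))"
  proof (rule local_suppI[OF open_UNIV])
    fix K :: "real set" assume K: "compact K"
    obtain B where B: "\<And>t. t \<in> K ==> \<bar>t\<bar> \<le> B"
      using compact_imp_bounded[OF K] unfolding bounded_iff by auto
    have "compact ((\<lambda>t. snd (c t)) ` K)"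
      by (rule compact_continuous_image[OF continuous_on_subset[OF smooth_in_continuous[OF sx] subset_UNIV] K])
    then obtain B' where B': "\<And>t. t \<in> K ==> norm (snd (c t)) \<le> B'"
      using compact_imp_bounded[OF \<open>compact ((\<lambda>t. snd (c t)) ` K)\<close>] unfolding bounded_iff by auto
    obtain r where r: "\<And>t x. \<bar>t\<bar> \<le> B ==> norm x > r ==> T t x = 0"
      using tf_smooth_curve_joint(2)[OF T, of B] by auto
    have "fst (c t) y = 0" if "t \<in> K" "norm y > r + B'" for t y
    proof -
      have "norm (y + snd (c t)) \<ge> norm y - norm (snd (c t))" using norm_diff_ineq[of y "snd (c t)"] by simp
      then show ?thesis unfolding eq using B[OF that(1)] B'[OF that(1)] that(2) by (intro r) auto
    qed
    then show "\<exists>r. \<forall>x\<in>K. \<forall>y. norm y > r --> fst (c (fst (x, y))) (snd (x, y)) = 0" by auto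
  qed
qed

section \<open>The energy of test objects\<close>

definition energy :: "'n::finite tfun => real" where
  "energy \<psi> = (LINT y|lborel. \<psi> y \<bullet> \<psi> y)"

lemma local_supp_inner:
  assumes "open W" "local_supp W h"
  shows "local_supp W (\<lambda>z. h z \<bullet> h z)"
proof (rule local_suppI[OF assms(1)])
  fix K assume "compact K" "K \<subseteq> W"
  from local_supp_compact[OF assms(2) this] obtain r where "\<forall>x\<in>K. \<forall>y. norm y > r --> h (x, y) = 0" by (rule exE)
  then show "\<exists>r. \<forall>x\<in>K. \<forall>y. norm y > r --> h (x, y) \<bullet> h (x, y) = 0" by (intro exI[of _ r]) simp
qed

lemma smooth_in_energy:
  fixes h :: "'p::euclidean_space \<times> (real^'n::finite) => complex"
  assumes W: "open W" and h: "smooth_in (W \<times> UNIV) h" "local_supp W h"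
  shows "smooth_in W (\<lambda>w. energy (\<lambda>y. h (w, y)))"
proof -
  have o: "open (W \<times> (UNIV :: (real^'n) set))" using W by (intro open_Times open_UNIV)
  show ?thesis
    unfolding energy_def
    by (rule smooth_in_integral[OF W smooth_in_inner[OF o h(1) h(1)] local_supp_inner[OF W h(2)]])
qed

text \<open>Squaring puts \<open>ep ^ CARD('n)\<close> twice into the denominator, and the
  substitution cancels it once.\<close>

lemma energy_S_op:
  fixes \<psi> :: "'n::finite tfun"
  assumes \<psi>: "\<psi> \<in> test_funs UNIV" and ep: "ep > 0"
  shows "energy (S_op ep \<psi>) = energy \<psi> / ep ^ CARD('n)"
proof -
  define g where "g y = \<psi> y \<bullet> \<psi> y" for y
  have "smooth_in UNIV g" unfolding g_def by (intro smooth_in_inner test_funsD(1)[OF \<psi>] open_UNIV)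
  then have m: "g \<in> borel_measurable borel" by (intro borel_measurable_continuous_onI smooth_in_continuous)
  have "S_op ep \<psi> y \<bullet> S_op ep \<psi> y = g (y /\<^sub>R ep) /\<^sub>R (ep ^ CARD('n) * ep ^ CARD('n))" for y
    by (simp add: S_op_def g_def inverse_mult_distrib)
  then have "energy (S_op ep \<psi>) = (LINT y|lborel. g (y /\<^sub>R ep)) /\<^sub>R (ep ^ CARD('n) * ep ^ CARD('n))"
    unfolding energy_def by (simp only: integral_scaleR_right)
  also have "(LINT y|lborel. g (y /\<^sub>R ep)) = ep ^ CARD('n) *\<^sub>R energy \<psi>"
    using lborel_integral_scale[OF ep m] by (simp add: energy_def g_def)
  finally show ?thesis using ep by (simp add: field_simps)
qed

text \<open>A function with integral 1 on a set of finite measure cannot have a small square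
  integral. In place of the Cauchy-Schwarz inequality, the pointwise bound that follows from the
  square of \<open>V * Re (\<phi> y) - 1\<close> being non-negative is integrated.\<close>

lemma energy_ge:
  fixes \<phi> :: "'n::finite tfun"
  assumes \<phi>: "\<phi> \<in> A_set 0 UNIV" and r: "\<And>y. norm y > r ==> \<phi> y = 0"
  shows "1 / (measure lborel (cball (0 :: real^'n) r) + 1) \<le> energy \<phi>"
proof -
  \<comment> \<open>The summand 1 keeps \<open>V\<close> positive even if the ball is empty.\<close>
  define V where "V = measure lborel (cball (0 :: real^'n) r) + 1"
  have V: "V > 0" by (simp add: V_def add_nonneg_pos)
  have s: "smooth_in UNIV \<phi>" by (rule test_funsD(1)[OF A_setD(1)[OF \<phi>]])
  have i1: "integrable lborel (\<lambda>y. \<phi> y \<bullet> \<phi> y)"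
    by (rule integrable_compact_supp[of _ r])
      (auto intro!: smooth_in_continuous smooth_in_inner s open_UNIV simp: r)
  have i2: "integrable lborel (indicat_real (cball (0 :: real^'n) r))"
    using emeasure_lborel_cball_finite[of "0 :: real^'n" r] by (intro integrable_real_indicator) auto
  have i0: "integrable lborel \<phi>" by (rule integrable_moment(2)[OF A_setD(1)[OF \<phi>]])
  have pt: "Re (\<phi> y) \<le> V / 2 * (\<phi> y \<bullet> \<phi> y) + indicat_real (cball 0 r) y / (2 * V)" for y
  proof (cases "norm y > r")
    case False
    have "0 \<le> (V * Re (\<phi> y) - 1)\<^sup>2" by simp
    then have "2 * V * Re (\<phi> y) \<le> V\<^sup>2 * (Re (\<phi> y))\<^sup>2 + 1"
      by (simp add: power2_eq_square algebra_simps)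
    also have "\<dots> \<le> V\<^sup>2 * (\<phi> y \<bullet> \<phi> y) + 1"
      by (intro add_right_mono mult_left_mono) (auto simp: inner_complex_def power2_eq_square)
    finally have "2 * V * Re (\<phi> y) \<le> V\<^sup>2 * (\<phi> y \<bullet> \<phi> y) + 1" .
    then show ?thesis using V False by (simp add: field_simps power2_eq_square)
  qed (simp add: r)
  have "1 = (LINT y|lborel. Re (\<phi> y))" using integral_Re[OF i0] A_setD(2)[OF \<phi>] by simp
  also have "\<dots> \<le> (LINT y|lborel. V / 2 * (\<phi> y \<bullet> \<phi> y) + indicat_real (cball 0 r) y / (2 * V))"
    using i0 i1 i2 pt by (intro integral_mono_AE[OF _ _ AE_I2]) auto
  also have "\<dots> = V / 2 * energy \<phi> + measure lborel (cball (0 :: real^'n) r) / (2 * V)"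
    using i1 i2 by (simp add: energy_def)
  also have "\<dots> \<le> V / 2 * energy \<phi> + 1 / 2"
    using V by (simp add: V_def field_simps)
  finally have "1 \<le> V * energy \<phi>" by simp
  then show ?thesis using V unfolding V_def[symmetric] by (simp add: field_simps)
qed

text \<open>Derivatives pass under the integral; the integrands are bounded uniformly in
  \<open>ep\<close> and vanish outside a common ball, whose measure enters the bound.\<close>

lemma Cb_energy_dbound:
  fixes \<Omega> :: "(real^'n::finite) set"
  assumes \<Omega>: "open \<Omega>" and \<phi>: "\<phi> \<in> Cb \<Omega> q" and K: "compact K" "K \<subseteq> \<Omega>"
  shows "\<exists>M\<ge>1. \<forall>ep\<in>{0<..1}. dbound k K (\<lambda>x. energy (\<phi> ep x)) M"
proof (rule ex_dbound)
  fix vs :: "(real^'n) list" assume vs: "set vs \<subseteq> Basis" "length vs \<le> k"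
  define h where "h ep z = \<phi> ep (fst z) (snd z) \<bullet> \<phi> ep (fst z) (snd z)" for ep and z :: "(real^'n) \<times> (real^'n)"
  define ws where "ws = map (\<lambda>v. (v, 0 :: real^'n)) vs"
  have ws: "set ws \<subseteq> Basis" "length ws \<le> k" using vs by (auto simp: ws_def Basis_prod_def)
  obtain \<delta> where \<delta>: "\<delta> > 0" "nb K (2 * \<delta>) \<subseteq> \<Omega>" by (rule nb_exists[OF K(1) \<Omega> K(2)])
  have K': "compact (nb K \<delta>)" "nb K \<delta> \<subseteq> \<Omega>"
    using compact_nb[OF K(1)] order_trans[OF nb_mono \<delta>(2)] \<delta>(1) by auto
  obtain r where r: "\<And>ep x y. 0 < ep ==> ep \<le> 1 ==> x \<in> nb K \<delta> ==> norm y > r ==> \<phi> ep x y = 0"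
    by (rule Cb_supp[OF \<phi> K'], rule that)
  have o: "open (\<Omega> \<times> (UNIV :: (real^'n) set))" using \<Omega> by (intro open_Times open_UNIV)
  have s\<phi>: "smooth_in (\<Omega> \<times> UNIV) (\<lambda>z. \<phi> ep (fst z) (snd z))" if "ep \<in> {0<..1}" for ep
    using Cb_joint[OF \<Omega> \<phi>, of ep] that by simp
  have sh: "smooth_in (\<Omega> \<times> UNIV) (h ep)" if "ep \<in> {0<..1}" for ep
    unfolding h_def by (intro smooth_in_inner s\<phi> that o)
  have lh: "local_supp \<Omega> (h ep)" if "ep \<in> {0<..1}" for ep
    using local_supp_inner[OF \<Omega> Cb_local_supp[OF \<Omega> \<phi>, of ep]] that by (simp add: h_def[abs_def])
  from Cb_bounds[OF \<Omega> \<phi> K, of "[]"] obtain B where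
    B: "\<forall>ep\<in>{0<..1}. \<forall>z\<in>K \<times> UNIV. norm (\<phi> ep (fst z) (snd z)) \<le> B" by auto
  have sq: "smooth_in UNIV (\<lambda>w::complex. w \<bullet> w)" by (intro smooth_in_inner smooth_in_id open_UNIV)
  have "\<exists>M. \<forall>ep\<in>{0<..1}. dbound k (K \<times> UNIV) (\<lambda>z. \<phi> ep (fst z) (snd z) \<bullet> \<phi> ep (fst z) (snd z)) M"
  proof (rule dbound_comp_family[where f="\<lambda>_ w. w \<bullet> w" and V=UNIV and L="cball 0 B" and g="\<lambda>ep z. \<phi> ep (fst z) (snd z)", OF o s\<phi> sq])
    show "(\<lambda>z. \<phi> ep (fst z) (snd z)) ` (K \<times> UNIV) \<subseteq> cball 0 B" if "ep \<in> {0<..1}" for ep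
      using B that by auto
    show "\<exists>M. \<forall>ep\<in>{0<..1}. \<forall>z\<in>K \<times> UNIV. norm (dirds bs (\<lambda>z. \<phi> ep (fst z) (snd z)) z) \<le> M" if "set bs \<subseteq> Basis" for bs
      by (rule Cb_bounds[OF \<Omega> \<phi> K that])
    show "\<exists>M. \<forall>ep\<in>{0<..1::real}. \<forall>w\<in>cball 0 B. norm (dirds bs (\<lambda>w::complex. w \<bullet> w) w) \<le> M" if bs: "set bs \<subseteq> Basis" for bs
    proof -
      from compact_dbound[OF sq compact_cball subset_UNIV, of "length bs" "0::complex" B]
      obtain M where "1 \<le> M \<and> dbound (length bs) (cball 0 B) (\<lambda>w::complex. w \<bullet> w) M" by (rule exE)
      then show ?thesis using dboundD[of "length bs" "cball 0 B" "\<lambda>w::complex. w \<bullet> w" M bs] bs by blast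
    qed
  qed (use K(2) in auto)
  then obtain M where M: "\<forall>ep\<in>{0<..1}. dbound k (K \<times> UNIV) (\<lambda>z. \<phi> ep (fst z) (snd z) \<bullet> \<phi> ep (fst z) (snd z)) M" by (rule exE)
  have "norm (dirds vs (\<lambda>x. energy (\<phi> ep x)) x) \<le> M * measure lborel (cball (0 :: real^'n) r)"
    if ep: "ep \<in> {0<..1}" and x: "x \<in> K" for ep x
  proof -
    have x\<Omega>: "x \<in> \<Omega>" using x K(2) by blast
    have eq: "dirds vs (\<lambda>x. energy (\<phi> ep x)) x = (LINT y|lborel. dirds ws (h ep) (x, y))"
      using dirds_integral[OF \<Omega> x\<Omega> sh[OF ep] lh[OF ep], of vs] by (simp add: energy_def h_def ws_def)
    have out: "dirds ws (h ep) (x, y) = 0" if "norm y > r" for y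
    proof (rule dirds_outside[of "nbo K \<delta> \<times> {y. norm y > r}"])
      show "open (nbo K \<delta> \<times> {y :: real^'n. norm y > r})"
        by (intro open_Times open_nbo open_Collect_less continuous_intros)
      show "(x, y) \<in> nbo K \<delta> \<times> {y. norm y > r}" using that x subset_nbo[OF \<delta>(1), of K] by auto
      show "h ep w = 0" if "w \<in> nbo K \<delta> \<times> {y. norm y > r}" for w
        using r[of ep "fst w" "snd w"] that ep subsetD[OF nbo_subset_nb, of "fst w" K \<delta>] by (auto simp: h_def)
    qed
    have bd: "norm (dirds ws (h ep) (x, y)) \<le> M" for y
      using dboundD[OF bspec[OF M ep] ws, of "(x, y)"] x by (simp add: h_def[abs_def])
    have i2: "integrable lborel (indicat_real (cball (0 :: real^'n) r))"
      using emeasure_lborel_cball_finite[of "0 :: real^'n" r] by (intro integrable_real_indicator) auto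
    have "norm (LINT y|lborel. dirds ws (h ep) (x, y)) \<le> (LINT y|lborel. norm (dirds ws (h ep) (x, y)))"
      by (rule integral_norm_bound)
    also have "\<dots> \<le> (LINT y|lborel. M * indicat_real (cball (0 :: real^'n) r) y)"
    proof (rule integral_mono_AE[OF _ _ AE_I2])
      show "integrable lborel (\<lambda>y. norm (dirds ws (h ep) (x, y)))"
        by (intro integrable_norm integrable_compact_supp[of _ r] out smooth_in_continuous
              smooth_in_slice[OF smooth_in_dirds[OF sh[OF ep]] x\<Omega>])
      show "integrable lborel (\<lambda>y. M * indicat_real (cball (0 :: real^'n) r) y)" using i2 by simp
      show "norm (dirds ws (h ep) (x, y)) \<le> M * indicat_real (cball 0 r) y" for y :: "real^'n"
        using bd[of y] out[of y] by (cases "norm y > r") auto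
    qed
    also have "\<dots> = M * measure lborel (cball (0 :: real^'n) r)" by simp
    finally show ?thesis unfolding eq .
  qed
  then show "\<exists>M. \<forall>ep\<in>{0<..1}. \<forall>x\<in>K. norm (dirds vs (\<lambda>x. energy (\<phi> ep x)) x) \<le> M" by blast
qed

lemma smooth_in_Cb_energy:
  fixes \<Omega> :: "(real^'n::finite) set"
  assumes \<Omega>: "open \<Omega>" and \<phi>: "\<phi> \<in> Cb \<Omega> q" and ep: "0 < ep" "ep \<le> 1"
  shows "smooth_in \<Omega> (\<lambda>x. energy (\<phi> ep x))"
  using smooth_in_energy[OF \<Omega> Cb_joint[OF \<Omega> \<phi> ep] Cb_local_supp[OF \<Omega> \<phi> ep]] by simp

text \<open>The energy after scaling is a family with bounded derivatives divided by
  \<open>ep ^ CARD('n)\<close>, and the chain rule multiplies at most \<open>k\<close> inner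
  derivatives. Hence the exponent \<open>CARD('n) * k\<close>.\<close>

lemma Cb_path_dbound:
  fixes \<Omega> :: "(real^'n::finite) set" and c :: "real => 'b::euclidean_space"
  assumes \<Omega>: "open \<Omega>" and \<phi>: "\<phi> \<in> Cb \<Omega> q" and K: "compact K" "K \<subseteq> \<Omega>"
    and c: "smooth_in UNIV c" "\<And>vs. \<exists>M. \<forall>t. norm (dirds vs c t) \<le> M"
  shows "\<And>ep. 0 < ep ==> ep \<le> 1 ==> smooth_in \<Omega> (\<lambda>x. c (energy (S_op ep (\<phi> ep x))))"
    and "\<exists>C\<ge>1. \<forall>ep\<in>{0<..1}. dbound k K (\<lambda>x. c (energy (S_op ep (\<phi> ep x)))) (C * inverse (ep ^ (CARD('n) * k)))"
proof -
  have eq: "energy (S_op ep (\<phi> ep x)) = inverse (ep ^ CARD('n)) *\<^sub>R energy (\<phi> ep x)"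
    if "0 < ep" "ep \<le> 1" "x \<in> \<Omega>" for ep x
    using energy_S_op[OF A_setD(1)[OF CbD(1)[OF \<phi> that]] that(1)] by (simp add: field_simps)
  define g where "g ep x = inverse (ep ^ CARD('n)) *\<^sub>R energy (\<phi> ep x)" for ep x
  have se: "smooth_in \<Omega> (\<lambda>x. energy (\<phi> ep x))" if "0 < ep" "ep \<le> 1" for ep
    by (rule smooth_in_Cb_energy[OF \<Omega> \<phi> that])
  have sg: "smooth_in \<Omega> (g ep)" if "0 < ep" "ep \<le> 1" for ep
    unfolding g_def by (intro smooth_in_scaleR smooth_in_const se that \<Omega>)
  have sc: "smooth_in \<Omega> (\<lambda>x. c (g ep x))" if "0 < ep" "ep \<le> 1" for ep
    by (rule smooth_in_comp[OF \<Omega> sg[OF that] c(1)]) simp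
  have eq': "c (g ep x) = c (energy (S_op ep (\<phi> ep x)))" if "0 < ep" "ep \<le> 1" "x \<in> \<Omega>" for ep x
    unfolding eq[OF that] g_def ..
  show "smooth_in \<Omega> (\<lambda>x. c (energy (S_op ep (\<phi> ep x))))" if "0 < ep" "ep \<le> 1" for ep
    by (rule smooth_in_cong[OF \<Omega> eq'[OF that] sc[OF that]])
  \<comment> \<open>Order \<open>Suc k\<close> also serves \<open>k = 0\<close>, where
    \<open>k - 1\<close> is 0 and \<open>dbound_comp\<close> still asks for first
    derivatives.\<close>
  from Cb_energy_dbound[OF \<Omega> \<phi> K, of "Suc k"] obtain M where
    M: "M \<ge> 1 \<and> (\<forall>ep\<in>{0<..1}. dbound (Suc k) K (\<lambda>x. energy (\<phi> ep x)) M)" by (rule exE)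
  have "\<exists>M\<ge>1. \<forall>i\<in>{()}. dbound k UNIV c M"
    by (rule ex_dbound) (use c(2) in auto)
  then obtain Mc where Mc: "1 \<le> Mc" "dbound k UNIV c Mc" by auto
  from dbound_comp[of k] obtain C0 where C0: "C0 \<ge> 1 \<and> (\<forall>(f::real => 'b) (g::real^'n => real) U V K L M.
     open U --> smooth_in U g --> smooth_in V f --> g ` U \<subseteq> V --> K \<subseteq> U --> 1 \<le> L --> 0 \<le> M -->
     (\<forall>b\<in>Basis. dbound (k - 1) K (dird b g) L) --> dbound k (g ` K) f M -->
     dbound k K (\<lambda>x. f (g x)) (C0 * L ^ k * M))" by (rule exE)
  have "dbound k K (\<lambda>x. c (energy (S_op ep (\<phi> ep x)))) (C0 * M ^ k * Mc * inverse (ep ^ (CARD('n) * k)))"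
    if ep: "ep \<in> {0<..1}" for ep
  proof -
    have ep': "0 < ep" "ep \<le> 1" using ep by auto
    define L where "L = M * inverse (ep ^ CARD('n))"
    have i1: "1 \<le> inverse (ep ^ CARD('n))" using ep' by (simp add: one_le_inverse power_le_one)
    have L: "1 \<le> L" unfolding L_def using mult_mono[of 1 M 1 "inverse (ep ^ CARD('n))"] M i1 by simp
    have "dbound (Suc k) K (g ep) L"
      unfolding dbound_def
    proof (intro allI impI ballI, elim conjE)
      fix vs :: "(real^'n) list" and x assume vs: "set vs \<subseteq> Basis" "length vs \<le> Suc k" and x: "x \<in> K"
      have "dirds vs (g ep) x = inverse (ep ^ CARD('n)) *\<^sub>R dirds vs (\<lambda>x. energy (\<phi> ep x)) x"
        unfolding g_def[abs_def] by (rule dirds_scaleR[OF \<Omega> se[OF ep']]) (use x K(2) in blast)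
      then have "norm (dirds vs (g ep) x) = inverse (ep ^ CARD('n)) * norm (dirds vs (\<lambda>x. energy (\<phi> ep x)) x)"
        using ep'(1) by (simp only: norm_scaleR) simp
      also have "\<dots> \<le> inverse (ep ^ CARD('n)) * M"
        using dboundD[OF bspec[OF conjunct2[OF M] ep] vs x] ep'(1) by (intro mult_left_mono) auto
      finally show "norm (dirds vs (g ep) x) \<le> L" by (simp add: L_def mult.commute)
    qed
    then have b: "\<forall>b\<in>Basis. dbound (k - 1) K (dird b (g ep)) L"
      by (intro ballI dbound_mono[OF dbound_dird, of k K "g ep" L]) auto
    have "dbound k K (\<lambda>x. c (g ep x)) (C0 * L ^ k * Mc)"
      by (rule conjunct2[OF C0, rule_format, OF \<Omega> sg[OF ep'] c(1) subset_UNIV K(2) L _ bspec[OF b] dbound_mono[OF Mc(2)]])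
        (use Mc(1) in auto)
    moreover have "C0 * L ^ k * Mc = C0 * M ^ k * Mc * inverse (ep ^ (CARD('n) * k))"
      by (simp add: L_def power_mult_distrib power_mult power_inverse)
    ultimately have "dbound k K (\<lambda>x. c (g ep x)) (C0 * M ^ k * Mc * inverse (ep ^ (CARD('n) * k)))" by simp
    show ?thesis by (rule dbound_cong[OF \<Omega> K(2) _ \<open>dbound k K (\<lambda>x. c (g ep x)) (C0 * M ^ k * Mc * inverse (ep ^ (CARD('n) * k)))\<close>], rule eq'[OF ep'])
  qed
  moreover have "C0 * M ^ k * Mc \<ge> 1"
  proof -
    have "1 \<le> M ^ k" using M by (intro one_le_power) simp
    then have "1 \<le> C0 * M ^ k" using mult_mono[of 1 C0 1 "M ^ k"] C0 by simp
    then show ?thesis using mult_mono[of 1 "C0 * M ^ k" 1 Mc] Mc(1) by simp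
  qed
  ultimately show "\<exists>C\<ge>1. \<forall>ep\<in>{0<..1}. dbound k K (\<lambda>x. c (energy (S_op ep (\<phi> ep x)))) (C * inverse (ep ^ (CARD('n) * k)))"
    by (intro exI[of _ "C0 * M ^ k * Mc"]) simp
qed

text \<open>Bumps of radius 2 around times at least 5 apart leave gaps, so an interval of length 1
  meets at most one of them. The path is therefore locally a single bump, and its derivatives are
  bounded although infinitely many values are prescribed.\<close>

lemma interpolating_path:
  fixes x :: "nat => 'a::euclidean_space" and t :: "nat => real"
  assumes t: "\<And>j. t (Suc j) \<ge> t j + 5" and x: "\<And>j. norm (x j - a) \<le> \<rho>"
  obtains c where "smooth_in UNIV c" "\<And>s. norm (c s - a) \<le> \<rho>" "\<And>j. c (t j) = x j"
    "\<And>vs. \<exists>M. \<forall>s. norm (dirds vs c s) \<le> M"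
proof -
  define near where "near j s \<longleftrightarrow> \<bar>s - t j\<bar> < 2" for j s
  define p where "p j s = a + bump (s - t j) *\<^sub>R (x j - a)" for j s
  \<comment> \<open>If no \<open>t j\<close> is near \<open>s\<close>, the choice is arbitrary and
    every \<open>p j s\<close> equals \<open>a\<close>.\<close>
  define c where "c s = p (SOME j. near j s) s" for s
  have tlt: "t i + 5 \<le> t j" if "i < j" for i j
    using that
  proof (induction j)
    case (Suc j)
    then show ?case using t[of j] by (cases "i = j") auto
  qed simp
  have ntl: "\<not> i < j" if "near i s" "near j s'" "\<bar>s - s'\<bar> < 1" for i j s s'
  proof
    assume "i < j"
    from tlt[OF this] that show False unfolding near_def abs_less_iff by linarith
  qed
  have uniq: "i = j" if "near i s" "near j s'" "\<bar>s - s'\<bar> < 1" for i j s s'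
    using ntl[OF that] ntl[OF that(2,1)] that(3) by (simp add: abs_minus_commute)
  have p0: "p j s = a" if n: "\<not> near j s" for j s
  proof -
    have "bump (s - t j) = 0" by (rule bump_0) (use n in \<open>simp add: near_def\<close>)
    then show ?thesis by (simp add: p_def)
  qed
  have c_p: "c s = p j s" if u: "\<And>i. near i s ==> i = j" for s j
  proof (cases "near j s")
    case True
    then have "(SOME j. near j s) = j" by (rule some_equality) (rule u)
    then show ?thesis by (simp add: c_def)
  next
    case False
    have n: "\<not> near i s" for i
    proof
      assume "near i s"
      with u[OF this] False show False by simp
    qed
    show ?thesis unfolding c_def p0[OF n] ..
  qed
  have loc: "\<exists>j. \<forall>s'\<in>ball s (1/2). c s' = p j s'" for s
  proof (cases "\<exists>j. \<exists>s'\<in>ball s (1/2). near j s'")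
    case True
    then obtain j s1 where j: "s1 \<in> ball s (1/2)" "near j s1" by blast
    have "c s' = p j s'" if "s' \<in> ball s (1/2)" for s'
    proof (rule c_p)
      fix i assume i: "near i s'"
      have "\<bar>s' - s1\<bar> < 1" using j(1) that unfolding mem_ball dist_real_def abs_less_iff by linarith
      then show "i = j" by (rule uniq[OF i j(2)])
    qed
    then show ?thesis by (intro exI[of _ j] ballI)
  next
    case False
    have "c s' = p 0 s'" if s': "s' \<in> ball s (1/2)" for s'
    proof (rule c_p)
      fix i assume "near i s'"
      with False s' show "i = 0" by blast
    qed
    then show ?thesis by (intro exI[of _ 0] ballI)
  qed
  have sb: "smooth_in UNIV (\<lambda>s. bump (s - t j))" for j
    by (rule smooth_in_comp[OF open_UNIV _ smooth_bump]) (auto intro!: smooth_in_diff)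
  have sp: "smooth_in UNIV (p j)" for j
    unfolding p_def by (intro smooth_in_add smooth_in_scaleR smooth_in_const sb open_UNIV)
  have "smooth_in UNIV c"
  proof (rule smooth_in_local_eq)
    fix s :: real
    from loc[of s] obtain j where "\<forall>s'\<in>ball s (1/2). c s' = p j s'" by (rule exE)
    then show "\<exists>V g. open V \<and> s \<in> V \<and> smooth_in V g \<and> (\<forall>y\<in>V. c y = g y)"
      by (intro exI[of _ "ball s (1/2)"] exI[of _ "p j"]) (auto intro: smooth_in_subset[OF sp])
  qed
  moreover have "norm (c s - a) \<le> \<rho>" for s
  proof -
    have "norm (p j s - a) \<le> 1 * norm (x j - a)" for j
      unfolding p_def using bump_bounds[of "s - t j"] by (simp add: mult_left_le_one_le)
    then have "norm (p j s - a) \<le> \<rho>" for j using order_trans[OF _ x[of j]] by simp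
    then show ?thesis unfolding c_def .
  qed
  moreover have "c (t j) = x j" for j
  proof -
    have "c (t j) = p j (t j)" by (rule c_p, rule uniq[of _ "t j" j "t j"]) (auto simp: near_def)
    then show ?thesis by (simp add: p_def bump_1)
  qed
  moreover have "\<exists>M. \<forall>s. norm (dirds vs c s) \<le> M" for vs
  proof -
    have "\<exists>M. \<forall>s. norm (dirds vs (bump :: real => real) s) \<le> M"
      by (rule dirds_compact_support_bounded[OF smooth_bump, of 2]) (auto intro: bump_0)
    then obtain M where M: "\<forall>s. norm (dirds vs (bump :: real => real) s) \<le> M" by (rule exE)
    have M0: "0 \<le> M" by (rule order_trans[OF norm_ge_zero M[rule_format, of 0]])
    have \<rho>0: "0 \<le> \<rho>" by (rule order_trans[OF norm_ge_zero x[of 0]])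
    have "norm (dirds vs (p j) s) \<le> norm a + M * \<rho>" for j s
    proof -
      have bl: "bounded_linear (\<lambda>r::real. r *\<^sub>R (x j - a))" by (rule bounded_linear_scaleR_left)
      have sq: "smooth_in UNIV (\<lambda>s. bump (s - t j) *\<^sub>R (x j - a))"
        by (rule smooth_in_scaleR[OF open_UNIV sb smooth_in_const])
      have "dirds vs (p j) s = dirds vs (\<lambda>_. a) s + dirds vs (\<lambda>s. bump (s - t j) *\<^sub>R (x j - a)) s"
        unfolding p_def[abs_def] by (rule dirds_add[OF open_UNIV smooth_in_const sq UNIV_I])
      also have "dirds vs (\<lambda>s. bump (s - t j) *\<^sub>R (x j - a)) s = dirds vs (\<lambda>s. bump (s - t j)) s *\<^sub>R (x j - a)"
        by (rule dirds_linear_comp[OF open_UNIV sb bl UNIV_I])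
      finally have "dirds vs (p j) s = dirds vs (\<lambda>_. a) s + dirds vs (\<lambda>s. bump (s - t j)) s *\<^sub>R (x j - a)" .
      moreover have "dirds vs (\<lambda>s. bump (s - t j)) s = dirds vs bump (s - t j)"
        using dirds_shift[of vs bump "- t j"] by (simp add: fun_eq_iff)
      moreover have "norm (dirds vs (\<lambda>_::real. a) s) \<le> norm a"
        by (cases "vs = []") (simp_all add: dirds_const)
      moreover have "norm (dirds vs bump (s - t j) *\<^sub>R (x j - a)) \<le> M * \<rho>"
        unfolding norm_scaleR using M x M0 by (intro mult_mono) auto
      ultimately show ?thesis by (simp add: norm_triangle_mono)
    qed
    note bp = this
    have "norm (dirds vs c s) \<le> norm a + M * \<rho>" for s
    proof -
      from loc[of s] obtain j where j: "\<forall>s'\<in>ball s (1/2). c s' = p j s'" by (rule exE)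
      have "dirds vs c s = dirds vs (p j) s" by (rule dirds_cong[of "ball s (1/2)"]) (use j in auto)
      then show ?thesis using bp[of j s] by simp
    qed
    then show ?thesis by blast
  qed
  ultimately show ?thesis by (rule that)
qed

lemma moderate_dirds_upto:
  fixes R :: "'n::finite tfun \<times> (real^'n) => 'v::euclidean_space"
  assumes \<Omega>: "open \<Omega>" and R: "R \<in> smooth_maps \<Omega> V" "moderate \<Omega> R" and K: "compact K" "K \<subseteq> \<Omega>"
  obtains N where "\<And>\<phi>. \<phi> \<in> Cb \<Omega> 0 ==> sup_bigO ({is. length is \<le> k} \<times> K)
    (\<lambda>ep p. dirds (axes (fst p)) (\<lambda>x. R (S_op ep (\<phi> ep x), x)) (snd p)) (\<lambda>ep. inverse (ep ^ N))"
proof -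
  have "\<forall>is. \<exists>N. \<forall>\<phi>\<in>Cb \<Omega> 0. sup_bigO K (\<lambda>ep. dirds (axes is) (\<lambda>x. R (S_op ep (\<phi> ep x), x))) (\<lambda>ep. inverse (ep ^ N))"
    by (rule allI, rule moderate_dirds[OF \<Omega> R K], rule exI, rule ballI)
  from choice[OF this] obtain N where N': "\<forall>is. \<forall>\<phi>\<in>Cb \<Omega> 0.
      sup_bigO K (\<lambda>ep. dirds (axes is) (\<lambda>x. R (S_op ep (\<phi> ep x), x))) (\<lambda>ep. inverse (ep ^ N is))"
    by (rule exE)
  note N = bspec[OF spec[OF N']]
  define I where "I = {is :: 'n list. length is \<le> k}"
  have I: "finite I" using finite_lists_length_le[of "UNIV :: 'n set" k] by (simp add: I_def)
  \<comment> \<open>The sum dominates each exponent, lists of bounded length being finite in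
    number.\<close>
  define N0 where "N0 = (\<Sum>is\<in>I. N is)"
  have NN: "N is \<le> N0" if "is \<in> I" for "is" unfolding N0_def by (rule member_le_sum[OF that _ I]) simp
  show ?thesis
  proof (rule that[of N0])
    fix \<phi> assume \<phi>: "\<phi> \<in> Cb \<Omega> 0"
    show "sup_bigO ({is. length is \<le> k} \<times> K)
      (\<lambda>ep p. dirds (axes (fst p)) (\<lambda>x. R (S_op ep (\<phi> ep x), x)) (snd p)) (\<lambda>ep. inverse (ep ^ N0))"
      unfolding I_def[symmetric]
      by (rule sup_bigO_Times_finite[OF I, where f="\<lambda>ep is. dirds (axes is) (\<lambda>x. R (S_op ep (\<phi> ep x), x))"],
          rule sup_bigO_inverse_power_mono[OF N[OF \<phi>] NN])
  qed
qed

section \<open>Derivatives off the diagonal\<close>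

lemma ex_contraction:
  fixes u v :: "'a::euclidean_space"
  assumes "norm u \<le> norm v"
  obtains D where "bounded_linear D" "D v = u" "\<And>z. norm (D z) \<le> norm (z :: 'a)"
proof (cases "v = 0")
  case True
  then show ?thesis using assms that[of "\<lambda>_. 0"] by simp
next
  case False
  \<comment> \<open>The rank one map onto the line of \<open>u\<close>, normalised so that
    \<open>v\<close> goes to \<open>u\<close>.\<close>
  define D where "D z = (v \<bullet> z) *\<^sub>R (u /\<^sub>R (v \<bullet> v))" for z
  show ?thesis
  proof (rule that)
    show "bounded_linear D"
      unfolding D_def[abs_def] by (rule bounded_linear_compose[OF bounded_linear_scaleR_left bounded_linear_inner_right])
    show "D v = u" using False by (simp add: D_def)
    fix z :: 'a
    have "norm (D z) = \<bar>v \<bullet> z\<bar> * (norm u / (norm v)\<^sup>2)"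
      unfolding D_def norm_scaleR by (simp add: power2_norm_eq_inner divide_inverse mult.commute)
    also have "\<dots> \<le> (norm v * norm z) * (norm v / (norm v)\<^sup>2)"
      using assms by (intro mult_mono Cauchy_Schwarz_ineq2 divide_right_mono) auto
    also have "\<dots> = norm z" using False by (simp add: power2_eq_square)
    finally show "norm (D z) \<le> norm z" .
  qed
qed

text \<open>A bounded smooth map with bounded derivatives that is the identity near 0. Composed with
  it, a linear map becomes a reparametrisation to which the uniform estimates apply.\<close>

definition local_id :: "real => 'a::euclidean_space => 'a" where
  "local_id \<sigma> z = bump (z /\<^sub>R \<sigma>) *\<^sub>R z"

lemma local_id:
  fixes z :: "'a::euclidean_space"
  assumes \<sigma>: "\<sigma> > 0"
  shows "smooth_in UNIV (local_id \<sigma> :: 'a => 'a)" "norm z \<le> \<sigma> ==> local_id \<sigma> z = z" "norm (local_id \<sigma> z) \<le> 2 * \<sigma>"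
    "\<exists>M. \<forall>z. norm (dirds vs (local_id \<sigma>) (z :: 'a)) \<le> M"
proof -
  have "smooth_in UNIV (\<lambda>z::'a. bump (z /\<^sub>R \<sigma>))"
    by (rule smooth_in_comp[OF open_UNIV _ smooth_bump]) (auto intro!: smooth_in_scaleR)
  then show s: "smooth_in UNIV (local_id \<sigma> :: 'a => 'a)"
    unfolding local_id_def by (intro smooth_in_scaleR smooth_in_id open_UNIV)
  show "local_id \<sigma> z = z" if "norm z \<le> \<sigma>"
  proof -
    have "bump (z /\<^sub>R \<sigma>) = 1" by (rule bump_1) (use that \<sigma> in \<open>simp add: field_simps\<close>)
    then show ?thesis by (simp add: local_id_def)
  qed
  have out: "local_id \<sigma> z = 0" if "norm z > 2 * \<sigma>" for z :: 'a
  proof -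
    have "bump (z /\<^sub>R \<sigma>) = 0" by (rule bump_0) (use that \<sigma> in \<open>simp add: field_simps\<close>)
    then show ?thesis by (simp add: local_id_def)
  qed
  show "norm (local_id \<sigma> z) \<le> 2 * \<sigma>"
  proof (cases "norm z > 2 * \<sigma>")
    case False
    have "norm (local_id \<sigma> z) = bump (z /\<^sub>R \<sigma>) * norm z" using bump_bounds(1)[of "z /\<^sub>R \<sigma>"] by (simp add: local_id_def)
    also have "\<dots> \<le> 1 * norm z" by (intro mult_right_mono bump_bounds(2) norm_ge_zero)
    finally show ?thesis using False by simp
  qed (use \<sigma> in \<open>simp add: out\<close>)
  show "\<exists>M. \<forall>z. norm (dirds vs (local_id \<sigma>) (z :: 'a)) \<le> M"
    by (rule dirds_compact_support_bounded[OF s out])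
qed

text \<open>
  The moderateness estimate only involves derivatives along the diagonal. Mixed derivatives of
  \<open>F (x, y) = R (S_op ep (\<phi> ep x), y)\<close> are reached by composing \<open>\<phi> ep\<close> with a
  contraction \<open>D\<close> in the point variable: the graph of \<open>D\<close> contains \<open>(u, v)\<close> if \<open>D v = u\<close>, and
  polarisation expresses mixed derivatives through powers of such directional derivatives.
\<close>

definition diag_dirs :: "((real^'n::finite) \<times> (real^'n)) set" where
  "diag_dirs = range (\<lambda>i. (0, axis i 1)) \<union> range (\<lambda>i. (axis i 1, axis i 1))"

lemma finite_diag_dirs: "finite diag_dirs"
  by (simp add: diag_dirs_def)

text \<open>A pure direction in the first variable is \<open>(a, a) - (0, a)\<close>, hence the
  constant 2.\<close>

lemma Basis_diag_dirs:
  assumes b: "b \<in> (Basis :: ((real^'n::finite) \<times> (real^'n)) set)"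
  shows "\<exists>c. b = (\<Sum>s\<in>diag_dirs. c s *\<^sub>R s) \<and> (\<Sum>s\<in>diag_dirs. \<bar>c s\<bar>) \<le> 2"
proof -
  obtain i where i: "b = (0, axis i 1) \<or> b = (axis i 1, 0)" using b by (auto simp: Basis_prod_def Basis_eq_axis)
  define a where "a = (axis i 1 :: real^'n)"
  have a: "a \<noteq> 0" "(a, a) \<in> diag_dirs" "(0, a) \<in> diag_dirs" by (auto simp: a_def diag_dirs_def axis_eq_0_iff)
  have sub: "sum f diag_dirs = f (a, a) + f (0, a)" if "\<And>s. s \<noteq> (a, a) ==> s \<noteq> (0, a) ==> f s = 0"
    for f :: "(real^'n) \<times> (real^'n) => 'z::comm_monoid_add"
  proof -
    have "sum f diag_dirs = sum f {(a, a), (0, a)}"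
      by (rule sum.mono_neutral_right[OF finite_diag_dirs]) (use a that in auto)
    then show ?thesis using a(1) by simp
  qed
  define c1 c2 :: "(real^'n) \<times> (real^'n) => real"
    where "c1 s = (if s = (0, a) then 1 else 0)" and "c2 s = (if s = (a, a) then 1 else if s = (0, a) then -1 else 0)" for s
  have "(\<Sum>s\<in>diag_dirs. c1 s *\<^sub>R s) = (0, a)" "(\<Sum>s\<in>diag_dirs. \<bar>c1 s\<bar>) = 1"
    "(\<Sum>s\<in>diag_dirs. c2 s *\<^sub>R s) = (a, 0)" "(\<Sum>s\<in>diag_dirs. \<bar>c2 s\<bar>) = 2"
    using a(1) by (subst sub; simp add: c1_def c2_def)+
  then show ?thesis using i unfolding a_def[symmetric] by (elim disjE) (rule exI[of _ c1], simp, rule exI[of _ c2], simp)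
qed

text \<open>All entries are non-negative, and those of the first component do not exceed those of
  the second. This survives combinations with non-negative coefficients and the common sign, and
  yields the norm comparison that \<open>ex_contraction\<close> needs. Second components are basis
  vectors with coefficients at most 1, so each list element adds at most 1 to the sum.\<close>

lemma diag_dirs_combination:
  fixes ws :: "((real^'n::finite) \<times> (real^'n)) list"
  assumes ws: "set ws \<subseteq> diag_dirs" and S: "S \<subseteq> {..<length ws}"
  defines "w \<equiv> - (\<Sum>j\<in>S. (1 / real (Suc j)) *\<^sub>R ws ! j)"
  shows "norm (fst w) \<le> norm (snd w)" "(\<Sum>b\<in>Basis. \<bar>snd w \<bullet> b\<bar>) \<le> real (length ws)"
proof -
  have fS: "finite S" using S finite_subset by blast
  have el: "ws ! j \<in> diag_dirs" if "j \<in> S" for j using S ws that nth_mem by blast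
  have f: "fst w = - (\<Sum>j\<in>S. (1 / real (Suc j)) *\<^sub>R fst (ws ! j))"
    and s: "snd w = - (\<Sum>j\<in>S. (1 / real (Suc j)) *\<^sub>R snd (ws ! j))"
    by (simp_all add: w_def fst_sum snd_sum)
  show "norm (fst w) \<le> norm (snd w)"
  proof (rule norm_le_componentwise_cart)
    fix i
    have c: "0 \<le> fst (ws ! j) $ i" "fst (ws ! j) $ i \<le> snd (ws ! j) $ i" if "j \<in> S" for j
      using el[OF that] by (auto simp: diag_dirs_def axis_def)
    have "0 \<le> (\<Sum>j\<in>S. (1 / real (Suc j)) * fst (ws ! j) $ i)"
      using c(1) by (intro sum_nonneg mult_nonneg_nonneg) auto
    moreover have "(\<Sum>j\<in>S. (1 / real (Suc j)) * fst (ws ! j) $ i) \<le> (\<Sum>j\<in>S. (1 / real (Suc j)) * snd (ws ! j) $ i)"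
      using c(2) by (intro sum_mono mult_left_mono) auto
    ultimately show "norm (fst w $ i) \<le> norm (snd w $ i)"
      unfolding f s by (simp only: vector_minus_component sum_component vector_scaleR_component real_norm_def abs_minus_cancel) simp
  qed
  have "(\<Sum>b\<in>Basis. \<bar>snd w \<bullet> b\<bar>) \<le> (\<Sum>b\<in>(Basis :: (real^'n) set). \<Sum>j\<in>S. \<bar>snd (ws ! j) \<bullet> b\<bar>)"
  proof (rule sum_mono)
    fix b :: "real^'n"
    have "\<bar>snd w \<bullet> b\<bar> = \<bar>\<Sum>j\<in>S. (1 / real (Suc j)) * (snd (ws ! j) \<bullet> b)\<bar>"
      unfolding s by (simp only: inner_minus_left inner_sum_left inner_scaleR_left abs_minus_cancel)
    also have "\<dots> \<le> (\<Sum>j\<in>S. \<bar>(1 / real (Suc j)) * (snd (ws ! j) \<bullet> b)\<bar>)" by (rule sum_abs)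
    also have "\<dots> \<le> (\<Sum>j\<in>S. \<bar>snd (ws ! j) \<bullet> b\<bar>)"
    proof (rule sum_mono)
      fix j
      have "\<bar>(1 / real (Suc j)) * (snd (ws ! j) \<bullet> b)\<bar> = (1 / real (Suc j)) * \<bar>snd (ws ! j) \<bullet> b\<bar>" by (simp only: abs_mult) simp
      also have "\<dots> \<le> 1 * \<bar>snd (ws ! j) \<bullet> b\<bar>" by (intro mult_right_mono) auto
      finally show "\<bar>(1 / real (Suc j)) * (snd (ws ! j) \<bullet> b)\<bar> \<le> \<bar>snd (ws ! j) \<bullet> b\<bar>" by simp
    qed
    finally show "\<bar>snd w \<bullet> b\<bar> \<le> (\<Sum>j\<in>S. \<bar>snd (ws ! j) \<bullet> b\<bar>)" .
  qed
  also have "\<dots> = (\<Sum>j\<in>S. \<Sum>b\<in>(Basis :: (real^'n) set). \<bar>snd (ws ! j) \<bullet> b\<bar>)" by (rule sum.swap)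
  also have "\<dots> = (\<Sum>j\<in>S. 1)"
  proof (rule sum.cong[OF refl])
    fix j assume "j \<in> S"
    from el[OF this] have b': "snd (ws ! j) \<in> Basis" by (auto simp: diag_dirs_def Basis_eq_axis)
    have "(\<Sum>b\<in>Basis. \<bar>snd (ws ! j) \<bullet> b\<bar>) = (\<Sum>b\<in>Basis. if b = snd (ws ! j) then 1 else 0)"
      by (rule sum.cong[OF refl]) (use b' in \<open>auto simp: inner_Basis\<close>)
    then show "(\<Sum>b\<in>Basis. \<bar>snd (ws ! j) \<bullet> b\<bar>) = 1" using b' by simp
  qed
  also have "\<dots> \<le> real (length ws)" using card_mono[OF finite_lessThan S] by simp
  finally show "(\<Sum>b\<in>Basis. \<bar>snd w \<bullet> b\<bar>) \<le> real (length ws)" .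
qed

text \<open>\<open>N\<close> is fixed before \<open>\<phi>\<close>, as moderateness of composites
  requires; the constant and the scale may depend on \<open>\<phi>\<close>.\<close>

lemma mixed_dbound:
  fixes R :: "'n::finite tfun \<times> (real^'n) => 'v::euclidean_space"
  assumes \<Omega>: "open \<Omega>" and R: "R \<in> smooth_maps \<Omega> V" "moderate \<Omega> R"
    and K: "compact K" "K \<subseteq> \<Omega>" and L: "compact L" "L \<subseteq> \<Omega>"
  obtains N where "\<And>\<phi>. \<phi> \<in> Cb \<Omega> 0 ==> \<exists>C>0. \<exists>e>0. \<forall>ep. 0 < ep \<and> ep < e -->
    dbound k (K \<times> L) (\<lambda>z. R (S_op ep (\<phi> ep (fst z)), snd z)) (C * inverse (ep ^ N))"
proof -
  have KL: "compact (K \<union> L)" "K \<union> L \<subseteq> \<Omega>" using K L by auto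
  obtain \<delta> where \<delta>: "\<delta> > 0" "nb (K \<union> L) (2 * \<delta>) \<subseteq> \<Omega>" by (rule nb_exists[OF KL(1) \<Omega> KL(2)])
  have \<delta>': "nb K (2 * \<delta>) \<subseteq> \<Omega>" "nb L (2 * \<delta>) \<subseteq> \<Omega>" using \<delta>(2) by (auto simp: nb_def)
  have K': "compact (nb K \<delta>)" "nb K \<delta> \<subseteq> \<Omega>"
    using compact_nb[OF K(1)] order_trans[OF nb_mono \<delta>'(1)] \<delta>(1) by auto
  define I where "I = {is :: 'n list. length is \<le> k}"
  obtain N where N': "\<And>\<phi>. \<phi> \<in> Cb \<Omega> 0 ==> sup_bigO ({is. length is \<le> k} \<times> L)
    (\<lambda>ep p. dirds (axes (fst p)) (\<lambda>x. R (S_op ep (\<phi> ep x), x)) (snd p)) (\<lambda>ep. inverse (ep ^ N))"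
    by (rule moderate_dirds_upto[OF \<Omega> R L, of k], rule that)
  note N = N'[folded I_def]
  define \<sigma> where "\<sigma> = \<delta> / 2"
  have \<sigma>: "\<sigma> > 0" "2 * \<sigma> = \<delta>" using \<delta>(1) by (auto simp: \<sigma>_def)
  \<comment> \<open>\<open>local_id\<close> keeps the values within \<open>\<delta>\<close> of
    \<open>x0\<close>; for \<open>y\<close> within \<open>\<sigma>\<close> of \<open>y0\<close> the
    map is \<open>x0 + D (y - y0)\<close>.\<close>
  define \<xi> :: "real^'n => real^'n => (real^'n => real^'n) => real^'n => real^'n"
    where "\<xi> x0 y0 D y = x0 + D (local_id \<sigma> (y - y0))" for x0 y0 D y
  define \<Xi> where "\<Xi> = {\<xi> x0 y0 D |x0 y0 D. x0 \<in> K \<and> bounded_linear D \<and> (\<forall>z. norm (D z) \<le> norm z)}"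
  have sl: "smooth_in UNIV (\<lambda>y. local_id \<sigma> (y - y0))" for y0 :: "real^'n"
    by (rule smooth_in_comp[OF open_UNIV _ local_id(1)[OF \<sigma>(1)]]) (auto intro!: smooth_in_diff)
  have sD: "smooth_in UNIV (\<lambda>y. D (local_id \<sigma> (y - y0)))" if "bounded_linear D"
    for y0 :: "real^'n" and D :: "real^'n => real^'n"
    by (rule smooth_in_linear_comp[OF open_UNIV that sl])
  have \<xi>n: "norm (D (local_id \<sigma> (y - y0))) \<le> \<delta>" if "\<forall>z. norm (D z) \<le> norm z"
    for y y0 :: "real^'n" and D :: "real^'n => real^'n"
    using order_trans[OF spec[OF that] local_id(3)[OF \<sigma>(1)]] \<sigma>(2) by simp
  show ?thesis
  proof (rule that[of N])
    fix \<phi> assume \<phi>: "\<phi> \<in> Cb \<Omega> 0"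
    \<comment> \<open>Moderateness for each single test object becomes uniform over all base points
      and contractions.\<close>
    have "\<exists>C>0. \<exists>e>0. \<forall>ep. 0 < ep \<and> ep < e --> (\<forall>\<xi>\<in>\<Xi>. \<forall>p\<in>I \<times> L.
      norm (dirds (axes (fst p)) (\<lambda>y. R (S_op ep (\<phi> ep (\<xi> y)), y)) (snd p)) \<le> C * \<bar>inverse (ep ^ N)\<bar>)"
    proof (rule Cb_uniform[OF \<Omega> \<phi> K', where \<Xi>=\<Xi> and L="I \<times> L" and g="\<lambda>ep. inverse (ep ^ N)" and
          H="\<lambda>ep \<psi> p. dirds (axes (fst p)) (\<lambda>y. R (S_op ep (\<psi> y), y)) (snd p)"])
      fix \<zeta> assume "\<zeta> \<in> \<Xi>"
      then obtain x0 y0 D where \<zeta>: "\<zeta> = \<xi> x0 y0 D" and x0: "x0 \<in> K" and D: "bounded_linear D" "\<forall>z. norm (D z) \<le> norm z"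
        unfolding \<Xi>_def by auto
      show "smooth_in UNIV \<zeta>" unfolding \<zeta> \<xi>_def by (intro smooth_in_add smooth_in_const sD[OF D(1)] open_UNIV)
      show "\<zeta> x \<in> nb K \<delta>" for x
        unfolding \<zeta> \<xi>_def nb_def using x0 \<xi>n[OF D(2)] by (intro UN_I[of x0]) (auto simp: dist_norm)
    next
      fix vs :: "(real^'n) list" assume vs: "vs \<noteq> []"
      from local_id(4)[OF \<sigma>(1), of vs] obtain M where M: "\<forall>z. norm (dirds vs (local_id \<sigma>) z) \<le> M" by (rule exE)
      have "norm (dirds vs \<zeta> y) \<le> M" if zX: "\<zeta> \<in> \<Xi>" for \<zeta> y
      proof -
        obtain x0 y0 D where \<zeta>: "\<zeta> = \<xi> x0 y0 D" and D: "bounded_linear D" "\<forall>z. norm (D z) \<le> norm z"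
          using zX unfolding \<Xi>_def by auto
        have "dirds vs \<zeta> y = dirds vs (\<lambda>_. x0) y + dirds vs (\<lambda>y. D (local_id \<sigma> (y - y0))) y"
          unfolding \<zeta> \<xi>_def[abs_def] by (rule dirds_add[OF open_UNIV smooth_in_const sD[OF D(1)] UNIV_I])
        also have "dirds vs (\<lambda>_. x0) y = 0" by (simp add: dirds_const[OF vs])
        also have "dirds vs (\<lambda>y. D (local_id \<sigma> (y - y0))) y = D (dirds vs (\<lambda>y. local_id \<sigma> (y - y0)) y)"
          by (rule dirds_linear_comp[OF open_UNIV sl D(1) UNIV_I])
        also have "dirds vs (\<lambda>y. local_id \<sigma> (y - y0)) y = dirds vs (local_id \<sigma>) (y - y0)"
          using dirds_shift[of vs "local_id \<sigma>" "- y0"] by (simp add: fun_eq_iff)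
        finally show ?thesis using order_trans[OF spec[OF D(2)] spec[OF M]] by simp
      qed
      then show "\<exists>M. \<forall>\<zeta>\<in>\<Xi>. \<forall>y. norm (dirds vs \<zeta> y) \<le> M" by (intro exI[of _ M]) simp
    qed (rule N)
    then obtain C where C: "0 < C \<and> (\<exists>e>0. \<forall>ep. 0 < ep \<and> ep < e --> (\<forall>\<xi>\<in>\<Xi>. \<forall>p\<in>I \<times> L.
      norm (dirds (axes (fst p)) (\<lambda>y. R (S_op ep (\<phi> ep (\<xi> y)), y)) (snd p)) \<le> C * \<bar>inverse (ep ^ N)\<bar>))" by (rule exE)
    from conjunct2[OF C] obtain e1 where e1: "0 < e1 \<and> (\<forall>ep. 0 < ep \<and> ep < e1 --> (\<forall>\<xi>\<in>\<Xi>. \<forall>p\<in>I \<times> L.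
      norm (dirds (axes (fst p)) (\<lambda>y. R (S_op ep (\<phi> ep (\<xi> y)), y)) (snd p)) \<le> C * \<bar>inverse (ep ^ N)\<bar>))" by (rule exE)
    obtain e2 where e2: "e2 > 0" "e2 \<le> 1"
      "\<And>ep. 0 < ep ==> ep < e2 ==> smooth_in (nbo K \<delta> \<times> nbo L \<delta>) (\<lambda>z. R (S_op ep (\<phi> ep (fst z)), snd z))"
      by (rule smooth_maps_Cb[OF \<Omega> \<phi> R(1) \<delta>(1) K(1) \<delta>'(1) L(1) \<delta>'(2)], rule that)
    \<comment> \<open>One factor \<open>2 ^ k\<close> counts the subsets in the polarisation, the
      other comes from expressing basis vectors in \<open>diag_dirs\<close>; the power of
      \<open>Suc k\<close> bounds the cost of expanding the polarised directions in the
      basis.\<close>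
    define C' where "C' = 4 ^ k * real (Suc k) ^ k * C"
    have "dbound k (K \<times> L) (\<lambda>z. R (S_op ep (\<phi> ep (fst z)), snd z)) (C' * inverse (ep ^ N))"
      if ep: "0 < ep" "ep < e1" "ep < e2" for ep
      unfolding dbound_def
    proof (intro allI impI ballI, elim conjE)
      fix bs :: "((real^'n) \<times> (real^'n)) list" and z assume bs: "set bs \<subseteq> Basis" "length bs \<le> k" and z: "z \<in> K \<times> L"
      obtain x0 y0 where z0: "z = (x0, y0)" and x0: "x0 \<in> K" and y0: "y0 \<in> L" using z by auto
      define B where "B = C * inverse (ep ^ N)"
      have B: "B \<ge> 0" using C ep(1) by (simp add: B_def)
      define F where "F = (\<lambda>z. R (S_op ep (\<phi> ep (fst z)), snd z))"
      define P where "P = nbo K \<delta> \<times> nbo L \<delta>"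
      have P: "open P" "(x0, y0) \<in> P"
        unfolding P_def using x0 y0 subset_nbo[OF \<delta>(1), of K] subset_nbo[OF \<delta>(1), of L]
        by (auto intro: open_Times open_nbo)
      have sF: "smooth_in P F" unfolding P_def F_def by (rule e2(3)[OF ep(1,3)])
      have pure: "norm (dirds (replicate m (u, v)) F (x0, y0)) \<le> \<kappa> ^ m * B"
        if uv: "norm u \<le> norm v" and \<kappa>: "(\<Sum>b\<in>Basis. \<bar>v \<bullet> b\<bar>) \<le> \<kappa>" and m: "m \<le> k" for u v \<kappa> m
      proof -
        obtain D where D: "bounded_linear D" "D v = u" "\<And>z. norm (D z) \<le> norm z" by (rule ex_contraction[OF uv], rule that)
        define h where "h y = R (S_op ep (\<phi> ep (\<xi> x0 y0 D y)), y)" for y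
        have \<Xi>: "\<xi> x0 y0 D \<in> \<Xi>" unfolding \<Xi>_def using x0 D by blast
        have hb: "norm (dirds (axes is) h y0) \<le> B" if "length is \<le> k" for "is"
        proof -
          have "(is, y0) \<in> I \<times> L" using that y0 by (simp add: I_def)
          from bspec[OF bspec[OF mp[OF spec[OF conjunct2[OF e1]] conjI[OF ep(1,2)]] \<Xi>] this]
          show ?thesis using ep(1) by (simp add: h_def[abs_def] B_def)
        qed
        define W where "W = ball y0 \<sigma>"
        have W: "open W" "y0 \<in> W" using \<sigma> by (auto simp: W_def)
        have \<xi>W: "\<xi> x0 y0 D y = x0 + D (y - y0)" if "y \<in> W" for y
          using that by (simp add: \<xi>_def W_def local_id(2)[OF \<sigma>(1)] dist_norm norm_minus_commute)
        have im: "(\<xi> x0 y0 D y, y) \<in> P" if "y \<in> W" for y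
        proof -
          have n: "norm (y - y0) < \<delta>" using that \<sigma> by (simp add: W_def dist_norm norm_minus_commute)
          have "dist x0 (\<xi> x0 y0 D y) < \<delta>" using le_less_trans[OF D(3) n] by (simp add: \<xi>W[OF that] dist_norm)
          moreover have "dist y0 y < \<delta>" using n by (simp add: dist_norm norm_minus_commute)
          ultimately show ?thesis using x0 y0 by (auto simp: P_def nbo_def)
        qed
        have s\<xi>: "smooth_in W (\<xi> x0 y0 D)"
          unfolding \<xi>_def by (intro smooth_in_add smooth_in_const smooth_in_subset[OF sD[OF D(1)]] W(1)) simp
        have hF: "h y = F (\<xi> x0 y0 D y, y)" for y by (simp add: h_def F_def)
        have sh: "smooth_in W h"
          unfolding hF[abs_def]
          by (rule smooth_in_comp[OF W(1) smooth_in_Pair[OF W(1) s\<xi> smooth_in_id] sF]) (use im in auto)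
        have "norm (dirds (replicate m v) h y0) \<le> \<kappa> ^ length (replicate m v) * B"
        proof (rule dirds_span_bound[OF finite_Basis W _ B sh])
          show "0 \<le> \<kappa>" by (rule order_trans[OF sum_nonneg \<kappa>]) simp
          show "norm (dirds bs h y0) \<le> B" if bs: "set bs \<subseteq> Basis" "length bs = length (replicate m v)" for bs
          proof -
            obtain "is" where "is": "bs = axes is" by (rule Basis_list_axes[OF bs(1)])
            show ?thesis unfolding "is" by (rule hb) (use bs(2) m "is" in simp)
          qed
          show "\<exists>c. w = (\<Sum>s\<in>Basis. c s *\<^sub>R s) \<and> (\<Sum>s\<in>Basis. \<bar>c s\<bar>) \<le> \<kappa>" if "w \<in> set (replicate m v)" for w
            using that \<kappa> by (intro exI[of _ "\<lambda>b. v \<bullet> b"]) (auto simp: euclidean_representation split: if_splits)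
        qed
        \<comment> \<open>The graph of \<open>x0 + D (y - y0)\<close> contains the line through
          \<open>(x0, y0)\<close> in direction \<open>(u, v)\<close>, since \<open>D v = u\<close>;
          along it \<open>h\<close> and \<open>F\<close> agree.\<close>
        also have "dirds (replicate m v) h y0 = dirds (replicate m (u, v)) F (x0, y0)"
        proof -
          define J where "J = (\<lambda>s::real. y0 + s *\<^sub>R v) -` W"
          have J: "open J" "0 \<in> J" unfolding J_def using W by (auto intro!: open_vimage continuous_intros)
          have "dirds (replicate m 1) (\<lambda>s. h (y0 + s *\<^sub>R v)) 0 = dirds (replicate m 1) (\<lambda>s. F ((x0, y0) + s *\<^sub>R (u, v))) 0"
          proof (rule dirds_cong[OF J])
            fix s assume "s \<in> J"
            then have "y0 + s *\<^sub>R v \<in> W" by (simp add: J_def)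
            then show "h (y0 + s *\<^sub>R v) = F ((x0, y0) + s *\<^sub>R (u, v))"
              using bounded_linear.linear[OF D(1)] D(2) by (simp add: hF \<xi>W linear_scale)
          qed
          then show ?thesis unfolding dirds_line by simp
        qed
        finally show ?thesis by simp
      qed
      have diag: "norm (dirds ws F (x0, y0)) \<le> 2 ^ length ws * (real (length ws) ^ length ws * B)"
        if ws: "set ws \<subseteq> diag_dirs" "length ws \<le> k" for ws
      proof -
        have "norm (dirds ws F (x0, y0)) \<le> (\<Sum>S\<in>Pow {..<length ws}.
            norm (dirds (replicate (length ws) (- (\<Sum>j\<in>S. (1 / real (Suc j)) *\<^sub>R ws ! j))) F (x0, y0)))"
          by (rule dirds_polarisation_bound[OF P(1) sF P(2)])
        also have "\<dots> \<le> (\<Sum>S\<in>Pow {..<length ws}. real (length ws) ^ length ws * B)"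
        proof (rule sum_mono)
          fix S assume "S \<in> Pow {..<length ws}"
          then have S: "S \<subseteq> {..<length ws}" by simp
          note * = diag_dirs_combination[OF ws(1) S]
          show "norm (dirds (replicate (length ws) (- (\<Sum>j\<in>S. (1 / real (Suc j)) *\<^sub>R ws ! j))) F (x0, y0))
            \<le> real (length ws) ^ length ws * B"
            using pure[OF *(1) *(2) ws(2)] unfolding prod.collapse .
        qed
        also have "\<dots> = 2 ^ length ws * (real (length ws) ^ length ws * B)" by (simp add: card_Pow)
        finally show ?thesis .
      qed
      define m where "m = length bs"
      have mk: "m \<le> k" using bs(2) by (simp add: m_def)
      have "norm (dirds bs F (x0, y0)) \<le> 2 ^ length bs * (2 ^ m * (real m ^ m * B))"
      proof (rule dirds_span_bound[OF finite_diag_dirs P _ _ sF])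
        show "norm (dirds ws F (x0, y0)) \<le> 2 ^ m * (real m ^ m * B)"
          if "set ws \<subseteq> diag_dirs" "length ws = length bs" for ws
          using diag[OF that(1)] that(2) mk by (simp add: m_def)
        show "\<exists>c. b = (\<Sum>s\<in>diag_dirs. c s *\<^sub>R s) \<and> (\<Sum>s\<in>diag_dirs. \<bar>c s\<bar>) \<le> 2" if "b \<in> set bs" for b
          by (rule Basis_diag_dirs[OF subsetD[OF bs(1) that]])
        show "0 \<le> 2 ^ m * (real m ^ m * B)" by (intro mult_nonneg_nonneg B zero_le_power) auto
        show "(0::real) \<le> 2" by simp
      qed
      also have "\<dots> = (4 ^ m * real m ^ m) * B"
      proof -
        have "(4::real) ^ m = 2 ^ m * 2 ^ m" by (simp only: power_mult_distrib[symmetric]) simp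
        then show ?thesis by (simp only: m_def mult.assoc)
      qed
      also have "\<dots> \<le> (4 ^ k * real (Suc k) ^ k) * B"
      proof (intro mult_right_mono mult_mono B)
        have "real m ^ m \<le> real (Suc k) ^ m" using mk by (intro power_mono) auto
        also have "\<dots> \<le> real (Suc k) ^ k" using mk by (intro power_increasing) auto
        finally show "real m ^ m \<le> real (Suc k) ^ k" .
        show "(4::real) ^ m \<le> 4 ^ k" using mk by (intro power_increasing) auto
      qed auto
      also have "\<dots> = C' * inverse (ep ^ N)" by (simp add: C'_def B_def)
      finally show "norm (dirds bs (\<lambda>z. R (S_op ep (\<phi> ep (fst z)), snd z)) z) \<le> C' * inverse (ep ^ N)"
        unfolding F_def z0 .
    qed
    then have ex: "\<exists>e>0. \<forall>ep. 0 < ep \<and> ep < e -->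
      dbound k (K \<times> L) (\<lambda>z. R (S_op ep (\<phi> ep (fst z)), snd z)) (C' * inverse (ep ^ N))"
      using e1 e2(1) by (intro exI[of _ "min e1 e2"]) simp
    have C': "C' > 0" using C by (simp add: C'_def)
    show "\<exists>C>0. \<exists>e>0. \<forall>ep. 0 < ep \<and> ep < e -->
      dbound k (K \<times> L) (\<lambda>z. R (S_op ep (\<phi> ep (fst z)), snd z)) (C * inverse (ep ^ N))"
      by (rule exI[of _ C'], rule conjI[OF C' ex])
  qed
qed

section \<open>Cut-off of test objects and values along a path\<close>

definition tf_truncate :: "real => 'n::finite tfun => 'n tfun => 'n tfun" where
  "tf_truncate \<rho> \<eta> f = (\<lambda>y. bump (y /\<^sub>R \<rho>) *\<^sub>R f y + (1 - (LINT z|lborel. bump (z /\<^sub>R \<rho>) *\<^sub>R f z)) * \<eta> y)"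

lemma smooth_bump_scaled: "smooth_in UNIV (\<lambda>y::'a::euclidean_space. bump (y /\<^sub>R \<rho>))"
  by (rule smooth_in_comp[OF open_UNIV _ smooth_bump]) (auto intro!: smooth_in_scaleR)

lemma bump_scaled:
  assumes "\<rho> > 0"
  shows "norm y \<le> \<rho> ==> bump (y /\<^sub>R \<rho>) = 1" "norm y > 2 * \<rho> ==> bump (y /\<^sub>R \<rho>) = 0"
proof -
  show "bump (y /\<^sub>R \<rho>) = 1" if "norm y \<le> \<rho>" by (rule bump_1) (use that assms in \<open>simp add: field_simps\<close>)
  show "bump (y /\<^sub>R \<rho>) = 0" if "norm y > 2 * \<rho>" by (rule bump_0) (use that assms in \<open>simp add: field_simps\<close>)
qed

text \<open>On objects supported in the ball of radius \<open>\<rho>\<close> the cut-off changes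
  nothing and the correction has coefficient 0. At sufficiently small scales this covers any family
  with common bounded support.\<close>

lemma tf_truncate_id:
  assumes f: "f \<in> A_set 0 UNIV" "\<And>y. norm y > \<rho> ==> f y = 0" and \<rho>: "\<rho> > 0"
  shows "tf_truncate \<rho> \<eta> f = f"
proof -
  have "bump (y /\<^sub>R \<rho>) *\<^sub>R f y = f y" for y
    using bump_scaled(1)[OF \<rho>, of y] f(2)[of y] by (cases "norm y \<le> \<rho>") auto
  then show ?thesis by (simp add: tf_truncate_def A_setD(2)[OF f(1)])
qed

text \<open>The cut-off destroys the unit integral; a multiple of \<open>\<eta>\<close> restores
  it.\<close>

lemma tf_truncate_A_set:
  assumes f: "f \<in> test_funs UNIV" and \<eta>: "\<eta> \<in> A_set 0 UNIV"
  shows "tf_truncate \<rho> \<eta> f \<in> A_set 0 UNIV"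
proof -
  define g where "g y = bump (y /\<^sub>R \<rho>) *\<^sub>R f y" for y
  define d where "d = 1 - (LINT z|lborel. g z)"
  have s: "smooth_in UNIV g"
    unfolding g_def by (intro smooth_in_scaleR smooth_bump_scaled test_funsD(1)[OF f] open_UNIV)
  have g: "g \<in> test_funs UNIV"
    by (rule test_funsI(1)[OF s test_funsD(2)[OF f] subset_UNIV]) (simp add: g_def supp_outside)
  have eq: "tf_truncate \<rho> \<eta> f = (\<lambda>y. 1 * g y + d * \<eta> y)" by (simp add: tf_truncate_def g_def d_def)
  have "tf_truncate \<rho> \<eta> f \<in> test_funs UNIV"
    unfolding eq by (rule test_funs_lincomb[OF g A_setD(1)[OF \<eta>]])
  moreover have "(LINT y|lborel. tf_truncate \<rho> \<eta> f y) = 1"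
    using integrable_moment(2)[OF g] integrable_moment(2)[OF A_setD(1)[OF \<eta>]] A_setD(2)[OF \<eta>]
    by (simp add: eq d_def)
  ultimately show ?thesis by (auto simp: A_set_def)
qed

lemma tf_truncate_outside:
  assumes "\<rho> > 0" "\<And>y. norm y > 2 * \<rho> ==> \<eta> y = 0" "norm y > 2 * \<rho>"
  shows "tf_truncate \<rho> \<eta> f y = 0"
  using bump_scaled(2)[OF assms(1,3)] assms(2)[OF assms(3)] by (simp add: tf_truncate_def)

lemma smooth_in_tf_truncate:
  fixes h :: "'p::euclidean_space \<times> (real^'n::finite) => complex"
  assumes W: "open W" and h: "smooth_in (W \<times> UNIV) h" "local_supp W h" and \<eta>: "\<eta> \<in> A_set 0 UNIV"
  shows "smooth_in (W \<times> UNIV) (\<lambda>z. tf_truncate \<rho> \<eta> (\<lambda>y. h (fst z, y)) (snd z))"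
proof -
  have o: "open (W \<times> (UNIV :: (real^'n) set))" using W by (intro open_Times open_UNIV)
  have sb: "smooth_in (W \<times> UNIV) (\<lambda>z::'p \<times> (real^'n). f (snd z))" if "smooth_in UNIV f"
    for f :: "real^'n => 'c::euclidean_space"
    by (rule smooth_in_comp[OF o _ that]) (auto intro!: smooth_in_snd o)
  define g where "g z = bump (snd z /\<^sub>R \<rho>) *\<^sub>R h z" for z
  have g: "smooth_in (W \<times> UNIV) g"
    unfolding g_def by (intro smooth_in_scaleR sb[OF smooth_bump_scaled] h(1) o)
  have lg: "local_supp W g"
  proof (rule local_suppI[OF W])
    fix K assume "compact K" "K \<subseteq> W"
    from local_supp_compact[OF h(2) this] obtain r where "\<forall>x\<in>K. \<forall>y. norm y > r --> h (x, y) = 0" by (rule exE)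
    then show "\<exists>r. \<forall>x\<in>K. \<forall>y. norm y > r --> g (x, y) = 0" by (intro exI[of _ r]) (simp add: g_def)
  qed
  have si: "smooth_in (W \<times> (UNIV :: (real^'n) set)) (\<lambda>z. (\<lambda>w. LINT y|lborel. g (w, y)) (fst z))"
    by (rule smooth_in_comp[OF o _ smooth_in_integral[OF W g lg]]) (auto intro!: smooth_in_fst o)
  have "smooth_in (W \<times> UNIV) (\<lambda>z. g z + (1 - (\<lambda>w. LINT y|lborel. g (w, y)) (fst z)) * \<eta> (snd z))"
    by (intro smooth_in_add smooth_in_mult smooth_in_diff smooth_in_const g si o
        sb[OF test_funsD(1)[OF A_setD(1)[OF \<eta>]]])
  then show ?thesis by (simp add: tf_truncate_def g_def)
qed

definition path_point :: "(real => 'b) => 'n::finite tfun \<times> (real^'n) => 'b" where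
  "path_point c u = c (energy (fst u))"

text \<open>\<open>R\<close> may be evaluated at the path point only if the test object can be
  translated there. The cut-off bounds its support, which makes the expression meaningful for all
  test objects. It uses the first component only, as a generalized number must.\<close>

definition path_value ::
    "('n::finite tfun \<times> (real^'n) => 'v) => real => 'n tfun => (real => real^'n) => 'n tfun \<times> (real^'n) => 'v" where
  "path_value R \<rho> \<eta> c u = R (tf_truncate \<rho> \<eta> (fst u), c (energy (fst u)))"

lemma smooth_in_path:
  fixes c :: "real => 'b::euclidean_space" and u :: "real => 'n::finite tfun \<times> (real^'n)"
  assumes u: "U_smooth_curve \<Omega> u" and c: "smooth_in UNIV c"
  shows "smooth_in UNIV (\<lambda>t. c (energy (fst (u t))))"
proof -
  have "smooth_in (UNIV \<times> UNIV) (\<lambda>z. fst (u (fst z)) (snd z))"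
    using U_smooth_curve_joint(1)[OF u] by simp
  from smooth_in_energy[OF open_UNIV this U_smooth_curve_joint(2)[OF u]]
  have "smooth_in UNIV (\<lambda>t. energy (fst (u t)))" by simp
  then show ?thesis by (rule smooth_in_comp[OF open_UNIV _ c]) simp
qed

text \<open>The path stays within \<open>\<rho>\<close> of \<open>a\<close> and truncated objects
  have supports of radius \<open>2 * \<rho>\<close>; together they need the ball of radius
  \<open>3 * \<rho>\<close>.\<close>

locale path_construction =
  fixes \<Omega> :: "(real^'n::finite) set" and c :: "real => real^'n" and a :: "real^'n" and \<rho> :: real and \<eta> :: "'n tfun"
  assumes \<Omega>: "open \<Omega>" and \<rho>: "\<rho> > 0" and a: "cball a (3 * \<rho>) \<subseteq> \<Omega>"
    and c: "smooth_in UNIV c" "\<And>s. norm (c s - a) \<le> \<rho>" "\<And>vs. \<exists>M. \<forall>s. norm (dirds vs c s) \<le> M"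
    and \<eta>: "\<eta> \<in> A_set 0 UNIV" "\<And>y. norm y > 2 * \<rho> ==> \<eta> y = 0"
begin

lemma path_in: "c s \<in> cball a \<rho>" "cball (c s) (2 * \<rho>) \<subseteq> cball a (3 * \<rho>)" "cball a \<rho> \<subseteq> \<Omega>" "c s \<in> cball a (3 * \<rho>)"
proof -
  have d: "dist a (c s) \<le> \<rho>" using c(2)[of s] by (simp add: dist_norm norm_minus_commute)
  then show "c s \<in> cball a \<rho>" "c s \<in> cball a (3 * \<rho>)" using \<rho> by auto
  show "cball a \<rho> \<subseteq> \<Omega>" by (rule order_trans[OF _ a]) (use \<rho> in auto)
  show "cball (c s) (2 * \<rho>) \<subseteq> cball a (3 * \<rho>)"
  proof
    fix y assume "y \<in> cball (c s) (2 * \<rho>)"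
    then show "y \<in> cball a (3 * \<rho>)" using d dist_triangle[of a y "c s"] by simp
  qed
qed

lemma truncate_U_set:
  assumes "f \<in> test_funs UNIV"
  shows "(tf_truncate \<rho> \<eta> f, c s) \<in> U_set \<Omega>"
  by (rule U_setI[OF tf_truncate_A_set[OF assms \<eta>(1)] tf_truncate_outside[OF \<rho> \<eta>(2)]])
    (use path_in(2,4)[of s] a in auto)

lemma path_point_V_M: "path_point c \<in> V_M \<Omega> \<Omega>"
proof -
  have 1: "path_point c \<in> smooth_maps \<Omega> \<Omega>"
    unfolding smooth_maps_def smooth_curve_iff mem_Collect_eq path_point_def
  proof (intro conjI allI impI ballI)
    show "c (energy (fst u)) \<in> \<Omega>" for u :: "'n tfun \<times> (real^'n)" using path_in(1,3) by blast
    show "smooth_in UNIV (\<lambda>t. c (energy (fst (u t))))" if "U_smooth_curve \<Omega> u" for u :: "real => 'n tfun \<times> (real^'n)"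
      by (rule smooth_in_path[OF that c(1)])
  qed
  have "moderate \<Omega> (path_point c)"
    unfolding moderate_def
  proof (intro allI impI, elim conjE)
    fix K :: "(real^'n) set" and \<alpha> :: "'n => nat" assume K: "compact K" "K \<subseteq> \<Omega>"
    define k where "k = length (mi_list \<alpha>)"
    \<comment> \<open>The successor ensures an exponent of at least 1, also for
      \<open>k = 0\<close>.\<close>
    have "sup_bigO K (\<lambda>ep. mderiv \<alpha> (\<lambda>x. path_point c (S_op ep (\<phi> ep x), x))) (\<lambda>ep. inverse (ep ^ Suc (CARD('n) * k)))"
      if \<phi>: "\<phi> \<in> Cb \<Omega> 0" for \<phi>
    proof -
      from Cb_path_dbound(2)[OF \<Omega> \<phi> K c(1,3), of k] obtain C where
        C: "C \<ge> 1 \<and> (\<forall>ep\<in>{0<..1}. dbound k K (\<lambda>x. c (energy (S_op ep (\<phi> ep x)))) (C * inverse (ep ^ (CARD('n) * k))))" by (rule exE)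
      have "sup_bigO K (\<lambda>ep. mderiv \<alpha> (\<lambda>x. path_point c (S_op ep (\<phi> ep x), x))) (\<lambda>ep. inverse (ep ^ (CARD('n) * k)))"
      proof (rule sup_bigOI[of C 1])
        fix ep :: real and x assume ep: "0 < ep" "ep < 1" and x: "x \<in> K"
        then have "ep \<in> {0<..1}" by simp
        from dboundD[OF bspec[OF conjunct2[OF C] this] axes_Basis, of "mi_list \<alpha>" x] x ep(1)
        show "norm (mderiv \<alpha> (\<lambda>x. path_point c (S_op ep (\<phi> ep x), x)) x) \<le> C * \<bar>inverse (ep ^ (CARD('n) * k))\<bar>"
          by (simp add: mderiv_eq_dirds path_point_def k_def)
      qed (use C in auto)
      then show ?thesis by (rule sup_bigO_inverse_power_mono) simp
    qed
    then show "\<exists>N\<ge>1. \<forall>\<phi>\<in>Cb \<Omega> 0. sup_bigO K (\<lambda>ep. mderiv \<alpha> (\<lambda>x. path_point c (S_op ep (\<phi> ep x), x))) (\<lambda>ep. inverse (ep ^ N))"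
      by (intro exI[of _ "Suc (CARD('n) * k)"]) simp
  qed
  with 1 show ?thesis by (simp add: V_M_def indep_snd_def path_point_def)
qed

lemma good_rep_path_point: "good_rep \<Omega> \<Omega> (path_point c)"
  unfolding good_rep_def path_point_def
  by (intro exI[of _ "cball a \<rho>"] conjI ballI compact_cball path_in)

lemma path_value_smooth_maps:
  assumes R: "R \<in> smooth_maps \<Omega> V"
  shows "path_value R \<rho> \<eta> c \<in> smooth_maps \<Omega> V"
  unfolding smooth_maps_def smooth_curve_iff mem_Collect_eq
proof (intro conjI allI impI ballI)
  show "path_value R \<rho> \<eta> c u \<in> V" if "u \<in> U_set \<Omega>" for u
  proof -
    have "fst u \<in> test_funs UNIV" using that A_setD(1) by (auto simp: U_set_def)
    then show ?thesis using R truncate_U_set unfolding path_value_def smooth_maps_def by blast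
  qed
  fix u :: "real => 'n tfun \<times> (real^'n)" assume u: "U_smooth_curve \<Omega> u"
  have A: "fst (u t) \<in> test_funs UNIV" for t
  proof -
    have "u t \<in> U_set \<Omega>" using u unfolding U_smooth_curve_def by simp
    then show ?thesis using A_setD(1) by (auto simp: U_set_def)
  qed
  have s: "smooth_in (UNIV \<times> UNIV) (\<lambda>z. fst (u (fst z)) (snd z))"
    using U_smooth_curve_joint(1)[OF u] by simp
  from smooth_in_tf_truncate[OF open_UNIV this U_smooth_curve_joint(2)[OF u] \<eta>(1), of \<rho>]
  have j: "smooth_in (UNIV \<times> UNIV) (\<lambda>z. tf_truncate \<rho> \<eta> (fst (u (fst z))) (snd z))" by simp
  have out: "tf_truncate \<rho> \<eta> (fst (u t)) y = 0" if "norm y > 2 * \<rho>" for t y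
    by (rule tf_truncate_outside[OF \<rho> \<eta>(2) that])
  have "smooth_in UNIV (\<lambda>t. R (tf_truncate \<rho> \<eta> (fst (u t)), c (energy (fst (u t)))))"
    by (rule smooth_maps_comp(1)[OF R open_UNIV j tf_truncate_A_set[OF A \<eta>(1)] smooth_in_path[OF u c(1)] out compact_cball a])
      (use path_in(2,4) in auto)
  then show "smooth_in UNIV (\<lambda>t. path_value R \<rho> \<eta> c (u t))" by (simp add: path_value_def)
qed

text \<open>At small scales all members of \<open>B\<close> have supports within
  \<open>\<rho>\<close>, where truncation is the identity; the possible values of the path lie in
  the compact ball around \<open>a\<close>, which plays the role of \<open>L\<close> in
  \<open>small_scales\<close>.\<close>

lemma is_S_RX_path_value:
  assumes R: "R \<in> smooth_maps \<Omega> UNIV"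
  shows "is_S_RX \<Omega> R (path_point c) (path_value R \<rho> \<eta> c)"
proof -
  have "\<exists>W e. open W \<and> K \<subseteq> W \<and> compact (closure W) \<and> closure W \<subseteq> \<Omega> \<and> 0 < e \<and>
          (\<forall>x\<in>W. \<forall>\<phi>\<in>B \<inter> A_set 0 UNIV. \<forall>ep. 0 < ep \<and> ep < e -->
             (S_op ep \<phi>, x) \<in> U_set \<Omega> \<and> (S_op ep \<phi>, path_point c (S_op ep \<phi>, x)) \<in> U_set \<Omega> \<and>
             path_value R \<rho> \<eta> c (S_op ep \<phi>, x) = R (S_op ep \<phi>, path_point c (S_op ep \<phi>, x)))"
    if K: "compact K" "K \<subseteq> \<Omega>" and r: "\<forall>\<phi>\<in>B. supp \<phi> \<subseteq> cball 0 r" for K B r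
  proof -
    obtain W e where W: "open W" "K \<subseteq> W" "compact (closure W)" "closure W \<subseteq> \<Omega>" "e > 0"
      "\<And>x \<psi> ep. x \<in> W \<union> cball a \<rho> ==> \<psi> \<in> A_set 0 UNIV ==> supp \<psi> \<subseteq> cball 0 r ==> 0 < ep ==> ep < e ==>
        (S_op ep \<psi>, x) \<in> U_set \<Omega>"
      "\<And>(\<psi> :: 'n tfun) ep y. supp \<psi> \<subseteq> cball 0 r ==> 0 < ep ==> ep < e ==> norm y > \<rho> ==> S_op ep \<psi> y = 0"
      by (rule small_scales[OF \<Omega> K compact_cball path_in(3) \<rho>, of r], rule that)
    have "(S_op ep \<phi>, x) \<in> U_set \<Omega> \<and> (S_op ep \<phi>, path_point c (S_op ep \<phi>, x)) \<in> U_set \<Omega> \<and>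
        path_value R \<rho> \<eta> c (S_op ep \<phi>, x) = R (S_op ep \<phi>, path_point c (S_op ep \<phi>, x))"
      if x: "x \<in> W" "\<phi> \<in> B \<inter> A_set 0 UNIV" "0 < ep" "ep < e" for x \<phi> ep
    proof (intro conjI)
      have s: "supp \<phi> \<subseteq> cball 0 r" using x(2) r by blast
      have A: "\<phi> \<in> A_set 0 UNIV" using x(2) by blast
      show "(S_op ep \<phi>, x) \<in> U_set \<Omega>" by (rule W(6)[OF _ A s x(3,4)]) (use x(1) in simp)
      show "(S_op ep \<phi>, path_point c (S_op ep \<phi>, x)) \<in> U_set \<Omega>"
        by (rule W(6)[OF _ A s x(3,4)]) (unfold path_point_def, rule UnI2, rule path_in(1))
      have "tf_truncate \<rho> \<eta> (S_op ep \<phi>) = S_op ep \<phi>"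
        by (rule tf_truncate_id[OF S_op_A_set[OF A x(3)] W(7)[OF s x(3,4)] \<rho>])
      then show "path_value R \<rho> \<eta> c (S_op ep \<phi>, x) = R (S_op ep \<phi>, path_point c (S_op ep \<phi>, x))"
        by (simp add: path_value_def path_point_def)
    qed
    then show ?thesis using W(1-5) by (intro exI[of _ W] exI[of _ e]) simp
  qed
  moreover have "path_value R \<rho> \<eta> c \<in> smooth_maps \<Omega> UNIV" by (rule path_value_smooth_maps[OF R])
  moreover have "indep_snd \<Omega> (path_value R \<rho> \<eta> c)" by (simp add: indep_snd_def path_value_def)
  ultimately show ?thesis unfolding is_S_RX_def by auto
qed

text \<open>At small scales truncation is trivial and the value is \<open>F (x, X x)\<close> with
  \<open>X\<close> the path point. The mixed derivatives of \<open>F\<close> and the derivatives of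
  \<open>X\<close> grow at most like powers of \<open>inverse ep\<close>, and by
  \<open>dbound_comp\<close> so do those of the composition.\<close>

lemma moderate_path_value:
  fixes R :: "'n tfun \<times> (real^'n) => 'v::euclidean_space"
  assumes R: "R \<in> smooth_maps \<Omega> V" "moderate \<Omega> R"
  shows "moderate \<Omega> (path_value R \<rho> \<eta> c)"
  unfolding moderate_def
proof (intro allI impI, elim conjE)
  fix K :: "(real^'n) set" and \<alpha> :: "'n => nat" assume K: "compact K" "K \<subseteq> \<Omega>"
  define k where "k = length (mi_list \<alpha>)"
  define L where "L = cball a \<rho>"
  have L: "compact L" "L \<subseteq> \<Omega>" unfolding L_def by (rule compact_cball, rule path_in(3))
  have KL: "compact (K \<union> L)" "K \<union> L \<subseteq> \<Omega>" using K L by auto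
  obtain \<delta>1 where \<delta>1: "\<delta>1 > 0" "nb (K \<union> L) (2 * \<delta>1) \<subseteq> \<Omega>" by (rule nb_exists[OF KL(1) \<Omega> KL(2)])
  \<comment> \<open>Supports within \<open>\<delta>\<close> must be left alone by the cut-off at
    radius \<open>\<rho>\<close>.\<close>
  define \<delta> where "\<delta> = min \<rho> \<delta>1"
  have \<delta>: "\<delta> > 0" "\<delta> \<le> \<rho>" using \<rho> \<delta>1 by (auto simp: \<delta>_def)
  have "nb (K \<union> L) (2 * \<delta>) \<subseteq> \<Omega>" by (rule order_trans[OF nb_mono \<delta>1(2)]) (simp add: \<delta>_def)
  then have \<delta>': "nb K (2 * \<delta>) \<subseteq> \<Omega>" "nb L (2 * \<delta>) \<subseteq> \<Omega>" by (auto simp: nb_def)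
  obtain N where N: "\<And>\<phi>. \<phi> \<in> Cb \<Omega> 0 ==> \<exists>C>0. \<exists>e>0. \<forall>ep. 0 < ep \<and> ep < e -->
    dbound k (K \<times> L) (\<lambda>z. R (S_op ep (\<phi> ep (fst z)), snd z)) (C * inverse (ep ^ N))"
    by (rule mixed_dbound[OF \<Omega> R K L, of k], rule that)
  \<comment> \<open>Up to \<open>k\<close> inner derivatives, each of size
    \<open>inverse (ep ^ (CARD('n) * Suc k))\<close>, and one outer factor
    \<open>inverse (ep ^ N)\<close>.\<close>
  define N' where "N' = CARD('n) * Suc k * k + N"
  from dbound_comp[of k] obtain C0 where C0: "C0 \<ge> 1 \<and> (\<forall>(f::(real^'n) \<times> (real^'n) => 'v) (g::real^'n => (real^'n) \<times> (real^'n)) U V K L M.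
     open U --> smooth_in U g --> smooth_in V f --> g ` U \<subseteq> V --> K \<subseteq> U --> 1 \<le> L --> 0 \<le> M -->
     (\<forall>b\<in>Basis. dbound (k - 1) K (dird b g) L) --> dbound k (g ` K) f M -->
     dbound k K (\<lambda>x. f (g x)) (C0 * L ^ k * M))" by (rule exE)
  have "sup_bigO K (\<lambda>ep. mderiv \<alpha> (\<lambda>x. path_value R \<rho> \<eta> c (S_op ep (\<phi> ep x), x))) (\<lambda>ep. inverse (ep ^ N'))"
    if \<phi>: "\<phi> \<in> Cb \<Omega> 0" for \<phi>
  proof -
    from N[OF \<phi>] obtain C1 where C1: "0 < C1 \<and> (\<exists>e>0. \<forall>ep. 0 < ep \<and> ep < e -->
      dbound k (K \<times> L) (\<lambda>z. R (S_op ep (\<phi> ep (fst z)), snd z)) (C1 * inverse (ep ^ N)))" by (rule exE)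
    from conjunct2[OF C1] obtain e1 where e1: "0 < e1 \<and> (\<forall>ep. 0 < ep \<and> ep < e1 -->
      dbound k (K \<times> L) (\<lambda>z. R (S_op ep (\<phi> ep (fst z)), snd z)) (C1 * inverse (ep ^ N)))" by (rule exE)
    from Cb_path_dbound(2)[OF \<Omega> \<phi> K c(1,3), of "Suc k"] obtain C2 where C2: "C2 \<ge> 1 \<and>
      (\<forall>ep\<in>{0<..1}. dbound (Suc k) K (\<lambda>x. c (energy (S_op ep (\<phi> ep x)))) (C2 * inverse (ep ^ (CARD('n) * Suc k))))" by (rule exE)
    obtain e2 where e2: "e2 > 0" "e2 \<le> 1"
      "\<And>ep. 0 < ep ==> ep < e2 ==> smooth_in (nbo K \<delta> \<times> nbo L \<delta>) (\<lambda>z. R (S_op ep (\<phi> ep (fst z)), snd z))"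
      "\<And>ep x y. 0 < ep ==> ep < e2 ==> x \<in> nbo K \<delta> ==> y \<in> nbo L \<delta> ==> (S_op ep (\<phi> ep x), y) \<in> U_set \<Omega>"
      "\<And>ep x y. 0 < ep ==> ep < e2 ==> x \<in> nbo K \<delta> ==> norm y > \<delta> ==> S_op ep (\<phi> ep x) y = 0"
      by (rule smooth_maps_Cb[OF \<Omega> \<phi> R(1) \<delta>(1) K(1) \<delta>'(1) L(1) \<delta>'(2)], rule that)
    have Kn: "K \<subseteq> nbo K \<delta>" "nbo K \<delta> \<subseteq> \<Omega>" "L \<subseteq> nbo L \<delta>"
      using subset_nbo[OF \<delta>(1)] order_trans[OF nbo_subset_nb order_trans[OF nb_mono \<delta>'(1)]] \<delta>(1) by auto
    show ?thesis
    proof (rule sup_bigOI[of "C0 * (2 * C2) ^ k * C1" "min e1 e2"])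
      fix ep x assume ep: "0 < ep" "ep < min e1 e2" and x: "x \<in> K"
      have ep': "ep < e1" "ep < e2" "ep \<le> 1" "ep \<in> {0<..1}" using ep e2(2) by auto
      define X where "X x = c (energy (S_op ep (\<phi> ep x)))" for x
      define F where "F = (\<lambda>z. R (S_op ep (\<phi> ep (fst z)), snd z))"
      define E where "E = inverse (ep ^ (CARD('n) * Suc k))"
      have E: "1 \<le> E" unfolding E_def using ep(1) ep'(3) by (intro one_le_inverse zero_less_power power_le_one) auto
      have CE: "1 \<le> C2 * E" using mult_mono[of 1 C2 1 E] C2 E by simp
      have sX: "smooth_in \<Omega> X" unfolding X_def by (rule Cb_path_dbound(1)[OF \<Omega> \<phi> K c(1,3) ep(1) ep'(3)])
      have bX: "dbound (Suc k) K X (C2 * E)" unfolding X_def[abs_def] E_def by (rule bspec[OF conjunct2[OF C2] ep'(4)])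
      have XL: "X x \<in> L" for x unfolding X_def L_def by (rule path_in(1))
      define g where "g x = (x, X x)" for x
      have sXn: "smooth_in (nbo K \<delta>) X" by (rule smooth_in_subset[OF sX Kn(2)])
      have sg: "smooth_in (nbo K \<delta>) g" unfolding g_def by (intro smooth_in_Pair smooth_in_id sXn open_nbo)
      have bg: "dbound (k - 1) K (dird b g) (2 * C2 * E)" if b: "b \<in> Basis" for b
        unfolding dbound_def
      proof (intro allI impI ballI, elim conjE)
        fix vs :: "(real^'n) list" and x assume vs: "set vs \<subseteq> Basis" "length vs \<le> k - 1" and x: "x \<in> K"
        define ws where "ws = vs @ [b]"
        have "dirds ws (\<lambda>y. y) = dirds vs (\<lambda>_. b)" by (simp add: ws_def dird_bounded_linear[OF bounded_linear_ident])
        then have i: "norm (dirds ws (\<lambda>y. y) x) \<le> 1" using b by (cases "vs = []") (auto simp: dirds_const)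
        have "norm (dirds ws X x) \<le> C2 * E"
          by (rule dboundD[OF bX _ _ x]) (use vs b in \<open>auto simp: ws_def\<close>)
        moreover have "dirds ws g x = (dirds ws (\<lambda>y. y) x, dirds ws X x)"
          unfolding g_def[abs_def] by (rule dirds_Pair[OF open_nbo smooth_in_id sXn]) (use x Kn(1) in blast)
        ultimately have "norm (dirds ws g x) \<le> 1 + C2 * E" using norm_Pair_le[of "dirds ws (\<lambda>y. y) x" "dirds ws X x"] i by simp
        then show "norm (dirds vs (dird b g) x) \<le> 2 * C2 * E" using CE by (simp add: ws_def)
      qed
      have "dbound k (K \<times> L) F (C1 * inverse (ep ^ N))" unfolding F_def by (rule mp[OF spec[OF conjunct2[OF e1]] conjI[OF ep(1) ep'(1)]])
      then have bF: "dbound k (g ` K) F (C1 * inverse (ep ^ N))"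
        by (rule dbound_mono) (use XL in \<open>auto simp: g_def\<close>)
      have gP: "g ` nbo K \<delta> \<subseteq> nbo K \<delta> \<times> nbo L \<delta>" using XL Kn(3) by (auto simp: g_def)
      have sF: "smooth_in (nbo K \<delta> \<times> nbo L \<delta>) F" unfolding F_def by (rule e2(3)[OF ep(1) ep'(2)])
      have "dbound k K (\<lambda>x. F (g x)) (C0 * (2 * C2 * E) ^ k * (C1 * inverse (ep ^ N)))"
        by (rule conjunct2[OF C0, rule_format, OF open_nbo sg sF gP Kn(1) _ _ bg bF])
          (use CE C1 ep(1) in \<open>auto intro: mult_nonneg_nonneg\<close>)
      from dbound_cong[OF open_nbo Kn(1) _ this]
      have "dbound k K (\<lambda>x. path_value R \<rho> \<eta> c (S_op ep (\<phi> ep x), x)) (C0 * (2 * C2 * E) ^ k * (C1 * inverse (ep ^ N)))"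
      proof this
        fix x assume x: "x \<in> nbo K \<delta>"
        have A: "\<phi> ep x \<in> A_set 0 UNIV" by (rule CbD(1)[OF \<phi> ep(1) ep'(3)]) (use x Kn(2) in blast)
        have "tf_truncate \<rho> \<eta> (S_op ep (\<phi> ep x)) = S_op ep (\<phi> ep x)"
          by (rule tf_truncate_id[OF S_op_A_set[OF A ep(1)] e2(5)[OF ep(1) ep'(2) x] \<rho>]) (use \<delta>(2) in simp)
        then show "F (g x) = path_value R \<rho> \<eta> c (S_op ep (\<phi> ep x), x)"
          by (simp add: F_def g_def path_value_def X_def)
      qed
      from dboundD[OF this axes_Basis _ x, of "mi_list \<alpha>"]
      have "norm (mderiv \<alpha> (\<lambda>x. path_value R \<rho> \<eta> c (S_op ep (\<phi> ep x), x)) x) \<le> C0 * (2 * C2 * E) ^ k * (C1 * inverse (ep ^ N))"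
        by (simp add: mderiv_eq_dirds k_def)
      also have "\<dots> = (C0 * (2 * C2) ^ k * C1) * (E ^ k * inverse (ep ^ N))" by (simp add: power_mult_distrib)
      also have "E ^ k * inverse (ep ^ N) = inverse (ep ^ N')"
        by (simp only: E_def N'_def power_inverse[symmetric] power_mult[symmetric] power_add inverse_mult_distrib)
      finally show "norm (mderiv \<alpha> (\<lambda>x. path_value R \<rho> \<eta> c (S_op ep (\<phi> ep x), x)) x) \<le> C0 * (2 * C2) ^ k * C1 * \<bar>inverse (ep ^ N')\<bar>"
        using ep(1) by simp
    qed (use C0 C1 C2 e1 e2(1) in auto)
  qed
  then have "sup_bigO K (\<lambda>ep. mderiv \<alpha> (\<lambda>x. path_value R \<rho> \<eta> c (S_op ep (\<phi> ep x), x))) (\<lambda>ep. inverse (ep ^ Suc N'))"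
    if "\<phi> \<in> Cb \<Omega> 0" for \<phi>
    using that by (intro sup_bigO_inverse_power_mono[of _ _ N' "Suc N'"]) auto
  then show "\<exists>N\<ge>1. \<forall>\<phi>\<in>Cb \<Omega> 0. sup_bigO K (\<lambda>ep. mderiv \<alpha> (\<lambda>x. path_value R \<rho> \<eta> c (S_op ep (\<phi> ep x), x))) (\<lambda>ep. inverse (ep ^ N))"
    by (intro exI[of _ "Suc N'"]) simp
qed

end

section \<open>Violations of the estimate and their detection\<close>

lemma sup_bigO_Un:
  assumes "sup_bigO K f g" "sup_bigO K' f g"
  shows "sup_bigO (K \<union> K') f g"
proof -
  obtain C e where C: "C > 0" "e > 0" "\<And>ep x. 0 < ep ==> ep < e ==> x \<in> K ==> norm (f ep x) \<le> C * \<bar>g ep\<bar>"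
    by (rule sup_bigOE[OF assms(1)], rule that)
  obtain C' e' where C': "C' > 0" "e' > 0" "\<And>ep x. 0 < ep ==> ep < e' ==> x \<in> K' ==> norm (f ep x) \<le> C' * \<bar>g ep\<bar>"
    by (rule sup_bigOE[OF assms(2)], rule that)
  show ?thesis
  proof (rule sup_bigOI[of "C + C'" "min e e'"])
    fix ep x assume ep: "0 < ep" "ep < min e e'" and x: "x \<in> K \<union> K'"
    have m: "C * \<bar>g ep\<bar> \<le> (C + C') * \<bar>g ep\<bar>" "C' * \<bar>g ep\<bar> \<le> (C + C') * \<bar>g ep\<bar>"
      using C(1) C'(1) by (intro mult_right_mono; simp)+
    show "norm (f ep x) \<le> (C + C') * \<bar>g ep\<bar>"
    proof (cases "x \<in> K")
      case True
      show ?thesis by (rule order_trans[OF C(3) m(1)]) (use ep True in auto)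
    next
      case False
      show ?thesis by (rule order_trans[OF C'(3) m(2)]) (use ep x False in auto)
    qed
  qed (use C C' in auto)
qed

text \<open>Estimates on finitely many balls combine at the maximum of the orders, because
  \<open>Cb\<close> decreases with the order. If each point of \<open>K\<close> had a ball with an
  estimate for some order, compactness would give one on \<open>K\<close>; so one centre fails for
  all orders.\<close>

lemma not_vanishing_localize:
  fixes \<Omega> :: "(real^'n::finite) set"
  assumes K: "compact K" and \<rho>: "\<rho> > 0"
    and nv: "\<not> (\<exists>q\<ge>1. \<forall>\<phi>\<in>Cb \<Omega> q. sup_bigO K (\<lambda>ep x. R (S_op ep (\<phi> ep x), x)) g)"
  obtains a where "a \<in> K" "\<And>q. q \<ge> 1 ==> \<exists>\<phi>\<in>Cb \<Omega> q. \<not> sup_bigO (cball a \<rho>) (\<lambda>ep x. R (S_op ep (\<phi> ep x), x)) g"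
proof -
  define V where "V A \<longleftrightarrow> (\<exists>q\<ge>1. \<forall>\<phi>\<in>Cb \<Omega> q. sup_bigO A (\<lambda>ep x. R (S_op ep (\<phi> ep x), x)) g)" for A
  have VUn: "V (A \<union> B)" if A: "V A" and B: "V B" for A B
  proof -
    from A[unfolded V_def] obtain q where q: "1 \<le> q \<and> (\<forall>\<phi>\<in>Cb \<Omega> q. sup_bigO A (\<lambda>ep x. R (S_op ep (\<phi> ep x), x)) g)" by (rule exE)
    from B[unfolded V_def] obtain q' where q': "1 \<le> q' \<and> (\<forall>\<phi>\<in>Cb \<Omega> q'. sup_bigO B (\<lambda>ep x. R (S_op ep (\<phi> ep x), x)) g)" by (rule exE)
    have "sup_bigO (A \<union> B) (\<lambda>ep x. R (S_op ep (\<phi> ep x), x)) g" if \<phi>: "\<phi> \<in> Cb \<Omega> (max q q')" for \<phi>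
      by (rule sup_bigO_Un[OF bspec[OF conjunct2[OF q] subsetD[OF Cb_antimono \<phi>]] bspec[OF conjunct2[OF q'] subsetD[OF Cb_antimono \<phi>]]]) auto
    then show ?thesis unfolding V_def using q by (intro exI[of _ "max q q'"]) auto
  qed
  note witness = that
  show ?thesis
  proof (rule ccontr)
    assume not_thesis: "\<not> thesis"
    have all: "V (cball a \<rho>)" if aK: "a \<in> K" for a
    proof (rule ccontr)
      assume nV: "\<not> V (cball a \<rho>)"
      have "\<exists>\<phi>\<in>Cb \<Omega> q. \<not> sup_bigO (cball a \<rho>) (\<lambda>ep x. R (S_op ep (\<phi> ep x), x)) g" if "q \<ge> 1" for q
        using nV that unfolding V_def by auto
      from witness[OF aK this] not_thesis show False by blast
    qed
    have "K \<subseteq> (\<Union>a\<in>K. ball a \<rho>)" using \<rho> by auto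
    then obtain D where D: "D \<subseteq> K" "finite D" "K \<subseteq> (\<Union>a\<in>D. ball a \<rho>)"
      by (rule compactE_image[OF K open_ball])
    have "V (\<Union>a\<in>D. cball a \<rho>)" using D(2,1)
    proof (induction D rule: finite_induct)
      case empty
      have "sup_bigO {} (\<lambda>ep x. R (S_op ep (\<phi> ep x), x)) g" for \<phi> :: "real => real^'n => 'n tfun" by (rule sup_bigOI[of 1 1]) auto
      then show ?case unfolding V_def by (intro exI[of _ 1]) simp
    next
      case (insert b D)
      show ?case
        unfolding UN_insert by (rule VUn[OF all insert.IH]) (use insert.prems in auto)
    qed
    then obtain q where q: "1 \<le> q \<and> (\<forall>\<phi>\<in>Cb \<Omega> q. sup_bigO (\<Union>a\<in>D. cball a \<rho>) (\<lambda>ep x. R (S_op ep (\<phi> ep x), x)) g)"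
      unfolding V_def by (rule exE)
    have sub: "K \<subseteq> (\<Union>a\<in>D. cball a \<rho>)" by (rule order_trans[OF D(3)]) (auto intro: less_imp_le)
    have "\<forall>\<phi>\<in>Cb \<Omega> q. sup_bigO K (\<lambda>ep x. R (S_op ep (\<phi> ep x), x)) g"
      by (rule ballI, rule sup_bigO_subset[OF bspec[OF conjunct2[OF q]] sub])
    then have "\<exists>q\<ge>1. \<forall>\<phi>\<in>Cb \<Omega> q. sup_bigO K (\<lambda>ep x. R (S_op ep (\<phi> ep x), x)) g"
      using conjunct1[OF q] by (intro exI[of _ q] conjI)
    with nv show False by (rule notE)
  qed
qed

text \<open>Before scaling, the energies over \<open>K\<close> have a common positive lower bound,
  and scaling divides them by a positive power of \<open>ep\<close>.\<close>

lemma energy_tends_to_infinity: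
  fixes \<Omega> :: "(real^'n::finite) set"
  assumes \<phi>: "\<phi> \<in> Cb \<Omega> q" and K: "compact K" "K \<subseteq> \<Omega>"
  shows "\<exists>e>0. \<forall>ep x. 0 < ep \<and> ep < e \<and> x \<in> K --> T \<le> energy (S_op ep (\<phi> ep x))"
proof -
  obtain r where r: "\<And>ep x y. 0 < ep ==> ep \<le> 1 ==> x \<in> K ==> norm y > r ==> \<phi> ep x y = 0"
    by (rule Cb_supp[OF \<phi> K], rule that)
  define v where "v = 1 / (measure lborel (cball (0 :: real^'n) r) + 1)"
  have v: "v > 0" by (simp add: v_def add_nonneg_pos)
  define e where "e = min 1 (v / (\<bar>T\<bar> + 1))"
  have "T \<le> energy (S_op ep (\<phi> ep x))" if ep: "0 < ep" "ep < e" and x: "x \<in> K" for ep x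
  proof -
    have ep1: "ep \<le> 1" and epv: "ep < v / (\<bar>T\<bar> + 1)" using ep(2) by (auto simp: e_def)
    have "\<phi> ep x \<in> A_set q UNIV" by (rule CbD(1)[OF \<phi> ep(1) ep1]) (use x K(2) in blast)
    then have A: "\<phi> ep x \<in> A_set 0 UNIV" by (rule subsetD[OF A_set_antimono, rotated]) simp
    have "v \<le> energy (\<phi> ep x)" unfolding v_def by (rule energy_ge[OF A r[OF ep(1) ep1 x]])
    have "\<bar>T\<bar> + 1 \<le> v / ep" using epv ep(1) by (simp add: field_simps)
    also have "\<dots> \<le> energy (\<phi> ep x) / ep ^ CARD('n)"
    proof (rule frac_le)
      show "ep ^ CARD('n) \<le> ep" using power_decreasing[of 1 "CARD('n)" ep] ep(1) ep1 by (simp add: Suc_leI)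
    qed (use \<open>v \<le> energy (\<phi> ep x)\<close> v ep(1) in auto)
    also have "\<dots> = energy (S_op ep (\<phi> ep x))" by (rule energy_S_op[OF A_setD(1)[OF A] ep(1), symmetric])
    finally show ?thesis by simp
  qed
  moreover have "e > 0" using v by (auto simp: e_def intro!: divide_pos_pos)
  ultimately show ?thesis by (intro exI[of _ e]) simp
qed

text \<open>
  The scales \<open>ep\<close> at which \<open>R\<close> violates the estimate are recognised through the
  energy of \<open>S_op ep (\<phi> ep x)\<close>, so a single path \<open>c\<close> can take the value \<open>x\<close> there.
  Enumerating pairs \<open>(q, k)\<close> makes violations for every order \<open>q\<close> occur infinitely often.
\<close>

lemma detecting_point:
  fixes \<Omega> :: "(real^'n::finite) set"
  assumes \<Omega>: "open \<Omega>" and R: "R \<in> E_M \<Omega>" and nv: "\<not> vanishing \<Omega> R"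
  shows "\<exists>X S. X \<in> V_M \<Omega> \<Omega> \<and> good_rep \<Omega> \<Omega> X \<and> S \<in> V_M \<Omega> UNIV \<and> is_S_RX \<Omega> R X S \<and> \<not> vanishing \<Omega> S"
proof -
  have R': "R \<in> smooth_maps \<Omega> UNIV" "moderate \<Omega> R" using R by (auto simp: E_M_def)
  obtain K m where K: "compact K" "K \<subseteq> \<Omega>" and m: "m \<ge> 1"
    and nvK: "\<not> (\<exists>q\<ge>1. \<forall>\<phi>\<in>Cb \<Omega> q. sup_bigO K (\<lambda>ep x. R (S_op ep (\<phi> ep x), x)) (\<lambda>ep. ep ^ m))"
    using nv unfolding vanishing_def by auto
  obtain \<delta> where \<delta>: "\<delta> > 0" "nb K (2 * \<delta>) \<subseteq> \<Omega>" by (rule nb_exists[OF K(1) \<Omega> K(2)])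
  \<comment> \<open>Chosen so that the ball of radius \<open>3 * \<rho>\<close> around a point of
    \<open>K\<close> lies in \<open>nb K (2 * \<delta>)\<close>.\<close>
  define \<rho> where "\<rho> = 2 * \<delta> / 3"
  have \<rho>: "\<rho> > 0" "3 * \<rho> = 2 * \<delta>" using \<delta>(1) by (auto simp: \<rho>_def)
  obtain a where aK: "a \<in> K" and a\<phi>: "\<And>q. q \<ge> 1 ==>
      \<exists>\<phi>\<in>Cb \<Omega> q. \<not> sup_bigO (cball a \<rho>) (\<lambda>ep x. R (S_op ep (\<phi> ep x), x)) (\<lambda>ep. ep ^ m)"
    by (rule not_vanishing_localize[OF K(1) \<rho>(1) nvK], rule that)
  have a: "cball a (3 * \<rho>) \<subseteq> \<Omega>" using \<delta>(2) aK unfolding \<rho>(2) nb_def by blast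
  have "cball a \<rho> \<subseteq> cball a (3 * \<rho>)" using \<rho>(1) by auto
  then have K0: "compact (cball a \<rho>)" "cball a \<rho> \<subseteq> \<Omega>" using order_trans[OF _ a] by simp_all
  have a\<Omega>: "a \<in> \<Omega>" using aK K(2) by blast
  \<comment> \<open>Orders start at 1, hence the shift to \<open>Suc q\<close>.\<close>
  have "\<forall>q. \<exists>\<phi>. \<phi> \<in> Cb \<Omega> (Suc q) \<and> \<not> sup_bigO (cball a \<rho>) (\<lambda>ep x. R (S_op ep (\<phi> ep x), x)) (\<lambda>ep. ep ^ m)"
    using a\<phi> by (simp add: Bex_def)
  from choice[OF this] obtain \<phi> where \<phi>': "\<forall>q. \<phi> q \<in> Cb \<Omega> (Suc q) \<and>
      \<not> sup_bigO (cball a \<rho>) (\<lambda>ep x. R (S_op ep (\<phi> q ep x), x)) (\<lambda>ep. ep ^ m)" by (rule exE)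
  then have \<phi>: "\<phi> q \<in> Cb \<Omega> (Suc q)" and
    n\<phi>: "\<not> sup_bigO (cball a \<rho>) (\<lambda>ep x. R (S_op ep (\<phi> q ep x), x)) (\<lambda>ep. ep ^ m)" for q by simp_all
  have viol: "\<exists>ep x. 0 < ep \<and> ep < e \<and> x \<in> cball a \<rho> \<and> C * \<bar>ep ^ m\<bar> < norm (R (S_op ep (\<phi> q ep x), x))"
    if Ce: "C > 0" "e > 0" for C e q
  proof (rule ccontr)
    assume no: "\<not> ?thesis"
    have "sup_bigO (cball a \<rho>) (\<lambda>ep x. R (S_op ep (\<phi> q ep x), x)) (\<lambda>ep. ep ^ m)"
      by (rule sup_bigOI[OF Ce]) (use no not_le in blast)
    with n\<phi> show False by (rule notE)
  qed
  define qq where "qq j = fst (prod_decode j)" for j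
  define \<tau> where "\<tau> j z = energy (S_op (fst z) (\<phi> (qq j) (fst z) (snd z)))" for j z
  \<comment> \<open>The \<open>j\<close>-th violation defeats the constant \<open>Suc j\<close> at a
    scale below \<open>1 / real (Suc j)\<close>, so any given constant and scale is passed
    eventually.\<close>
  define P where "P j z \<longleftrightarrow> 0 < fst z \<and> fst z < 1 / real (Suc j) \<and> snd z \<in> cball a \<rho> \<and>
    real (Suc j) * \<bar>fst z ^ m\<bar> < norm (R (S_op (fst z) (\<phi> (qq j) (fst z) (snd z)), snd z))" for j z
  have ex: "\<exists>z. P j z \<and> T \<le> \<tau> j z" for j T
  proof -
    from energy_tends_to_infinity[OF \<phi> K0, of T "qq j"] obtain e where e: "0 < e \<and>
      (\<forall>ep x. 0 < ep \<and> ep < e \<and> x \<in> cball a \<rho> --> T \<le> energy (S_op ep (\<phi> (qq j) ep x)))" by (rule exE)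
    have "real (Suc j) > 0" "min e (1 / real (Suc j)) > 0" using e by auto
    from viol[OF this, of "qq j"] obtain ep where "\<exists>x. 0 < ep \<and> ep < min e (1 / real (Suc j)) \<and> x \<in> cball a \<rho> \<and>
      real (Suc j) * \<bar>ep ^ m\<bar> < norm (R (S_op ep (\<phi> (qq j) ep x), x))" by (rule exE)
    then obtain x where x: "0 < ep \<and> ep < min e (1 / real (Suc j)) \<and> x \<in> cball a \<rho> \<and>
      real (Suc j) * \<bar>ep ^ m\<bar> < norm (R (S_op ep (\<phi> (qq j) ep x), x))" by (rule exE)
    have "T \<le> \<tau> j (ep, x)" unfolding \<tau>_def fst_conv snd_conv
      by (rule conjunct2[OF e, rule_format]) (use x in simp)
    moreover have "P j (ep, x)" unfolding P_def fst_conv snd_conv using x unfolding min_less_iff_conj by blast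
    ultimately show ?thesis by (intro exI[of _ "(ep, x)"] conjI)
  qed
  \<comment> \<open>The energies are made to increase by at least 5, the spacing that
    \<open>interpolating_path\<close> asks for.\<close>
  have "\<exists>f. \<forall>j. P j (f j) \<and> \<tau> j (f j) + 5 \<le> \<tau> (Suc j) (f (Suc j))"
  proof (rule dependent_nat_choice)
    show "\<exists>z. P 0 z" using ex[of 0 0] by blast
    show "\<exists>z. P (Suc j) z \<and> \<tau> j y + 5 \<le> \<tau> (Suc j) z" for y j by (rule ex)
  qed
  then obtain f where f: "\<forall>j. P j (f j) \<and> \<tau> j (f j) + 5 \<le> \<tau> (Suc j) (f (Suc j))" by (rule exE)
  have P: "P j (f j)" and \<tau>: "\<tau> j (f j) + 5 \<le> \<tau> (Suc j) (f (Suc j))" for j using f by simp_all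
  have xn: "norm (snd (f j) - a) \<le> \<rho>" for j using P[of j] by (simp add: P_def dist_norm norm_minus_commute)
  obtain c where c: "smooth_in UNIV c" "\<And>s. norm (c s - a) \<le> \<rho>" "\<And>j. c (\<tau> j (f j)) = snd (f j)"
    "\<And>vs. \<exists>M. \<forall>s. norm (dirds vs c s) \<le> M"
    by (rule interpolating_path[of "\<lambda>j. \<tau> j (f j)" "\<lambda>j. snd (f j)" a \<rho>, OF \<tau> xn], rule that)
  note c_value = c(3)
  have "\<phi> 0 1 a \<in> A_set (Suc 0) UNIV" by (rule CbD(1)[OF \<phi> _ _ a\<Omega>]) auto
  then have A: "\<phi> 0 1 a \<in> A_set 0 UNIV" by (rule subsetD[OF A_set_antimono, rotated]) simp
  obtain r where r: "\<And>y. norm y > r ==> \<phi> 0 1 a y = 0" by (rule test_funs_bounded[OF A_setD(1)[OF A]], rule that)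
  \<comment> \<open>Some test object is rescaled to have support in the ball of radius
    \<open>2 * \<rho>\<close>, as required of \<open>\<eta>\<close>.\<close>
  define s where "s = 2 * \<rho> / (\<bar>r\<bar> + 1)"
  have s: "s > 0" unfolding s_def using \<rho>(1) by (intro divide_pos_pos) auto
  have sr: "s * r \<le> 2 * \<rho>"
  proof -
    have "s * r \<le> s * (\<bar>r\<bar> + 1)" using s by (intro mult_left_mono) auto
    also have "\<dots> = 2 * \<rho>" by (simp add: s_def)
    finally show ?thesis .
  qed
  define \<eta> where "\<eta> = S_op s (\<phi> 0 1 a)"
  interpret path_construction \<Omega> c a \<rho> \<eta>
  proof
    show "\<eta> \<in> A_set 0 UNIV" unfolding \<eta>_def by (rule S_op_A_set[OF A s])
    show "\<eta> y = 0" if "norm y > 2 * \<rho>" for y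
      unfolding \<eta>_def by (rule S_op_outside[where r=r, OF r s]) (use that sr in auto)
  qed (rule \<Omega> \<rho>(1) a c(1,2,4))+
  define S where "S = path_value R \<rho> \<eta> c"
  have SX: "is_S_RX \<Omega> R (path_point c) S" unfolding S_def by (rule is_S_RX_path_value[OF R'(1)])
  have SV: "S \<in> V_M \<Omega> UNIV"
    unfolding S_def using path_value_smooth_maps[OF R'(1)] moderate_path_value[OF R']
    by (simp add: V_M_def indep_snd_def path_value_def)
  have "\<not> vanishing \<Omega> S"
  proof
    assume v: "vanishing \<Omega> S"
    \<comment> \<open>\<open>S\<close> ignores its second argument, so an estimate at the single
      point \<open>a\<close> is enough. Freezing the test objects makes it uniform in the point
      \<open>x\<close> at which they are taken.\<close>
    have a1: "compact {a}" "{a} \<subseteq> \<Omega>" using a\<Omega> by auto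
    obtain q where q: "q \<ge> 1" "\<And>\<psi>. \<psi> \<in> Cb \<Omega> q ==> sup_bigO {a} (\<lambda>ep x. S (S_op ep (\<psi> ep x), x)) (\<lambda>ep. ep ^ m)"
      by (rule vanishingE[OF v a1 m], rule that)
    define p where "p = q - 1"
    have \<phi>p: "\<phi> p \<in> Cb \<Omega> q" using \<phi>[of p] q(1) by (simp add: p_def)
    obtain C e1 where C: "C > 0" "e1 > 0" "\<And>ep x y. 0 < ep ==> ep < e1 ==> x \<in> cball a \<rho> ==> y \<in> {a} ==>
        norm (S (S_op ep (\<phi> p ep x), y)) \<le> C * \<bar>ep ^ m\<bar>"
      by (rule Cb_uniform_const[OF \<Omega> \<phi>p K0, where H="\<lambda>ep \<psi> y. S (S_op ep (\<psi> y), y)", OF q(2)], assumption, rule that)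
    obtain e2 where e2: "e2 > 0"
      "\<And>ep x. 0 < ep ==> ep < e2 ==> x \<in> cball a \<rho> ==> (S_op ep (\<phi> p ep x), x) \<in> U_set \<Omega>"
      "\<And>ep x. 0 < ep ==> ep < e2 ==> x \<in> cball a \<rho> ==>
        S (S_op ep (\<phi> p ep x), x) = R (S_op ep (\<phi> p ep x), path_point c (S_op ep (\<phi> p ep x), x))"
      by (rule is_S_RX_Cb[OF SX \<phi>p K0], rule that)
    obtain k :: nat where k: "real k > max C (max (1 / e1) (1 / e2))" using reals_Archimedean2 by blast
    \<comment> \<open>The index carries the order \<open>p\<close> and is at least \<open>k\<close>,
      so its scale and constant lie beyond those of the supposed estimate.\<close>
    define j where "j = prod_encode (p, k)"
    have qj: "qq j = p" by (simp add: qq_def j_def)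
    have kj: "real k \<le> real j" unfolding j_def by (simp add: le_prod_encode_2)
    define ep x where "ep = fst (f j)" and "x = snd (f j)"
    have ep: "0 < ep" "ep < 1 / real (Suc j)" "x \<in> cball a \<rho>"
      and big: "real (Suc j) * \<bar>ep ^ m\<bar> < norm (R (S_op ep (\<phi> p ep x), x))"
      using P[of j] unfolding P_def qj ep_def x_def by auto
    have lt: "ep < e" if "e > 0" "1 / e < real k" for e
    proof -
      have "1 / e < real (Suc j)" using that(2) kj by simp
      then have "1 / real (Suc j) < e" using that(1) by (simp add: field_simps)
      then show ?thesis using ep(2) by simp
    qed
    have e12: "ep < e1" "ep < e2" using lt[OF C(2)] lt[OF e2(1)] k by auto
    have "path_point c (S_op ep (\<phi> p ep x), x) = c (\<tau> j (f j))" by (simp add: path_point_def \<tau>_def qj ep_def x_def)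
    also have "\<dots> = x" unfolding x_def by (rule c_value)
    finally have "R (S_op ep (\<phi> p ep x), x) = S (S_op ep (\<phi> p ep x), x)"
      using e2(3)[OF ep(1) e12(2) ep(3)] by simp
    also have "\<dots> = S (S_op ep (\<phi> p ep x), a)" by (simp add: S_def path_value_def)
    finally have "norm (R (S_op ep (\<phi> p ep x), x)) \<le> C * \<bar>ep ^ m\<bar>"
      using C(3)[OF ep(1) e12(1) ep(3), of a] by simp
    also have "\<dots> \<le> real (Suc j) * \<bar>ep ^ m\<bar>" using k kj by (intro mult_right_mono) auto
    finally show False using big by simp
  qed
  then show ?thesis using path_point_V_M good_rep_path_point SV SX by blast
qed

theorem theorem31:
  fixes \<Omega> :: "(real^'n::finite) set"
    and Rt :: "((real^'n \<Rightarrow> complex) \<times> (real^'n) \<Rightarrow> complex) set"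
  assumes "open \<Omega>"
    and "Rt \<in> G_d \<Omega>"
  shows "Rt = G_zero \<Omega> \<longleftrightarrow>
         (\<forall>Xt \<in> V_tilde_c \<Omega> \<Omega>. point_value \<Omega> Rt Xt = C_zero \<Omega>)"
proof -
  note \<Omega> = assms(1) and Rt = assms(2) and detect = detecting_point[OF assms(1)]
  show ?thesis
  proof
    assume z: "Rt = G_zero \<Omega>"
    have 0: "(\<lambda>_. 0) \<in> Rt" unfolding z G_zero_def by (rule equiv_class_self[OF equiv_G_rel[OF \<Omega>] zero_E_M])
    show "\<forall>Xt \<in> V_tilde_c \<Omega> \<Omega>. point_value \<Omega> Rt Xt = C_zero \<Omega>"
    proof
      fix Xt assume "Xt \<in> V_tilde_c \<Omega> \<Omega>"
      then obtain X where X: "Xt \<in> V_tilde \<Omega> \<Omega>" "X \<in> Xt" "good_rep \<Omega> \<Omega> X" unfolding V_tilde_c_def by blast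
      \<comment> \<open>As the point value does not depend on the choices, the zero function may
        serve both as representative of \<open>Rt\<close> and as its value.\<close>
      show "point_value \<Omega> Rt Xt = C_zero \<Omega>"
        unfolding C_zero_def by (rule point_value_eq[OF \<Omega> Rt 0 X zero_V_M is_S_RX_zero[OF \<Omega> X(3)]])
    qed
  next
    assume pv: "\<forall>Xt \<in> V_tilde_c \<Omega> \<Omega>. point_value \<Omega> Rt Xt = C_zero \<Omega>"
    obtain R where R: "R \<in> E_M \<Omega>" "Rt = G_rel \<Omega> `` {R}" using Rt unfolding G_d_def by (rule quotientE)
    have RRt: "R \<in> Rt" unfolding R(2) by (rule equiv_class_self[OF equiv_G_rel[OF \<Omega>] R(1)])
    have "vanishing \<Omega> R"
    proof (rule ccontr)
      assume "\<not> vanishing \<Omega> R"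
      then obtain X S where X: "X \<in> V_M \<Omega> \<Omega>" "good_rep \<Omega> \<Omega> X" and S: "S \<in> V_M \<Omega> UNIV" "is_S_RX \<Omega> R X S" "\<not> vanishing \<Omega> S"
        using detect[OF R(1)] by blast
      define Xt where "Xt = V_rel \<Omega> \<Omega> `` {X}"
      have Xt: "Xt \<in> V_tilde \<Omega> \<Omega>" "X \<in> Xt"
        unfolding Xt_def V_tilde_def by (rule quotientI[OF X(1)], rule equiv_class_self[OF equiv_V_rel X(1)])
      then have "Xt \<in> V_tilde_c \<Omega> \<Omega>" using X(2) unfolding V_tilde_c_def by blast
      then have "V_rel \<Omega> UNIV `` {S} = V_rel \<Omega> UNIV `` {\<lambda>_. 0}"
        using pv point_value_eq[OF \<Omega> Rt RRt Xt X(2) S(1,2)] unfolding C_zero_def by simp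
      then have "(S, \<lambda>_. 0) \<in> V_rel \<Omega> UNIV" by (rule eq_equiv_class[OF _ equiv_V_rel zero_V_M])
      then show False using S(3) by (simp add: V_rel_iff)
    qed
    then have "(R, \<lambda>_. 0) \<in> G_rel \<Omega>" using R(1) zero_E_M by (simp add: G_rel_iff[OF \<Omega>])
    then show "Rt = G_zero \<Omega>" unfolding R(2) G_zero_def by (rule equiv_class_eq[OF equiv_G_rel[OF \<Omega>]])
  qed
qed

end
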